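(* Let $\mathbb{X}=[X_1\rightrightarrows X_0]$ be a Lie groupoid with Lie algebroid $A$, equipped with an Ehresmann connection $\mathbb{H}$, and let $\pi\colon P\to M$ be a principal $\mathbb{X}$-bundle with anchor $a$. With the quasi actions $$\tau^0_g(p,\alpha)=(pg,\lambda^0_{g^{-1}}(\alpha)),\qquad \tau^1_g(p,v)=(pg,\lambda^1_{g^{-1}}(v))\qquad(a(p)=t(g))$$ on $P\times_{X_0}A$ and $a^*TX_0$ respectively, the map $\xi\colon P\times_{X_0}A\to a^*TX_0$, $\xi(p,\alpha)=(p,(dt)_{1_{a(p)}}(\alpha))$, and the homotopy map $\Upsilon(g,h)(p,v)=(pgh,K(h^{-1},g^{-1})(v))$ (for $a(p)=t(g)$, $s(g)=t(h)$), the bundle $P\times_{X_0}A\oplus a^*TX_0\to P$, $(p,\alpha,v)\mapsto p$, is a quasi equivariant $\mathbb{X}$-bundle up to homotopy.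
   Context: Lie groupoid $\mathbb{X}=[X_1\rightrightarrows X_0]$: source $s$, target $t$ are submersions, $gh$ is defined when $s(g)=t(h)$, units $1_x$, inversion $i$. For tangent vectors, $\beta.\alpha:=dm_{(g,h)}(\beta,\alpha)$, $m$ the composition. Right action on $P$ with anchor $a\colon P\to X_0$: $pg$ is defined when $a(p)=t(g)$, $a(pg)=s(g)$, $(pg)h=p(gh)$, $p1_{a(p)}=p$. Principal $\mathbb{X}$-bundle: a surjective submersion $\pi\colon P\to M$ with a right action, $\pi(pg)=\pi(p)$, and $(p,g)\mapsto(p,pg)$ a diffeomorphism $P\times_{X_0}X_1\to P\times_MP$. $A_x=\ker(ds)_{1_x}$. $r_g\colon A_{t(g)}\to T_gX_1$ is the differential at $1_{t(g)}$ of $h\mapsto hg$; $l_g\colon A_{s(g)}\to T_gX_1$ is the differential at $1_{s(g)}$ of $h\mapsto gh^{-1}$ on $s^{-1}(s(g))$. Ehresmann connection: a subbundle $\mathbb{H}\subset TX_1$ with $TX_1=\mathbb{H}\oplus\ker ds$ and $\mathbb{H}_{1_x}=(d1)_x(T_xX_0)$; $\sigma_g\colon T_{s(g)}X_0\to\mathbb{H}_g$ is the inverse of $ds|_{\mathbb{H}_g}$; $\psi_g\colon T_gX_1\to A_{t(g)}$ satisfies $r_g\psi_g+\sigma_g(ds)_g=\mathrm{Id}$. $\lambda^0_g=-\psi_gl_g\colon A_{s(g)}\to A_{t(g)}$, $\lambda^1_g=(dt)_g\sigma_g\colon T_{s(g)}X_0\to T_{t(g)}X_0$. Basic curvature: $K(g,h)(v)=-\psi_{gh}(\sigma_g(\lambda^1_hv).\sigma_h(v))\in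 A_{t(g)}$ for $v\in T_{s(h)}X_0$. A (degree 2) quasi equivariant $\mathbb{X}$-bundle up to homotopy over $P$ is a graded vector bundle $E=E^0\oplus E^1\to P$ with: smooth maps $\tau^j\colon E^j\times_{X_0}X_1\to E^j$ ($j=0,1$) given by linear maps $\tau^j_g\colon E^j_p\to E^j_{pg}$ for $a(p)=t(g)$, with $\tau^j_{1_{a(p)}}=\mathrm{Id}$; a smooth vector bundle map $\xi\colon E^0\to E^1$; a smooth family of linear maps $\Upsilon(g,h)\colon E^1_p\to E^0_{pgh}$ for $a(p)=t(g)$, $s(g)=t(h)$; such that for all composable $g,h,k$ and $a(p)=t(g)$: $\xi_{pg}\tau^0_g=\tau^1_g\xi_p$; $\tau^0_{gh}-\tau^0_h\tau^0_g=\Upsilon(g,h)\xi_p$; $\tau^1_{gh}-\tau^1_h\tau^1_g=\xi_{pgh}\Upsilon(g,h)$; and $\tau^0_k\Upsilon(g,h)+\Upsilon(gh,k)-\Upsilon(g,hk)-\Upsilon(h,k)\tau^1_g=0$. *)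

theory Defs
  imports "HOL-Analysis.Analysis" "HOL-Library.Function_Algebras"
begin

section \<open>Model spaces\<close>

text \<open>
  Manifolds are modelled on finite-dimensional normed spaces. The class \<open>euclidean_space\<close> is not
  used for this, because its members have dimension at least 1: this would exclude, for instance,
  Lie groups (groupoids whose space of objects is a point) and discrete manifolds. The instance
  for type \<open>unit\<close> is the zero-dimensional model space.
\<close>

class finite_dim_normed = real_normed_vector +
  assumes finite_dim: "\<exists>B. finite B \<and> (\<forall>x. \<exists>c. x = (\<Sum>b\<in>B. c b *\<^sub>R b))"

instance euclidean_space \<subseteq> finite_dim_normed
proof
  show "\<exists>B::'a set. finite B \<and> (\<forall>x. \<exists>c. x = (\<Sum>b\<in>B. c b *\<^sub>R b))"
    by (rule exI[of _ Basis]) (metis euclidean_representation finite_Basis)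
qed

instance prod :: (finite_dim_normed, finite_dim_normed) finite_dim_normed
proof
  obtain B :: "'a set" where B: "finite B" "\<And>x. \<exists>c. x = (\<Sum>b\<in>B. c b *\<^sub>R b)"
    using finite_dim by blast
  obtain C :: "'b set" where C: "finite C" "\<And>x. \<exists>c. x = (\<Sum>b\<in>C. c b *\<^sub>R b)"
    using finite_dim by blast
  let ?D = "(\<lambda>b. (b, 0)) ` B \<union> (\<lambda>b. (0, b)) ` C :: ('a \<times> 'b) set"
  have D: "finite ?D" using B C by simp
  have sp: "x \<in> span ?D" for x
  proof -
    obtain c where c: "fst x = (\<Sum>b\<in>B. c b *\<^sub>R b)" using B by blast
    obtain d where d: "snd x = (\<Sum>b\<in>C. d b *\<^sub>R b)" using C by blast
    have "x = (\<Sum>b\<in>B. c b *\<^sub>R (b, 0)) + (\<Sum>b\<in>C. d b *\<^sub>R (0, b))"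
      by (simp add: prod_eq_iff c d fst_sum snd_sum)
    also have "\<dots> \<in> span ?D"
      by (intro span_add span_sum span_scale span_base) auto
    finally show ?thesis .
  qed
  have "\<exists>c. x = (\<Sum>b\<in>?D. c b *\<^sub>R b)" for x
  proof -
    show ?thesis using sp[of x] span_finite[OF D] by auto
  qed
  with D show "\<exists>B::('a \<times> 'b) set. finite B \<and> (\<forall>x. \<exists>c. x = (\<Sum>b\<in>B. c b *\<^sub>R b))"
    by blast
qed

instantiation unit :: real_normed_vector
begin
definition "(0::unit) = ()"
definition "(x::unit) + y = ()"
definition "(r::real) *\<^sub>R (x::unit) = ()"
definition "norm (x::unit) = 0"
definition "dist (x::unit) y = 0"
definition "sgn (x::unit) = ()"
definition "(uniformity :: (unit \<times> unit) filter) = (INF e\<in>{0 <..}. principal {(x, y). dist x y < e})"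
definition "open (U::unit set) \<longleftrightarrow> (\<forall>x\<in>U. eventually (\<lambda>(x', y). x' = x \<longrightarrow> y \<in> U) uniformity)"
instance
  by standard (simp_all add: norm_unit_def dist_unit_def uniformity_unit_def open_unit_def)
end

instance unit :: finite_dim_normed
  by standard auto


section \<open>Smooth functions between open subsets of model spaces\<close>

primrec Ck_on :: "nat \<Rightarrow> ('a::real_normed_vector \<Rightarrow> 'b::real_normed_vector) \<Rightarrow> 'a set \<Rightarrow> bool" where
  "Ck_on 0 f W = continuous_on W f"
| "Ck_on (Suc k) f W \<longleftrightarrow>
     (\<forall>x\<in>W. f differentiable (at x)) \<and> (\<forall>v. Ck_on k (\<lambda>x. frechet_derivative f (at x) v) W)"

definition Cinf_on :: "('a::real_normed_vector \<Rightarrow> 'b::real_normed_vector) \<Rightarrow> 'a set \<Rightarrow> bool" where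
  "Cinf_on f W \<longleftrightarrow> (\<forall>k. Ck_on k f W)"


section \<open>Manifolds\<close>

text \<open>
  A manifold is given by a (not necessarily maximal) smooth atlas; its set of points is the union
  of the chart domains. Values of a chart map outside the chart domain are irrelevant.
\<close>

type_synonym ('a, 'e) chart = "'a set \<times> ('a \<Rightarrow> 'e)"
type_synonym ('a, 'e) atlas = "('a, 'e) chart set"

definition carrier :: "('a, 'e) atlas \<Rightarrow> 'a set" where
  "carrier X = (\<Union>(U, c)\<in>X. U)"

definition smooth_atlas :: "('a, 'e::real_normed_vector) atlas \<Rightarrow> bool" where
  "smooth_atlas X \<longleftrightarrow>
     (\<forall>(U, c)\<in>X. inj_on c U \<and> open (c ` U)) \<and>
     (\<forall>(U, c)\<in>X. \<forall>(V, d)\<in>X. open (c ` (U \<inter> V)) \<and> Cinf_on (d \<circ> inv_into U c) (c ` (U \<inter> V)))"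

definition mopen :: "('a, 'e::real_normed_vector) atlas \<Rightarrow> 'a set \<Rightarrow> bool" where
  "mopen X W \<longleftrightarrow> W \<subseteq> carrier X \<and> (\<forall>(U, c)\<in>X. open (c ` (W \<inter> U)))"

definition mtopology :: "('a, 'e::real_normed_vector) atlas \<Rightarrow> 'a topology" where
  "mtopology X = topology (mopen X)"

lemma openin_mtopology:
  assumes "smooth_atlas X"
  shows "openin (mtopology X) = mopen X"
proof -
  have inj: "inj_on c U" if "(U, c) \<in> X" for U c
    using assms that unfolding smooth_atlas_def by blast
  have "istopology (mopen X)"
    unfolding istopology_def
  proof (intro conjI allI impI)
    fix S T assume S: "mopen X S" and T: "mopen X T"
    show "mopen X (S \<inter> T)"
      unfolding mopen_def
    proof (intro conjI ballI, goal_cases)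
      case 1 then show ?case using S by (auto simp: mopen_def)
    next
      case (2 uc)
      obtain U c where uc: "uc = (U, c)" by (cases uc)
      have "c ` (S \<inter> T \<inter> U) = c ` (S \<inter> U) \<inter> c ` (T \<inter> U)"
        using inj_on_image_Int[OF inj, of U c "S \<inter> U" "T \<inter> U"] 2 uc by (simp add: Int_ac)
      moreover have "open (c ` (S \<inter> U))" "open (c ` (T \<inter> U))"
        using S T 2 uc by (auto simp: mopen_def)
      ultimately show ?case using uc by auto
    qed
  next
    fix K assume K: "\<forall>W\<in>K. mopen X W"
    show "mopen X (\<Union>K)"
      unfolding mopen_def
    proof (intro conjI ballI, goal_cases)
      case 1 then show ?case using K by (auto simp: mopen_def)
    next
      case (2 uc)
      obtain U c where uc: "uc = (U, c)" by (cases uc)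
      have "c ` (\<Union>K \<inter> U) = (\<Union>W\<in>K. c ` (W \<inter> U))" by auto
      moreover have "open (\<Union>W\<in>K. c ` (W \<inter> U))"
        using K 2 uc unfolding mopen_def by (intro open_UN) fastforce
      ultimately show ?case using uc by auto
    qed
  qed
  then show ?thesis by (simp add: mtopology_def)
qed

definition manifold :: "('a, 'e::finite_dim_normed) atlas \<Rightarrow> bool" where
  "manifold X \<longleftrightarrow>
     smooth_atlas X \<and> Hausdorff_space (mtopology X) \<and> second_countable (mtopology X)"

definition model_atlas :: "('e, 'e) atlas" where
  "model_atlas = {(UNIV, \<lambda>x. x)}"

definition prod_atlas :: "('a, 'd) atlas \<Rightarrow> ('b, 'e) atlas \<Rightarrow> ('a \<times> 'b, 'd \<times> 'e) atlas" where
  "prod_atlas X Y = {(U \<times> V, \<lambda>(x, y). (c x, d y)) | U c V d. (U, c) \<in> X \<and> (V, d) \<in> Y}"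

text \<open>
  Smoothness of a map \<open>S \<rightarrow> Y\<close> defined on a subset \<open>S\<close> of a manifold \<open>X\<close>: in charts, the map has
  local smooth extensions to open sets. If \<open>S\<close> is an embedded submanifold (an open set, a fibre of
  a submersion, a fibre product along a submersion) this is smoothness for the submanifold structure
  of \<open>S\<close>, so that embedded submanifolds need not be given atlases of their own.
\<close>

definition smooth_map ::
    "('a, 'd::real_normed_vector) atlas \<Rightarrow> ('b, 'e::real_normed_vector) atlas \<Rightarrow> 'a set \<Rightarrow> ('a \<Rightarrow> 'b) \<Rightarrow> bool"
  where
  "smooth_map X Y S f \<longleftrightarrow>
     (\<forall>x\<in>S. \<exists>(U, c)\<in>X. \<exists>(V, d)\<in>Y. x \<in> U \<and> f x \<in> V \<and>
        (\<exists>W F. open W \<and> c x \<in> W \<and> Cinf_on F W \<and>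
           (\<forall>y\<in>S \<inter> U. c y \<in> W \<longrightarrow> f y \<in> V \<and> d (f y) = F (c y))))"

definition diffeo ::
    "('a, 'd::real_normed_vector) atlas \<Rightarrow> 'a set \<Rightarrow> ('b, 'e::real_normed_vector) atlas \<Rightarrow> 'b set \<Rightarrow> ('a \<Rightarrow> 'b) \<Rightarrow> bool"
  where
  "diffeo X S Y T f \<longleftrightarrow>
     bij_betw f S T \<and> smooth_map X Y S f \<and> smooth_map Y X T (inv_into S f)"


section \<open>Tangent vectors\<close>

text \<open>
  A tangent vector at \<open>x\<close> assigns to every chart at \<open>x\<close> its coordinate vector, subject to the usual
  transformation rule (and is 0 on all other arguments). The vector space structure is pointwise.
\<close>

type_synonym ('a, 'e) tvec = "('a, 'e) chart \<Rightarrow> 'e"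

definition tspace :: "('a, 'e::real_normed_vector) atlas \<Rightarrow> 'a \<Rightarrow> ('a, 'e) tvec set" where
  "tspace X x = {v.
     (\<forall>U c. (U, c) \<notin> X \<or> x \<notin> U \<longrightarrow> v (U, c) = 0) \<and>
     (\<forall>(U, c)\<in>X. \<forall>(V, d)\<in>X. x \<in> U \<inter> V \<longrightarrow>
        v (V, d) = frechet_derivative (d \<circ> inv_into U c) (at (c x)) (v (U, c)))}"

definition tscale :: "real \<Rightarrow> ('a, 'e::real_normed_vector) tvec \<Rightarrow> ('a, 'e) tvec" where
  "tscale r v = (\<lambda>c. r *\<^sub>R v c)"

definition tangent :: "('a, 'e::real_normed_vector) atlas \<Rightarrow> ('a \<times> ('a, 'e) tvec, 'e \<times> 'e) atlas" where
  "tangent X =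
     {({(x, v). x \<in> U \<and> v \<in> tspace X x}, \<lambda>(x, v). (c x, v (U, c))) | U c. (U, c) \<in> X}"

definition smooth_curve :: "('a, 'e::real_normed_vector) atlas \<Rightarrow> 'a set \<Rightarrow> (real \<Rightarrow> 'a) \<Rightarrow> bool" where
  "smooth_curve X S \<gamma> \<longleftrightarrow>
     (\<exists>\<epsilon>>0. smooth_map model_atlas X {-\<epsilon><..<\<epsilon>} \<gamma> \<and> \<gamma> ` {-\<epsilon><..<\<epsilon>} \<subseteq> S)"

definition velocity :: "('a, 'e::real_normed_vector) atlas \<Rightarrow> (real \<Rightarrow> 'a) \<Rightarrow> ('a, 'e) tvec" where
  "velocity X \<gamma> = (\<lambda>(U, c). if (U, c) \<in> X \<and> \<gamma> 0 \<in> U then vector_derivative (c \<circ> \<gamma>) (at 0) else 0)"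

text \<open>
  The differential at \<open>x\<close> of a smooth map \<open>f : S \<rightarrow> Y\<close>, where \<open>S\<close> is an embedded submanifold of \<open>X\<close>
  and the tangent space of \<open>S\<close> at \<open>x\<close> is regarded as a subspace of that of \<open>X\<close>: it sends the
  velocity of a curve \<open>\<gamma>\<close> in \<open>S\<close> to the velocity of \<open>f \<circ> \<gamma>\<close>.
\<close>

definition tmap ::
    "('a, 'd::real_normed_vector) atlas \<Rightarrow> ('b, 'e::real_normed_vector) atlas \<Rightarrow> 'a set \<Rightarrow> ('a \<Rightarrow> 'b)
      \<Rightarrow> 'a \<Rightarrow> ('a, 'd) tvec \<Rightarrow> ('b, 'e) tvec"
  where
  "tmap X Y S f x v =
     (THE w. \<exists>\<gamma>. smooth_curve X S \<gamma> \<and> \<gamma> 0 = x \<and> velocity X \<gamma> = v \<and> velocity Y (f \<circ> \<gamma>) = w)"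

definition surj_submersion ::
    "('a, 'd::real_normed_vector) atlas \<Rightarrow> ('b, 'e::real_normed_vector) atlas \<Rightarrow> ('a \<Rightarrow> 'b) \<Rightarrow> bool"
  where
  "surj_submersion X Y f \<longleftrightarrow>
     smooth_map X Y (carrier X) f \<and> f ` carrier X = carrier Y \<and>
     (\<forall>x\<in>carrier X. tmap X Y (carrier X) f x ` tspace X x = tspace Y (f x))"


section \<open>Vector bundles\<close>

text \<open>
  The total space of a vector bundle is an embedded submanifold \<open>total E\<close> of a manifold
  \<open>ambient E\<close>. That it is an embedded submanifold is a consequence of local triviality, since
  the trivialisations are diffeomorphisms in the sense of \<open>diffeo\<close>. The typical fibre is a
  linear subspace of the model space of the ambient manifold, which is no restriction as the rank
  is at most the dimension of the total space.
\<close>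

record ('n, 'k, 'p) vbundle =
  ambient :: "('n, 'k) atlas"
  total :: "'n set"
  proj :: "'n \<Rightarrow> 'p"
  vadd :: "'n \<Rightarrow> 'n \<Rightarrow> 'n"
  vscale :: "real \<Rightarrow> 'n \<Rightarrow> 'n"

definition fibre :: "('n, 'k, 'p) vbundle \<Rightarrow> 'p \<Rightarrow> 'n set" where
  "fibre E p = {e \<in> total E. proj E e = p}"

definition vzero :: "('n, 'k, 'p) vbundle \<Rightarrow> 'p \<Rightarrow> 'n" where
  "vzero E p = (THE z. z \<in> fibre E p \<and> (\<forall>e\<in>fibre E p. vadd E z e = e))"

definition vsub :: "('n, 'k, 'p) vbundle \<Rightarrow> 'n \<Rightarrow> 'n \<Rightarrow> 'n" where
  "vsub E e e' = vadd E e (vscale E (-1) e')"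

definition local_trivialization ::
    "('p, 'c::real_normed_vector) atlas \<Rightarrow> ('n, 'k::real_normed_vector, 'p) vbundle \<Rightarrow> 'k set
      \<Rightarrow> 'p set \<Rightarrow> ('n \<Rightarrow> 'k) \<Rightarrow> bool"
  where
  "local_trivialization B E V U \<Phi> \<longleftrightarrow>
     mopen B U \<and>
     diffeo (ambient E) {e \<in> total E. proj E e \<in> U} (prod_atlas B model_atlas) (U \<times> V)
       (\<lambda>e. (proj E e, \<Phi> e)) \<and>
     (\<forall>p\<in>U. \<forall>e\<in>fibre E p. \<forall>e'\<in>fibre E p. vadd E e e' \<in> fibre E p \<and> \<Phi> (vadd E e e') = \<Phi> e + \<Phi> e') \<and>
     (\<forall>p\<in>U. \<forall>e\<in>fibre E p. \<forall>r. vscale E r e \<in> fibre E p \<and> \<Phi> (vscale E r e) = r *\<^sub>R \<Phi> e)"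

definition vector_bundle ::
    "('p, 'c::finite_dim_normed) atlas \<Rightarrow> ('n, 'k::finite_dim_normed, 'p) vbundle \<Rightarrow> bool"
  where
  "vector_bundle B E \<longleftrightarrow>
     manifold B \<and> manifold (ambient E) \<and> total E \<subseteq> carrier (ambient E) \<and>
     smooth_map (ambient E) B (total E) (proj E) \<and>
     (\<exists>V. subspace V \<and> (\<forall>p\<in>carrier B. \<exists>U \<Phi>. p \<in> U \<and> local_trivialization B E V U \<Phi>))"

definition fibre_linear ::
    "('n, 'k, 'p) vbundle \<Rightarrow> 'p \<Rightarrow> ('m, 'l, 'q) vbundle \<Rightarrow> 'q \<Rightarrow> ('n \<Rightarrow> 'm) \<Rightarrow> bool"
  where
  "fibre_linear E p F q f \<longleftrightarrow>
     (\<forall>e\<in>fibre E p. f e \<in> fibre F q) \<and>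
     (\<forall>e\<in>fibre E p. \<forall>e'\<in>fibre E p. f (vadd E e e') = vadd F (f e) (f e')) \<and>
     (\<forall>e\<in>fibre E p. \<forall>r. f (vscale E r e) = vscale F r (f e))"

definition tangent_subbundle ::
    "('a, 'e::real_normed_vector) atlas \<Rightarrow> ('a \<times> ('a, 'e) tvec) set \<Rightarrow> ('a \<times> ('a, 'e) tvec, 'e \<times> 'e, 'a) vbundle"
  where
  "tangent_subbundle X H =
     \<lparr>ambient = tangent X, total = H, proj = fst,
      vadd = (\<lambda>(x, v) (y, w). (x, v + w)), vscale = (\<lambda>r (x, v). (x, tscale r v))\<rparr>"


section \<open>Lie groupoids and principal bundles\<close>

text \<open>The product \<open>gcomp X g h\<close> is meaningful only if \<open>src X g = tgt X h\<close>.\<close>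

record ('x, 'd, 'g, 'e) groupoid =
  obj :: "('x, 'd) atlas"
  arr :: "('g, 'e) atlas"
  src :: "'g \<Rightarrow> 'x"
  tgt :: "'g \<Rightarrow> 'x"
  gcomp :: "'g \<Rightarrow> 'g \<Rightarrow> 'g"
  gunit :: "'x \<Rightarrow> 'g"
  ginv :: "'g \<Rightarrow> 'g"

definition composable :: "('x, 'd, 'g, 'e) groupoid \<Rightarrow> ('g \<times> 'g) set" where
  "composable X = {(g, h). g \<in> carrier (arr X) \<and> h \<in> carrier (arr X) \<and> src X g = tgt X h}"

definition lie_groupoid ::
    "('x, 'd::finite_dim_normed, 'g, 'e::finite_dim_normed) groupoid \<Rightarrow> bool"
  where
  "lie_groupoid X \<longleftrightarrow>
     manifold (obj X) \<and> manifold (arr X) \<and>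
     surj_submersion (arr X) (obj X) (src X) \<and> surj_submersion (arr X) (obj X) (tgt X) \<and>
     smooth_map (prod_atlas (arr X) (arr X)) (arr X) (composable X) (\<lambda>(g, h). gcomp X g h) \<and>
     smooth_map (obj X) (arr X) (carrier (obj X)) (gunit X) \<and>
     smooth_map (arr X) (arr X) (carrier (arr X)) (ginv X) \<and>
     (\<forall>(g, h)\<in>composable X. src X (gcomp X g h) = src X h \<and> tgt X (gcomp X g h) = tgt X g) \<and>
     (\<forall>g h k. (g, h) \<in> composable X \<and> (h, k) \<in> composable X \<longrightarrow>
        gcomp X (gcomp X g h) k = gcomp X g (gcomp X h k)) \<and>
     (\<forall>x\<in>carrier (obj X). src X (gunit X x) = x \<and> tgt X (gunit X x) = x) \<and>
     (\<forall>g\<in>carrier (arr X). gcomp X g (gunit X (src X g)) = g \<and> gcomp X (gunit X (tgt X g)) g = g) \<and>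
     (\<forall>g\<in>carrier (arr X).
        src X (ginv X g) = tgt X g \<and> tgt X (ginv X g) = src X g \<and>
        gcomp X g (ginv X g) = gunit X (tgt X g) \<and> gcomp X (ginv X g) g = gunit X (src X g))"

definition action_domain ::
    "('x, 'd, 'g, 'e) groupoid \<Rightarrow> ('p, 'c) atlas \<Rightarrow> ('p \<Rightarrow> 'x) \<Rightarrow> ('p \<times> 'g) set"
  where
  "action_domain X P a = {(p, g). p \<in> carrier P \<and> g \<in> carrier (arr X) \<and> a p = tgt X g}"

definition right_action ::
    "('x, 'd::finite_dim_normed, 'g, 'e::finite_dim_normed) groupoid \<Rightarrow> ('p, 'c::finite_dim_normed) atlas
      \<Rightarrow> ('p \<Rightarrow> 'x) \<Rightarrow> ('p \<Rightarrow> 'g \<Rightarrow> 'p) \<Rightarrow> bool"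
  where
  "right_action X P a act \<longleftrightarrow>
     manifold P \<and>
     smooth_map P (obj X) (carrier P) a \<and>
     smooth_map (prod_atlas P (arr X)) P (action_domain X P a) (\<lambda>(p, g). act p g) \<and>
     (\<forall>(p, g)\<in>action_domain X P a. a (act p g) = src X g) \<and>
     (\<forall>p g h. (p, g) \<in> action_domain X P a \<and> (g, h) \<in> composable X \<longrightarrow>
        act (act p g) h = act p (gcomp X g h)) \<and>
     (\<forall>p\<in>carrier P. act p (gunit X (a p)) = p)"

definition principal_bundle ::
    "('x, 'd::finite_dim_normed, 'g, 'e::finite_dim_normed) groupoid \<Rightarrow> ('p, 'c::finite_dim_normed) atlas
      \<Rightarrow> ('m, 'b::finite_dim_normed) atlas \<Rightarrow> ('p \<Rightarrow> 'm) \<Rightarrow> ('p \<Rightarrow> 'x) \<Rightarrow> ('p \<Rightarrow> 'g \<Rightarrow> 'p) \<Rightarrow> bool"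
  where
  "principal_bundle X P M \<pi> a act \<longleftrightarrow>
     manifold M \<and> right_action X P a act \<and> surj_submersion P M \<pi> \<and>
     (\<forall>(p, g)\<in>action_domain X P a. \<pi> (act p g) = \<pi> p) \<and>
     diffeo (prod_atlas P (arr X)) (action_domain X P a)
       (prod_atlas P P) {(p, q). p \<in> carrier P \<and> q \<in> carrier P \<and> \<pi> p = \<pi> q}
       (\<lambda>(p, g). (p, act p g))"


section \<open>Ehresmann connections and the adjoint quasi action\<close>

definition dsrc :: "('x, 'd::real_normed_vector, 'g, 'e::real_normed_vector) groupoid
    \<Rightarrow> 'g \<Rightarrow> ('g, 'e) tvec \<Rightarrow> ('x, 'd) tvec" where
  "dsrc X g = tmap (arr X) (obj X) (carrier (arr X)) (src X) g"

definition dtgt :: "('x, 'd::real_normed_vector, 'g, 'e::real_normed_vector) groupoid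
    \<Rightarrow> 'g \<Rightarrow> ('g, 'e) tvec \<Rightarrow> ('x, 'd) tvec" where
  "dtgt X g = tmap (arr X) (obj X) (carrier (arr X)) (tgt X) g"

definition dunit :: "('x, 'd::real_normed_vector, 'g, 'e::real_normed_vector) groupoid
    \<Rightarrow> 'x \<Rightarrow> ('x, 'd) tvec \<Rightarrow> ('g, 'e) tvec" where
  "dunit X x = tmap (obj X) (arr X) (carrier (obj X)) (gunit X) x"

text \<open>
  The differential of the product at \<open>(g, h)\<close>, applied to a tangent vector \<open>(\<beta>, \<alpha>)\<close> of the manifold
  of composable pairs, which is represented by a curve of composable pairs.
\<close>

definition dcomp :: "('x, 'd::real_normed_vector, 'g, 'e::real_normed_vector) groupoid
    \<Rightarrow> 'g \<Rightarrow> 'g \<Rightarrow> ('g, 'e) tvec \<Rightarrow> ('g, 'e) tvec \<Rightarrow> ('g, 'e) tvec" where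
  "dcomp X g h \<beta> \<alpha> =
     (THE w. \<exists>\<gamma> \<delta>. smooth_curve (prod_atlas (arr X) (arr X)) (composable X) (\<lambda>t. (\<gamma> t, \<delta> t)) \<and>
        \<gamma> 0 = g \<and> \<delta> 0 = h \<and> velocity (arr X) \<gamma> = \<beta> \<and> velocity (arr X) \<delta> = \<alpha> \<and>
        velocity (arr X) (\<lambda>t. gcomp X (\<gamma> t) (\<delta> t)) = w)"

definition src_fibre :: "('x, 'd, 'g, 'e) groupoid \<Rightarrow> 'x \<Rightarrow> 'g set" where
  "src_fibre X x = {g \<in> carrier (arr X). src X g = x}"

definition algebroid :: "('x, 'd::real_normed_vector, 'g, 'e::real_normed_vector) groupoid
    \<Rightarrow> 'x \<Rightarrow> ('g, 'e) tvec set" where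
  "algebroid X x = {\<alpha> \<in> tspace (arr X) (gunit X x). dsrc X (gunit X x) \<alpha> = 0}"

definition rtrans :: "('x, 'd::real_normed_vector, 'g, 'e::real_normed_vector) groupoid
    \<Rightarrow> 'g \<Rightarrow> ('g, 'e) tvec \<Rightarrow> ('g, 'e) tvec" where
  "rtrans X g =
     tmap (arr X) (arr X) (src_fibre X (tgt X g)) (\<lambda>h. gcomp X h g) (gunit X (tgt X g))"

definition ltrans :: "('x, 'd::real_normed_vector, 'g, 'e::real_normed_vector) groupoid
    \<Rightarrow> 'g \<Rightarrow> ('g, 'e) tvec \<Rightarrow> ('g, 'e) tvec" where
  "ltrans X g =
     tmap (arr X) (arr X) (src_fibre X (src X g)) (\<lambda>h. gcomp X g (ginv X h)) (gunit X (src X g))"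

definition ehresmann_connection ::
    "('x, 'd::finite_dim_normed, 'g, 'e::finite_dim_normed) groupoid \<Rightarrow> ('g \<times> ('g, 'e) tvec) set \<Rightarrow> bool"
  where
  "ehresmann_connection X H \<longleftrightarrow>
     vector_bundle (arr X) (tangent_subbundle (arr X) H) \<and>
     (\<forall>g\<in>carrier (arr X).
        (let Hg = {w. (g, w) \<in> H}; Kg = {w \<in> tspace (arr X) g. dsrc X g w = 0}
         in tspace (arr X) g = {w + u | w u. w \<in> Hg \<and> u \<in> Kg} \<and> Hg \<inter> Kg = {0})) \<and>
     (\<forall>x\<in>carrier (obj X). {w. (gunit X x, w) \<in> H} = dunit X x ` tspace (obj X) x)"

definition hlift :: "('x, 'd::real_normed_vector, 'g, 'e::real_normed_vector) groupoid
    \<Rightarrow> ('g \<times> ('g, 'e) tvec) set \<Rightarrow> 'g \<Rightarrow> ('x, 'd) tvec \<Rightarrow> ('g, 'e) tvec" where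
  "hlift X H g v = (THE w. (g, w) \<in> H \<and> dsrc X g w = v)"

definition vpart :: "('x, 'd::real_normed_vector, 'g, 'e::real_normed_vector) groupoid
    \<Rightarrow> ('g \<times> ('g, 'e) tvec) set \<Rightarrow> 'g \<Rightarrow> ('g, 'e) tvec \<Rightarrow> ('g, 'e) tvec" where
  "vpart X H g w =
     (THE \<alpha>. \<alpha> \<in> algebroid X (tgt X g) \<and> rtrans X g \<alpha> + hlift X H g (dsrc X g w) = w)"

definition lambda0 :: "('x, 'd::real_normed_vector, 'g, 'e::real_normed_vector) groupoid
    \<Rightarrow> ('g \<times> ('g, 'e) tvec) set \<Rightarrow> 'g \<Rightarrow> ('g, 'e) tvec \<Rightarrow> ('g, 'e) tvec" where
  "lambda0 X H g \<alpha> = - vpart X H g (ltrans X g \<alpha>)"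

definition lambda1 :: "('x, 'd::real_normed_vector, 'g, 'e::real_normed_vector) groupoid
    \<Rightarrow> ('g \<times> ('g, 'e) tvec) set \<Rightarrow> 'g \<Rightarrow> ('x, 'd) tvec \<Rightarrow> ('x, 'd) tvec" where
  "lambda1 X H g v = dtgt X g (hlift X H g v)"

definition basic_curvature :: "('x, 'd::real_normed_vector, 'g, 'e::real_normed_vector) groupoid
    \<Rightarrow> ('g \<times> ('g, 'e) tvec) set \<Rightarrow> 'g \<Rightarrow> 'g \<Rightarrow> ('x, 'd) tvec \<Rightarrow> ('g, 'e) tvec" where
  "basic_curvature X H g h v =
     - vpart X H (gcomp X g h) (dcomp X g h (hlift X H g (lambda1 X H h v)) (hlift X H h v))"


section \<open>Quasi equivariant bundles up to homotopy\<close>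

definition quasi_equivariant_bundle ::
    "('x, 'd::finite_dim_normed, 'g, 'e::finite_dim_normed) groupoid \<Rightarrow> ('p, 'c::finite_dim_normed) atlas
      \<Rightarrow> ('p \<Rightarrow> 'x) \<Rightarrow> ('p \<Rightarrow> 'g \<Rightarrow> 'p)
      \<Rightarrow> ('n, 'k::finite_dim_normed, 'p) vbundle \<Rightarrow> ('m, 'l::finite_dim_normed, 'p) vbundle
      \<Rightarrow> ('g \<Rightarrow> 'n \<Rightarrow> 'n) \<Rightarrow> ('g \<Rightarrow> 'm \<Rightarrow> 'm) \<Rightarrow> ('n \<Rightarrow> 'm) \<Rightarrow> ('g \<Rightarrow> 'g \<Rightarrow> 'm \<Rightarrow> 'n) \<Rightarrow> bool"
  where
  "quasi_equivariant_bundle X P a act E0 E1 \<tau>0 \<tau>1 \<xi> \<Upsilon> \<longleftrightarrow>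
     right_action X P a act \<and> vector_bundle P E0 \<and> vector_bundle P E1 \<and>
     smooth_map (prod_atlas (ambient E0) (arr X)) (ambient E0)
       {(e, g). e \<in> total E0 \<and> (proj E0 e, g) \<in> action_domain X P a} (\<lambda>(e, g). \<tau>0 g e) \<and>
     smooth_map (prod_atlas (ambient E1) (arr X)) (ambient E1)
       {(e, g). e \<in> total E1 \<and> (proj E1 e, g) \<in> action_domain X P a} (\<lambda>(e, g). \<tau>1 g e) \<and>
     (\<forall>(p, g)\<in>action_domain X P a.
        fibre_linear E0 p E0 (act p g) (\<tau>0 g) \<and> fibre_linear E1 p E1 (act p g) (\<tau>1 g)) \<and>
     (\<forall>p\<in>carrier P.
        (\<forall>e\<in>fibre E0 p. \<tau>0 (gunit X (a p)) e = e) \<and> (\<forall>e\<in>fibre E1 p. \<tau>1 (gunit X (a p)) e = e)) \<and>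
     smooth_map (ambient E0) (ambient E1) (total E0) \<xi> \<and>
     (\<forall>p\<in>carrier P. fibre_linear E0 p E1 p \<xi>) \<and>
     smooth_map (prod_atlas (ambient E1) (prod_atlas (arr X) (arr X))) (ambient E0)
       {(e, g, h). e \<in> total E1 \<and> (proj E1 e, g) \<in> action_domain X P a \<and> (g, h) \<in> composable X}
       (\<lambda>(e, g, h). \<Upsilon> g h e) \<and>
     (\<forall>p g h. (p, g) \<in> action_domain X P a \<and> (g, h) \<in> composable X \<longrightarrow>
        fibre_linear E1 p E0 (act p (gcomp X g h)) (\<Upsilon> g h)) \<and>
     (\<forall>p g. (p, g) \<in> action_domain X P a \<longrightarrow> (\<forall>e\<in>fibre E0 p. \<xi> (\<tau>0 g e) = \<tau>1 g (\<xi> e))) \<and>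
     (\<forall>p g h. (p, g) \<in> action_domain X P a \<and> (g, h) \<in> composable X \<longrightarrow>
        (\<forall>e\<in>fibre E0 p. vsub E0 (\<tau>0 (gcomp X g h) e) (\<tau>0 h (\<tau>0 g e)) = \<Upsilon> g h (\<xi> e)) \<and>
        (\<forall>e\<in>fibre E1 p. vsub E1 (\<tau>1 (gcomp X g h) e) (\<tau>1 h (\<tau>1 g e)) = \<xi> (\<Upsilon> g h e))) \<and>
     (\<forall>p g h k. (p, g) \<in> action_domain X P a \<and> (g, h) \<in> composable X \<and> (h, k) \<in> composable X \<longrightarrow>
        (\<forall>e\<in>fibre E1 p.
           vsub E0
             (vsub E0
               (vadd E0 (\<tau>0 k (\<Upsilon> g h e)) (\<Upsilon> (gcomp X g h) k e))
               (\<Upsilon> g (gcomp X h k) e))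
             (\<Upsilon> h k (\<tau>1 g e))
           = vzero E0 (act p (gcomp X (gcomp X g h) k))))"


section \<open>The two bundles over \<open>P\<close>\<close>

text \<open>
  Elements of the Lie algebroid over \<open>x\<close> and of the tangent bundle are pairs of a base point and a
  tangent vector, so a point of \<open>P \<times>\<^sub>X A\<close> has the form \<open>(p, (1\<^bsub>a p\<^esub>, \<alpha>))\<close>, and a point of the pulled
  back tangent bundle has the form \<open>(p, (a p, v))\<close>.
\<close>

definition algebroid_pullback ::
    "('x, 'd::real_normed_vector, 'g, 'e::real_normed_vector) groupoid \<Rightarrow> ('p, 'c::real_normed_vector) atlas
      \<Rightarrow> ('p \<Rightarrow> 'x) \<Rightarrow> ('p \<times> 'g \<times> ('g, 'e) tvec, 'c \<times> 'e \<times> 'e, 'p) vbundle"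
  where
  "algebroid_pullback X P a =
     \<lparr>ambient = prod_atlas P (tangent (arr X)),
      total = {(p, u, \<alpha>). p \<in> carrier P \<and> u = gunit X (a p) \<and> \<alpha> \<in> algebroid X (a p)},
      proj = fst,
      vadd = (\<lambda>(p, u, \<alpha>) (q, w, \<beta>). (p, u, \<alpha> + \<beta>)),
      vscale = (\<lambda>r (p, u, \<alpha>). (p, u, tscale r \<alpha>))\<rparr>"

definition tangent_pullback ::
    "('x, 'd::real_normed_vector, 'g, 'e::real_normed_vector) groupoid \<Rightarrow> ('p, 'c::real_normed_vector) atlas
      \<Rightarrow> ('p \<Rightarrow> 'x) \<Rightarrow> ('p \<times> 'x \<times> ('x, 'd) tvec, 'c \<times> 'd \<times> 'd, 'p) vbundle"
  where
  "tangent_pullback X P a =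
     \<lparr>ambient = prod_atlas P (tangent (obj X)),
      total = {(p, x, v). p \<in> carrier P \<and> x = a p \<and> v \<in> tspace (obj X) (a p)},
      proj = fst,
      vadd = (\<lambda>(p, x, v) (q, y, w). (p, x, v + w)),
      vscale = (\<lambda>r (p, x, v). (p, x, tscale r v))\<rparr>"

end

theory Submission
  imports Defs
begin

text \<open>
  Everything takes place in the tangent groupoid \<open>TX\<^sub>1 \<rightrightarrows> TX\<^sub>0\<close>. Its product \<open>\<beta>.\<alpha>\<close> is bilinear in the
  sense that \<open>(\<beta> + \<beta>').(\<alpha> + \<alpha>') = \<beta>.\<alpha> + \<beta>'.\<alpha>'\<close>, and differentiating the groupoid laws along
  curves shows that it is associative and has units and inverses (\<open>dcomp_add\<close>, \<open>dcomp_assoc\<close>,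
  \<open>dcomp_dunit\<close>, \<open>dinv_dcomp\<close>). In these terms right translation is \<open>r\<^sub>g\<alpha> = \<alpha>.0\<^sub>g\<close>, left translation
  is \<open>l\<^sub>g\<alpha> = 0\<^sub>g.di(\<alpha>)\<close>, and the vertical part is \<open>\<psi>\<^sub>gw = (w - \<sigma>\<^sub>g ds(w)).0\<^sub>i\<close> with \<open>i\<close> the inverse
  of \<open>g\<close>. Write \<open>\<rho>\<close> for the restriction of \<open>dt\<close> to \<open>A\<close>. The quasi action and the curvature are
  characterised by
    \<open>\<sigma>\<^sub>g(\<rho>\<alpha>) = l\<^sub>g\<alpha> + r\<^sub>g(\<lambda>\<^sup>0\<^sub>g\<alpha>)\<close> and \<open>\<sigma>\<^sub>g\<^sub>h(v) = \<sigma>\<^sub>g(\<lambda>\<^sup>1\<^sub>hv).\<sigma>\<^sub>h(v) + r\<^sub>g\<^sub>h K(g,h)(v)\<close>,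
  since \<open>r\<^sub>g\<close> is injective.

  Applying \<open>dt\<close> to these two equations gives \<open>\<rho>\<lambda>\<^sup>0\<^sub>g = \<lambda>\<^sup>1\<^sub>g\<rho>\<close> and \<open>\<lambda>\<^sup>1\<^sub>g\<^sub>h - \<lambda>\<^sup>1\<^sub>g\<lambda>\<^sup>1\<^sub>h = \<rho>K(g,h)\<close>
  (\<open>lambda_anchor\<close>, \<open>lambda1_curv\<close>). For \<open>\<lambda>\<^sup>0\<^sub>g\<^sub>h - \<lambda>\<^sup>0\<^sub>g\<lambda>\<^sup>0\<^sub>h = K(g,h)\<rho>\<close> one multiplies two instances of
  the first equation: with \<open>\<beta> = \<lambda>\<^sup>0\<^sub>h\<alpha>\<close> the product of \<open>l\<^sub>g\<beta> + r\<^sub>g(\<lambda>\<^sup>0\<^sub>g\<beta>)\<close> and \<open>r\<^sub>h\<beta> + l\<^sub>h\<alpha>\<close> is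
  \<open>r\<^sub>g\<^sub>h(\<lambda>\<^sup>0\<^sub>g\<beta>) + l\<^sub>g\<^sub>h\<alpha>\<close>, because \<open>(l\<^sub>g\<beta>).(r\<^sub>h\<beta>) = 0\<^sub>g.di(\<beta>).\<beta>.0\<^sub>h = 0\<close> (\<open>lambda0_curv\<close>). The cocycle
  identity for \<open>K\<close> expresses associativity of the triple product
  \<open>\<sigma>\<^sub>g(\<lambda>\<^sup>1\<^sub>h\<lambda>\<^sup>1\<^sub>kv).\<sigma>\<^sub>h(\<lambda>\<^sup>1\<^sub>kv).\<sigma>\<^sub>k(v)\<close>: each bracketing expresses it through \<open>\<sigma>\<^sub>g\<^sub>h\<^sub>k(v)\<close> and two values of
  \<open>K\<close> (\<open>curv_cocycle\<close>). A right action by \<open>g\<close> uses the left quasi action of the inverse of \<open>g\<close>, so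
  these are the identities required of the quasi equivariant bundle.

  The differentials of maps on submanifolds are defined by curves, so their use rests on the
  existence of enough curves. A submersion lifts curves with prescribed initial velocity
  (\<open>submersion_lift\<close>), by the inverse function theorem (\<open>local_right_inverse\<close>); lifting along the
  source map produces curves of composable pairs and curves in source fibres.

  Smoothness follows by composition once the basic operations are known to be smooth: \<open>Tf\<close> for
  smooth \<open>f\<close>, zero sections, differences, the product of the tangent groupoid, and \<open>\<sigma>\<close>. For \<open>\<sigma>\<close> a
  local frame of the connection is mapped by \<open>ds\<close> to a frame, whose matrix is inverted smoothly
  (\<open>hlift_local\<close>). The same inversion straightens the kernels of \<open>ds\<close> along the units, which makes
  \<open>P \<times>\<^sub>X A\<close> locally trivial (\<open>vector_bundle_E0\<close>).
\<close>


section \<open>Finite-dimensional normed spaces\<close>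

definition fbasis :: "'a::finite_dim_normed set" where
  "fbasis = (SOME B. finite B \<and> independent B \<and> span B = UNIV)"

lemma fbasis:
  shows finite_fbasis: "finite (fbasis :: 'a::finite_dim_normed set)"
    and independent_fbasis: "independent (fbasis :: 'a set)"
    and span_fbasis: "span (fbasis :: 'a set) = UNIV"
proof -
  obtain B :: "'a set" where B: "finite B" "\<And>x. \<exists>c. x = (\<Sum>b\<in>B. c b *\<^sub>R b)"
    using finite_dim by blast
  have sB: "span B = UNIV"
  proof -
    have "x \<in> span B" for x
    proof -
      obtain c where "x = (\<Sum>b\<in>B. c b *\<^sub>R b)" using B(2) by blast
      then show ?thesis by (simp add: span_sum span_scale span_base)
    qed
    then show ?thesis by blast
  qed
  obtain C where C: "C \<subseteq> B" "independent C" "B \<subseteq> span C"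
    using maximal_independent_subset[of B] by auto
  have "span C = UNIV"
    using span_mono[OF C(3)] sB by (metis span_span top.extremum_uniqueI)
  then have "\<exists>B::'a set. finite B \<and> independent B \<and> span B = UNIV"
    using C B(1) finite_subset by blast
  from someI_ex[OF this]
  show "finite (fbasis :: 'a set)" "independent (fbasis :: 'a set)" "span (fbasis :: 'a set) = UNIV"
    by (simp_all add: fbasis_def)
qed

lemma fin_dim_fbasis:
  "finite_dimensional_vector_space (scaleR :: real \<Rightarrow> 'a \<Rightarrow> 'a::finite_dim_normed) fbasis"
  by unfold_locales
    (simp_all add: fbasis[unfolded dependent_raw_def span_raw_def])

global_interpretation fin: finite_dimensional_vector_space
    "scaleR :: real \<Rightarrow> 'a \<Rightarrow> 'a::finite_dim_normed" fbasis
  rewrites "module.dependent (*\<^sub>R) = dependent"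
    and "module.representation (*\<^sub>R) = representation"
    and "module.subspace (*\<^sub>R) = subspace"
    and "module.span (*\<^sub>R) = span"
    and "vector_space.extend_basis (*\<^sub>R) = extend_basis"
    and "vector_space.dim (*\<^sub>R) = dim"
    and "Vector_Spaces.linear (*\<^sub>R) (*\<^sub>R) = linear"
  using fin_dim_fbasis
  by (auto simp add: dependent_raw_def representation_raw_def
      subspace_raw_def span_raw_def extend_basis_raw_def dim_raw_def linear_def)

definition fcoord :: "'a::finite_dim_normed \<Rightarrow> 'a \<Rightarrow> real" where
  "fcoord b x = representation fbasis x b"

lemma fcoord_expand: "(\<Sum>b\<in>fbasis. fcoord b x *\<^sub>R b) = (x::'a::finite_dim_normed)"
  unfolding fcoord_def
  by (rule sum_representation_eq) (auto simp: fbasis)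

lemma linear_fcoord: "linear (fcoord (b::'a::finite_dim_normed))"
  unfolding fcoord_def
  by (rule linearI)
    (auto simp: fbasis representation_add representation_scale)

text \<open>
  A vector outside a finite-dimensional subspace keeps a positive distance from it: otherwise it
  would be a limit of vectors of the subspace, whose coordinates would form Cauchy sequences.
  By induction on the basis, this bounds the coordinates by the norm.
\<close>

lemma coordinates_bounded:
  fixes B :: "'a::real_normed_vector set"
  assumes "finite B" "independent B"
  shows "\<exists>C. \<forall>f. \<forall>b\<in>B. \<bar>f b\<bar> \<le> C * norm (\<Sum>b\<in>B. f b *\<^sub>R b)"
  using assms
proof (induction B rule: finite_induct)
  case empty
  then show ?case by simp
next
  case (insert b0 B)
  have indB: "independent B" using insert.prems by (rule independent_mono) auto
  with insert.IH obtain C0 where "\<forall>f. \<forall>b\<in>B. \<bar>f b\<bar> \<le> C0 * norm (\<Sum>b\<in>B. f b *\<^sub>R b)" by blast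
  then have C: "\<bar>f b\<bar> \<le> \<bar>C0\<bar> * norm (\<Sum>b\<in>B. f b *\<^sub>R b)" if "b \<in> B" for f b
    using that by (meson abs_ge_self mult_right_mono norm_ge_zero order_trans)
  have nspan: "b0 \<notin> span B"
    using insert.prems insert.hyps(2) by (simp add: independent_insert)
  obtain d where d: "d > 0" "\<And>f. d \<le> norm (b0 - (\<Sum>b\<in>B. f b *\<^sub>R b))"
  proof (rule ccontr)
    assume "\<not> thesis"
    then have "\<And>d. d > 0 \<Longrightarrow> \<exists>f. norm (b0 - (\<Sum>b\<in>B. f b *\<^sub>R b)) < d"
      using that by (meson linorder_not_less)
    then have "\<forall>n. \<exists>f. norm (b0 - (\<Sum>b\<in>B. f b *\<^sub>R b)) < inverse (real (Suc n))"
      by (metis inverse_positive_iff_positive of_nat_0_less_iff zero_less_Suc)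
    then obtain f where f: "\<And>n. norm (b0 - (\<Sum>b\<in>B. f n b *\<^sub>R b)) < inverse (real (Suc n))"
      by metis
    let ?s = "\<lambda>n. (\<Sum>b\<in>B. f n b *\<^sub>R b)"
    have lim: "?s \<longlonglongrightarrow> b0"
    proof -
      have "(\<lambda>n. ?s n - b0) \<longlonglongrightarrow> 0"
        by (rule Lim_null_comparison[OF _ LIMSEQ_inverse_real_of_nat])
          (use f in \<open>auto intro!: always_eventually less_imp_le simp: norm_minus_commute\<close>)
      then show ?thesis by (simp add: LIM_zero_iff)
    qed
    have "Cauchy (\<lambda>n. f n b)" if "b \<in> B" for b
    proof (rule metric_CauchyI)
      fix e :: real assume "e > 0"
      then have e': "e / (\<bar>C0\<bar> + 1) > 0" by simp
      from LIMSEQ_imp_Cauchy[OF lim] e' obtain N where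
        N: "\<And>m n. m \<ge> N \<Longrightarrow> n \<ge> N \<Longrightarrow> dist (?s m) (?s n) < e / (\<bar>C0\<bar> + 1)"
        unfolding Cauchy_def by blast
      have "dist (f m b) (f n b) < e" if mn: "m \<ge> N" "n \<ge> N" for m n
      proof -
        have "\<bar>f m b - f n b\<bar> \<le> \<bar>C0\<bar> * norm (\<Sum>b\<in>B. (f m b - f n b) *\<^sub>R b)"
          using C[OF \<open>b \<in> B\<close>, of "\<lambda>b. f m b - f n b"] by simp
        also have "\<dots> = \<bar>C0\<bar> * dist (?s m) (?s n)"
          by (simp add: dist_norm scaleR_diff_left sum_subtractf)
        also have "\<dots> \<le> \<bar>C0\<bar> * (e / (\<bar>C0\<bar> + 1))"
          using N[OF mn] by (intro mult_left_mono) auto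
        also have "\<dots> < e" using \<open>e > 0\<close> by (simp add: field_simps)
        finally show ?thesis by (simp add: dist_real_def)
      qed
      then show "\<exists>M. \<forall>m\<ge>M. \<forall>n\<ge>M. dist (f m b) (f n b) < e" by blast
    qed
    then have "\<forall>b\<in>B. \<exists>l. (\<lambda>n. f n b) \<longlonglongrightarrow> l"
      by (meson Cauchy_convergent_iff convergent_def)
    then obtain l where l: "\<And>b. b \<in> B \<Longrightarrow> (\<lambda>n. f n b) \<longlonglongrightarrow> l b" by metis
    have "?s \<longlonglongrightarrow> (\<Sum>b\<in>B. l b *\<^sub>R b)"
      by (intro tendsto_sum tendsto_scaleR l tendsto_const)
    then have "b0 = (\<Sum>b\<in>B. l b *\<^sub>R b)" using lim LIMSEQ_unique by blast
    then have "b0 \<in> span B" by (simp add: span_sum span_scale span_base)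
    then show False using nspan by simp
  qed
  have b0: "\<bar>f b0\<bar> \<le> (1 / d) * norm (\<Sum>b\<in>insert b0 B. f b *\<^sub>R b)" for f
  proof (cases "f b0 = 0")
    case True then show ?thesis using d by simp
  next
    case False
    have "d \<le> norm (b0 - (\<Sum>b\<in>B. (- f b / f b0) *\<^sub>R b))" by (rule d)
    also have "b0 - (\<Sum>b\<in>B. (- f b / f b0) *\<^sub>R b) = (1 / f b0) *\<^sub>R (\<Sum>b\<in>insert b0 B. f b *\<^sub>R b)"
      using False insert.hyps by (simp add: scaleR_add_right scaleR_sum_right sum_negf)
    also have "norm \<dots> = norm (\<Sum>b\<in>insert b0 B. f b *\<^sub>R b) / \<bar>f b0\<bar>" by simp
    finally show ?thesis using d False by (simp add: field_simps)
  qed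
  let ?C = "1 / d + \<bar>C0\<bar> * (1 + (1 / d) * norm b0)"
  have "\<bar>f b\<bar> \<le> ?C * norm (\<Sum>b\<in>insert b0 B. f b *\<^sub>R b)" if "b \<in> insert b0 B" for f b
  proof -
    let ?x = "\<Sum>b\<in>insert b0 B. f b *\<^sub>R b"
    show ?thesis
    proof (cases "b = b0")
      case True
      have "\<bar>f b\<bar> \<le> (1 / d) * norm ?x" using b0 True by simp
      also have "\<dots> \<le> ?C * norm ?x" using d by (intro mult_right_mono) auto
      finally show ?thesis .
    next
      case False
      then have "b \<in> B" using that by simp
      then have "\<bar>f b\<bar> \<le> \<bar>C0\<bar> * norm (\<Sum>b\<in>B. f b *\<^sub>R b)" by (rule C)
      also have "(\<Sum>b\<in>B. f b *\<^sub>R b) = ?x - f b0 *\<^sub>R b0" using insert.hyps by simp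
      also have "\<bar>C0\<bar> * norm (?x - f b0 *\<^sub>R b0) \<le> \<bar>C0\<bar> * (norm ?x + \<bar>f b0\<bar> * norm b0)"
        by (intro mult_left_mono order_trans[OF norm_triangle_ineq4]) auto
      also have "\<dots> \<le> \<bar>C0\<bar> * (norm ?x + ((1 / d) * norm ?x) * norm b0)"
        by (intro mult_left_mono add_left_mono mult_right_mono b0) auto
      also have "\<dots> = (\<bar>C0\<bar> * (1 + (1 / d) * norm b0)) * norm ?x" by (simp add: algebra_simps)
      also have "\<dots> \<le> ?C * norm ?x" using d by (intro mult_right_mono) auto
      finally show ?thesis .
    qed
  qed
  then show ?case by blast
qed

lemma bounded_linear_fcoord: "b \<in> fbasis \<Longrightarrow> bounded_linear (fcoord b)"
proof -
  assume b: "b \<in> fbasis"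
  obtain C where "\<And>f b. b \<in> fbasis \<Longrightarrow> \<bar>f b\<bar> \<le> C * norm (\<Sum>b\<in>fbasis. f b *\<^sub>R (b::'a))"
    using coordinates_bounded[OF finite_fbasis independent_fbasis] by metis
  from this[OF b, of "\<lambda>b. fcoord b _"] have "\<bar>fcoord b x\<bar> \<le> C * norm x" for x
    by (simp add: fcoord_expand)
  then show "bounded_linear (fcoord b)"
    using linear_fcoord[of b]
    by (intro bounded_linear_intro[of _ C]) (auto simp: linear_add linear_cmul mult.commute)
qed

lemma linear_fcoord_expand:
  fixes f :: "'a::finite_dim_normed \<Rightarrow> 'b::real_normed_vector"
  assumes "linear f"
  shows "f x = (\<Sum>b\<in>fbasis. fcoord b x *\<^sub>R f b)"
proof -
  have "f x = f (\<Sum>b\<in>fbasis. fcoord b x *\<^sub>R b)" by (simp add: fcoord_expand)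
  then show ?thesis by (simp add: linear_sum[OF assms] linear_cmul[OF assms])
qed

lemma linear_imp_bounded_linear:
  fixes f :: "'a::finite_dim_normed \<Rightarrow> 'b::real_normed_vector"
  assumes "linear f"
  shows "bounded_linear f"
proof -
  have "bounded_linear (\<lambda>x. \<Sum>b\<in>fbasis. fcoord b x *\<^sub>R f b)"
    by (intro bounded_linear_sum bounded_linear_scaleR_const bounded_linear_fcoord)
  then show ?thesis by (simp flip: linear_fcoord_expand[OF assms])
qed

text \<open>
  Completeness is what the contraction argument in the inverse function theorem needs; second
  countability of the model spaces carries over to tangent bundles.
\<close>

instance finite_dim_normed \<subseteq> banach
proof
  fix X :: "nat \<Rightarrow> 'a" assume X: "Cauchy X"
  have "\<exists>l. (\<lambda>n. fcoord b (X n)) \<longlonglongrightarrow> l" if "b \<in> fbasis" for b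
    using bounded_linear.Cauchy[OF bounded_linear_fcoord[OF that] X]
    by (simp add: Cauchy_convergent_iff convergent_def)
  then obtain l where l: "\<And>b. b \<in> fbasis \<Longrightarrow> (\<lambda>n. fcoord b (X n)) \<longlonglongrightarrow> l b" by metis
  have "(\<lambda>n. \<Sum>b\<in>fbasis. fcoord b (X n) *\<^sub>R b) \<longlonglongrightarrow> (\<Sum>b\<in>fbasis. l b *\<^sub>R b)"
    by (intro tendsto_sum tendsto_scaleR l tendsto_const)
  then show "convergent X" by (auto simp: fcoord_expand convergent_def)
qed

lemma finite_dim_countable_dense:
  "\<exists>D :: 'a::finite_dim_normed set. countable D \<and> (\<forall>x. \<forall>e>0. \<exists>y\<in>D. dist x y < e)"
proof -
  let ?D = "(\<lambda>q. \<Sum>b\<in>fbasis. q b *\<^sub>R b) ` (PiE (fbasis :: 'a set) (\<lambda>_. \<rat>))"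
  have "countable ?D"
    by (intro countable_image countable_PiE finite_fbasis countable_rat)
  moreover have "\<exists>y\<in>?D. dist x y < e" if e: "e > 0" for x :: 'a and e
  proof -
    let ?N = "\<Sum>b\<in>(fbasis::'a set). norm b"
    have N: "?N \<ge> 0" by (intro sum_nonneg) auto
    define d where "d = e / (?N + 1)"
    have d: "d > 0" using N e by (simp add: d_def)
    have "\<exists>q\<in>\<rat>. \<bar>fcoord b x - q\<bar> < d" for b
    proof -
      obtain q where "q \<in> \<rat>" "fcoord b x - d < q" "q < fcoord b x + d"
        using Rats_dense_in_real[of "fcoord b x - d" "fcoord b x + d"] d by auto
      then show ?thesis by (intro bexI[of _ q]) auto
    qed
    then obtain q where q: "\<And>b. q b \<in> \<rat>" "\<And>b. \<bar>fcoord b x - q b\<bar> < d" by metis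
    let ?y = "\<Sum>b\<in>fbasis. restrict q fbasis b *\<^sub>R b"
    have "dist x ?y = norm (\<Sum>b\<in>fbasis. (fcoord b x - q b) *\<^sub>R b)"
      by (subst fcoord_expand[of x, symmetric]) (simp add: dist_norm scaleR_diff_left sum_subtractf)
    also have "\<dots> \<le> (\<Sum>b\<in>(fbasis::'a set). d * norm b)"
      by (rule sum_norm_le) (simp add: mult_right_mono less_imp_le[OF q(2)])
    also have "\<dots> = d * ?N" by (simp add: sum_distrib_left)
    also have "\<dots> < e" using N e by (simp add: d_def field_simps)
    finally have "dist x ?y < e" .
    moreover have "?y \<in> ?D" using q(1) by (intro imageI) auto
    ultimately show ?thesis by blast
  qed
  ultimately show ?thesis by blast
qed

instance finite_dim_normed \<subseteq> second_countable_topology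
proof
  obtain D :: "'a set" where D: "countable D" "\<And>x e. e > 0 \<Longrightarrow> \<exists>y\<in>D. dist x y < e"
    using finite_dim_countable_dense by blast
  let ?B = "(\<lambda>(y, n). ball y (inverse (real (Suc n)))) ` (D \<times> UNIV)"
  have "countable ?B" using D by auto
  moreover have "topological_basis ?B"
  proof (rule topological_basisI)
    fix S :: "'a set" and x assume S: "open S" "x \<in> S"
    then obtain e where e: "e > 0" "ball x e \<subseteq> S" by (meson open_contains_ball)
    then obtain n where n: "inverse (real (Suc n)) < e / 2"
      using reals_Archimedean[of "e/2"] by auto
    obtain y where y: "y \<in> D" "dist x y < inverse (real (Suc n))"
      using D(2)[of "inverse (real (Suc n))" x] by auto
    have "ball y (inverse (real (Suc n))) \<subseteq> ball x e"
    proof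
      fix z assume "z \<in> ball y (inverse (real (Suc n)))"
      then have "dist y z < inverse (real (Suc n))" by simp
      with y n show "z \<in> ball x e"
        using dist_triangle[of x z y] by (simp add: dist_commute)
    qed
    then show "\<exists>B'\<in>?B. x \<in> B' \<and> B' \<subseteq> S"
      using y e by (intro bexI[of _ "ball y (inverse (real (Suc n)))"]) (auto simp: dist_commute)
  qed auto
  ultimately show "\<exists>B::'a set set. countable B \<and> open = generate_topology B"
    using topological_basis_imp_subbasis by blast
qed


section \<open>Smooth calculus\<close>

lemma has_derivative_cong_open:
  assumes "open W" "x \<in> W" "\<And>y. y \<in> W \<Longrightarrow> f y = g y"
  shows "(f has_derivative D) (at x) \<longleftrightarrow> (g has_derivative D) (at x)"
  using has_derivative_transform_within_open[of f D x UNIV W g]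
    has_derivative_transform_within_open[of g D x UNIV W f] assms by auto

lemma frechet_derivative_cong_open:
  assumes "open W" "x \<in> W" "\<And>y. y \<in> W \<Longrightarrow> f y = g y"
  shows "frechet_derivative f (at x) = frechet_derivative g (at x)"
  unfolding frechet_derivative_def using has_derivative_cong_open[OF assms] by simp

text \<open>
  The derivatives in \<open>Ck_on\<close> are taken in the whole space, so a function may be replaced by one that
  agrees with it on \<open>W\<close> only if \<open>W\<close> is open.
\<close>

lemma Ck_on_cong:
  assumes "open W" "\<And>x. x \<in> W \<Longrightarrow> f x = g x" "Ck_on k f W"
  shows "Ck_on k g W"
  using assms(2,3)
proof (induction k arbitrary: f g)
  case 0
  then show ?case using continuous_on_cong[of W W f g] by simp
next
  case (Suc k)
  have "g differentiable (at x)" if "x \<in> W" for x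
  proof -
    obtain D where "(f has_derivative D) (at x)"
      using Suc.prems(2) \<open>x \<in> W\<close> by (auto simp: differentiable_def)
    from iffD1[OF has_derivative_cong_open[OF assms(1) that Suc.prems(1)] this]
    show ?thesis by (rule differentiableI)
  qed
  moreover have "Ck_on k (\<lambda>x. frechet_derivative g (at x) v) W" for v
  proof (rule Suc.IH)
    show "frechet_derivative f (at x) v = frechet_derivative g (at x) v" if "x \<in> W" for x
      by (rule fun_cong[OF frechet_derivative_cong_open[OF assms(1) that Suc.prems(1)]])
    show "Ck_on k (\<lambda>x. frechet_derivative f (at x) v) W" using Suc.prems(2) by simp
  qed
  ultimately show ?case by simp
qed

lemma Ck_on_subset: "Ck_on k f W \<Longrightarrow> W' \<subseteq> W \<Longrightarrow> Ck_on k f W'"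
  by (induction k arbitrary: f) (auto intro: continuous_on_subset)

lemma Ck_on_SucI:
  assumes "open W" "\<And>x. x \<in> W \<Longrightarrow> (f has_derivative D x) (at x)"
    and "\<And>v. Ck_on k (\<lambda>x. D x v) W"
  shows "Ck_on (Suc k) f W"
proof -
  have "D x = frechet_derivative f (at x)" if "x \<in> W" for x
    using frechet_derivative_at[OF assms(2)[OF that]] .
  then have "Ck_on k (\<lambda>x. frechet_derivative f (at x) v) W" for v
    by (intro Ck_on_cong[OF assms(1) _ assms(3)[of v]]) simp
  then show ?thesis using assms(2) by (auto simp: differentiable_def)
qed

lemma Ck_on_Suc_derivative:
  "Ck_on (Suc k) f W \<Longrightarrow> x \<in> W \<Longrightarrow> (f has_derivative frechet_derivative f (at x)) (at x)"
  by (simp flip: frechet_derivative_works)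

lemma Ck_on_Suc_imp: "Ck_on (Suc k) f W \<Longrightarrow> Ck_on k f W"
proof (induction k arbitrary: f)
  case 0
  then show ?case
    by (auto simp: intro!: continuous_at_imp_continuous_on differentiable_imp_continuous_within)
next
  case (Suc k)
  then show ?case by (metis Ck_on.simps(2))
qed

lemma Ck_on_linear: "bounded_linear f \<Longrightarrow> Ck_on k f W"
proof (induction k)
  case 0
  then show ?case by (simp add: linear_continuous_on)
next
  case (Suc k)
  have "Ck_on k (\<lambda>x. c) W" for c :: 'b
  proof (induction k arbitrary: c)
    case (Suc k) then show ?case by (simp add: frechet_derivative_const)
  qed simp
  then show ?case
    using Suc.prems frechet_derivative_at[OF bounded_linear_imp_has_derivative[OF Suc.prems]]
    by (auto simp: bounded_linear_imp_differentiable)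
qed

lemma Ck_on_const: "Ck_on k (\<lambda>x. c) W"
  by (induction k arbitrary: c) (auto simp: frechet_derivative_const)

lemma Ck_on_add:
  assumes "open W" "Ck_on k f W" "Ck_on k g W"
  shows "Ck_on k (\<lambda>x. f x + g x) W"
  using assms(2,3)
proof (induction k arbitrary: f g)
  case 0 then show ?case by (simp add: continuous_on_add)
next
  case (Suc k)
  show ?case
    by (rule Ck_on_SucI[OF assms(1) has_derivative_add[OF Ck_on_Suc_derivative Ck_on_Suc_derivative]])
      (use Suc in auto)
qed

lemma Ck_on_bilinear:
  assumes "bounded_bilinear p" "open W" "Ck_on k f W" "Ck_on k g W"
  shows "Ck_on k (\<lambda>x. p (f x) (g x)) W"
  using assms(3,4)
proof (induction k arbitrary: f g)
  case 0 then show ?case by (simp add: bounded_bilinear.continuous_on[OF assms(1)])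
next
  case (Suc k)
  show ?case
    by (rule Ck_on_SucI[OF assms(2)
          bounded_bilinear.FDERIV[OF assms(1) Ck_on_Suc_derivative Ck_on_Suc_derivative]])
      (use Suc Ck_on_Suc_imp[OF Suc.prems(1)] Ck_on_Suc_imp[OF Suc.prems(2)]
        in \<open>auto intro!: Ck_on_add[OF assms(2)]\<close>)
qed

lemma Ck_on_sum:
  assumes "open W" "\<And>i. i \<in> I \<Longrightarrow> Ck_on k (f i) W"
  shows "Ck_on k (\<lambda>x. \<Sum>i\<in>I. f i x) W"
proof (cases "finite I")
  case True
  then show ?thesis using assms(2)
    by (induction I rule: finite_induct) (auto intro: Ck_on_add[OF assms(1)] simp: Ck_on_const)
qed (simp add: Ck_on_const)

lemma Ck_on_scaleR:
  "open W \<Longrightarrow> Ck_on k f W \<Longrightarrow> Ck_on k g W \<Longrightarrow> Ck_on k (\<lambda>x. f x *\<^sub>R g x) W"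
  by (rule Ck_on_bilinear[OF bounded_bilinear_scaleR])

lemma Ck_on_linear_compose:
  assumes "bounded_linear L" "open W" "Ck_on k f W"
  shows "Ck_on k (\<lambda>x. L (f x)) W"
  using assms(3)
proof (induction k arbitrary: f)
  case 0 then show ?case
    using linear_continuous_on[OF assms(1)] by (auto intro: continuous_on_compose2[of UNIV L])
next
  case (Suc k)
  show ?case
    by (rule Ck_on_SucI[OF assms(2) bounded_linear.has_derivative[OF assms(1) Ck_on_Suc_derivative]])
      (use Suc in auto)
qed

text \<open>
  By the chain rule the derivative of a composition is a linear map \<open>Df\<close> applied to a varying
  vector. Expanding the vector in a basis turns this into a sum of products, to which the
  induction hypothesis applies.
\<close>

lemma Ck_on_compose:
  fixes g :: "'a::real_normed_vector \<Rightarrow> 'b::finite_dim_normed" and f :: "'b \<Rightarrow> 'c::real_normed_vector"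
  assumes "open W" "g ` W \<subseteq> V" "Ck_on k g W" "Ck_on k f V"
  shows "Ck_on k (\<lambda>x. f (g x)) W"
  using assms(3,4)
proof (induction k arbitrary: f)
  case 0 then show ?case using assms(2) by (auto intro: continuous_on_compose2)
next
  case (Suc k)
  let ?D = "\<lambda>x v. frechet_derivative f (at (g x)) (frechet_derivative g (at x) v)"
  have der: "((\<lambda>x. f (g x)) has_derivative ?D x) (at x)" if "x \<in> W" for x
    using has_derivative_compose[OF Ck_on_Suc_derivative[OF Suc.prems(1) that] Ck_on_Suc_derivative[OF Suc.prems(2)]]
      assms(2) that by auto
  have lin: "linear (frechet_derivative f (at (g x)))" if "x \<in> W" for x
    using Ck_on_Suc_derivative[OF Suc.prems(2), of "g x"] assms(2) that
    by (auto intro: has_derivative_linear)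
  have "Ck_on k (\<lambda>x. ?D x v) W" for v
  proof (rule Ck_on_cong[OF assms(1)])
    show "(\<Sum>b\<in>fbasis. fcoord b (frechet_derivative g (at x) v) *\<^sub>R frechet_derivative f (at (g x)) b)
        = ?D x v" if "x \<in> W" for x
      by (rule linear_fcoord_expand[OF lin[OF that], symmetric])
    show "Ck_on k (\<lambda>x. \<Sum>b\<in>fbasis. fcoord b (frechet_derivative g (at x) v) *\<^sub>R frechet_derivative f (at (g x)) b) W"
    proof (intro Ck_on_sum Ck_on_scaleR assms(1))
      fix b :: 'b assume b: "b \<in> fbasis"
      show "Ck_on k (\<lambda>x. fcoord b (frechet_derivative g (at x) v)) W"
        using Suc.prems(1) by (intro Ck_on_linear_compose[OF bounded_linear_fcoord[OF b] assms(1)]) simp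
      show "Ck_on k (\<lambda>x. frechet_derivative f (at (g x)) b) W"
        using Suc.prems(2) by (intro Suc.IH Ck_on_Suc_imp[OF Suc.prems(1)]) simp
    qed
  qed
  then show ?case
    using der by (intro Ck_on_SucI[OF assms(1), where D = ?D]) blast+
qed

lemma Cinf_on_cong: "open W \<Longrightarrow> (\<And>x. x \<in> W \<Longrightarrow> f x = g x) \<Longrightarrow> Cinf_on f W \<Longrightarrow> Cinf_on g W"
  unfolding Cinf_on_def by (meson Ck_on_cong)

lemma Cinf_on_subset: "Cinf_on f W \<Longrightarrow> W' \<subseteq> W \<Longrightarrow> Cinf_on f W'"
  unfolding Cinf_on_def by (meson Ck_on_subset)

lemma Cinf_on_continuous_on: "Cinf_on f W \<Longrightarrow> continuous_on W f"
  unfolding Cinf_on_def by (metis Ck_on.simps(1))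

lemma Cinf_on_has_derivative:
  "Cinf_on f W \<Longrightarrow> x \<in> W \<Longrightarrow> (f has_derivative frechet_derivative f (at x)) (at x)"
  unfolding Cinf_on_def by (meson Ck_on_Suc_derivative)

lemma Cinf_on_linear_derivative: "Cinf_on f W \<Longrightarrow> x \<in> W \<Longrightarrow> linear (frechet_derivative f (at x))"
  by (rule has_derivative_linear[OF Cinf_on_has_derivative])

lemma Cinf_on_derivative: "Cinf_on f W \<Longrightarrow> Cinf_on (\<lambda>x. frechet_derivative f (at x) v) W"
  unfolding Cinf_on_def by (metis Ck_on.simps(2))

lemma Cinf_on_const: "Cinf_on (\<lambda>x. c) W"
  unfolding Cinf_on_def by (simp add: Ck_on_const)

lemma Cinf_on_bounded_linear: "bounded_linear f \<Longrightarrow> Cinf_on f W"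
  unfolding Cinf_on_def by (simp add: Ck_on_linear)

lemma Cinf_on_ident: "Cinf_on (\<lambda>x. x) W"
  by (rule Cinf_on_bounded_linear[OF bounded_linear_ident])

lemma Cinf_on_linear: "linear (f :: 'a::finite_dim_normed \<Rightarrow> _) \<Longrightarrow> Cinf_on f W"
  by (rule Cinf_on_bounded_linear[OF linear_imp_bounded_linear])

lemma Cinf_on_add: "open W \<Longrightarrow> Cinf_on f W \<Longrightarrow> Cinf_on g W \<Longrightarrow> Cinf_on (\<lambda>x. f x + g x) W"
  unfolding Cinf_on_def by (simp add: Ck_on_add)

lemma Cinf_on_scaleR: "open W \<Longrightarrow> Cinf_on f W \<Longrightarrow> Cinf_on g W \<Longrightarrow> Cinf_on (\<lambda>x. f x *\<^sub>R g x) W"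
  unfolding Cinf_on_def by (simp add: Ck_on_scaleR)

lemma Cinf_on_sum: "open W \<Longrightarrow> (\<And>i. i \<in> I \<Longrightarrow> Cinf_on (f i) W) \<Longrightarrow> Cinf_on (\<lambda>x. \<Sum>i\<in>I. f i x) W"
  unfolding Cinf_on_def by (simp add: Ck_on_sum)

lemma Cinf_on_linear_compose:
  "bounded_linear L \<Longrightarrow> open W \<Longrightarrow> Cinf_on f W \<Longrightarrow> Cinf_on (\<lambda>x. L (f x)) W"
  unfolding Cinf_on_def by (simp add: Ck_on_linear_compose)

lemma Cinf_on_compose:
  fixes g :: "'a::real_normed_vector \<Rightarrow> 'b::finite_dim_normed" and f :: "'b \<Rightarrow> 'c::real_normed_vector"
  shows "Cinf_on f V \<Longrightarrow> Cinf_on g W \<Longrightarrow> open W \<Longrightarrow> g ` W \<subseteq> V \<Longrightarrow> Cinf_on (\<lambda>x. f (g x)) W"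
  unfolding Cinf_on_def using Ck_on_compose[of W g V _ f] by simp

lemma Cinf_on_Pair:
  assumes "open W" "Cinf_on f W" "Cinf_on g W"
  shows "Cinf_on (\<lambda>x. (f x, g x)) W"
proof -
  have "Cinf_on (\<lambda>x. (f x, 0) + (0, g x)) W"
    by (intro Cinf_on_add assms Cinf_on_linear_compose[of "\<lambda>y. (y, 0)"] Cinf_on_linear_compose[of "\<lambda>y. (0, y)"]
        bounded_linear_Pair bounded_linear_ident bounded_linear_zero)
  then show ?thesis by simp
qed

lemma Cinf_on_diff: "open W \<Longrightarrow> Cinf_on f W \<Longrightarrow> Cinf_on g W \<Longrightarrow> Cinf_on (\<lambda>x. f x - g x) W"
  using Cinf_on_add[of W f "\<lambda>x. - g x"]
    Cinf_on_linear_compose[OF bounded_linear_minus[OF bounded_linear_ident], of W g] by simp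

text \<open>
  By expansion in a basis, a family of linear maps is smooth in all variables together as soon as
  it is smooth on each fixed vector.
\<close>

lemma Cinf_on_family_apply:
  fixes T :: "'a::real_normed_vector \<Rightarrow> 'b::finite_dim_normed \<Rightarrow> 'c::real_normed_vector"
  assumes "open W" "\<And>x. x \<in> W \<Longrightarrow> linear (T x)" "\<And>b. Cinf_on (\<lambda>x. T x b) W" "Cinf_on v W"
  shows "Cinf_on (\<lambda>x. T x (v x)) W"
proof (rule Cinf_on_cong[OF assms(1)])
  show "(\<Sum>b\<in>fbasis. fcoord b (v x) *\<^sub>R T x b) = T x (v x)" if "x \<in> W" for x
    by (rule linear_fcoord_expand[OF assms(2)[OF that], symmetric])
  show "Cinf_on (\<lambda>x. \<Sum>b\<in>fbasis. fcoord b (v x) *\<^sub>R T x b) W"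
    by (intro Cinf_on_sum Cinf_on_scaleR assms(1,3) Cinf_on_linear_compose[OF bounded_linear_fcoord _ assms(4)])
qed

lemma Cinf_on_family:
  fixes T :: "'a::finite_dim_normed \<Rightarrow> 'b::finite_dim_normed \<Rightarrow> 'c::real_normed_vector"
  assumes "open W" "\<And>x. x \<in> W \<Longrightarrow> linear (T x)" "\<And>b. Cinf_on (\<lambda>x. T x b) W"
  shows "Cinf_on (\<lambda>(x, v). T x v) (W \<times> UNIV)"
proof -
  have W: "open (W \<times> (UNIV :: 'b set))" using assms(1) by (simp add: open_Times)
  have "Cinf_on (\<lambda>z :: 'a \<times> 'b. T (fst z) (snd z)) (W \<times> UNIV)"
  proof (rule Cinf_on_family_apply[OF W])
    show "Cinf_on (\<lambda>z :: 'a \<times> 'b. T (fst z) b) (W \<times> UNIV)" for b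
      by (rule Cinf_on_compose[OF assms(3)]) (auto intro: Cinf_on_bounded_linear bounded_linear_fst W)
  qed (auto intro: W assms(2) Cinf_on_bounded_linear bounded_linear_snd)
  then show ?thesis by (simp add: case_prod_unfold)
qed

lemma Cinf_on_joint_derivative:
  fixes f :: "'a::finite_dim_normed \<Rightarrow> 'c::real_normed_vector"
  assumes "open W" "Cinf_on f W"
  shows "Cinf_on (\<lambda>(x, v). frechet_derivative f (at x) v) (W \<times> UNIV)"
  by (rule Cinf_on_family) (auto intro: assms Cinf_on_linear_derivative Cinf_on_derivative)

lemma frechet_derivative_chain:
  assumes "Cinf_on f V" "Cinf_on g W" "x \<in> W" "g x \<in> V"
  shows "frechet_derivative (\<lambda>x. f (g x)) (at x) v
    = frechet_derivative f (at (g x)) (frechet_derivative g (at x) v)"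
  using frechet_derivative_at[OF has_derivative_compose[OF
      Cinf_on_has_derivative[OF assms(2,3)] Cinf_on_has_derivative[OF assms(1,4)]]]
  by (metis)


section \<open>Inverses\<close>

text \<open>
  Such a \<open>T\<close> is onto because \<open>w \<mapsto> w - T w + z\<close> is a contraction, with a solution of \<open>T w = z\<close> as its
  fixed point.
\<close>

lemma near_identity:
  fixes T :: "'a::finite_dim_normed \<Rightarrow> 'a"
  assumes "linear T" and near: "\<And>w. norm (T w - w) \<le> norm w / 2"
  shows near_identity_bound: "norm w \<le> 2 * norm (T w)" and near_identity_bij: "bij T"
proof -
  show bound: "norm w \<le> 2 * norm (T w)" for w
    using near[of w] norm_triangle_ineq4[of "T w" "T w - w"] by (simp add: norm_minus_commute)
  have "inj T"
    unfolding linear_injective_0[OF assms(1)] using bound by (metis norm_le_zero_iff mult_zero_right norm_zero)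
  moreover have "surj T"
  proof -
    have "\<exists>w. T w = z" for z
    proof -
      have "\<exists>!w. w \<in> UNIV \<and> w - T w + z = w"
      proof (rule Banach_fix[of UNIV "1/2" "\<lambda>w. w - T w + z"])
        show "dist (x - T x + z) (y - T y + z) \<le> 1 / 2 * dist x y" for x y
          using near[of "x - y"] linear_diff[OF assms(1), of x y]
          by (simp add: dist_norm norm_minus_commute algebra_simps)
      qed (auto simp: complete_UNIV)
      then obtain w where "w - T w + z = w" by blast
      then show ?thesis by (intro exI[of _ w]) (simp add: algebra_simps)
    qed
    then show ?thesis by (metis surjI)
  qed
  ultimately show "bij T" by (simp add: bij_def)
qed

text \<open>
  Continuity of \<open>T\<close> on finitely many basis vectors is uniform over the unit ball, because the
  coordinates of a vector are bounded by its norm.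
\<close>

lemma eventually_near_identity:
  fixes T :: "'a::metric_space \<Rightarrow> 'b::finite_dim_normed \<Rightarrow> 'b"
  assumes "open W" "x0 \<in> W" and lin: "\<And>x. x \<in> W \<Longrightarrow> linear (T x)"
    and cont: "\<And>b. continuous_on W (\<lambda>x. T x b)" and "\<And>w. T x0 w = w"
  shows "\<exists>r>0. ball x0 r \<subseteq> W \<and> (\<forall>x\<in>ball x0 r. \<forall>w. norm (T x w - w) \<le> norm w / 2)"
proof -
  obtain C where C: "\<And>f b. b \<in> fbasis \<Longrightarrow> \<bar>f b\<bar> \<le> C * norm (\<Sum>b\<in>fbasis. f b *\<^sub>R (b::'b))"
    using coordinates_bounded[OF finite_fbasis independent_fbasis] by metis
  have C': "\<bar>fcoord b w\<bar> \<le> (\<bar>C\<bar> + 1) * norm w" if "b \<in> fbasis" for b w :: 'b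
  proof -
    have "\<bar>fcoord b w\<bar> \<le> C * norm w"
      using C[OF that, of "\<lambda>b. fcoord b w"] by (simp add: fcoord_expand)
    also have "\<dots> \<le> (\<bar>C\<bar> + 1) * norm w" by (intro mult_right_mono) auto
    finally show ?thesis .
  qed
  define e where "e = 1 / (2 * (real (card (fbasis::'b set)) + 1) * (\<bar>C\<bar> + 1))"
  have e: "e > 0" by (simp add: e_def add_pos_nonneg)
  have "eventually (\<lambda>x. norm (T x b - b) < e) (nhds x0)" for b
  proof -
    have "isCont (\<lambda>x. T x b) x0" using cont assms(1,2) by (simp add: continuous_on_eq_continuous_at)
    then have "((\<lambda>x. T x b) \<longlongrightarrow> T x0 b) (nhds x0)"
      unfolding isCont_def using tendsto_at_iff_tendsto_nhds[of "\<lambda>x. T x b" x0] by simp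
    then show ?thesis using e assms(5) by (auto simp: tendsto_iff dist_norm)
  qed
  then have "eventually (\<lambda>x. \<forall>b\<in>fbasis. norm (T x b - b) < e) (nhds x0)"
    by (simp add: eventually_ball_finite finite_fbasis)
  moreover have "eventually (\<lambda>x. x \<in> W) (nhds x0)"
    using assms(1,2) by (rule eventually_nhds_in_open)
  ultimately have "eventually (\<lambda>x. x \<in> W \<and> (\<forall>b\<in>fbasis. norm (T x b - b) < e)) (nhds x0)"
    by eventually_elim auto
  then obtain r where r: "r > 0" "\<And>x. dist x x0 < r \<Longrightarrow> x \<in> W \<and> (\<forall>b\<in>fbasis. norm (T x b - b) < e)"
    unfolding eventually_nhds_metric by blast
  have "norm (T x w - w) \<le> norm w / 2" if "x \<in> ball x0 r" for x w
  proof -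
    have x: "x \<in> W" "\<And>b. b \<in> fbasis \<Longrightarrow> norm (T x b - b) < e"
      using r(2)[of x] that by (auto simp: dist_commute)
    have "T x w - w = (\<Sum>b\<in>fbasis. fcoord b w *\<^sub>R (T x b - b))"
      using linear_fcoord_expand[OF lin[OF x(1)], of w] fcoord_expand[of w]
      by (simp add: scaleR_diff_right sum_subtractf)
    also have "norm \<dots> \<le> (\<Sum>b\<in>(fbasis :: 'b set). ((\<bar>C\<bar> + 1) * norm w) * e)"
    proof (rule sum_norm_le)
      fix b :: 'b assume b: "b \<in> fbasis"
      show "norm (fcoord b w *\<^sub>R (T x b - b)) \<le> ((\<bar>C\<bar> + 1) * norm w) * e"
        unfolding norm_scaleR using C'[OF b, of w] x(2)[OF b] by (intro mult_mono) auto
    qed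
    also have "\<dots> = (real (card (fbasis::'b set)) * (\<bar>C\<bar> + 1) * e) * norm w" by simp
    also have "\<dots> \<le> (1/2) * norm w"
    proof (rule mult_right_mono)
      have "0 < (real (card (fbasis::'b set)) + 1) * (\<bar>C\<bar> + 1)" by (simp add: add_pos_nonneg)
      then show "real (card (fbasis::'b set)) * (\<bar>C\<bar> + 1) * e \<le> 1/2"
        unfolding e_def by (simp add: divide_le_eq algebra_simps)
    qed simp
    finally show ?thesis by simp
  qed
  moreover have "ball x0 r \<subseteq> W" using r(2) by (auto simp: dist_commute)
  ultimately show ?thesis using r(1) by blast
qed

text \<open>
  Where one factor vanishes, continuity of the other factor suffices for a product to be
  differentiable.
\<close>

lemma has_derivative_vanishing_scaleR:
  fixes f :: "'a::real_normed_vector \<Rightarrow> real" and g :: "'a \<Rightarrow> 'b::real_normed_vector"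
  assumes f: "(f has_derivative D) (at x)" "f x = 0" and g: "isCont g x"
  shows "((\<lambda>y. f y *\<^sub>R g y) has_derivative (\<lambda>v. D v *\<^sub>R g x)) (at x)"
  unfolding has_derivative_within
proof
  have D: "bounded_linear D" using f(1) by (rule has_derivative_bounded_linear)
  show "bounded_linear (\<lambda>v. D v *\<^sub>R g x)" using D by (rule bounded_linear_scaleR_const)
  obtain K where K: "\<And>v. norm (D v) \<le> norm v * K" using D bounded_linear.bounded by blast
  have g0: "((\<lambda>y. g y - g x) \<longlongrightarrow> 0) (at x)" using g by (simp add: isCont_def LIM_zero)
  have "((\<lambda>y. ((1 / norm (y - x)) *\<^sub>R (f y - (f x + D (y - x)))) *\<^sub>R g y) \<longlongrightarrow> 0 *\<^sub>R g x) (at x)"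
    using f(1) g by (intro tendsto_scaleR) (auto simp: has_derivative_within isCont_def)
  moreover have "((\<lambda>y. (D (y - x) / norm (y - x)) *\<^sub>R (g y - g x)) \<longlongrightarrow> 0) (at x)"
  proof (rule Lim_null_comparison)
    show "((\<lambda>y. \<bar>K\<bar> * norm (g y - g x)) \<longlongrightarrow> 0) (at x)"
      using tendsto_mult[OF tendsto_const tendsto_norm[OF g0], of "\<bar>K\<bar>"] by simp
    show "eventually (\<lambda>y. norm ((D (y - x) / norm (y - x)) *\<^sub>R (g y - g x)) \<le> \<bar>K\<bar> * norm (g y - g x)) (at x)"
    proof (rule always_eventually, rule allI)
      fix y
      have "\<bar>D (y - x)\<bar> \<le> norm (y - x) * \<bar>K\<bar>"
        using K[of "y - x"] by (smt (verit) abs_ge_self mult_left_mono norm_ge_zero real_norm_def)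
      then have "\<bar>D (y - x) / norm (y - x)\<bar> \<le> \<bar>K\<bar>"
        by (cases "y = x") (auto simp: divide_le_eq mult.commute)
      then show "norm ((D (y - x) / norm (y - x)) *\<^sub>R (g y - g x)) \<le> \<bar>K\<bar> * norm (g y - g x)"
        unfolding norm_scaleR by (intro mult_right_mono) auto
    qed
  qed
  ultimately have "((\<lambda>y. ((1 / norm (y - x)) *\<^sub>R (f y - (f x + D (y - x)))) *\<^sub>R g y
      + (D (y - x) / norm (y - x)) *\<^sub>R (g y - g x)) \<longlongrightarrow> 0) (at x)"
    using tendsto_add by fastforce
  then show "((\<lambda>y. (1 / norm (y - x)) *\<^sub>R (f y *\<^sub>R g y - (f x *\<^sub>R g x + D (y - x) *\<^sub>R g x))) \<longlongrightarrow> 0) (at x)"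
    by (rule Lim_transform_eventually) (use f(2) in \<open>auto intro!: always_eventually simp: algebra_simps\<close>)
qed

text \<open>
  With \<open>u = S(x\<^sub>0)w\<close> one has \<open>S(x)w = u - S(x)(T(x)u - w)\<close>, where \<open>T(x)u - w\<close> vanishes at \<open>x\<^sub>0\<close>.
  So continuity of \<open>S\<close> alone gives its derivative, which is again an expression in \<open>S\<close> and the
  derivatives of \<open>T\<close>.
\<close>

lemma Cinf_on_inverse_family:
  fixes T S :: "'a::finite_dim_normed \<Rightarrow> 'b::finite_dim_normed \<Rightarrow> 'b"
  assumes W: "open W" and lin: "\<And>x. x \<in> W \<Longrightarrow> linear (T x)" and T: "\<And>w. Cinf_on (\<lambda>x. T x w) W"
    and near: "\<And>x w. x \<in> W \<Longrightarrow> norm (T x w - w) \<le> norm w / 2"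
    and S: "\<And>x w. x \<in> W \<Longrightarrow> T x (S x w) = w"
  shows "\<And>x. x \<in> W \<Longrightarrow> linear (S x)" and "\<And>w. Cinf_on (\<lambda>x. S x w) W"
proof -
  have inj: "w = w'" if "x \<in> W" "T x w = T x w'" for x w w'
    using near_identity_bij[OF lin near, OF that(1) that(1)] that(2) by (simp add: bij_def inj_def)
  show linS: "linear (S x)" if "x \<in> W" for x
    by (rule linearI; rule inj[OF that])
      (simp_all add: S[OF that] linear_add[OF lin[OF that]] linear_cmul[OF lin[OF that]])
  have bound: "norm (S x w) \<le> 2 * norm w" if "x \<in> W" for x w
    using near_identity_bound[OF lin near, OF that that, of "S x w"] S[OF that, of w] by simp
  have expand: "S x w = S x0 w - S x (T x (S x0 w) - w)" if "x \<in> W" for x x0 w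
    by (rule inj[OF that]) (simp add: S[OF that] linear_diff[OF lin[OF that]])
  have cont: "isCont (\<lambda>x. S x w) x0" if x0: "x0 \<in> W" for x0 w
  proof -
    have "isCont (\<lambda>x. T x (S x0 w)) x0"
      using Cinf_on_continuous_on[OF T] W x0 by (simp add: continuous_on_eq_continuous_at)
    then have "((\<lambda>x. 2 * norm (T x (S x0 w) - w)) \<longlongrightarrow> 0) (at x0)"
      using tendsto_mult[OF tendsto_const tendsto_norm[OF LIM_zero], of "\<lambda>x. T x (S x0 w)" w "at x0" 2]
      by (simp add: isCont_def S[OF x0])
    then have "((\<lambda>x. S x w - S x0 w) \<longlongrightarrow> 0) (at x0)"
    proof (rule Lim_null_comparison[rotated])
      show "eventually (\<lambda>x. norm (S x w - S x0 w) \<le> 2 * norm (T x (S x0 w) - w)) (at x0)"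
        using eventually_at_in_open'[OF W x0]
      proof eventually_elim
        case (elim x)
        have "S x w - S x0 w = - S x (T x (S x0 w) - w)"
          using expand[OF elim, of w x0] by (simp add: algebra_simps)
        then show ?case using bound[OF elim, of "T x (S x0 w) - w"] by simp
      qed
    qed
    then show ?thesis by (simp add: isCont_def LIM_zero_iff)
  qed
  let ?dT = "\<lambda>x w v. frechet_derivative (\<lambda>x. T x w) (at x) v"
  have der: "((\<lambda>x. S x w) has_derivative (\<lambda>v. - S x0 (?dT x0 (S x0 w) v))) (at x0)"
    if x0: "x0 \<in> W" for x0 w
  proof -
    let ?u = "S x0 w"
    have d: "((\<lambda>x. fcoord b (T x ?u - w)) has_derivative (\<lambda>v. fcoord b (?dT x0 ?u v))) (at x0)"
      if "b \<in> fbasis" for b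
      using bounded_linear.has_derivative[OF bounded_linear_fcoord[OF that]
          has_derivative_diff[OF Cinf_on_has_derivative[OF T[of ?u] x0] has_derivative_const[of w]]]
      by simp
    have "((\<lambda>x. ?u - (\<Sum>b\<in>fbasis. fcoord b (T x ?u - w) *\<^sub>R S x b)) has_derivative
        (\<lambda>v. 0 - (\<Sum>b\<in>fbasis. fcoord b (?dT x0 ?u v) *\<^sub>R S x0 b))) (at x0)"
      by (intro has_derivative_diff has_derivative_const has_derivative_sum
          has_derivative_vanishing_scaleR d cont x0)
        (auto simp: S[OF x0] linear_0[OF linear_fcoord])
    also have "(\<lambda>v. 0 - (\<Sum>b\<in>fbasis. fcoord b (?dT x0 ?u v) *\<^sub>R S x0 b)) = (\<lambda>v. - S x0 (?dT x0 ?u v))"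
      by (simp flip: linear_fcoord_expand[OF linS[OF x0]])
    finally show ?thesis
      by (rule has_derivative_transform_within_open[OF _ W x0])
        (simp flip: linear_fcoord_expand[OF linS] expand)
  qed
  have "Ck_on k (\<lambda>x. S x w) W" for k w
  proof (induction k arbitrary: w)
    case 0
    then show ?case using cont by (simp add: continuous_at_imp_continuous_on)
  next
    case (Suc k)
    have dlin: "?dT x u v = (\<Sum>b\<in>fbasis. fcoord b u *\<^sub>R ?dT x b v)" if x: "x \<in> W" for x u v
    proof -
      have "((\<lambda>x. \<Sum>b\<in>fbasis. fcoord b u *\<^sub>R T x b) has_derivative
          (\<lambda>v. \<Sum>b\<in>fbasis. fcoord b u *\<^sub>R ?dT x b v)) (at x)"
        by (intro has_derivative_sum has_derivative_scaleR_right Cinf_on_has_derivative[OF T x])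
      then have "((\<lambda>x. T x u) has_derivative (\<lambda>v. \<Sum>b\<in>fbasis. fcoord b u *\<^sub>R ?dT x b v)) (at x)"
        by (rule has_derivative_transform_within_open[OF _ W x])
          (simp flip: linear_fcoord_expand[OF lin])
      from fun_cong[OF frechet_derivative_at[OF this], of v] show ?thesis by (rule sym)
    qed
    show ?case
    proof (rule Ck_on_SucI[OF W der])
      fix v
      have IH: "Ck_on k (\<lambda>x. fcoord b (S x w)) W" if "b \<in> fbasis" for b
        by (rule Ck_on_linear_compose[OF bounded_linear_fcoord[OF that] W Suc.IH])
      have d: "Ck_on k (\<lambda>x. ?dT x b v) W" for b
        using Cinf_on_derivative[OF T] by (simp add: Cinf_on_def)
      let ?r = "\<lambda>x. \<Sum>b\<in>fbasis. fcoord b (S x w) *\<^sub>R ?dT x b v"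
      have r: "Ck_on k ?r W" by (intro Ck_on_sum W Ck_on_scaleR IH d)
      have "Ck_on k (\<lambda>x. - (\<Sum>b\<in>fbasis. fcoord b (?r x) *\<^sub>R S x b)) W"
        by (intro Ck_on_linear_compose[OF bounded_linear_minus[OF bounded_linear_ident] W]
            Ck_on_sum[OF W] Ck_on_scaleR[OF W] Suc.IH Ck_on_linear_compose[OF bounded_linear_fcoord W r])
      then show "Ck_on k (\<lambda>x. - S x (?dT x (S x w) v)) W"
        by (rule Ck_on_cong[OF W, rotated]) (simp flip: linear_fcoord_expand[OF linS] dlin)
    qed
  qed
  then show "Cinf_on (\<lambda>x. S x w) W" for w by (simp add: Cinf_on_def)
qed

text \<open>
  The half of the inverse function theorem that lifts curves, normalised so that the derivative
  at the given point is the identity. The inverse is the fixed point of the contraction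
  \<open>y \<mapsto> y - f y + z\<close>.
\<close>

lemma local_right_inverse:
  fixes f :: "'a::finite_dim_normed \<Rightarrow> 'a"
  assumes "open W" "x0 \<in> W" and f: "Cinf_on f W" and id: "\<And>v. frechet_derivative f (at x0) v = v"
  obtains V G where "open V" "f x0 \<in> V" "Cinf_on G V" "G ` V \<subseteq> W"
    "\<And>z. z \<in> V \<Longrightarrow> f (G z) = z" "G (f x0) = x0"
proof -
  let ?D = "\<lambda>x. frechet_derivative f (at x)"
  have lin: "linear (?D x)" if "x \<in> W" for x by (rule Cinf_on_linear_derivative[OF f that])
  obtain r where r: "r > 0" "ball x0 r \<subseteq> W"
      and near: "\<And>x w. x \<in> ball x0 r \<Longrightarrow> norm (?D x w - w) \<le> norm w / 2"
    using eventually_near_identity[OF assms(1,2) lin Cinf_on_continuous_on[OF Cinf_on_derivative[OF f]] id]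
    by blast
  have contr: "norm ((f x - x) - (f y - y)) \<le> 1/2 * norm (x - y)"
    if "x \<in> ball x0 r" "y \<in> ball x0 r" for x y
  proof (rule differentiable_bound[of "ball x0 r" "\<lambda>x. f x - x" "\<lambda>x v. ?D x v - v"])
    show "((\<lambda>x. f x - x) has_derivative (\<lambda>v. ?D z v - v)) (at z within ball x0 r)" if "z \<in> ball x0 r" for z
      by (rule has_derivative_at_withinI[OF has_derivative_diff[OF Cinf_on_has_derivative[OF f] has_derivative_ident]])
        (use r(2) that in auto)
    show "onorm (\<lambda>v. ?D z v - v) \<le> 1/2" if "z \<in> ball x0 r" for z
          proof (rule onorm_bound)
      show "norm (?D z v - v) \<le> 1/2 * norm v" for v using near[OF that, of v] by linarith
    qed simp
  qed (use that in auto)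
  have lip: "norm (x - y) \<le> 2 * norm (f x - f y)" if "x \<in> ball x0 r" "y \<in> ball x0 r" for x y
    using contr[OF that] norm_triangle_ineq4[of "f x - f y" "(f x - x) - (f y - y)"]
    by (simp add: algebra_simps)
  let ?C = "cball x0 (r/2)" and ?V = "ball (f x0) (r/4)"
  have CB: "?C \<subseteq> ball x0 r" using r(1) by auto
  have ex: "\<exists>y\<in>?C. f y = z" if z: "z \<in> ?V" for z
  proof -
    have "\<exists>!y\<in>?C. y - f y + z = y"
    proof (rule Banach_fix[of _ "1/2"])
      show "complete ?C" by (simp add: complete_eq_closed)
      show "(\<lambda>y. y - f y + z) ` ?C \<subseteq> ?C"
      proof
        fix w assume "w \<in> (\<lambda>y. y - f y + z) ` ?C"
        then obtain y where y: "y \<in> ?C" "w = y - f y + z" by blast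
        have "norm (w - x0) = norm (((f x0 - x0) - (f y - y)) + (z - f x0))"
          unfolding y(2) by (rule arg_cong[where f = norm]) (simp add: algebra_simps)
        also have "\<dots> \<le> 1/2 * norm (x0 - y) + norm (z - f x0)"
          using CB y(1) r(1) by (intro order_trans[OF norm_triangle_ineq] add_mono contr) auto
        also have "\<dots> \<le> r/2" using y(1) z by (auto simp: dist_norm norm_minus_commute)
        finally show "w \<in> ?C" by (simp add: dist_norm norm_minus_commute)
      qed
      show "dist (x - f x + z) (y - f y + z) \<le> 1/2 * dist x y" if "x \<in> ?C" "y \<in> ?C" for x y
      proof -
        have "norm ((x - f x) - (y - f y)) = norm ((f x - x) - (f y - y))"
          by (subst norm_minus_cancel[symmetric]) (simp add: algebra_simps)
        moreover have "norm ((f x - x) - (f y - y)) \<le> 1/2 * norm (x - y)"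
          using that CB by (intro contr) auto
        ultimately show ?thesis by (simp add: dist_norm algebra_simps)
      qed
    qed (use r in auto)
    then obtain y where "y \<in> ?C" "y - f y + z = y" by blast
    then show ?thesis by (intro bexI[of _ y]) (auto simp: algebra_simps)
  qed
  then obtain G where G: "\<And>z. z \<in> ?V \<Longrightarrow> G z \<in> ?C" "\<And>z. z \<in> ?V \<Longrightarrow> f (G z) = z" by metis
  have GB: "G z \<in> ball x0 r" if "z \<in> ?V" for z using G(1)[OF that] CB by blast
  have G0: "G (f x0) = x0"
    using lip[of "G (f x0)" x0] GB[of "f x0"] G(2)[of "f x0"] r(1) by simp
  have contG: "isCont G z" if z: "z \<in> ?V" for z
  proof -
    have "((\<lambda>y. 2 * norm (y - z)) \<longlongrightarrow> 2 * norm (z - z)) (at z)"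
      by (intro tendsto_intros)
    then have "((\<lambda>y. 2 * norm (y - z)) \<longlongrightarrow> 0) (at z)" by simp
    then have "((\<lambda>y. G y - G z) \<longlongrightarrow> 0) (at z)"
    proof (rule Lim_null_comparison[rotated])
      show "eventually (\<lambda>y. norm (G y - G z) \<le> 2 * norm (y - z)) (at z)"
        using eventually_at_in_open'[OF open_ball z]
      proof eventually_elim
        case (elim y)
        show ?case using lip[OF GB[OF elim] GB[OF z]] by (simp add: G(2)[OF elim] G(2)[OF z])
      qed
    qed
    then show ?thesis by (simp add: isCont_def LIM_zero_iff)
  qed
  define S where "S x = inv (?D x)" for x
  have bijD: "bij (?D x)" if "x \<in> ball x0 r" for x
    using near_identity_bij[OF lin near] that r(2) by blast
  have DS: "?D x (S x w) = w" if "x \<in> ball x0 r" for x w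
    unfolding S_def using bijD[OF that] by (simp add: bij_def surj_f_inv_f)
  have linB: "linear (?D x)" if "x \<in> ball x0 r" for x
    using lin r(2) that by blast
  note inv = Cinf_on_inverse_family[of "ball x0 r" ?D S, OF open_ball linB
      Cinf_on_subset[OF Cinf_on_derivative[OF f] r(2)] near DS]
  have S: "linear (S x)" if "x \<in> ball x0 r" for x
    by (rule inv(1)) (use that in auto)
  have CS: "Cinf_on (\<lambda>x. S x w) (ball x0 r)" for w
    by (rule inv(2)) auto
  have derG: "(G has_derivative S (G z)) (at z)" if z: "z \<in> ?V" for z
  proof (rule has_derivative_inverse_basic[OF _ _ _ contG[OF z] open_ball z G(2)])
    show "(f has_derivative ?D (G z)) (at (G z))"
      using GB[OF z] r(2) by (intro Cinf_on_has_derivative[OF f]) auto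
    show "bounded_linear (S (G z))" using S[OF GB[OF z]] by (rule linear_imp_bounded_linear)
    show "S (G z) \<circ> ?D (G z) = id"
      using bijD[OF GB[OF z]] by (auto simp: S_def fun_eq_iff bij_def)
  qed
  have "Ck_on k G ?V" for k
  proof (induction k)
    case 0 then show ?case using contG by (simp add: continuous_at_imp_continuous_on)
  next
    case (Suc k)
    show ?case
    proof (rule Ck_on_SucI[OF open_ball derG])
      show "Ck_on k (\<lambda>z. S (G z) v) ?V" for v
        using CS GB by (intro Ck_on_compose[OF open_ball _ Suc.IH, of "ball x0 r"]) (auto simp: Cinf_on_def)
    qed
  qed
  then show thesis
    using that[of ?V G] G GB r G0 by (force simp: Cinf_on_def)
qed

lemma dim_kernel_surjective:
  fixes L :: "'a::finite_dim_normed \<Rightarrow> 'b::finite_dim_normed"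
  assumes L: "linear L" "surj L"
  shows "dim {x. L x = 0} + dim (UNIV :: 'b set) = dim (UNIV :: 'a set)"
proof -
  interpret d: finite_dimensional_vector_space_pair_1 "scaleR :: real \<Rightarrow> 'b \<Rightarrow> 'b" fbasis "scaleR :: real \<Rightarrow> 'a \<Rightarrow> 'a"
    by unfold_locales
  obtain R where R: "linear R" "L \<circ> R = id"
    using linear_surjective_right_inverse[OF L] by blast
  have LR: "L (R y) = y" for y using R(2) by (metis comp_apply id_apply)
  have "inj R" using LR by (metis injI)
  have dR: "dim (range R) = dim (UNIV :: 'b set)"
    using d.dim_image_eq[of R UNIV] R(1) \<open>inj R\<close>
    by (simp add: dim_raw_def linear_def inj_on_subset)
  have "{x + y |x y. x \<in> {x. L x = 0} \<and> y \<in> range R} = UNIV"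
  proof -
    have "x = (x - R (L x)) + R (L x) \<and> L (x - R (L x)) = 0" for x
      by (simp add: linear_diff[OF L(1)] LR)
    then show ?thesis by blast
  qed
  moreover have "{x. L x = 0} \<inter> range R = {0}"
  proof -
    have "x = 0" if "L x = 0" "x = R y" for x y
      using that LR[of y] linear_0[OF R(1)] by simp
    moreover have "0 = R 0" by (simp add: linear_0[OF R(1)])
    ultimately show ?thesis using linear_0[OF L(1)] by blast
  qed
  moreover have "subspace {x. L x = 0}" "subspace (range R)"
    using linear_subspace_kernel[OF L(1)] linear_subspace_image[OF R(1) subspace_UNIV] by auto
  ultimately show ?thesis
    using fin.dim_sums_Int[of "{x. L x = 0}" "range R"] dR by simp
qed

text \<open>
  The kernels of all differentials of a submersion have the same dimension, so that they have a
  common typical fibre.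
\<close>

lemma kernels_isomorphic:
  fixes L L' :: "'a::finite_dim_normed \<Rightarrow> 'b::finite_dim_normed"
  assumes L: "linear L" "surj L" and L': "linear L'" "surj L'"
  obtains J J' where "linear J" "linear J'" "J ` {x. L x = 0} = {x. L' x = 0}"
    "\<And>x. L x = 0 \<Longrightarrow> J' (J x) = x"
proof -
  interpret d: finite_dimensional_vector_space_pair "scaleR :: real \<Rightarrow> 'a \<Rightarrow> 'a" fbasis "scaleR :: real \<Rightarrow> 'a \<Rightarrow> 'a" fbasis
    by unfold_locales
  have sub: "subspace {x. L x = 0}" "subspace {x. L' x = 0}"
    using linear_subspace_kernel L(1) L'(1) by auto
  have "dim {x. L x = 0} = dim {x. L' x = 0}"
    using dim_kernel_surjective[OF L] dim_kernel_surjective[OF L'] by simp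
  then obtain J where J: "linear J" "J ` {x. L x = 0} = {x. L' x = 0}" "inj_on J {x. L x = 0}"
    using d.subspace_isomorphism[of "{x. L x = 0}" "{x. L' x = 0}"] sub
    by (auto simp: dim_raw_def subspace_raw_def linear_def)
  obtain J' where "linear J'" "\<forall>x\<in>{x. L x = 0}. J' (J x) = x"
    using linear_exists_left_inverse_on[OF J(1) sub(1) J(3)] by blast
  then show thesis using that J by blast
qed


section \<open>Smooth maps between manifolds\<close>

lemma carrierI: "(U, c) \<in> X \<Longrightarrow> x \<in> U \<Longrightarrow> x \<in> carrier X"
  by (auto simp: carrier_def)

lemma carrierE:
  assumes "x \<in> carrier X" obtains U c where "(U, c) \<in> X" "x \<in> U"
  using assms by (auto simp: carrier_def)

lemma chart_inj: "smooth_atlas X \<Longrightarrow> (U, c) \<in> X \<Longrightarrow> inj_on c U"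
  by (auto simp: smooth_atlas_def)

lemma chart_open: "smooth_atlas X \<Longrightarrow> (U, c) \<in> X \<Longrightarrow> open (c ` U)"
  by (auto simp: smooth_atlas_def)

lemma transition_open: "smooth_atlas X \<Longrightarrow> (U, c) \<in> X \<Longrightarrow> (V, d) \<in> X \<Longrightarrow> open (c ` (U \<inter> V))"
  unfolding smooth_atlas_def by blast

lemma transition_smooth:
  "smooth_atlas X \<Longrightarrow> (U, c) \<in> X \<Longrightarrow> (V, d) \<in> X \<Longrightarrow> Cinf_on (d \<circ> inv_into U c) (c ` (U \<inter> V))"
  unfolding smooth_atlas_def by blast

lemma chart_inv: "smooth_atlas X \<Longrightarrow> (U, c) \<in> X \<Longrightarrow> x \<in> U \<Longrightarrow> inv_into U c (c x) = x"
  by (rule inv_into_f_f[OF chart_inj])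

lemma open_vimage_Int: "continuous_on A f \<Longrightarrow> open A \<Longrightarrow> open B \<Longrightarrow> open (A \<inter> f -` B)"
  by (rule continuous_open_preimage)

text \<open>
  The condition that \<open>smooth_map\<close> imposes at one point, with all charts and extensions under one
  existential quantifier, so that they can be supplied by a single introduction rule.
\<close>

definition smooth_at ::
    "('a, 'd::real_normed_vector) atlas \<Rightarrow> ('b, 'e::real_normed_vector) atlas \<Rightarrow> 'a set \<Rightarrow> ('a \<Rightarrow> 'b) \<Rightarrow> 'a \<Rightarrow> bool"
  where
  "smooth_at X Y S f x \<longleftrightarrow>
     (\<exists>U c V d W F. (U, c) \<in> X \<and> x \<in> U \<and> (V, d) \<in> Y \<and> f x \<in> V \<and> open W \<and> c x \<in> W \<and> Cinf_on F W \<and>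
        (\<forall>y\<in>S \<inter> U. c y \<in> W \<longrightarrow> f y \<in> V \<and> d (f y) = F (c y)))"

lemma smooth_map_iff: "smooth_map X Y S f \<longleftrightarrow> (\<forall>x\<in>S. smooth_at X Y S f x)"
  unfolding smooth_map_def smooth_at_def Bex_def split_paired_Ex prod.case
  by (rule ball_cong[OF refl]) blast

lemma smooth_atI:
  assumes "(U, c) \<in> X" "x \<in> U" "(V, d) \<in> Y" "f x \<in> V" "open W" "c x \<in> W" "Cinf_on F W"
    and "\<And>y. y \<in> S \<Longrightarrow> y \<in> U \<Longrightarrow> c y \<in> W \<Longrightarrow> f y \<in> V \<and> d (f y) = F (c y)"
  shows "smooth_at X Y S f x"
  unfolding smooth_at_def using assms by blast

lemma smooth_mapI: "(\<And>x. x \<in> S \<Longrightarrow> smooth_at X Y S f x) \<Longrightarrow> smooth_map X Y S f"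
  unfolding smooth_map_iff by (rule ballI)

lemma smooth_mapD:
  assumes "smooth_map X Y S f" "x \<in> S"
  obtains U c V d W F where "(U, c) \<in> X" "(V, d) \<in> Y" "x \<in> U" "f x \<in> V" "open W" "c x \<in> W"
      "Cinf_on F W" "\<And>y. y \<in> S \<Longrightarrow> y \<in> U \<Longrightarrow> c y \<in> W \<Longrightarrow> f y \<in> V \<and> d (f y) = F (c y)"
  using bspec[OF assms(1)[unfolded smooth_map_iff] assms(2)] unfolding smooth_at_def by blast

lemma smooth_map_carrier: "smooth_map X Y S f \<Longrightarrow> x \<in> S \<Longrightarrow> x \<in> carrier X \<and> f x \<in> carrier Y"
  by (erule (1) smooth_mapD) (auto intro: carrierI)

text \<open>
  Because the transition functions are smooth, the charts in the definition of smoothness may be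
  chosen at will; the representative is cut down to the part where old and new charts overlap.
\<close>

lemma smooth_mapE:
  fixes X :: "('a, 'd::finite_dim_normed) atlas" and Y :: "('b, 'e::finite_dim_normed) atlas"
  assumes X: "smooth_atlas X" and Y: "smooth_atlas Y" and f: "smooth_map X Y S f" and x: "x \<in> S"
    and U: "(U, c) \<in> X" "x \<in> U" and V: "(V, d) \<in> Y" "f x \<in> V"
  obtains W F where "open W" "c x \<in> W" "W \<subseteq> c ` U" "Cinf_on F W" "F ` W \<subseteq> d ` V"
    "\<And>y. y \<in> S \<Longrightarrow> y \<in> U \<Longrightarrow> c y \<in> W \<Longrightarrow> f y \<in> V \<and> d (f y) = F (c y)"
proof -
  obtain U0 c0 V0 d0 W0 F0 where
    U0: "(U0, c0) \<in> X" and V0: "(V0, d0) \<in> Y" and U0x: "x \<in> U0" and V0x: "f x \<in> V0"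
    and W0: "open W0" "c0 x \<in> W0" and F0: "Cinf_on F0 W0"
    and fF: "\<And>y. y \<in> S \<Longrightarrow> y \<in> U0 \<Longrightarrow> c0 y \<in> W0 \<Longrightarrow> f y \<in> V0 \<and> d0 (f y) = F0 (c0 y)"
    by (rule smooth_mapD[OF f x]; blast)
  note U0 = U0 U0x and V0 = V0 V0x
  let ?\<phi> = "c0 \<circ> inv_into U c" and ?\<psi> = "d \<circ> inv_into V0 d0"
  let ?A = "c ` (U \<inter> U0)" and ?B = "d0 ` (V0 \<inter> V)"
  have A: "open ?A" "Cinf_on ?\<phi> ?A" using transition_open transition_smooth X U(1) U0(1) by blast+
  have B: "open ?B" "Cinf_on ?\<psi> ?B" using transition_open transition_smooth Y V(1) V0(1) by blast+
  define A1 where "A1 = ?A \<inter> ?\<phi> -` W0"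
  have A1: "open A1" unfolding A1_def
    by (rule open_vimage_Int[OF Cinf_on_continuous_on[OF A(2)] A(1) W0(1)])
  let ?G = "\<lambda>z. F0 (?\<phi> z)"
  have G: "Cinf_on ?G A1"
    by (rule Cinf_on_compose[OF F0 Cinf_on_subset[OF A(2)] A1]) (auto simp: A1_def)
  define W where "W = A1 \<inter> ?G -` ?B"
  have W: "open W" unfolding W_def by (rule open_vimage_Int[OF Cinf_on_continuous_on[OF G] A1 B(1)])
  let ?F = "\<lambda>z. ?\<psi> (?G z)"
  have F: "Cinf_on ?F W"
    by (rule Cinf_on_compose[OF B(2) Cinf_on_subset[OF G] W]) (auto simp: W_def)
  have \<phi>: "?\<phi> (c y) = c0 y" if "y \<in> U" for y by (simp add: chart_inv[OF X U(1) that])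
  have \<psi>: "?\<psi> (d0 v) = d v" if "v \<in> V0" for v by (simp add: chart_inv[OF Y V0(1) that])
  show thesis
  proof (rule that[of W ?F])
    show "open W" by (rule W)
    have "?G (c x) = d0 (f x)" using fF[OF x U0(2) W0(2)] \<phi>[OF U(2)] by simp
    then show "c x \<in> W"
      using U U0 V V0 W0(2) \<phi>[OF U(2)] by (auto simp: W_def A1_def simp del: comp_apply)
    show "W \<subseteq> c ` U" by (auto simp: W_def A1_def)
    show "Cinf_on ?F W" by (rule F)
    show "?F ` W \<subseteq> d ` V"
    proof
      fix w assume "w \<in> ?F ` W"
      then obtain z where z: "z \<in> W" "w = ?\<psi> (?G z)" by blast
      then obtain v where "v \<in> V0 \<inter> V" "?G z = d0 v" by (auto simp: W_def)
      then show "w \<in> d ` V" using z(2) \<psi>[of v] by (simp del: comp_apply)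
    qed
    fix y assume y: "y \<in> S" "y \<in> U" "c y \<in> W"
    then obtain y' where "y' \<in> U \<inter> U0" "c y = c y'" by (auto simp: W_def A1_def)
    then have yU0: "y \<in> U0" using inj_onD[OF chart_inj[OF X U(1)]] y(2) by auto
    have "c0 y \<in> W0" using y(3) \<phi>[OF y(2)] by (auto simp: W_def A1_def)
    from fF[OF y(1) yU0 this] have fy: "f y \<in> V0" "d0 (f y) = F0 (c0 y)" by auto
    have "?G (c y) \<in> ?B" using y(3) by (auto simp: W_def simp del: comp_apply)
    then have "d0 (f y) \<in> ?B" using fy(2) \<phi>[OF y(2)] by simp
    then have "f y \<in> V" using inj_onD[OF chart_inj[OF Y V0(1)]] fy(1) by auto
    then show "f y \<in> V \<and> d (f y) = ?F (c y)" using \<psi>[OF fy(1)] fy(2) \<phi>[OF y(2)] by simp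
  qed
qed

lemma smooth_map_subset: "smooth_map X Y S f \<Longrightarrow> T \<subseteq> S \<Longrightarrow> smooth_map X Y T f"
proof (rule smooth_mapI)
  fix x assume f: "smooth_map X Y S f" and T: "T \<subseteq> S" and x: "x \<in> T"
  from T x have "x \<in> S" by blast
  with f obtain U c V d W F where "(U, c) \<in> X" "(V, d) \<in> Y" "x \<in> U" "f x \<in> V" "open W" "c x \<in> W"
      "Cinf_on F W" "\<And>y. y \<in> S \<Longrightarrow> y \<in> U \<Longrightarrow> c y \<in> W \<Longrightarrow> f y \<in> V \<and> d (f y) = F (c y)"
    by (rule smooth_mapD; blast)
  then show "smooth_at X Y T f x"
    using T by (intro smooth_atI[of U c _ _ V d _ _ W F]) auto
qed

lemma smooth_map_cong:
  assumes "smooth_map X Y S f" "\<And>x. x \<in> S \<Longrightarrow> f x = g x"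
  shows "smooth_map X Y S g"
proof (rule smooth_mapI)
  fix x assume x: "x \<in> S"
  from assms(1) x obtain U c V d W F where "(U, c) \<in> X" "(V, d) \<in> Y" "x \<in> U" "f x \<in> V" "open W" "c x \<in> W"
      "Cinf_on F W" "\<And>y. y \<in> S \<Longrightarrow> y \<in> U \<Longrightarrow> c y \<in> W \<Longrightarrow> f y \<in> V \<and> d (f y) = F (c y)"
    by (rule smooth_mapD; blast)
  then show "smooth_at X Y S g x"
    using assms(2) x by (intro smooth_atI[of U c _ _ V d _ _ W F]) auto
qed

lemma smooth_map_compose:
  fixes X :: "('a, 'd::finite_dim_normed) atlas" and Y :: "('b, 'e::finite_dim_normed) atlas"
    and Z :: "('c, 'f::finite_dim_normed) atlas"
  assumes X: "smooth_atlas X" and Y: "smooth_atlas Y" and Z: "smooth_atlas Z"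
    and f: "smooth_map X Y S f" and g: "smooth_map Y Z T g" and ST: "f ` S \<subseteq> T"
  shows "smooth_map X Z S (\<lambda>x. g (f x))"
proof (rule smooth_mapI)
  fix x assume x: "x \<in> S"
  then have fx: "f x \<in> T" using ST by blast
  obtain U c where U: "(U, c) \<in> X" "x \<in> U" using smooth_map_carrier[OF f x] by (blast elim: carrierE)
  obtain V d where V: "(V, d) \<in> Y" "f x \<in> V" using smooth_map_carrier[OF f x] by (blast elim: carrierE)
  obtain A e where A: "(A, e) \<in> Z" "g (f x) \<in> A" using smooth_map_carrier[OF g fx] by (blast elim: carrierE)
  obtain W F where W: "open W" "c x \<in> W" "W \<subseteq> c ` U" "Cinf_on F W" "F ` W \<subseteq> d ` V"
      and F: "\<And>y. y \<in> S \<Longrightarrow> y \<in> U \<Longrightarrow> c y \<in> W \<Longrightarrow> f y \<in> V \<and> d (f y) = F (c y)"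
    by (rule smooth_mapE[OF X Y f x U V]; blast)
  obtain W' G where W': "open W'" "d (f x) \<in> W'" "W' \<subseteq> d ` V" "Cinf_on G W'" "G ` W' \<subseteq> e ` A"
      and G: "\<And>y. y \<in> T \<Longrightarrow> y \<in> V \<Longrightarrow> d y \<in> W' \<Longrightarrow> g y \<in> A \<and> e (g y) = G (d y)"
    by (rule smooth_mapE[OF Y Z g fx V A]; blast)
  let ?W = "W \<inter> F -` W'"
  have oW: "open ?W" by (rule open_vimage_Int[OF Cinf_on_continuous_on[OF W(4)] W(1) W'(1)])
  have "Cinf_on (\<lambda>z. G (F z)) ?W"
    by (rule Cinf_on_compose[OF W'(4) Cinf_on_subset[OF W(4)] oW]) auto
  moreover have "c x \<in> ?W" using W(2) W'(2) F[OF x U(2) W(2)] by auto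
  moreover have "g (f y) \<in> A \<and> e (g (f y)) = G (F (c y))" if "y \<in> S \<inter> U" "c y \<in> ?W" for y
  proof -
    have "f y \<in> V" "d (f y) = F (c y)" using F[of y] that by auto
    then show ?thesis using G[of "f y"] that ST by auto
  qed
  ultimately show "smooth_at X Z S (\<lambda>y. g (f y)) x"
    using U A oW by (intro smooth_atI[of U c _ _ A e _ _ ?W "\<lambda>z. G (F z)"]) auto
qed

lemma smooth_map_id: "S \<subseteq> carrier X \<Longrightarrow> smooth_map X X S (\<lambda>x. x)"
proof (rule smooth_mapI)
  fix x assume "S \<subseteq> carrier X" "x \<in> S"
  then obtain U c where "(U, c) \<in> X" "x \<in> U" by (blast elim: carrierE)
  then show "smooth_at X X S (\<lambda>y. y) x"
    by (intro smooth_atI[of U c _ _ U c _ _ UNIV "\<lambda>z. z"])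
      (auto simp: Cinf_on_ident)
qed

lemma smooth_map_const: "S \<subseteq> carrier X \<Longrightarrow> y \<in> carrier Y \<Longrightarrow> smooth_map X Y S (\<lambda>x. y)"
proof (rule smooth_mapI)
  fix x assume "S \<subseteq> carrier X" "x \<in> S" "y \<in> carrier Y"
  then obtain U c V d where "(U, c) \<in> X" "x \<in> U" "(V, d) \<in> Y" "y \<in> V" by (blast elim: carrierE)
  then show "smooth_at X Y S (\<lambda>z. y) x"
    by (intro smooth_atI[of U c _ _ V d _ _ UNIV "\<lambda>z. d y"])
      (auto simp: Cinf_on_const)
qed


subsection \<open>Model spaces\<close>

lemma carrier_model_atlas [simp]: "carrier model_atlas = UNIV"
  by (simp add: carrier_def model_atlas_def)

lemma smooth_atlas_model: "smooth_atlas (model_atlas :: ('e::real_normed_vector, 'e) atlas)"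
proof -
  have *: "(\<lambda>x. x) \<circ> inv_into UNIV (\<lambda>x. x) = (\<lambda>x :: 'e. x)"
    by (auto simp: fun_eq_iff inv_into_f_eq)
  have "Cinf_on ((\<lambda>x. x) \<circ> inv_into UNIV (\<lambda>x. x)) (UNIV :: 'e set)"
    unfolding * by (rule Cinf_on_ident)
  then show ?thesis by (simp add: smooth_atlas_def model_atlas_def)
qed

lemma smooth_map_Cinf: "open W \<Longrightarrow> Cinf_on F W \<Longrightarrow> smooth_map model_atlas model_atlas W F"
  by (rule smooth_mapI, rule smooth_atI[of UNIV "\<lambda>x. x" _ _ UNIV "\<lambda>x. x" _ _ W F]) (auto simp: model_atlas_def)

lemma smooth_map_chart: "(U, c) \<in> X \<Longrightarrow> smooth_map X model_atlas U c"
proof (rule smooth_mapI)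
  fix x assume "(U, c) \<in> X" "x \<in> U"
  then show "smooth_at X model_atlas U c x"
    by (intro smooth_atI[of U c _ _ UNIV "\<lambda>x. x" _ _ UNIV "\<lambda>z. z"])
      (auto simp: Cinf_on_ident model_atlas_def)
qed


subsection \<open>Products\<close>

lemma prod_atlasI: "(U, c) \<in> X \<Longrightarrow> (V, d) \<in> Y \<Longrightarrow> (U \<times> V, \<lambda>(x, y). (c x, d y)) \<in> prod_atlas X Y"
  by (auto simp: prod_atlas_def)

lemma prod_atlasE:
  assumes "(A, p) \<in> prod_atlas X Y"
  obtains U c V d where "(U, c) \<in> X" "(V, d) \<in> Y" "A = U \<times> V" "p = (\<lambda>(x, y). (c x, d y))"
  using assms by (auto simp: prod_atlas_def)

lemma carrier_prod_atlas [simp]: "carrier (prod_atlas X Y) = carrier X \<times> carrier Y"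
  by (auto simp: carrier_def prod_atlas_def) blast

text \<open>
  A pair of maps into model spaces is thus a map into a model space, to which a smooth function of
  two variables can be applied.
\<close>

lemma prod_atlas_model: "prod_atlas model_atlas model_atlas = model_atlas"
  by (auto simp: prod_atlas_def model_atlas_def)

lemma inv_into_prod_chart:
  assumes "inj_on c U" "inj_on d V" "y \<in> c ` U" "z \<in> d ` V"
  shows "inv_into (U \<times> V) (\<lambda>(x, y). (c x, d y)) (y, z) = (inv_into U c y, inv_into V d z)"
proof (rule inv_into_f_eq)
  show "inj_on (\<lambda>(x, y). (c x, d y)) (U \<times> V)" using assms(1,2) by (auto simp: inj_on_def)
qed (use assms(3,4) in \<open>auto simp: inv_into_into f_inv_into_f\<close>)

lemma smooth_atlas_prod:
  fixes X :: "('a, 'd::finite_dim_normed) atlas" and Y :: "('b, 'e::finite_dim_normed) atlas"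
  assumes X: "smooth_atlas X" and Y: "smooth_atlas Y"
  shows "smooth_atlas (prod_atlas X Y)"
proof -
  have img: "(\<lambda>(x, y). (c x, d y)) ` (A \<times> B) = c ` A \<times> d ` B" for c d A B by auto
  have "inj_on p A \<and> open (p ` A)" if "(A, p) \<in> prod_atlas X Y" for A p
    using that
  proof (rule prod_atlasE)
    fix U c V d assume *: "(U, c) \<in> X" "(V, d) \<in> Y" "A = U \<times> V" "p = (\<lambda>(x, y). (c x, d y))"
    show ?thesis
      using chart_inj[OF X *(1)] chart_inj[OF Y *(2)] chart_open[OF X *(1)] chart_open[OF Y *(2)]
      unfolding *(3,4) img by (auto simp: inj_on_def open_Times)
  qed
  moreover have "open (p ` (A \<inter> B)) \<and> Cinf_on (q \<circ> inv_into A p) (p ` (A \<inter> B))"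
    if Ap: "(A, p) \<in> prod_atlas X Y" and Bq: "(B, q) \<in> prod_atlas X Y" for A p B q
  proof -
    obtain U c V d where 1: "(U, c) \<in> X" "(V, d) \<in> Y" "A = U \<times> V" "p = (\<lambda>(x, y). (c x, d y))"
      using Ap by (rule prod_atlasE)
    obtain U' c' V' d' where 2: "(U', c') \<in> X" "(V', d') \<in> Y" "B = U' \<times> V'" "q = (\<lambda>(x, y). (c' x, d' y))"
      using Bq by (rule prod_atlasE)
    let ?A = "c ` (U \<inter> U')" and ?B = "d ` (V \<inter> V')"
    have im: "p ` (A \<inter> B) = ?A \<times> ?B" unfolding 1(3,4) 2(3) Times_Int_Times by (rule img)
    have oA: "open ?A" by (rule transition_open[OF X 1(1) 2(1)])
    have oB: "open ?B" by (rule transition_open[OF Y 1(2) 2(2)])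
    have o: "open (?A \<times> ?B)" using oA oB by (rule open_Times)
    have "Cinf_on (\<lambda>z. ((c' \<circ> inv_into U c) (fst z), (d' \<circ> inv_into V d) (snd z))) (?A \<times> ?B)"
    proof (rule Cinf_on_Pair[OF o])
      show "Cinf_on (\<lambda>z. (c' \<circ> inv_into U c) (fst z)) (?A \<times> ?B)"
        by (rule Cinf_on_compose[OF transition_smooth[OF X 1(1) 2(1)] Cinf_on_bounded_linear[OF bounded_linear_fst] o]) auto
      show "Cinf_on (\<lambda>z. (d' \<circ> inv_into V d) (snd z)) (?A \<times> ?B)"
        by (rule Cinf_on_compose[OF transition_smooth[OF Y 1(2) 2(2)] Cinf_on_bounded_linear[OF bounded_linear_snd] o]) auto
    qed
    then have "Cinf_on (q \<circ> inv_into A p) (?A \<times> ?B)"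
    proof (rule Cinf_on_cong[OF o, rotated])
      fix z assume "z \<in> ?A \<times> ?B"
      then show "((c' \<circ> inv_into U c) (fst z), (d' \<circ> inv_into V d) (snd z)) = (q \<circ> inv_into A p) z"
        using inv_into_prod_chart[OF chart_inj[OF X 1(1)] chart_inj[OF Y 1(2)], of "fst z" "snd z"]
        by (auto simp: 1(3,4) 2(4))
    qed
    then show ?thesis using o im by simp
  qed
  ultimately show ?thesis unfolding smooth_atlas_def by fast
qed

lemma smooth_map_Pair:
  fixes X :: "('a, 'd::finite_dim_normed) atlas" and Y :: "('b, 'e::finite_dim_normed) atlas"
    and Z :: "('c, 'f::finite_dim_normed) atlas"
  assumes X: "smooth_atlas X" and Y: "smooth_atlas Y" and Z: "smooth_atlas Z"
    and f: "smooth_map X Y S f" and g: "smooth_map X Z S g"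
  shows "smooth_map X (prod_atlas Y Z) S (\<lambda>x. (f x, g x))"
proof (rule smooth_mapI)
  fix x assume x: "x \<in> S"
  obtain U c where U: "(U, c) \<in> X" "x \<in> U" using smooth_map_carrier[OF f x] by (blast elim: carrierE)
  obtain V d where V: "(V, d) \<in> Y" "f x \<in> V" using smooth_map_carrier[OF f x] by (blast elim: carrierE)
  obtain A e where A: "(A, e) \<in> Z" "g x \<in> A" using smooth_map_carrier[OF g x] by (blast elim: carrierE)
  obtain W F where W: "open W" "c x \<in> W" "W \<subseteq> c ` U" "Cinf_on F W" "F ` W \<subseteq> d ` V"
      and F: "\<And>y. y \<in> S \<Longrightarrow> y \<in> U \<Longrightarrow> c y \<in> W \<Longrightarrow> f y \<in> V \<and> d (f y) = F (c y)"
    by (rule smooth_mapE[OF X Y f x U V]; blast)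
  obtain W' G where W': "open W'" "c x \<in> W'" "W' \<subseteq> c ` U" "Cinf_on G W'" "G ` W' \<subseteq> e ` A"
      and G: "\<And>y. y \<in> S \<Longrightarrow> y \<in> U \<Longrightarrow> c y \<in> W' \<Longrightarrow> g y \<in> A \<and> e (g y) = G (c y)"
    by (rule smooth_mapE[OF X Z g x U A]; blast)
  have o: "open (W \<inter> W')" using W(1) W'(1) by blast
  have "Cinf_on (\<lambda>z. (F z, G z)) (W \<inter> W')"
    by (rule Cinf_on_Pair[OF o Cinf_on_subset[OF W(4)] Cinf_on_subset[OF W'(4)]]) auto
  then show "smooth_at X (prod_atlas Y Z) S (\<lambda>y. (f y, g y)) x"
    using U V A o W(2) W'(2) F G prod_atlasI[OF V(1) A(1)]
    by (intro smooth_atI[of U c _ _ "V \<times> A" "\<lambda>(x, y). (d x, e y)" _ _ "W \<inter> W'" "\<lambda>z. (F z, G z)"]) auto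
qed

lemma smooth_map_fst: "S \<subseteq> carrier X \<times> carrier Y \<Longrightarrow> smooth_map (prod_atlas X Y) X S fst"
proof (rule smooth_mapI)
  fix x assume "S \<subseteq> carrier X \<times> carrier Y" "x \<in> S"
  then obtain U c V d where *: "(U, c) \<in> X" "(V, d) \<in> Y" "x \<in> U \<times> V" by (force elim!: carrierE)
  show "smooth_at (prod_atlas X Y) X S fst x"
    using * prod_atlasI[OF *(1,2)]
    by (intro smooth_atI[of "U \<times> V" "\<lambda>(x, y). (c x, d y)" _ _ U c _ _ UNIV fst])
      (auto simp: Cinf_on_bounded_linear bounded_linear_fst)
qed

lemma smooth_map_snd: "S \<subseteq> carrier X \<times> carrier Y \<Longrightarrow> smooth_map (prod_atlas X Y) Y S snd"
proof (rule smooth_mapI)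
  fix x assume "S \<subseteq> carrier X \<times> carrier Y" "x \<in> S"
  then obtain U c V d where *: "(U, c) \<in> X" "(V, d) \<in> Y" "x \<in> U \<times> V" by (force elim!: carrierE)
  show "smooth_at (prod_atlas X Y) Y S snd x"
    using * prod_atlasI[OF *(1,2)]
    by (intro smooth_atI[of "U \<times> V" "\<lambda>(x, y). (c x, d y)" _ _ V d _ _ UNIV snd])
      (auto simp: Cinf_on_bounded_linear bounded_linear_snd)
qed


section \<open>The manifold topology\<close>

lemma mopenI:
  assumes "O' \<subseteq> carrier X" "\<And>U c x. (U, c) \<in> X \<Longrightarrow> x \<in> O' \<Longrightarrow> x \<in> U \<Longrightarrow> \<exists>T. open T \<and> c x \<in> T \<and> T \<subseteq> c ` (O' \<inter> U)"
  shows "mopen X O'"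
  unfolding mopen_def
proof (intro conjI assms(1) ballI, clarify)
  fix U c assume "(U, c) \<in> X"
  with assms(2) show "open (c ` (O' \<inter> U))" by (subst open_subopen) blast
qed

lemma mopen_preimage:
  fixes X :: "('a, 'd::finite_dim_normed) atlas" and Y :: "('b, 'e::finite_dim_normed) atlas"
  assumes X: "smooth_atlas X" and Y: "smooth_atlas Y" and f: "smooth_map X Y S f"
    and S: "mopen X S" and O: "mopen Y O'"
  shows "mopen X {x \<in> S. f x \<in> O'}"
proof (rule mopenI)
  show "{x \<in> S. f x \<in> O'} \<subseteq> carrier X" using S by (auto simp: mopen_def)
  fix U c x assume U: "(U, c) \<in> X" "x \<in> U" and "x \<in> {x \<in> S. f x \<in> O'}"
  then have x: "x \<in> S" "f x \<in> O'" by auto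
  obtain V d where V: "(V, d) \<in> Y" "f x \<in> V" using smooth_map_carrier[OF f x(1)] by (blast elim: carrierE)
  obtain W F where W: "open W" "c x \<in> W" "W \<subseteq> c ` U" "Cinf_on F W" "F ` W \<subseteq> d ` V"
      and F: "\<And>y. y \<in> S \<Longrightarrow> y \<in> U \<Longrightarrow> c y \<in> W \<Longrightarrow> f y \<in> V \<and> d (f y) = F (c y)"
    by (rule smooth_mapE[OF X Y f x(1) U V]; blast)
  have oV: "open (d ` (O' \<inter> V))" and oS: "open (c ` (S \<inter> U))"
    using O S V(1) U(1) unfolding mopen_def by blast+
  let ?T = "(W \<inter> F -` (d ` (O' \<inter> V))) \<inter> c ` (S \<inter> U)"
  have "open ?T"
    using open_vimage_Int[OF Cinf_on_continuous_on[OF W(4)] W(1) oV] oS by blast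
  moreover have "c x \<in> ?T"
    using W(2) F[OF x(1) U(2) W(2)] x U(2) imageI[of "f x" "O' \<inter> V" d] by auto
  moreover have "?T \<subseteq> c ` ({x \<in> S. f x \<in> O'} \<inter> U)"
  proof
    fix z assume z: "z \<in> ?T"
    then obtain y where y: "y \<in> S" "y \<in> U" "z = c y" by blast
    then have "f y \<in> V" "d (f y) \<in> d ` (O' \<inter> V)" using F[of y] z by auto
    then have "f y \<in> O'" using inj_onD[OF chart_inj[OF Y V(1)]] by auto
    then show "z \<in> c ` ({x \<in> S. f x \<in> O'} \<inter> U)" using y by auto
  qed
  ultimately show "\<exists>T. open T \<and> c x \<in> T \<and> T \<subseteq> c ` ({x \<in> S. f x \<in> O'} \<inter> U)" by blast
qed

lemma mopen_chart: "smooth_atlas X \<Longrightarrow> (U, c) \<in> X \<Longrightarrow> mopen X U"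
  unfolding mopen_def by (auto simp: Int_commute carrierI intro: transition_open)

lemma mopen_carrier: "smooth_atlas X \<Longrightarrow> mopen X (carrier X)"
proof -
  assume X: "smooth_atlas X"
  have "carrier X \<inter> U = U" if "(U, c) \<in> X" for U c using that by (auto simp: carrier_def)
  then show ?thesis using X unfolding mopen_def by (auto intro: chart_open)
qed

lemma mopen_model: "mopen model_atlas W \<longleftrightarrow> open W"
  by (auto simp: mopen_def model_atlas_def carrier_def)

lemma mopen_chart_preimage:
  fixes X :: "('a, 'd::finite_dim_normed) atlas"
  assumes "smooth_atlas X" "(U, c) \<in> X" "open W"
  shows "mopen X {x \<in> U. c x \<in> W}"
  by (rule mopen_preimage[OF assms(1) smooth_atlas_model smooth_map_chart[OF assms(2)] mopen_chart[OF assms(1,2)]])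
    (simp add: mopen_model assms)

lemma topspace_mtopology: "smooth_atlas X \<Longrightarrow> topspace (mtopology X) = carrier X"
  using mopen_carrier[of X] unfolding topspace_def
  by (auto simp: openin_mtopology mopen_def)

text \<open>
  Second countability amounts to a countable atlas. In this form it passes to products and to
  tangent bundles, whose charts come from those of the given manifolds.
\<close>

lemma countable_subatlas:
  assumes X: "smooth_atlas X" and "second_countable (mtopology X)"
  obtains C where "countable C" "C \<subseteq> X" "carrier C = carrier X"
proof -
  obtain B where B: "countable B" "\<And>V. V \<in> B \<Longrightarrow> mopen X V"
    "\<And>U x. mopen X U \<Longrightarrow> x \<in> U \<Longrightarrow> \<exists>V\<in>B. x \<in> V \<and> V \<subseteq> U"
  proof -
    from assms(2) obtain B where "countable B \<and> (\<forall>V\<in>B. mopen X V) \<and>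
        (\<forall>U x. mopen X U \<and> x \<in> U \<longrightarrow> (\<exists>V\<in>B. x \<in> V \<and> V \<subseteq> U))"
      unfolding second_countable_def openin_mtopology[OF X] by (rule exE)
    then show thesis by (intro that[of B]) simp_all
  qed
  define B' where "B' = {V\<in>B. \<exists>a\<in>X. V \<subseteq> fst a}"
  have "\<forall>V\<in>B'. \<exists>a\<in>X. V \<subseteq> fst a" by (simp add: B'_def)
  then obtain k where k: "\<And>V. V \<in> B' \<Longrightarrow> k V \<in> X \<and> V \<subseteq> fst (k V)" by metis
  show thesis
  proof (rule that[of "k ` B'"])
    show "countable (k ` B')" using B(1) by (auto simp: B'_def)
    show sub: "k ` B' \<subseteq> X" using k by blast
    have "x \<in> carrier (k ` B')" if x: "x \<in> carrier X" for x
    proof -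
      obtain U c where U: "(U, c) \<in> X" "x \<in> U" using x by (rule carrierE)
      then obtain V where V: "V \<in> B" "x \<in> V" "V \<subseteq> U" using B(3)[OF mopen_chart[OF X]] by blast
      then have "V \<in> B'" using U by (force simp: B'_def)
      with k[OF this] V(2) show ?thesis by (cases "k V") (auto simp: carrier_def intro!: bexI[of _ V])
    qed
    moreover have "carrier (k ` B') \<subseteq> carrier X" using sub unfolding carrier_def by (rule Union_mono[OF image_mono])
    ultimately show "carrier (k ` B') = carrier X" by (intro equalityI subsetI) auto
  qed
qed

lemma second_countable_subatlas:
  fixes X :: "('a, 'd::finite_dim_normed) atlas"
  assumes X: "smooth_atlas X" and C: "countable C" "C \<subseteq> X" "carrier C = carrier X"
  shows "second_countable (mtopology X)"
proof -
  obtain D :: "'d set set" where D: "countable D" "topological_basis D"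
    using ex_countable_basis by blast
  let ?B = "(\<lambda>((U, c), W). {x \<in> U. c x \<in> W}) ` (C \<times> D)"
  have "countable ?B" using C(1) D(1) by blast
  moreover have "mopen X V" if "V \<in> ?B" for V
    using that C(2) topological_basis_open[OF D(2)] mopen_chart_preimage[OF X] by fastforce
  moreover have "\<exists>V\<in>?B. x \<in> V \<and> V \<subseteq> O'" if O: "mopen X O'" "x \<in> O'" for O' x
  proof -
    have "x \<in> carrier C" using O C(3) by (auto simp: mopen_def)
    then obtain U c where U: "(U, c) \<in> C" "x \<in> U" by (rule carrierE)
    then have "open (c ` (O' \<inter> U))" using O(1) C(2) unfolding mopen_def by blast
    then obtain W where W: "W \<in> D" "c x \<in> W" "W \<subseteq> c ` (O' \<inter> U)"
      using topological_basisE[OF D(2), of "c ` (O' \<inter> U)" "c x"] O(2) U(2) by blast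
    have "{x \<in> U. c x \<in> W} \<subseteq> O'"
    proof clarify
      fix y assume "y \<in> U" "c y \<in> W"
      then obtain z where "z \<in> O' \<inter> U" "c y = c z" using W(3) by blast
      then show "y \<in> O'" using inj_onD[OF chart_inj[OF X], of U c y z] U(1) C(2) \<open>y \<in> U\<close> by auto
    qed
    moreover have "{x \<in> U. c x \<in> W} \<in> ?B"
      by (rule image_eqI[of _ _ "((U, c), W)"]) (use U W in auto)
    moreover have "x \<in> {x \<in> U. c x \<in> W}" using U W by simp
    ultimately show ?thesis by (intro bexI[of _ "{x \<in> U. c x \<in> W}"] conjI)
  qed
  ultimately show ?thesis unfolding second_countable_def openin_mtopology[OF X]
    by (intro exI[of _ ?B] conjI ballI allI impI) simp_all
qed

lemma Hausdorff_mtopologyI: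
  assumes "smooth_atlas X" "\<And>x y. x \<in> carrier X \<Longrightarrow> y \<in> carrier X \<Longrightarrow> x \<noteq> y \<Longrightarrow>
     \<exists>U V. mopen X U \<and> mopen X V \<and> x \<in> U \<and> y \<in> V \<and> U \<inter> V = {}"
  shows "Hausdorff_space (mtopology X)"
  unfolding Hausdorff_space_def openin_mtopology[OF assms(1)] topspace_mtopology[OF assms(1)]
  using assms(2) by (auto simp: disjnt_def)

lemma Hausdorff_mtopologyD:
  assumes "smooth_atlas X" "Hausdorff_space (mtopology X)" "x \<in> carrier X" "y \<in> carrier X" "x \<noteq> y"
  shows "\<exists>U V. mopen X U \<and> mopen X V \<and> x \<in> U \<and> y \<in> V \<and> U \<inter> V = {}"
proof -
  from assms(2) have "\<forall>x y. x \<in> carrier X \<and> y \<in> carrier X \<and> x \<noteq> y \<longrightarrow>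
      (\<exists>U V. mopen X U \<and> mopen X V \<and> x \<in> U \<and> y \<in> V \<and> disjnt U V)"
    unfolding Hausdorff_space_def openin_mtopology[OF assms(1)] topspace_mtopology[OF assms(1)] .
  from this[rule_format, of x y] show ?thesis using assms(3-) by (simp add: disjnt_def)
qed

lemma manifold_smooth_atlas: "manifold X \<Longrightarrow> smooth_atlas X"
  by (simp add: manifold_def)

text \<open>
  Preimages of disjoint open sets are disjoint. Applied to projections, this reduces the Hausdorff
  property of products and tangent bundles to that of the base.
\<close>

lemma separated_by_smooth_map:
  fixes X :: "('a, 'd::finite_dim_normed) atlas" and Y :: "('b, 'e::finite_dim_normed) atlas"
  assumes X: "smooth_atlas X" and Y: "smooth_atlas Y" "Hausdorff_space (mtopology Y)"
    and f: "smooth_map X Y (carrier X) f" and xy: "x \<in> carrier X" "y \<in> carrier X" "f x \<noteq> f y"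
  shows "\<exists>U V. mopen X U \<and> mopen X V \<and> x \<in> U \<and> y \<in> V \<and> U \<inter> V = {}"
proof -
  obtain U V where *: "mopen Y U" "mopen Y V" "f x \<in> U" "f y \<in> V" "U \<inter> V = {}"
    using Hausdorff_mtopologyD[OF Y conjunct2[OF smooth_map_carrier[OF f xy(1)]]
        conjunct2[OF smooth_map_carrier[OF f xy(2)]] xy(3)] by blast
  show ?thesis
    using mopen_preimage[OF X Y(1) f mopen_carrier[OF X] *(1)]
      mopen_preimage[OF X Y(1) f mopen_carrier[OF X] *(2)] * xy
    by (intro exI[of _ "{z \<in> carrier X. f z \<in> U}"] exI[of _ "{z \<in> carrier X. f z \<in> V}"]) auto
qed

lemma manifold_prod:
  fixes X :: "('a, 'd::finite_dim_normed) atlas" and Y :: "('b, 'e::finite_dim_normed) atlas"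
  assumes "manifold X" "manifold Y"
  shows "manifold (prod_atlas X Y)"
proof -
  have X: "smooth_atlas X" "Hausdorff_space (mtopology X)" "second_countable (mtopology X)"
    and Y: "smooth_atlas Y" "Hausdorff_space (mtopology Y)" "second_countable (mtopology Y)"
    using assms by (auto simp: manifold_def)
  note P = smooth_atlas_prod[OF X(1) Y(1)]
  have "Hausdorff_space (mtopology (prod_atlas X Y))"
  proof (rule Hausdorff_mtopologyI[OF P])
    fix x y assume *: "x \<in> carrier (prod_atlas X Y)" "y \<in> carrier (prod_atlas X Y)" "x \<noteq> y"
    then consider "fst x \<noteq> fst y" | "snd x \<noteq> snd y" by (auto simp: prod_eq_iff)
    then show "\<exists>U V. mopen (prod_atlas X Y) U \<and> mopen (prod_atlas X Y) V \<and> x \<in> U \<and> y \<in> V \<and> U \<inter> V = {}"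
    proof cases
      case 1
      show ?thesis by (rule separated_by_smooth_map[OF P X(1,2) smooth_map_fst *(1,2) 1]) simp
    next
      case 2
      show ?thesis by (rule separated_by_smooth_map[OF P Y(1,2) smooth_map_snd *(1,2) 2]) simp
    qed
  qed
  moreover have "second_countable (mtopology (prod_atlas X Y))"
  proof -
    obtain C where C: "countable C" "C \<subseteq> X" "carrier C = carrier X"
      using countable_subatlas[OF X(1,3)] by blast
    obtain D where D: "countable D" "D \<subseteq> Y" "carrier D = carrier Y"
      using countable_subatlas[OF Y(1,3)] by blast
    have eq: "prod_atlas C D = (\<lambda>((U, c), (V, d)). (U \<times> V, \<lambda>(x, y). (c x, d y))) ` (C \<times> D)"
      by (force simp: prod_atlas_def)
    show ?thesis
    proof (rule second_countable_subatlas[OF P])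
      show "countable (prod_atlas C D)" unfolding eq using C(1) D(1) by blast
      show "prod_atlas C D \<subseteq> prod_atlas X Y" using C(2) D(2) unfolding prod_atlas_def by blast
    qed (simp add: C D)
  qed
  ultimately show ?thesis using P by (simp add: manifold_def)
qed


section \<open>Tangent vectors\<close>

lemma transition_derivative_linear:
  assumes "smooth_atlas X" "(U, c) \<in> X" "(V, d) \<in> X" "x \<in> U" "x \<in> V"
  shows "linear (frechet_derivative (d \<circ> inv_into U c) (at (c x)))"
  by (rule Cinf_on_linear_derivative[OF transition_smooth[OF assms(1-3)]]) (use assms in auto)

lemma transition_derivative_id:
  assumes "smooth_atlas X" "(U, c) \<in> X" "x \<in> U"
  shows "frechet_derivative (c \<circ> inv_into U c) (at (c x)) e = e"
proof -
  have "frechet_derivative (c \<circ> inv_into U c) (at (c x)) = frechet_derivative (\<lambda>y. y) (at (c x))"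
    by (rule frechet_derivative_cong_open[OF chart_open[OF assms(1,2)]])
      (use assms in \<open>auto simp: f_inv_into_f\<close>)
  then show ?thesis by simp
qed

text \<open>
  The cocycle condition for the differentials of the transition functions; it is what makes
  \<open>tvec_of\<close> below a tangent vector.
\<close>

lemma transition_derivative_chain:
  fixes X :: "('a, 'e::finite_dim_normed) atlas"
  assumes X: "smooth_atlas X" and U: "(U, c) \<in> X" "x \<in> U" and V: "(V, d) \<in> X" "x \<in> V"
    and V': "(V', d') \<in> X" "x \<in> V'"
  shows "frechet_derivative (d' \<circ> inv_into U c) (at (c x)) e =
    frechet_derivative (d' \<circ> inv_into V d) (at (d x)) (frechet_derivative (d \<circ> inv_into U c) (at (c x)) e)"
proof -
  let ?\<phi> = "d \<circ> inv_into U c" and ?\<psi> = "d' \<circ> inv_into V d"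
  let ?A = "c ` (U \<inter> V)"
  have \<phi>x: "?\<phi> (c x) = d x" by (simp add: chart_inv[OF X U])
  have "frechet_derivative (\<lambda>y. ?\<psi> (?\<phi> y)) (at (c x)) e
      = frechet_derivative ?\<psi> (at (?\<phi> (c x))) (frechet_derivative ?\<phi> (at (c x)) e)"
    by (rule frechet_derivative_chain[OF transition_smooth[OF X V(1) V'(1)] transition_smooth[OF X U(1) V(1)]])
      (use U V V' \<phi>x in auto)
  moreover have "frechet_derivative (\<lambda>y. ?\<psi> (?\<phi> y)) (at (c x)) = frechet_derivative (d' \<circ> inv_into U c) (at (c x))"
  proof (rule frechet_derivative_cong_open[OF transition_open[OF X U(1) V(1)]])
    show "c x \<in> ?A" using U V by blast
    fix y assume "y \<in> ?A"
    then obtain z where z: "z \<in> U" "z \<in> V" "y = c z" by blast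
    then show "?\<psi> (?\<phi> y) = (d' \<circ> inv_into U c) y"
      by (simp add: chart_inv[OF X U(1)] chart_inv[OF X V(1)])
  qed
  ultimately show ?thesis using \<phi>x by simp
qed

lemma tspace_transform:
  "v \<in> tspace X x \<Longrightarrow> (U, c) \<in> X \<Longrightarrow> (V, d) \<in> X \<Longrightarrow> x \<in> U \<Longrightarrow> x \<in> V \<Longrightarrow>
    v (V, d) = frechet_derivative (d \<circ> inv_into U c) (at (c x)) (v (U, c))"
  unfolding tspace_def by blast

lemma tspace_outside: "v \<in> tspace X x \<Longrightarrow> (U, c) \<notin> X \<or> x \<notin> U \<Longrightarrow> v (U, c) = 0"
  unfolding tspace_def by blast

lemma tspaceI:
  assumes "\<And>U c. (U, c) \<notin> X \<or> x \<notin> U \<Longrightarrow> v (U, c) = 0"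
    and "\<And>U c V d. (U, c) \<in> X \<Longrightarrow> (V, d) \<in> X \<Longrightarrow> x \<in> U \<Longrightarrow> x \<in> V \<Longrightarrow>
      v (V, d) = frechet_derivative (d \<circ> inv_into U c) (at (c x)) (v (U, c))"
  shows "v \<in> tspace X x"
  unfolding tspace_def using assms by blast

lemma tspace_eqI:
  assumes "v \<in> tspace X x" "w \<in> tspace X x" "(U, c) \<in> X" "x \<in> U" "v (U, c) = w (U, c)"
  shows "v = w"
proof (rule ext, goal_cases)
  case (1 k)
  obtain V d where k: "k = (V, d)" by (cases k)
  show ?case
  proof (cases "(V, d) \<in> X \<and> x \<in> V")
    case True
    then show ?thesis
      using tspace_transform[OF assms(1,3), of V d] tspace_transform[OF assms(2,3), of V d] assms(4,5) k by simp
  next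
    case False
    then show ?thesis using tspace_outside[OF assms(1), of V d] tspace_outside[OF assms(2), of V d] k by auto
  qed
qed

text \<open>
  The tangent vector at \<open>x\<close> whose coordinate vector in the chart \<open>(U, c)\<close> is \<open>e\<close>.
\<close>

definition tvec_of :: "('a, 'e::real_normed_vector) atlas \<Rightarrow> 'a set \<Rightarrow> ('a \<Rightarrow> 'e) \<Rightarrow> 'a \<Rightarrow> 'e \<Rightarrow> ('a, 'e) tvec" where
  "tvec_of X U c x e =
     (\<lambda>(V, d). if (V, d) \<in> X \<and> x \<in> V then frechet_derivative (d \<circ> inv_into U c) (at (c x)) e else 0)"

lemma tvec_of_coord: "smooth_atlas X \<Longrightarrow> (U, c) \<in> X \<Longrightarrow> x \<in> U \<Longrightarrow> tvec_of X U c x e (U, c) = e"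
  by (simp add: tvec_of_def transition_derivative_id)

lemma tvec_of_tspace:
  fixes X :: "('a, 'e::finite_dim_normed) atlas"
  assumes "smooth_atlas X" "(U, c) \<in> X" "x \<in> U"
  shows "tvec_of X U c x e \<in> tspace X x"
  by (rule tspaceI)
    (auto simp: tvec_of_def intro: transition_derivative_chain[OF assms])

lemma tscale_apply: "tscale r v k = r *\<^sub>R v k"
  by (simp add: tscale_def)

lemma tspace_0: "smooth_atlas X \<Longrightarrow> 0 \<in> tspace X x"
  by (rule tspaceI) (simp_all add: linear_0[OF transition_derivative_linear])

lemma tspace_add: "smooth_atlas X \<Longrightarrow> v \<in> tspace X x \<Longrightarrow> w \<in> tspace X x \<Longrightarrow> v + w \<in> tspace X x"
  by (rule tspaceI)
    (auto simp: tspace_outside linear_add[OF transition_derivative_linear] intro!: arg_cong2[of _ _ _ _ "(+)"]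
      elim: tspace_transform)

lemma tspace_tscale: "smooth_atlas X \<Longrightarrow> v \<in> tspace X x \<Longrightarrow> tscale r v \<in> tspace X x"
  by (rule tspaceI)
    (auto simp: tscale_def tspace_outside linear_cmul[OF transition_derivative_linear] elim: tspace_transform
      intro!: arg_cong2[of _ _ _ _ scaleR])

lemma tscale_minus_one: "tscale (-1) v = - v"
  by (auto simp: tscale_def fun_eq_iff)

lemma tspace_minus: "smooth_atlas X \<Longrightarrow> v \<in> tspace X x \<Longrightarrow> - v \<in> tspace X x"
  using tspace_tscale[of X v x "-1"] by (simp add: tscale_minus_one)

lemma tspace_diff: "smooth_atlas X \<Longrightarrow> v \<in> tspace X x \<Longrightarrow> w \<in> tspace X x \<Longrightarrow> v - w \<in> tspace X x"
  using tspace_add[of X v x "- w"] tspace_minus[of X w x] by simp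


section \<open>Curves and differentials\<close>

lemma interval_eq_ball: "{-r<..<r} = ball (0::real) r"
  by (auto simp: dist_real_def)

lemma smooth_curveE:
  fixes X :: "('a, 'e::finite_dim_normed) atlas"
  assumes X: "smooth_atlas X" and \<gamma>: "smooth_curve X S \<gamma>" and U: "(U, c) \<in> X" "\<gamma> 0 \<in> U"
  obtains \<epsilon> F where "\<epsilon> > 0" "Cinf_on F {-\<epsilon><..<\<epsilon>}"
    "\<And>t. t \<in> {-\<epsilon><..<\<epsilon>} \<Longrightarrow> \<gamma> t \<in> S \<and> \<gamma> t \<in> U \<and> c (\<gamma> t) = F t"
proof -
  obtain e where e: "e > 0" "smooth_map model_atlas X {-e<..<e} \<gamma>" "\<gamma> ` {-e<..<e} \<subseteq> S"
    using \<gamma> unfolding smooth_curve_def by blast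
  have 0: "(0::real) \<in> {-e<..<e}" using e(1) by simp
  have m: "(UNIV, \<lambda>x. x) \<in> (model_atlas :: (real, real) atlas)" by (simp add: model_atlas_def)
  obtain W F where W: "open W" "0 \<in> W" "Cinf_on F W"
      and F: "\<And>t. t \<in> {-e<..<e} \<Longrightarrow> t \<in> UNIV \<Longrightarrow> t \<in> W \<Longrightarrow> \<gamma> t \<in> U \<and> c (\<gamma> t) = F t"
    by (rule smooth_mapE[OF smooth_atlas_model X e(2) 0 m UNIV_I U]; blast)
  obtain r where r: "r > 0" "ball 0 r \<subseteq> W" using W(1,2) by (meson open_contains_ball)
  let ?d = "min e r"
  have sub: "{- ?d<..<?d} \<subseteq> W" "{- ?d<..<?d} \<subseteq> {-e<..<e}" using r(2) by (auto simp: dist_real_def min_def subset_iff split: if_splits)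
  show thesis
    by (rule that[of ?d F]) (use e r sub F Cinf_on_subset[OF W(3) sub(1)] in auto)
qed

lemma smooth_curveI:
  fixes X :: "('a, 'e::finite_dim_normed) atlas"
  assumes "(U, c) \<in> X" "\<epsilon> > 0" "Cinf_on F {-\<epsilon><..<\<epsilon>}"
    and "\<And>t. t \<in> {-\<epsilon><..<\<epsilon>} \<Longrightarrow> \<gamma> t \<in> S \<and> \<gamma> t \<in> U \<and> c (\<gamma> t) = F t"
  shows "smooth_curve X S \<gamma>"
proof -
  have "smooth_map model_atlas X {-\<epsilon><..<\<epsilon>} \<gamma>"
  proof (rule smooth_mapI)
    fix t assume "t \<in> {-\<epsilon><..<\<epsilon>}"
    then show "smooth_at model_atlas X {-\<epsilon><..<\<epsilon>} (\<lambda>y. \<gamma> y) t"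
      using assms
      by (intro smooth_atI[of UNIV "\<lambda>x. x" _ _ U c _ _ "{-\<epsilon><..<\<epsilon>}" F])
        (simp_all add: model_atlas_def)
  qed
  then show ?thesis using assms unfolding smooth_curve_def by blast
qed

lemma curve_derivative:
  fixes F :: "real \<Rightarrow> 'e::real_normed_vector"
  assumes "\<epsilon> > 0" "Cinf_on F {-\<epsilon><..<\<epsilon>}"
  shows "(F has_derivative (\<lambda>t. t *\<^sub>R frechet_derivative F (at 0) 1)) (at 0)"
proof -
  have "(F has_derivative frechet_derivative F (at 0)) (at 0)"
    by (rule Cinf_on_has_derivative[OF assms(2)]) (use assms(1) in simp)
  moreover have "frechet_derivative F (at 0) t = t *\<^sub>R frechet_derivative F (at 0) 1" for t
    using linear_cmul[OF has_derivative_linear[OF calculation], of t 1] by simp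
  ultimately show ?thesis by (metis (no_types, lifting) ext)
qed

lemma velocity_chart:
  assumes "(U, c) \<in> X" "\<gamma> 0 \<in> U" and \<epsilon>: "\<epsilon> > 0" "Cinf_on F {-\<epsilon><..<\<epsilon>}"
    and "\<And>t. t \<in> {-\<epsilon><..<\<epsilon>} \<Longrightarrow> c (\<gamma> t) = F t"
  shows "velocity X \<gamma> (U, c) = frechet_derivative F (at 0) 1"
proof -
  have "((c \<circ> \<gamma>) has_derivative (\<lambda>t. t *\<^sub>R frechet_derivative F (at 0) 1)) (at 0)"
    using iffD1[OF has_derivative_cong_open[of "{-\<epsilon><..<\<epsilon>}" 0 F "c \<circ> \<gamma>"] curve_derivative[OF \<epsilon>]] assms
    by simp
  then have "vector_derivative (c \<circ> \<gamma>) (at 0) = frechet_derivative F (at 0) 1"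
    by (intro vector_derivative_at) (simp add: has_vector_derivative_def)
  then show ?thesis using assms(1,2) by (simp add: velocity_def)
qed

lemma velocity_outside: "(U, c) \<notin> X \<or> \<gamma> 0 \<notin> U \<Longrightarrow> velocity X \<gamma> (U, c) = 0"
  by (auto simp: velocity_def)

lemma velocity_cong:
  assumes "\<epsilon> > 0" "\<And>t. t \<in> {-\<epsilon><..<\<epsilon>} \<Longrightarrow> \<gamma> t = \<delta> t"
  shows "velocity X \<gamma> = velocity X \<delta>"
proof (rule ext, goal_cases)
  case (1 k)
  obtain U c where k: "k = (U, c)" by (cases k)
  have "vector_derivative (c \<circ> \<gamma>) (at 0) = vector_derivative (c \<circ> \<delta>) (at 0)"
    unfolding vector_derivative_def has_vector_derivative_def
    using has_derivative_cong_open[of "{-\<epsilon><..<\<epsilon>}" 0 "c \<circ> \<gamma>" "c \<circ> \<delta>"] assms by simp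
  moreover have "\<gamma> 0 = \<delta> 0" using assms by simp
  ultimately show ?case by (simp add: velocity_def k)
qed

lemma smooth_curve_shrink:
  assumes "smooth_curve X S \<gamma>" "\<epsilon> > 0" "\<And>t. t \<in> {-\<epsilon><..<\<epsilon>} \<Longrightarrow> \<gamma> t \<in> T"
  shows "smooth_curve X T \<gamma>"
proof -
  obtain e where e: "e > 0" "smooth_map model_atlas X {-e<..<e} \<gamma>"
    using assms(1) unfolding smooth_curve_def by blast
  let ?d = "min e \<epsilon>"
  have "smooth_map model_atlas X {- ?d<..<?d} \<gamma>" by (rule smooth_map_subset[OF e(2)]) auto
  moreover have "\<gamma> ` {- ?d<..<?d} \<subseteq> T" using assms(3) by auto
  ultimately show ?thesis unfolding smooth_curve_def using e(1) assms(2) by (intro exI[of _ ?d]) auto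
qed

lemma smooth_curve_carrier: "smooth_curve X S \<gamma> \<Longrightarrow> smooth_curve X (carrier X) \<gamma>"
  unfolding smooth_curve_def by (meson image_subsetI smooth_map_carrier)

lemma smooth_curve_at_0: "smooth_curve X S \<gamma> \<Longrightarrow> \<gamma> 0 \<in> S \<and> \<gamma> 0 \<in> carrier X"
  unfolding smooth_curve_def using smooth_map_carrier by fastforce

lemma smooth_curve_compose:
  fixes X :: "('a, 'd::finite_dim_normed) atlas" and Y :: "('b, 'e::finite_dim_normed) atlas"
  assumes X: "smooth_atlas X" and Y: "smooth_atlas Y" and f: "smooth_map X Y S f"
    and \<gamma>: "smooth_curve X S \<gamma>" and "f ` S \<subseteq> T"
  shows "smooth_curve Y T (\<lambda>t. f (\<gamma> t))"
proof -
  obtain e where e: "e > 0" "smooth_map model_atlas X {-e<..<e} \<gamma>" "\<gamma> ` {-e<..<e} \<subseteq> S"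
    using \<gamma> unfolding smooth_curve_def by blast
  have "smooth_map model_atlas Y {-e<..<e} (\<lambda>t. f (\<gamma> t))"
    by (rule smooth_map_compose[OF smooth_atlas_model X Y e(2) f e(3)])
  then show ?thesis unfolding smooth_curve_def using e assms(5) by blast
qed

lemma smooth_curve_const: "x \<in> S \<Longrightarrow> x \<in> carrier X \<Longrightarrow> smooth_curve X S (\<lambda>t. x)"
  unfolding smooth_curve_def
  by (intro exI[of _ 1] conjI smooth_map_const) auto

lemma velocity_const: "velocity X (\<lambda>t. x) = 0"
  by (auto simp: velocity_def fun_eq_iff o_def)

text \<open>
  Only the values of the extension \<open>F\<close> along the curve enter the velocity of the image curve, so
  that its derivative at the point acts on velocities of curves in \<open>S\<close> in the same way for every
  choice of \<open>F\<close>.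
\<close>

lemma velocity_compose:
  fixes X :: "('a, 'd::finite_dim_normed) atlas" and Y :: "('b, 'e::finite_dim_normed) atlas"
  assumes X: "smooth_atlas X" and \<gamma>: "smooth_curve X S \<gamma>" and U: "(U, c) \<in> X" "\<gamma> 0 \<in> U"
    and V: "(V, d) \<in> Y" and W: "open W" "c (\<gamma> 0) \<in> W" "Cinf_on F W"
    and F: "\<And>y. y \<in> S \<Longrightarrow> y \<in> U \<Longrightarrow> c y \<in> W \<Longrightarrow> f y \<in> V \<and> d (f y) = F (c y)"
  shows "velocity Y (\<lambda>t. f (\<gamma> t)) (V, d) = frechet_derivative F (at (c (\<gamma> 0))) (velocity X \<gamma> (U, c))"
proof -
  obtain e G where e: "e > 0" "Cinf_on G {-e<..<e}"
    and G: "\<And>t. t \<in> {-e<..<e} \<Longrightarrow> \<gamma> t \<in> S \<and> \<gamma> t \<in> U \<and> c (\<gamma> t) = G t"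
    by (rule smooth_curveE[OF X \<gamma> U]; blast)
  have G0: "G 0 = c (\<gamma> 0)" using G[of 0] e(1) by simp
  have vG: "velocity X \<gamma> (U, c) = frechet_derivative G (at 0) 1"
    by (rule velocity_chart[of U c X \<gamma> e G, OF U e]) (use G in blast)
  let ?A = "{-e<..<e} \<inter> G -` W"
  have "open ?A" by (rule open_vimage_Int[OF Cinf_on_continuous_on[OF e(2)] _ W(1)]) simp
  moreover have "0 \<in> ?A" using e(1) W(2) G0 by simp
  ultimately obtain r where r: "r > 0" "ball 0 r \<subseteq> ?A" by (meson open_contains_ball)
  then have sub: "{-r<..<r} \<subseteq> ?A" by (simp add: interval_eq_ball)
  have FG: "Cinf_on (\<lambda>t. F (G t)) {-r<..<r}"
    by (rule Cinf_on_compose[OF W(3) Cinf_on_subset[OF e(2)]]) (use sub in auto)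
  have dfG: "f (\<gamma> t) \<in> V \<and> d (f (\<gamma> t)) = F (G t)" if "t \<in> {-r<..<r}" for t
  proof -
    have t: "t \<in> {-e<..<e}" "G t \<in> W" using sub that by blast+
    then show ?thesis using F[of "\<gamma> t"] G[OF t(1)] by simp
  qed
  have "velocity Y (\<lambda>t. f (\<gamma> t)) (V, d) = frechet_derivative (\<lambda>t. F (G t)) (at 0) 1"
    by (rule velocity_chart[OF V _ r(1) FG]) (use dfG r(1) in auto)
  also have "\<dots> = frechet_derivative F (at (G 0)) (frechet_derivative G (at 0) 1)"
    by (rule frechet_derivative_chain[OF W(3) e(2)]) (use e(1) W(2) G0 in auto)
  finally show ?thesis by (simp add: vG G0)
qed

lemma velocity_tspace:
  fixes X :: "('a, 'e::finite_dim_normed) atlas"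
  assumes X: "smooth_atlas X" and \<gamma>: "smooth_curve X S \<gamma>"
  shows "velocity X \<gamma> \<in> tspace X (\<gamma> 0)"
proof (rule tspaceI)
  show "velocity X \<gamma> (U, c) = 0" if "(U, c) \<notin> X \<or> \<gamma> 0 \<notin> U" for U c
    using that by (rule velocity_outside)
  fix U c V d assume U: "(U, c) \<in> X" and V: "(V, d) \<in> X" and 0: "\<gamma> 0 \<in> U" "\<gamma> 0 \<in> V"
  have "velocity X (\<lambda>t. (\<lambda>x. x) (\<gamma> t)) (V, d) =
      frechet_derivative (d \<circ> inv_into U c) (at (c (\<gamma> 0))) (velocity X \<gamma> (U, c))"
  proof (rule velocity_compose[OF X \<gamma> U 0(1) V transition_open[OF X U V] _ transition_smooth[OF X U V]])
    show "c (\<gamma> 0) \<in> c ` (U \<inter> V)" using 0 by blast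
    fix y assume y: "y \<in> U" "c y \<in> c ` (U \<inter> V)"
    then have "y \<in> V" using inj_onD[OF chart_inj[OF X U]] by auto
    then show "y \<in> V \<and> d y = (d \<circ> inv_into U c) (c y)" by (simp add: chart_inv[OF X U y(1)])
  qed
  then show "velocity X \<gamma> (V, d) = frechet_derivative (d \<circ> inv_into U c) (at (c (\<gamma> 0))) (velocity X \<gamma> (U, c))"
    by simp
qed

text \<open>
  This uniqueness is what gives a meaning to the definite descriptions in \<open>tmap\<close> and \<open>dcomp\<close>. The
  velocities are compared in the charts of \<open>X\<close> only, which for a product are products of charts.
\<close>

lemma velocity_compose_unique:
  fixes X :: "('a, 'd::finite_dim_normed) atlas" and Y :: "('b, 'e::finite_dim_normed) atlas"
  assumes X: "smooth_atlas X" and Y: "smooth_atlas Y" and f: "smooth_map X Y S f"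
    and \<gamma>: "smooth_curve X S \<gamma>" and \<delta>: "smooth_curve X S \<delta>"
    and 0: "\<gamma> 0 = \<delta> 0" and v: "\<And>U c. (U, c) \<in> X \<Longrightarrow> \<gamma> 0 \<in> U \<Longrightarrow> velocity X \<gamma> (U, c) = velocity X \<delta> (U, c)"
  shows "velocity Y (\<lambda>t. f (\<gamma> t)) = velocity Y (\<lambda>t. f (\<delta> t))"
proof (rule ext, goal_cases)
  case (1 k)
  obtain V d where k: "k = (V, d)" by (cases k)
  show ?case
  proof (cases "(V, d) \<in> Y \<and> f (\<gamma> 0) \<in> V")
    case True
    then have V: "(V, d) \<in> Y" "f (\<gamma> 0) \<in> V" by auto
    have x: "\<gamma> 0 \<in> S" "\<gamma> 0 \<in> carrier X" using smooth_curve_at_0[OF \<gamma>] by auto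
    obtain U c where U: "(U, c) \<in> X" "\<gamma> 0 \<in> U" using x(2) by (rule carrierE)
    obtain W F where W: "open W" "c (\<gamma> 0) \<in> W" "Cinf_on F W"
        and F: "\<And>y. y \<in> S \<Longrightarrow> y \<in> U \<Longrightarrow> c y \<in> W \<Longrightarrow> f y \<in> V \<and> d (f y) = F (c y)"
      by (rule smooth_mapE[OF X Y f x(1) U V]; blast)
    have U': "\<delta> 0 \<in> U" and W': "c (\<delta> 0) \<in> W" using U W(2) 0 by auto
    show ?thesis
      using velocity_compose[OF X \<gamma> U V(1) W F] velocity_compose[OF X \<delta> U(1) U' V(1) W(1) W' W(3) F] 0 v[OF U]
      by (simp add: k)
  next
    case False
    then show ?thesis
      using velocity_outside[of V d Y "\<lambda>t. f (\<gamma> t)"] velocity_outside[of V d Y "\<lambda>t. f (\<delta> t)"] 0 k by auto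
  qed
qed

lemma tmap_velocity:
  fixes X :: "('a, 'd::finite_dim_normed) atlas" and Y :: "('b, 'e::finite_dim_normed) atlas"
  assumes X: "smooth_atlas X" and Y: "smooth_atlas Y" and f: "smooth_map X Y S f"
    and \<gamma>: "smooth_curve X S \<gamma>"
  shows "tmap X Y S f (\<gamma> 0) (velocity X \<gamma>) = velocity Y (\<lambda>t. f (\<gamma> t))"
  unfolding tmap_def
proof (rule the_equality)
  show "\<exists>\<gamma>'. smooth_curve X S \<gamma>' \<and> \<gamma>' 0 = \<gamma> 0 \<and> velocity X \<gamma>' = velocity X \<gamma> \<and>
      velocity Y (f \<circ> \<gamma>') = velocity Y (\<lambda>t. f (\<gamma> t))"
    using \<gamma> by (intro exI[of _ \<gamma>]) (simp add: o_def)
  fix w assume "\<exists>\<gamma>'. smooth_curve X S \<gamma>' \<and> \<gamma>' 0 = \<gamma> 0 \<and> velocity X \<gamma>' = velocity X \<gamma> \<and> velocity Y (f \<circ> \<gamma>') = w"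
  then obtain \<gamma>' where *: "smooth_curve X S \<gamma>'" "\<gamma>' 0 = \<gamma> 0" "velocity X \<gamma>' = velocity X \<gamma>" "velocity Y (f \<circ> \<gamma>') = w"
    by blast
  show "w = velocity Y (\<lambda>t. f (\<gamma> t))"
    using velocity_compose_unique[OF X Y f *(1) \<gamma> *(2)] *(3,4) by (simp add: o_def)
qed

text \<open>
  In a chart, a straight line will do.
\<close>

lemma curve_with_velocity:
  fixes X :: "('a, 'e::finite_dim_normed) atlas"
  assumes X: "smooth_atlas X" and x: "x \<in> carrier X" and v: "v \<in> tspace X x"
  obtains \<gamma> where "smooth_curve X (carrier X) \<gamma>" "\<gamma> 0 = x" "velocity X \<gamma> = v"
proof -
  obtain U c where U: "(U, c) \<in> X" "x \<in> U" using x by (rule carrierE)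
  let ?F = "\<lambda>t. c x + t *\<^sub>R v (U, c)"
  have der: "(?F has_derivative (\<lambda>t. t *\<^sub>R v (U, c))) (at t)" for t
    by (auto intro!: derivative_eq_intros)
  have bl: "bounded_linear (\<lambda>t::real. t *\<^sub>R v (U, c))"
    by (rule bounded_linear_scaleR_left)
  have F: "Cinf_on ?F UNIV"
    by (rule Cinf_on_add[OF open_UNIV Cinf_on_const Cinf_on_bounded_linear[OF bl]])
  have "open (UNIV \<inter> ?F -` (c ` U))"
    by (rule open_vimage_Int[OF Cinf_on_continuous_on[OF F] open_UNIV chart_open[OF X U(1)]])
  moreover have "0 \<in> UNIV \<inter> ?F -` (c ` U)" using U by simp
  ultimately obtain r where r: "r > 0" "ball 0 r \<subseteq> UNIV \<inter> ?F -` (c ` U)" by (meson open_contains_ball)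
  then have sub: "?F t \<in> c ` U" if "t \<in> {-r<..<r}" for t using that by (auto simp: dist_real_def subset_iff)
  let ?\<gamma> = "\<lambda>t. inv_into U c (?F t)"
  have \<gamma>: "?\<gamma> t \<in> carrier X \<and> ?\<gamma> t \<in> U \<and> c (?\<gamma> t) = ?F t" if "t \<in> {-r<..<r}" for t
    using inv_into_into[OF sub[OF that]] f_inv_into_f[OF sub[OF that]] carrierI[OF U(1)] by simp
  have Fr: "Cinf_on ?F {-r<..<r}" by (rule Cinf_on_subset[OF F]) simp
  have sc: "smooth_curve X (carrier X) ?\<gamma>" by (rule smooth_curveI[OF U(1) r(1) Fr \<gamma>])
  have 0: "?\<gamma> 0 = x" by (simp add: chart_inv[OF X U])
  have "velocity X ?\<gamma> (U, c) = frechet_derivative ?F (at 0) 1"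
    by (rule velocity_chart[OF U(1) _ r(1) Fr]) (use 0 U(2) \<gamma> in auto)
  also have "\<dots> = v (U, c)" using fun_cong[OF frechet_derivative_at[OF der[of 0]], of 1] by simp
  finally have "velocity X ?\<gamma> = v"
    using tspace_eqI[of "velocity X ?\<gamma>" X x v, OF _ v U] velocity_tspace[OF X sc] 0 by simp
  with that sc 0 show thesis by blast
qed

lemma
  fixes X :: "('a, 'd::finite_dim_normed) atlas" and Y :: "('b, 'e::finite_dim_normed) atlas"
  assumes X: "smooth_atlas X" and Y: "smooth_atlas Y" and f: "smooth_map X Y (carrier X) f"
    and x: "x \<in> carrier X" and v: "v \<in> tspace X x"
  shows tmap_tspace: "tmap X Y (carrier X) f x v \<in> tspace Y (f x)"
    and tmap_coord: "\<And>U c V d W F. (U, c) \<in> X \<Longrightarrow> x \<in> U \<Longrightarrow> (V, d) \<in> Y \<Longrightarrow> open W \<Longrightarrow> c x \<in> W \<Longrightarrow> Cinf_on F W \<Longrightarrow>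
      (\<And>y. y \<in> carrier X \<Longrightarrow> y \<in> U \<Longrightarrow> c y \<in> W \<Longrightarrow> f y \<in> V \<and> d (f y) = F (c y)) \<Longrightarrow>
      tmap X Y (carrier X) f x v (V, d) = frechet_derivative F (at (c x)) (v (U, c))"
proof -
  obtain \<gamma> where \<gamma>: "smooth_curve X (carrier X) \<gamma>" "\<gamma> 0 = x" "velocity X \<gamma> = v"
    by (rule curve_with_velocity[OF X x v])
  have eq: "tmap X Y (carrier X) f x v = velocity Y (\<lambda>t. f (\<gamma> t))"
    using tmap_velocity[OF X Y f \<gamma>(1)] \<gamma>(2,3) by simp
  have im: "f ` carrier X \<subseteq> carrier Y" using smooth_map_carrier[OF f] by blast
  show "tmap X Y (carrier X) f x v \<in> tspace Y (f x)"
    using velocity_tspace[OF Y smooth_curve_compose[OF X Y f \<gamma>(1) im]] eq \<gamma>(2) by simp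
  fix U c V d W F
  assume *: "(U, c) \<in> X" "x \<in> U" "(V, d) \<in> Y" "open W" "c x \<in> W" "Cinf_on F W"
    "\<And>y. y \<in> carrier X \<Longrightarrow> y \<in> U \<Longrightarrow> c y \<in> W \<Longrightarrow> f y \<in> V \<and> d (f y) = F (c y)"
  show "tmap X Y (carrier X) f x v (V, d) = frechet_derivative F (at (c x)) (v (U, c))"
    using velocity_compose[OF X \<gamma>(1) *(1) _ *(3,4) _ *(6,7)] *(2,5) \<gamma>(2,3) eq by simp
qed

lemma
  fixes X :: "('a, 'd::finite_dim_normed) atlas" and Y :: "('b, 'e::finite_dim_normed) atlas"
  assumes X: "smooth_atlas X" and Y: "smooth_atlas Y" and f: "smooth_map X Y (carrier X) f"
    and x: "x \<in> carrier X" and v: "v \<in> tspace X x"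
  shows tmap_add: "w \<in> tspace X x \<Longrightarrow> tmap X Y (carrier X) f x (v + w)
      = tmap X Y (carrier X) f x v + tmap X Y (carrier X) f x w"
    and tmap_tscale: "tmap X Y (carrier X) f x (tscale r v) = tscale r (tmap X Y (carrier X) f x v)"
proof -
  obtain U c where U: "(U, c) \<in> X" "x \<in> U" using x by (rule carrierE)
  obtain V d where V: "(V, d) \<in> Y" "f x \<in> V" using smooth_map_carrier[OF f x] by (blast elim: carrierE)
  obtain W F where W: "open W" "c x \<in> W" "Cinf_on F W"
      and F: "\<And>y. y \<in> carrier X \<Longrightarrow> y \<in> U \<Longrightarrow> c y \<in> W \<Longrightarrow> f y \<in> V \<and> d (f y) = F (c y)"
    by (rule smooth_mapE[OF X Y f x U V]; blast)
  have lin: "linear (frechet_derivative F (at (c x)))" by (rule Cinf_on_linear_derivative[OF W(3,2)])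
  note coord = tmap_coord[OF X Y f x _ U V(1) W F] and tsp = tmap_tspace[OF X Y f x]
  show "tmap X Y (carrier X) f x (tscale r v) = tscale r (tmap X Y (carrier X) f x v)"
    by (rule tspace_eqI[OF tsp[OF tspace_tscale[OF X v]] tspace_tscale[OF Y tsp[OF v]] V])
      (simp add: coord[OF v] coord[OF tspace_tscale[OF X v]] tscale_apply linear_cmul[OF lin])
  assume w: "w \<in> tspace X x"
  show "tmap X Y (carrier X) f x (v + w) = tmap X Y (carrier X) f x v + tmap X Y (carrier X) f x w"
    by (rule tspace_eqI[OF tsp[OF tspace_add[OF X v w]] tspace_add[OF Y tsp[OF v] tsp[OF w]] V])
      (simp add: coord[OF v] coord[OF w] coord[OF tspace_add[OF X v w]] linear_add[OF lin])
qed


section \<open>Lifting curves along submersions\<close>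

lemma submersion_coord_surj:
  fixes X :: "('a, 'd::finite_dim_normed) atlas" and Y :: "('b, 'e::finite_dim_normed) atlas"
  assumes X: "smooth_atlas X" and Y: "smooth_atlas Y" and f: "smooth_map X Y (carrier X) f"
    and x: "x \<in> carrier X" and surj: "tmap X Y (carrier X) f x ` tspace X x = tspace Y (f x)"
    and U: "(U, c) \<in> X" "x \<in> U" and V: "(V, d) \<in> Y" "f x \<in> V"
    and W: "open W" "c x \<in> W" "Cinf_on F W"
    and F: "\<And>y. y \<in> carrier X \<Longrightarrow> y \<in> U \<Longrightarrow> c y \<in> W \<Longrightarrow> f y \<in> V \<and> d (f y) = F (c y)"
  shows "surj (frechet_derivative F (at (c x)))"
proof -
  have "\<exists>y. frechet_derivative F (at (c x)) y = z" for z
  proof -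
    have "tvec_of Y V d (f x) z \<in> tmap X Y (carrier X) f x ` tspace X x"
      unfolding surj by (rule tvec_of_tspace[OF Y V])
    then obtain v where v: "v \<in> tspace X x" "tvec_of Y V d (f x) z = tmap X Y (carrier X) f x v" by blast
    then have "frechet_derivative F (at (c x)) (v (U, c)) = z"
      using tmap_coord[OF X Y f x v(1) U V(1) W F] tvec_of_coord[OF Y V, of z] by simp
    then show ?thesis by (rule exI)
  qed
  then show ?thesis unfolding surj_def by (metis (no_types))
qed

text \<open>
  In charts let \<open>L\<close> be the differential of \<open>f\<close> at the given point and \<open>R\<close> a right inverse of \<open>L\<close>.
  The map \<open>\<Phi>(y) = y - RLy + R f(y)\<close> has the identity as differential and turns \<open>f\<close> into \<open>L\<close>:
  \<open>L \<circ> \<Phi> = f\<close>. So its local inverse reduces lifting along \<open>f\<close> to lifting along a linear map.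
\<close>

lemma submersion_lift:
  fixes X :: "('a, 'd::finite_dim_normed) atlas" and Y :: "('b, 'e::finite_dim_normed) atlas"
  assumes X: "smooth_atlas X" and Y: "smooth_atlas Y" and f: "smooth_map X Y (carrier X) f"
    and surj: "tmap X Y (carrier X) f x ` tspace X x = tspace Y (f x)"
    and x: "x \<in> carrier X" and \<delta>: "smooth_curve Y (carrier Y) \<delta>" "\<delta> 0 = f x"
    and \<beta>: "\<beta> \<in> tspace X x" "tmap X Y (carrier X) f x \<beta> = velocity Y \<delta>"
  obtains \<gamma> \<epsilon> where "smooth_curve X (carrier X) \<gamma>" "\<gamma> 0 = x" "velocity X \<gamma> = \<beta>" "\<epsilon> > 0"
    "\<And>t. t \<in> {-\<epsilon><..<\<epsilon>} \<Longrightarrow> f (\<gamma> t) = \<delta> t"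
proof -
  obtain U c where U: "(U, c) \<in> X" "x \<in> U" using x by (rule carrierE)
  obtain V d where V: "(V, d) \<in> Y" "f x \<in> V" using smooth_map_carrier[OF f x] by (blast elim: carrierE)
  obtain W F where W: "open W" "c x \<in> W" "W \<subseteq> c ` U" "Cinf_on F W"
      and F: "\<And>y. y \<in> carrier X \<Longrightarrow> y \<in> U \<Longrightarrow> c y \<in> W \<Longrightarrow> f y \<in> V \<and> d (f y) = F (c y)"
    by (rule smooth_mapE[OF X Y f x U V]; blast)
  let ?L = "frechet_derivative F (at (c x))"
  have L: "linear ?L" by (rule Cinf_on_linear_derivative[OF W(4,2)])
  have coord: "tmap X Y (carrier X) f x v (V, d) = ?L (v (U, c))" if "v \<in> tspace X x" for v
    by (rule tmap_coord[OF X Y f x that U V(1) W(1,2,4) F])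
  have "surj ?L" by (rule submersion_coord_surj[OF X Y f x surj U V W(1,2,4) F])
  then obtain R where R: "linear R" "?L \<circ> R = id"
    using linear_surjective_right_inverse[OF L] by blast
  have LR: "?L (R y) = y" for y using R(2) by (metis comp_apply id_apply)
  define K where "K y = y - R (?L y)" for y
  have K: "linear K" unfolding K_def
    by (rule linear_compose_sub[OF linear_ident linear_compose[OF L R(1), unfolded o_def]])
  have LK: "?L (K y) = 0" for y by (simp add: K_def linear_diff[OF L] LR)
  define \<Phi> where "\<Phi> y = K y + R (F y)" for y
  have \<Phi>: "Cinf_on \<Phi> W" unfolding \<Phi>_def
    by (rule Cinf_on_add[OF W(1) Cinf_on_linear[OF K] Cinf_on_linear_compose[OF linear_imp_bounded_linear[OF R(1)] W(1,4)]])
  have L\<Phi>: "?L (\<Phi> y) = F y" for y by (simp add: \<Phi>_def linear_add[OF L] LK LR)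
  have d\<Phi>: "frechet_derivative \<Phi> (at (c x)) v = v" for v
  proof -
    have "(\<Phi> has_derivative (\<lambda>v. K v + R (?L v))) (at (c x))" unfolding \<Phi>_def
      by (rule has_derivative_add[OF bounded_linear_imp_has_derivative[OF linear_imp_bounded_linear[OF K]]
          bounded_linear.has_derivative[OF linear_imp_bounded_linear[OF R(1)] Cinf_on_has_derivative[OF W(4,2)]]])
    from fun_cong[OF frechet_derivative_at[OF this], of v] show ?thesis by (simp add: K_def)
  qed
  obtain N G where N: "open N" "\<Phi> (c x) \<in> N" and G: "Cinf_on G N" "G ` N \<subseteq> W"
      "\<And>z. z \<in> N \<Longrightarrow> \<Phi> (G z) = z" "G (\<Phi> (c x)) = c x"
    by (rule local_right_inverse[OF W(1,2) \<Phi> d\<Phi>]; blast)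
  have dG: "frechet_derivative G (at (\<Phi> (c x))) v = v" for v
  proof -
    have "frechet_derivative (\<lambda>z. \<Phi> (G z)) (at (\<Phi> (c x))) v
        = frechet_derivative \<Phi> (at (G (\<Phi> (c x)))) (frechet_derivative G (at (\<Phi> (c x))) v)"
      by (rule frechet_derivative_chain[OF \<Phi> G(1) N(2)]) (use W(2) G(4) in simp)
    moreover have "frechet_derivative (\<lambda>z. \<Phi> (G z)) (at (\<Phi> (c x))) = frechet_derivative (\<lambda>z. z) (at (\<Phi> (c x)))"
      by (rule frechet_derivative_cong_open[OF N(1,2) G(3)])
    ultimately show ?thesis by (simp add: G(4) d\<Phi>)
  qed
  have \<delta>V: "\<delta> 0 \<in> V" using \<delta>(2) V(2) by simp
  obtain e D where e: "e > 0" "Cinf_on D {-e<..<e}"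
    and D: "\<And>t. t \<in> {-e<..<e} \<Longrightarrow> \<delta> t \<in> carrier Y \<and> \<delta> t \<in> V \<and> d (\<delta> t) = D t"
    by (rule smooth_curveE[OF Y \<delta>(1) V(1) \<delta>V]; blast)
  have dD: "frechet_derivative D (at 0) 1 = ?L (\<beta> (U, c))"
    using velocity_chart[of V d Y \<delta> e D, OF V(1) \<delta>V e] D \<beta>(2) coord[OF \<beta>(1)] by simp
  have D0: "D 0 = F (c x)" using D[of 0] e(1) \<delta>(2) F[OF x U(2) W(2)] by simp
  define z where "z t = R (D t) + K (c x + t *\<^sub>R \<beta> (U, c))" for t
  have bl: "bounded_linear (\<lambda>t::real. t *\<^sub>R \<beta> (U, c))" by (rule bounded_linear_scaleR_left)
  have z: "Cinf_on z {-e<..<e}" unfolding z_def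
    by (rule Cinf_on_add[OF _ Cinf_on_linear_compose[OF linear_imp_bounded_linear[OF R(1)] _ e(2)]
        Cinf_on_linear_compose[OF linear_imp_bounded_linear[OF K] _
          Cinf_on_add[OF _ Cinf_on_const Cinf_on_bounded_linear[OF bl]]]])
      simp_all
  have Lz: "?L (z t) = D t" for t by (simp add: z_def linear_add[OF L] LR LK)
  have z0: "z 0 = \<Phi> (c x)" by (simp add: z_def D0 \<Phi>_def add.commute)
  have dz: "frechet_derivative z (at 0) 1 = \<beta> (U, c)"
  proof -
    have "(z has_derivative (\<lambda>t. R (t *\<^sub>R frechet_derivative D (at 0) 1) + K (0 + t *\<^sub>R \<beta> (U, c)))) (at 0)"
      unfolding z_def
      by (rule has_derivative_add[OF
          bounded_linear.has_derivative[OF linear_imp_bounded_linear[OF R(1)] curve_derivative[OF e]]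
          bounded_linear.has_derivative[OF linear_imp_bounded_linear[OF K]
            has_derivative_add[OF has_derivative_const bounded_linear_imp_has_derivative[OF bl]]]])
    from fun_cong[OF frechet_derivative_at[OF this], of 1] show ?thesis by (simp add: dD K_def)
  qed
  have "open ({-e<..<e} \<inter> z -` N)"
    by (rule open_vimage_Int[OF Cinf_on_continuous_on[OF z] _ N(1)]) simp
  moreover have "0 \<in> {-e<..<e} \<inter> z -` N" using e(1) z0 N(2) by simp
  ultimately obtain r where r: "r > 0" "ball 0 r \<subseteq> {-e<..<e} \<inter> z -` N" by (meson open_contains_ball)
  have sub: "t \<in> {-e<..<e}" "z t \<in> N" if "t \<in> {-r<..<r}" for t
    using r(2) that by (auto simp: dist_real_def subset_iff)
  let ?\<gamma> = "\<lambda>t. inv_into U c (G (z t))"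
  have GW: "G (z t) \<in> W" if "t \<in> {-r<..<r}" for t using sub(2)[OF that] G(2) by blast
  have \<gamma>: "?\<gamma> t \<in> carrier X \<and> ?\<gamma> t \<in> U \<and> c (?\<gamma> t) = G (z t)" if "t \<in> {-r<..<r}" for t
    using GW[OF that] W(3) carrierI[OF U(1)] inv_into_into[of "G (z t)" c U] f_inv_into_f[of "G (z t)" c U] by auto
  have Gz: "Cinf_on (\<lambda>t. G (z t)) {-r<..<r}"
    by (rule Cinf_on_compose[OF G(1) Cinf_on_subset[OF z]]) (use sub in auto)
  have sc: "smooth_curve X (carrier X) ?\<gamma>" by (rule smooth_curveI[OF U(1) r(1) Gz \<gamma>])
  have 0: "?\<gamma> 0 = x" by (simp add: z0 G(4) chart_inv[OF X U])
  have "velocity X ?\<gamma> (U, c) = frechet_derivative (\<lambda>t. G (z t)) (at 0) 1"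
    by (rule velocity_chart[OF U(1) _ r(1) Gz]) (use 0 U(2) \<gamma> in auto)
  also have "\<dots> = frechet_derivative G (at (z 0)) (frechet_derivative z (at 0) 1)"
    by (rule frechet_derivative_chain[OF G(1) z]) (use e(1) z0 N(2) in auto)
  also have "\<dots> = \<beta> (U, c)" by (simp add: z0 dG dz)
  finally have v: "velocity X ?\<gamma> = \<beta>"
    using tspace_eqI[of "velocity X ?\<gamma>" X x \<beta>, OF _ \<beta>(1) U] velocity_tspace[OF X sc] 0 by simp
  have "f (?\<gamma> t) = \<delta> t" if t: "t \<in> {-r<..<r}" for t
  proof -
    have "f (?\<gamma> t) \<in> V" "d (f (?\<gamma> t)) = F (G (z t))"
      using F[of "?\<gamma> t"] \<gamma>[OF t] GW[OF t] by auto
    moreover have "F (G (z t)) = D t" using L\<Phi>[of "G (z t)"] G(3)[OF sub(2)[OF t]] Lz by simp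
    ultimately show ?thesis using D[OF sub(1)[OF t]] inj_onD[OF chart_inj[OF Y V(1)]] by auto
  qed
  with that[OF sc 0 v r(1)] show thesis by blast
qed


section \<open>The tangent bundle\<close>

abbreviation tdom :: "('a, 'e::real_normed_vector) atlas \<Rightarrow> 'a set \<Rightarrow> ('a \<times> ('a, 'e) tvec) set" where
  "tdom X U \<equiv> {(x, v). x \<in> U \<and> v \<in> tspace X x}"

abbreviation tchart :: "'a set \<Rightarrow> ('a \<Rightarrow> 'e) \<Rightarrow> 'a \<times> ('a, 'e) tvec \<Rightarrow> 'e \<times> 'e" where
  "tchart U c \<equiv> \<lambda>(x, v). (c x, v (U, c))"

lemma tangent_chartI: "(U, c) \<in> X \<Longrightarrow> (tdom X U, tchart U c) \<in> tangent X"
  unfolding tangent_def by blast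

lemma tangent_chartE:
  assumes "(A, p) \<in> tangent X"
  obtains U c where "(U, c) \<in> X" "A = tdom X U" "p = tchart U c"
  using assms unfolding tangent_def by blast

lemma carrier_tangent: "carrier (tangent X) = {(x, v). x \<in> carrier X \<and> v \<in> tspace X x}"
proof (intro equalityI subsetI)
  fix p assume "p \<in> carrier (tangent X)"
  then obtain A q where "(A, q) \<in> tangent X" "p \<in> A" by (rule carrierE)
  then show "p \<in> {(x, v). x \<in> carrier X \<and> v \<in> tspace X x}"
    by (auto elim!: tangent_chartE intro: carrierI)
next
  fix p assume "p \<in> {(x, v). x \<in> carrier X \<and> v \<in> tspace X x}"
  then obtain x v where p: "p = (x, v)" "x \<in> carrier X" "v \<in> tspace X x" by blast
  then obtain U c where "(U, c) \<in> X" "x \<in> U" by (blast elim: carrierE)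
  then show "p \<in> carrier (tangent X)" using p by (intro carrierI[OF tangent_chartI]) auto
qed

lemma tchart_inj:
  assumes "smooth_atlas X" "(U, c) \<in> X"
  shows "inj_on (tchart U c) (tdom X U)"
proof (rule inj_onI, clarify)
  fix x v y w assume *: "x \<in> U" "v \<in> tspace X x" "y \<in> U" "w \<in> tspace X y" "c x = c y" "v (U, c) = w (U, c)"
  have "x = y" using inj_onD[OF chart_inj[OF assms]] * by blast
  then show "x = y \<and> v = w" using tspace_eqI[of v X x w U c] * assms(2) by simp
qed

lemma tchart_image:
  fixes X :: "('a, 'e::finite_dim_normed) atlas"
  assumes X: "smooth_atlas X" "(U, c) \<in> X"
  shows "tchart U c ` (tdom X U \<inter> tdom X V) = c ` (U \<inter> V) \<times> UNIV"
proof (intro equalityI subsetI)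
  fix z assume "z \<in> c ` (U \<inter> V) \<times> (UNIV :: 'e set)"
  then obtain x e where x: "x \<in> U" "x \<in> V" "z = (c x, e)" by blast
  then show "z \<in> tchart U c ` (tdom X U \<inter> tdom X V)"
    using tvec_of_tspace[OF X x(1)] tvec_of_coord[OF X x(1)]
    by (intro image_eqI[of _ _ "(x, tvec_of X U c x e)"]) auto
qed auto

lemma tchart_inv:
  fixes X :: "('a, 'e::finite_dim_normed) atlas"
  assumes X: "smooth_atlas X" "(U, c) \<in> X" and x: "x \<in> U"
  shows "inv_into (tdom X U) (tchart U c) (c x, e) = (x, tvec_of X U c x e)"
  by (rule inv_into_f_eq[OF tchart_inj[OF X]])
    (use tvec_of_tspace[OF X x] tvec_of_coord[OF X x] x in auto)

lemma smooth_atlas_tangent: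
  fixes X :: "('a, 'e::finite_dim_normed) atlas"
  assumes X: "smooth_atlas X"
  shows "smooth_atlas (tangent X)"
proof -
  have "inj_on p A \<and> open (p ` A)" if Ap: "(A, p) \<in> tangent X" for A p
  proof -
    obtain U c where U: "(U, c) \<in> X" "A = tdom X U" "p = tchart U c" using Ap by (rule tangent_chartE)
    then show ?thesis
      using tchart_inj[OF X U(1)] tchart_image[OF X U(1), of U] chart_open[OF X U(1)]
      by (simp add: open_Times)
  qed
  moreover have "open (p ` (A \<inter> B)) \<and> Cinf_on (q \<circ> inv_into A p) (p ` (A \<inter> B))"
    if Ap: "(A, p) \<in> tangent X" and Bq: "(B, q) \<in> tangent X" for A p B q
  proof -
    obtain U c where U: "(U, c) \<in> X" "A = tdom X U" "p = tchart U c" using Ap by (rule tangent_chartE)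
    obtain V d where V: "(V, d) \<in> X" "B = tdom X V" "q = tchart V d" using Bq by (rule tangent_chartE)
    let ?W = "c ` (U \<inter> V)" and ?F = "d \<circ> inv_into U c"
    have im: "p ` (A \<inter> B) = ?W \<times> UNIV" unfolding U V by (rule tchart_image[OF X U(1)])
    have W: "open ?W" by (rule transition_open[OF X U(1) V(1)])
    have oW: "open (?W \<times> (UNIV :: 'e set))" using W by (simp add: open_Times)
    have F: "Cinf_on ?F ?W" by (rule transition_smooth[OF X U(1) V(1)])
    have "Cinf_on (\<lambda>z. (?F (fst z), (\<lambda>(x, v). frechet_derivative ?F (at x) v) z)) (?W \<times> UNIV)"
      by (rule Cinf_on_Pair[OF oW Cinf_on_compose[OF F Cinf_on_bounded_linear[OF bounded_linear_fst] oW]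
            Cinf_on_joint_derivative[OF W F]]) auto
    then have "Cinf_on (q \<circ> inv_into A p) (?W \<times> UNIV)"
    proof (rule Cinf_on_cong[OF oW, rotated])
      fix z assume "z \<in> ?W \<times> (UNIV :: 'e set)"
      then obtain x e where x: "x \<in> U" "x \<in> V" "z = (c x, e)" by blast
      have "(q \<circ> inv_into A p) z = (d x, tvec_of X U c x e (V, d))"
        using tchart_inv[OF X U(1) x(1)] by (simp add: U V x(3))
      then show "(?F (fst z), (\<lambda>(x, v). frechet_derivative ?F (at x) v) z) = (q \<circ> inv_into A p) z"
        using x V(1) by (simp add: chart_inv[OF X U(1) x(1)] tvec_of_def)
    qed
    then show ?thesis using oW im by simp
  qed
  ultimately show ?thesis unfolding smooth_atlas_def by fast
qed

text \<open>
  Smoothness at \<open>z\<close> of the coordinate vector of \<open>w\<close> in some chart of \<open>Y\<close> at the base point.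
\<close>

definition coord_smooth_at ::
    "('z, 'f::real_normed_vector) atlas \<Rightarrow> ('b, 'e::real_normed_vector) atlas \<Rightarrow> 'z set \<Rightarrow> ('z \<Rightarrow> 'b)
      \<Rightarrow> ('z \<Rightarrow> ('b, 'e) tvec) \<Rightarrow> 'z \<Rightarrow> bool"
  where
  "coord_smooth_at Z Y S f w z \<longleftrightarrow>
     (\<exists>A a V d W G. (A, a) \<in> Z \<and> z \<in> A \<and> (V, d) \<in> Y \<and> f z \<in> V \<and> open W \<and> a z \<in> W \<and> Cinf_on G W \<and>
        (\<forall>y\<in>S \<inter> A. a y \<in> W \<longrightarrow> f y \<in> V \<longrightarrow> w y (V, d) = G (a y)))"

lemma coord_smooth_atI:
  assumes "(A, a) \<in> Z" "z \<in> A" "(V, d) \<in> Y" "f z \<in> V" "open W" "a z \<in> W" "Cinf_on G W"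
    and "\<And>y. y \<in> S \<Longrightarrow> y \<in> A \<Longrightarrow> a y \<in> W \<Longrightarrow> f y \<in> V \<Longrightarrow> w y (V, d) = G (a y)"
  shows "coord_smooth_at Z Y S f w z"
  unfolding coord_smooth_at_def using assms by blast

text \<open>A map into a tangent bundle is smooth as soon as its base map and its coordinates are.\<close>

lemma smooth_map_tangentI:
  fixes Z :: "('z, 'f::finite_dim_normed) atlas" and Y :: "('b, 'e::finite_dim_normed) atlas"
  assumes Z: "smooth_atlas Z" and Y: "smooth_atlas Y" and f: "smooth_map Z Y S f"
    and w: "\<And>z. z \<in> S \<Longrightarrow> w z \<in> tspace Y (f z)"
    and loc: "\<And>z. z \<in> S \<Longrightarrow> coord_smooth_at Z Y S f w z"
  shows "smooth_map Z (tangent Y) S (\<lambda>z. (f z, w z))"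
proof (rule smooth_mapI)
  fix z assume z: "z \<in> S"
  from loc[OF z] obtain A a V d W G where A: "(A, a) \<in> Z" "z \<in> A" and V: "(V, d) \<in> Y" "f z \<in> V"
    and W: "open W" "a z \<in> W" "Cinf_on G W"
    and G: "\<And>y. y \<in> S \<Longrightarrow> y \<in> A \<Longrightarrow> a y \<in> W \<Longrightarrow> f y \<in> V \<Longrightarrow> w y (V, d) = G (a y)"
    unfolding coord_smooth_at_def by blast
  obtain W' F where W': "open W'" "a z \<in> W'" "Cinf_on F W'"
      and F: "\<And>y. y \<in> S \<Longrightarrow> y \<in> A \<Longrightarrow> a y \<in> W' \<Longrightarrow> f y \<in> V \<and> d (f y) = F (a y)"
    by (rule smooth_mapE[OF Z Y f z A V]; blast)
  have o: "open (W \<inter> W')" using W(1) W'(1) by blast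
  have "Cinf_on (\<lambda>y. (F y, G y)) (W \<inter> W')"
    by (rule Cinf_on_Pair[OF o Cinf_on_subset[OF W'(3)] Cinf_on_subset[OF W(3)]]) auto
  then show "smooth_at Z (tangent Y) S (\<lambda>y. (f y, w y)) z"
    using A V o W(2) W'(2) F G w z tangent_chartI[OF V(1)]
    by (intro smooth_atI[of A a _ _ "tdom Y V" "tchart V d" _ _ "W \<inter> W'" "\<lambda>y. (F y, G y)"]) auto
qed

lemma smooth_map_tangentE:
  fixes Z :: "('z, 'f::finite_dim_normed) atlas" and Y :: "('b, 'e::finite_dim_normed) atlas"
  assumes Z: "smooth_atlas Z" and Y: "smooth_atlas Y" and f: "smooth_map Z (tangent Y) S (\<lambda>z. (f z, w z))"
    and z: "z \<in> S" and A: "(A, a) \<in> Z" "z \<in> A" and V: "(V, d) \<in> Y" "f z \<in> V"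
  obtains W G where "open W" "a z \<in> W" "Cinf_on G W"
    "\<And>y. y \<in> S \<Longrightarrow> y \<in> A \<Longrightarrow> a y \<in> W \<Longrightarrow> f y \<in> V \<and> w y \<in> tspace Y (f y) \<and> w y (V, d) = G (a y)"
proof -
  have "(f z, w z) \<in> tdom Y V"
    using V(2) smooth_map_carrier[OF f z] by (simp add: carrier_tangent)
  then obtain W F where W: "open W" "a z \<in> W" "Cinf_on F W"
    and F: "\<And>y. y \<in> S \<Longrightarrow> y \<in> A \<Longrightarrow> a y \<in> W \<Longrightarrow> (f y, w y) \<in> tdom Y V \<and> tchart V d (f y, w y) = F (a y)"
    by (rule smooth_mapE[OF Z smooth_atlas_tangent[OF Y] f z A tangent_chartI[OF V(1)]]; blast)
  have "Cinf_on (\<lambda>y. snd (F y)) W" by (rule Cinf_on_linear_compose[OF bounded_linear_snd W(1,3)])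
  moreover have "f y \<in> V \<and> w y \<in> tspace Y (f y) \<and> w y (V, d) = snd (F (a y))" if "y \<in> S" "y \<in> A" "a y \<in> W" for y
    using conjunct1[OF F[OF that]] arg_cong[OF conjunct2[OF F[OF that]], of snd] by simp
  ultimately show thesis using that W(1,2) by blast
qed

lemma smooth_map_tangent_base:
  assumes "S \<subseteq> carrier (tangent X)"
  shows "smooth_map (tangent X) X S fst"
proof (rule smooth_mapI)
  fix z assume "z \<in> S"
  then have "z \<in> carrier (tangent X)" using assms by blast
  then obtain U c where U: "(U, c) \<in> X" "fst z \<in> U" "snd z \<in> tspace X (fst z)"
    by (auto simp: carrier_tangent elim!: carrierE)
  then show "smooth_at (tangent X) X S fst z"
    using tangent_chartI[OF U(1)]
    by (intro smooth_atI[of "tdom X U" "tchart U c" _ _ U c _ _ UNIV fst])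
      (auto simp: Cinf_on_bounded_linear bounded_linear_fst)
qed

lemma smooth_map_base:
  fixes Z :: "('z, 'f::finite_dim_normed) atlas" and X :: "('b, 'e::finite_dim_normed) atlas"
  assumes "smooth_atlas Z" "smooth_atlas X" and f: "smooth_map Z (tangent X) S (\<lambda>z. (f z, w z))"
  shows "smooth_map Z X S f"
proof -
  have "(\<lambda>z. (f z, w z)) ` S \<subseteq> carrier (tangent X)" using smooth_map_carrier[OF f] by blast
  from smooth_map_compose[OF assms(1) smooth_atlas_tangent[OF assms(2)] assms(2) f
      smooth_map_tangent_base[OF order_refl] this]
  show ?thesis by simp
qed

lemma smooth_map_tangent_in:
  "smooth_map Z (tangent X) S (\<lambda>z. (f z, w z)) \<Longrightarrow> z \<in> S \<Longrightarrow> f z \<in> carrier X \<and> w z \<in> tspace X (f z)"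
  using smooth_map_carrier[of Z "tangent X" S "\<lambda>z. (f z, w z)" z] by (simp add: carrier_tangent)

text \<open>
  Vectors with different base points are separated by the projection, vectors with the same base
  point by a chart.
\<close>

lemma manifold_tangent:
  fixes X :: "('a, 'e::finite_dim_normed) atlas"
  assumes "manifold X"
  shows "manifold (tangent X)"
proof -
  have X: "smooth_atlas X" "Hausdorff_space (mtopology X)" "second_countable (mtopology X)"
    using assms by (auto simp: manifold_def)
  note T = smooth_atlas_tangent[OF X(1)]
  have "Hausdorff_space (mtopology (tangent X))"
  proof (rule Hausdorff_mtopologyI[OF T])
    fix p q assume pq: "p \<in> carrier (tangent X)" "q \<in> carrier (tangent X)" "p \<noteq> q"
    show "\<exists>U V. mopen (tangent X) U \<and> mopen (tangent X) V \<and> p \<in> U \<and> q \<in> V \<and> U \<inter> V = {}"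
    proof (cases "fst p = fst q")
      case False
      show ?thesis
        by (rule separated_by_smooth_map[OF T X(1,2) smooth_map_tangent_base[OF order_refl] pq(1,2) False])
    next
      case True
      obtain U c where U: "(U, c) \<in> X" "fst p \<in> U"
        using pq(1) by (auto simp: carrier_tangent elim!: carrierE)
      have in_U: "p \<in> tdom X U" "q \<in> tdom X U" using pq(1,2) U(2) True by (auto simp: carrier_tangent)
      then have "tchart U c p \<noteq> tchart U c q" using inj_onD[OF tchart_inj[OF X(1) U(1)]] pq(3) by blast
      from hausdorff[OF this] obtain A B
        where AB: "open A" "open B" "tchart U c p \<in> A" "tchart U c q \<in> B" "A \<inter> B = {}"
        by blast
      note mo = mopen_chart_preimage[OF T tangent_chartI[OF U(1)]]
      show ?thesis using mo[OF AB(1)] mo[OF AB(2)] AB in_U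
        by (intro exI[of _ "{z \<in> tdom X U. tchart U c z \<in> A}"] exI[of _ "{z \<in> tdom X U. tchart U c z \<in> B}"]) auto
    qed
  qed
  moreover have "second_countable (mtopology (tangent X))"
  proof -
    obtain C where C: "countable C" "C \<subseteq> X" "carrier C = carrier X"
      using countable_subatlas[OF X(1,3)] by blast
    let ?C = "(\<lambda>(U, c). (tdom X U, tchart U c)) ` C"
    show ?thesis
    proof (rule second_countable_subatlas[OF T])
      show "countable ?C" using C(1) by blast
      show "?C \<subseteq> tangent X" proof (rule image_subsetI)
        fix k assume "k \<in> C"
        moreover obtain U c where "k = (U, c)" by (cases k)
        ultimately show "(case k of (U, c) \<Rightarrow> (tdom X U, tchart U c)) \<in> tangent X"
          using C(2) tangent_chartI[of U c X] by auto
      qed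
      have "carrier ?C = {(x, v). x \<in> carrier C \<and> v \<in> tspace X x}"
        unfolding carrier_def by auto
      then show "carrier ?C = carrier (tangent X)" by (simp add: C(3) carrier_tangent)
    qed
  qed
  ultimately show ?thesis using T by (simp add: manifold_def)
qed

lemma smooth_map_tvec_of:
  fixes Z :: "('z, 'f::finite_dim_normed) atlas" and X :: "('b, 'e::finite_dim_normed) atlas"
  assumes Z: "smooth_atlas Z" and X: "smooth_atlas X" and f: "smooth_map Z X S f"
    and U: "(U, c) \<in> X" and fU: "f ` S \<subseteq> U" and e: "smooth_map Z model_atlas S e"
  shows "smooth_map Z (tangent X) S (\<lambda>z. (f z, tvec_of X U c (f z) (e z)))"
proof (rule smooth_map_tangentI[OF Z X f])
  fix z assume z: "z \<in> S"
  then have fz: "f z \<in> U" using fU by blast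
  show "tvec_of X U c (f z) (e z) \<in> tspace X (f z)" by (rule tvec_of_tspace[OF X U fz])
  obtain A a where A: "(A, a) \<in> Z" "z \<in> A" using smooth_map_carrier[OF f z] by (blast elim: carrierE)
  have m: "(UNIV, \<lambda>x. x) \<in> (model_atlas :: ('e, 'e) atlas)" by (simp add: model_atlas_def)
  obtain W F where W: "open W" "a z \<in> W" "Cinf_on F W"
      and F: "\<And>y. y \<in> S \<Longrightarrow> y \<in> A \<Longrightarrow> a y \<in> W \<Longrightarrow> e y \<in> UNIV \<and> e y = F (a y)"
    by (rule smooth_mapE[OF Z smooth_atlas_model e z A m UNIV_I]; blast)
  show "coord_smooth_at Z X S f (\<lambda>y. tvec_of X U c (f y) (e y)) z"
    using A U fz W F tvec_of_coord[OF X U]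
    by (intro coord_smooth_atI[of A a _ _ U c _ _ W F]) auto
qed

lemma smooth_map_zero:
  fixes Z :: "('z, 'f::finite_dim_normed) atlas" and X :: "('b, 'e::finite_dim_normed) atlas"
  assumes Z: "smooth_atlas Z" and X: "smooth_atlas X" and f: "smooth_map Z X S f"
  shows "smooth_map Z (tangent X) S (\<lambda>z. (f z, 0))"
proof (rule smooth_map_tangentI[OF Z X f tspace_0[OF X]])
  fix z assume z: "z \<in> S"
  obtain A a where A: "(A, a) \<in> Z" "z \<in> A" using smooth_map_carrier[OF f z] by (blast elim: carrierE)
  obtain V d where V: "(V, d) \<in> X" "f z \<in> V" using smooth_map_carrier[OF f z] by (blast elim: carrierE)
  show "coord_smooth_at Z X S f (\<lambda>y. 0) z"
    using A V by (intro coord_smooth_atI[of A a _ _ V d _ _ UNIV "\<lambda>x. 0"])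
      (auto simp: Cinf_on_const)
qed

lemma smooth_map_tangent_diff:
  fixes Z :: "('z, 'f::finite_dim_normed) atlas" and X :: "('b, 'e::finite_dim_normed) atlas"
  assumes Z: "smooth_atlas Z" and X: "smooth_atlas X"
    and v: "smooth_map Z (tangent X) S (\<lambda>z. (f z, v z))" and w: "smooth_map Z (tangent X) S (\<lambda>z. (f z, w z))"
  shows "smooth_map Z (tangent X) S (\<lambda>z. (f z, v z - w z))"
proof (rule smooth_map_tangentI[OF Z X smooth_map_base[OF Z X v]])
  fix z assume z: "z \<in> S"
  show "v z - w z \<in> tspace X (f z)"
    using smooth_map_tangent_in[OF v z] smooth_map_tangent_in[OF w z] tspace_diff[OF X] by blast
  note c = smooth_map_carrier[OF smooth_map_base[OF Z X v] z]
  obtain A a where A: "(A, a) \<in> Z" "z \<in> A" using c by (blast elim: carrierE)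
  obtain V d where V: "(V, d) \<in> X" "f z \<in> V" using c by (blast elim: carrierE)
  obtain W G where W: "open W" "a z \<in> W" "Cinf_on G W" and G: "\<And>y. y \<in> S \<Longrightarrow> y \<in> A \<Longrightarrow> a y \<in> W \<Longrightarrow>
      f y \<in> V \<and> v y \<in> tspace X (f y) \<and> v y (V, d) = G (a y)"
    by (rule smooth_map_tangentE[OF Z X v z A V]; blast)
  obtain W' G' where W': "open W'" "a z \<in> W'" "Cinf_on G' W'" and G': "\<And>y. y \<in> S \<Longrightarrow> y \<in> A \<Longrightarrow> a y \<in> W' \<Longrightarrow>
      f y \<in> V \<and> w y \<in> tspace X (f y) \<and> w y (V, d) = G' (a y)"
    by (rule smooth_map_tangentE[OF Z X w z A V]; blast)
  have o: "open (W \<inter> W')" using W(1) W'(1) by blast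
  have "Cinf_on (\<lambda>y. G y - G' y) (W \<inter> W')"
    by (rule Cinf_on_diff[OF o Cinf_on_subset[OF W(3)] Cinf_on_subset[OF W'(3)]]) auto
  then show "coord_smooth_at Z X S f (\<lambda>y. (v y - w y)) z"
    using A V o W(2) W'(2) G G'
    by (intro coord_smooth_atI[of A a _ _ V d _ _ "W \<inter> W'" "\<lambda>y. G y - G' y"]) auto
qed

lemma smooth_map_tangent_minus:
  fixes Z :: "('z, 'f::finite_dim_normed) atlas" and X :: "('b, 'e::finite_dim_normed) atlas"
  assumes Z: "smooth_atlas Z" and X: "smooth_atlas X"
    and v: "smooth_map Z (tangent X) S (\<lambda>z. (f z, v z))"
  shows "smooth_map Z (tangent X) S (\<lambda>z. (f z, - v z))"
  using smooth_map_tangent_diff[OF Z X smooth_map_zero[OF Z X smooth_map_base[OF Z X v]] v] by simp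

text \<open>
  In charts the differential is the derivative of a local representative of \<open>g\<close>, which is smooth in
  the point and the vector together.
\<close>

lemma smooth_map_tmap:
  fixes X :: "('a, 'd::finite_dim_normed) atlas" and Y :: "('b, 'e::finite_dim_normed) atlas"
    and Z :: "('z, 'f::finite_dim_normed) atlas"
  assumes Z: "smooth_atlas Z" and X: "smooth_atlas X" and Y: "smooth_atlas Y" and g: "smooth_map X Y (carrier X) g"
    and v: "smooth_map Z (tangent X) S (\<lambda>z. (f z, v z))"
  shows "smooth_map Z (tangent Y) S (\<lambda>z. (g (f z), tmap X Y (carrier X) g (f z) (v z)))"
proof (rule smooth_map_tangentI[OF Z Y])
  note f = smooth_map_base[OF Z X v]
  have im: "f ` S \<subseteq> carrier X" using smooth_map_carrier[OF f] by blast
  show "smooth_map Z Y S (\<lambda>z. g (f z))" by (rule smooth_map_compose[OF Z X Y f g im])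
  fix z assume z: "z \<in> S"
  note fz = smooth_map_tangent_in[OF v z]
  show "tmap X Y (carrier X) g (f z) (v z) \<in> tspace Y (g (f z))"
    by (rule tmap_tspace[OF X Y g]) (use fz in auto)
  obtain A a where A: "(A, a) \<in> Z" "z \<in> A" using smooth_map_carrier[OF f z] by (blast elim: carrierE)
  obtain U c where U: "(U, c) \<in> X" "f z \<in> U" using fz by (blast elim: carrierE)
  obtain V d where V: "(V, d) \<in> Y" "g (f z) \<in> V" using smooth_map_carrier[OF g, of "f z"] fz by (blast elim: carrierE)
  obtain W G where W: "open W" "a z \<in> W" "Cinf_on G W" and G: "\<And>y. y \<in> S \<Longrightarrow> y \<in> A \<Longrightarrow> a y \<in> W \<Longrightarrow>
      f y \<in> U \<and> v y \<in> tspace X (f y) \<and> v y (U, c) = G (a y)"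
    by (rule smooth_map_tangentE[OF Z X v z A U]; blast)
  obtain W1 F1 where W1: "open W1" "a z \<in> W1" "Cinf_on F1 W1"
      and F1: "\<And>y. y \<in> S \<Longrightarrow> y \<in> A \<Longrightarrow> a y \<in> W1 \<Longrightarrow> f y \<in> U \<and> c (f y) = F1 (a y)"
    by (rule smooth_mapE[OF Z X f z A U]; blast)
  obtain W2 F2 where W2: "open W2" "c (f z) \<in> W2" "Cinf_on F2 W2"
      and F2: "\<And>y. y \<in> carrier X \<Longrightarrow> y \<in> U \<Longrightarrow> c y \<in> W2 \<Longrightarrow> g y \<in> V \<and> d (g y) = F2 (c y)"
    by (rule smooth_mapE[OF X Y g conjunct1[OF fz] U V]; blast)
  let ?W = "W \<inter> (W1 \<inter> F1 -` W2)"
  have o: "open ?W" using W(1) open_vimage_Int[OF Cinf_on_continuous_on[OF W1(3)] W1(1) W2(1)] by blast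
  let ?G = "\<lambda>y. (\<lambda>(x, v). frechet_derivative F2 (at x) v) (F1 y, G y)"
  have "Cinf_on ?G ?W"
    by (rule Cinf_on_compose[OF Cinf_on_joint_derivative[OF W2(1,3)]
          Cinf_on_Pair[OF o Cinf_on_subset[OF W1(3)] Cinf_on_subset[OF W(3)]] o]) auto
  moreover have "a z \<in> ?W" using W(2) W1(2) W2(2) F1[OF z A(2) W1(2)] by auto
  moreover have "tmap X Y (carrier X) g (f y) (v y) (V, d) = ?G (a y)" if y: "y \<in> S" "y \<in> A" "a y \<in> ?W" for y
  proof -
    have fy: "f y \<in> U" "c (f y) = F1 (a y)" "v y (U, c) = G (a y)" using F1[of y] G[of y] y by auto
    have "tmap X Y (carrier X) g (f y) (v y) (V, d) = frechet_derivative F2 (at (c (f y))) (v y (U, c))"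
      by (rule tmap_coord[OF X Y g _ _ U(1) fy(1) V(1) W2(1) _ W2(3) F2])
        (use smooth_map_tangent_in[OF v y(1)] fy(2) y(3) in auto)
    then show ?thesis using fy by simp
  qed
  ultimately show "coord_smooth_at Z Y S (\<lambda>y. g (f y)) (\<lambda>y. tmap X Y (carrier X) g (f y) (v y)) z"
    using A V o by (intro coord_smooth_atI[of A a _ _ V d _ _ ?W ?G]) auto
qed


section \<open>Curves in products\<close>

lemma smooth_curve_Pair:
  fixes X :: "('a, 'd::finite_dim_normed) atlas" and Y :: "('b, 'e::finite_dim_normed) atlas"
  assumes X: "smooth_atlas X" and Y: "smooth_atlas Y"
    and \<gamma>: "smooth_curve X A \<gamma>" and \<delta>: "smooth_curve Y B \<delta>"
  shows "smooth_curve (prod_atlas X Y) (carrier X \<times> carrier Y) (\<lambda>t. (\<gamma> t, \<delta> t))"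
proof -
  obtain e where e: "e > 0" "smooth_map model_atlas X {-e<..<e} \<gamma>"
    using \<gamma> unfolding smooth_curve_def by blast
  obtain e' where e': "e' > 0" "smooth_map model_atlas Y {-e'<..<e'} \<delta>"
    using \<delta> unfolding smooth_curve_def by blast
  let ?I = "{- min e e'<..<min e e'}"
  have *: "smooth_map model_atlas X ?I \<gamma>" "smooth_map model_atlas Y ?I \<delta>"
    by (rule smooth_map_subset[OF e(2)], force, rule smooth_map_subset[OF e'(2)], force)
  have "smooth_map model_atlas (prod_atlas X Y) ?I (\<lambda>t. (\<gamma> t, \<delta> t))"
    by (rule smooth_map_Pair[OF smooth_atlas_model X Y *])
  then show ?thesis
    unfolding smooth_curve_def using e(1) e'(1) smooth_map_carrier[OF *(1)] smooth_map_carrier[OF *(2)]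
    by (intro exI[of _ "min e e'"]) auto
qed

lemma smooth_curve_prod_components:
  fixes X :: "('a, 'd::finite_dim_normed) atlas" and Y :: "('b, 'e::finite_dim_normed) atlas"
  assumes X: "smooth_atlas X" and Y: "smooth_atlas Y"
    and c: "smooth_curve (prod_atlas X Y) S (\<lambda>t. (\<gamma> t, \<delta> t))"
  shows "smooth_curve X (carrier X) \<gamma>" "smooth_curve Y (carrier Y) \<delta>"
proof -
  note c' = smooth_curve_carrier[OF c, unfolded carrier_prod_atlas]
  show "smooth_curve X (carrier X) \<gamma>"
    using smooth_curve_compose[OF smooth_atlas_prod[OF X Y] X smooth_map_fst[OF order_refl] c', of "carrier X"]
    by fastforce
  show "smooth_curve Y (carrier Y) \<delta>"
    using smooth_curve_compose[OF smooth_atlas_prod[OF X Y] Y smooth_map_snd[OF order_refl] c', of "carrier Y"]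
    by fastforce
qed

lemma velocity_Pair:
  fixes X :: "('a, 'd::finite_dim_normed) atlas" and Y :: "('b, 'e::finite_dim_normed) atlas"
  assumes X: "smooth_atlas X" and Y: "smooth_atlas Y"
    and \<gamma>: "smooth_curve X A \<gamma>" and \<delta>: "smooth_curve Y B \<delta>"
    and U: "(U, c) \<in> X" "\<gamma> 0 \<in> U" and V: "(V, d) \<in> Y" "\<delta> 0 \<in> V"
  shows "velocity (prod_atlas X Y) (\<lambda>t. (\<gamma> t, \<delta> t)) (U \<times> V, \<lambda>(x, y). (c x, d y))
    = (velocity X \<gamma> (U, c), velocity Y \<delta> (V, d))"
proof -
  obtain e F where e: "e > 0" "Cinf_on F {-e<..<e}"
    and F: "\<And>t. t \<in> {-e<..<e} \<Longrightarrow> \<gamma> t \<in> A \<and> \<gamma> t \<in> U \<and> c (\<gamma> t) = F t"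
    by (rule smooth_curveE[OF X \<gamma> U]; blast)
  obtain e' G where e': "e' > 0" "Cinf_on G {-e'<..<e'}"
    and G: "\<And>t. t \<in> {-e'<..<e'} \<Longrightarrow> \<delta> t \<in> B \<and> \<delta> t \<in> V \<and> d (\<delta> t) = G t"
    by (rule smooth_curveE[OF Y \<delta> V]; blast)
  let ?r = "min e e'"
  have sub: "{- ?r<..<?r} \<subseteq> {-e<..<e}" "{- ?r<..<?r} \<subseteq> {-e'<..<e'}" by force+
  have FG: "Cinf_on (\<lambda>t. (F t, G t)) {- ?r<..<?r}"
    by (rule Cinf_on_Pair[OF _ Cinf_on_subset[OF e(2) sub(1)] Cinf_on_subset[OF e'(2) sub(2)]]) simp
  have "velocity (prod_atlas X Y) (\<lambda>t. (\<gamma> t, \<delta> t)) (U \<times> V, \<lambda>(x, y). (c x, d y))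
      = frechet_derivative (\<lambda>t. (F t, G t)) (at 0) 1"
  proof (rule velocity_chart[OF prod_atlasI[OF U(1) V(1)] _ _ FG])
    fix t assume "t \<in> {- ?r<..<?r}"
    then have "t \<in> {-e<..<e}" "t \<in> {-e'<..<e'}" using sub by blast+
    then show "(case (\<gamma> t, \<delta> t) of (x, y) \<Rightarrow> (c x, d y)) = (F t, G t)" using F G by simp
  qed (use U V e(1) e'(1) in auto)
  also have "\<dots> = (frechet_derivative F (at 0) 1, frechet_derivative G (at 0) 1)"
    using fun_cong[OF frechet_derivative_at[OF has_derivative_Pair[OF curve_derivative[OF e] curve_derivative[OF e']]], of 1]
    by simp
  also have "\<dots> = (velocity X \<gamma> (U, c), velocity Y \<delta> (V, d))"
    using velocity_chart[of U c X \<gamma> e F, OF U e] velocity_chart[of V d Y \<delta> e' G, OF V e'] F G by simp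
  finally show ?thesis .
qed

lemma
  fixes X :: "('a, 'd::finite_dim_normed) atlas" and Y :: "('b, 'e::finite_dim_normed) atlas"
  assumes X: "smooth_atlas X" and Y: "smooth_atlas Y" and f: "smooth_map X Y (carrier X) f"
    and x: "x \<in> carrier X"
  shows tmap_0: "tmap X Y (carrier X) f x 0 = 0"
    and tmap_minus: "v \<in> tspace X x \<Longrightarrow> tmap X Y (carrier X) f x (- v) = - tmap X Y (carrier X) f x v"
    and tmap_diff: "v \<in> tspace X x \<Longrightarrow> w \<in> tspace X x \<Longrightarrow>
      tmap X Y (carrier X) f x (v - w) = tmap X Y (carrier X) f x v - tmap X Y (carrier X) f x w"
proof -
  show "tmap X Y (carrier X) f x 0 = 0"
    using tmap_add[OF X Y f x tspace_0[OF X] tspace_0[OF X]] by simp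
  show m: "tmap X Y (carrier X) f x (- v) = - tmap X Y (carrier X) f x v" if "v \<in> tspace X x" for v
    using tmap_tscale[OF X Y f x that, of "-1"] by (simp add: tscale_minus_one)
  show "tmap X Y (carrier X) f x (v - w) = tmap X Y (carrier X) f x v - tmap X Y (carrier X) f x w"
    if "v \<in> tspace X x" "w \<in> tspace X x"
    using tmap_add[OF X Y f x that(1) tspace_minus[OF X that(2)]] m[OF that(2)] by simp
qed


section \<open>The tangent groupoid\<close>

locale lie_gpd =
  fixes X :: "('x, 'd::finite_dim_normed, 'g, 'e::finite_dim_normed) groupoid"
  assumes lie: "lie_groupoid X"
begin

abbreviation comp (infixl "\<odot>" 70) where "g \<odot> h \<equiv> gcomp X g h"
abbreviation "G1 \<equiv> carrier (arr X)"
abbreviation "G0 \<equiv> carrier (obj X)"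
abbreviation "T1 \<equiv> tspace (arr X)"
abbreviation "T0 \<equiv> tspace (obj X)"
abbreviation "dinv \<equiv> tmap (arr X) (arr X) G1 (ginv X)"

lemma manifolds: "manifold (obj X)" "manifold (arr X)"
  using lie by (auto simp: lie_groupoid_def)

lemma atlases: "smooth_atlas (obj X)" "smooth_atlas (arr X)" "smooth_atlas (prod_atlas (arr X) (arr X))"
  using manifold_smooth_atlas manifolds smooth_atlas_prod by auto

lemma smooth_structure:
  shows smooth_src: "smooth_map (arr X) (obj X) G1 (src X)"
    and smooth_tgt: "smooth_map (arr X) (obj X) G1 (tgt X)"
    and smooth_comp: "smooth_map (prod_atlas (arr X) (arr X)) (arr X) (composable X) (\<lambda>(g, h). g \<odot> h)"
    and smooth_unit: "smooth_map (obj X) (arr X) G0 (gunit X)"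
    and smooth_inv: "smooth_map (arr X) (arr X) G1 (ginv X)"
  using lie by (auto simp: lie_groupoid_def surj_submersion_def)

lemma closed:
  shows src_in: "g \<in> G1 \<Longrightarrow> src X g \<in> G0" and tgt_in: "g \<in> G1 \<Longrightarrow> tgt X g \<in> G0"
    and unit_in: "x \<in> G0 \<Longrightarrow> gunit X x \<in> G1" and inv_in: "g \<in> G1 \<Longrightarrow> ginv X g \<in> G1"
    and comp_in: "(g, h) \<in> composable X \<Longrightarrow> g \<odot> h \<in> G1"
  using smooth_map_carrier[OF smooth_src] smooth_map_carrier[OF smooth_tgt] smooth_map_carrier[OF smooth_unit]
    smooth_map_carrier[OF smooth_inv] smooth_map_carrier[OF smooth_comp, of "(g, h)"] by auto

lemma composable_iff: "(g, h) \<in> composable X \<longleftrightarrow> g \<in> G1 \<and> h \<in> G1 \<and> src X g = tgt X h"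
  by (simp add: composable_def)

lemma
  shows src_comp: "(g, h) \<in> composable X \<Longrightarrow> src X (g \<odot> h) = src X h"
    and tgt_comp: "(g, h) \<in> composable X \<Longrightarrow> tgt X (g \<odot> h) = tgt X g"
    and comp_assoc: "(g, h) \<in> composable X \<Longrightarrow> (h, k) \<in> composable X \<Longrightarrow> (g \<odot> h) \<odot> k = g \<odot> (h \<odot> k)"
    and src_unit: "x \<in> G0 \<Longrightarrow> src X (gunit X x) = x"
    and tgt_unit: "x \<in> G0 \<Longrightarrow> tgt X (gunit X x) = x"
    and comp_unit: "g \<in> G1 \<Longrightarrow> g \<odot> gunit X (src X g) = g"
    and unit_comp: "g \<in> G1 \<Longrightarrow> gunit X (tgt X g) \<odot> g = g"
    and src_inv: "g \<in> G1 \<Longrightarrow> src X (ginv X g) = tgt X g"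
    and tgt_inv: "g \<in> G1 \<Longrightarrow> tgt X (ginv X g) = src X g"
    and comp_inv: "g \<in> G1 \<Longrightarrow> g \<odot> ginv X g = gunit X (tgt X g)"
    and inv_comp: "g \<in> G1 \<Longrightarrow> ginv X g \<odot> g = gunit X (src X g)"
  using lie unfolding lie_groupoid_def by blast+

lemma inv_unique:
  assumes "(g, h) \<in> composable X" "g \<odot> h = gunit X (tgt X g)"
  shows "ginv X g = h"
proof -
  have gh: "g \<in> G1" "h \<in> G1" "src X g = tgt X h" using assms(1) by (auto simp: composable_iff)
  have c: "(ginv X g, g) \<in> composable X" using gh by (simp add: composable_iff inv_in src_inv)
  have "ginv X g = ginv X g \<odot> gunit X (src X (ginv X g))" using comp_unit[OF inv_in[OF gh(1)]] by simp
  also have "\<dots> = ginv X g \<odot> (g \<odot> h)" using assms(2) gh by (simp add: src_inv)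
  also have "\<dots> = (ginv X g \<odot> g) \<odot> h" by (rule comp_assoc[OF c assms(1), symmetric])
  also have "\<dots> = h" using gh unit_comp[OF gh(2)] by (simp add: inv_comp)
  finally show ?thesis .
qed

lemma inv_unit: "x \<in> G0 \<Longrightarrow> ginv X (gunit X x) = gunit X x"
  using comp_unit[OF unit_in, of x]
  by (intro inv_unique) (auto simp: composable_iff unit_in src_unit tgt_unit)

lemma inv_of_comp:
  assumes "(g, h) \<in> composable X"
  shows "ginv X (g \<odot> h) = ginv X h \<odot> ginv X g"
proof -
  have gh: "g \<in> G1" "h \<in> G1" "src X g = tgt X h" using assms by (auto simp: composable_iff)
  have c: "(h, ginv X h) \<in> composable X" "(ginv X h, ginv X g) \<in> composable X"
    "(g, h \<odot> (ginv X h \<odot> ginv X g)) \<in> composable X" "(h, ginv X h \<odot> ginv X g) \<in> composable X"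
    "(g \<odot> h, ginv X h \<odot> ginv X g) \<in> composable X"
    using gh assms by (auto simp: composable_iff inv_in src_inv tgt_inv comp_in src_comp tgt_comp)
  have "h \<odot> (ginv X h \<odot> ginv X g) = (h \<odot> ginv X h) \<odot> ginv X g" by (rule comp_assoc[OF c(1,2), symmetric])
  also have "\<dots> = ginv X g" using unit_comp[OF inv_in[OF gh(1)]] gh by (simp add: comp_inv tgt_inv)
  finally have "(g \<odot> h) \<odot> (ginv X h \<odot> ginv X g) = g \<odot> ginv X g"
    using comp_assoc[OF assms c(4)] by simp
  then show ?thesis using c(5) gh assms by (intro inv_unique) (auto simp: comp_inv tgt_comp)
qed

lemma unit_composable: "g \<in> G1 \<Longrightarrow> (gunit X (tgt X g), g) \<in> composable X"
  "g \<in> G1 \<Longrightarrow> (g, gunit X (src X g)) \<in> composable X"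
  by (auto simp: composable_iff unit_in tgt_in src_in src_unit tgt_unit)

lemma inv_composable: "g \<in> G1 \<Longrightarrow> (ginv X g, g) \<in> composable X" "g \<in> G1 \<Longrightarrow> (g, ginv X g) \<in> composable X"
  by (auto simp: composable_iff inv_in src_inv tgt_inv)


subsection \<open>Differentials of the structure maps\<close>

lemma
  assumes "g \<in> G1" "v \<in> T1 g"
  shows dsrc_in: "dsrc X g v \<in> T0 (src X g)"
    and dsrc_add: "w \<in> T1 g \<Longrightarrow> dsrc X g (v + w) = dsrc X g v + dsrc X g w"
    and dsrc_tscale: "dsrc X g (tscale r v) = tscale r (dsrc X g v)"
    and dsrc_minus: "dsrc X g (- v) = - dsrc X g v"
    and dsrc_diff: "w \<in> T1 g \<Longrightarrow> dsrc X g (v - w) = dsrc X g v - dsrc X g w"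
  unfolding dsrc_def
  by (rule tmap_tspace[OF atlases(2,1) smooth_src assms] tmap_add[OF atlases(2,1) smooth_src assms]
      tmap_tscale[OF atlases(2,1) smooth_src assms] tmap_minus[OF atlases(2,1) smooth_src assms]
      tmap_diff[OF atlases(2,1) smooth_src assms]; assumption)+

lemma
  assumes "g \<in> G1" "v \<in> T1 g"
  shows dtgt_in: "dtgt X g v \<in> T0 (tgt X g)"
    and dtgt_add: "w \<in> T1 g \<Longrightarrow> dtgt X g (v + w) = dtgt X g v + dtgt X g w"
    and dtgt_tscale: "dtgt X g (tscale r v) = tscale r (dtgt X g v)"
    and dtgt_minus: "dtgt X g (- v) = - dtgt X g v"
    and dtgt_diff: "w \<in> T1 g \<Longrightarrow> dtgt X g (v - w) = dtgt X g v - dtgt X g w"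
  unfolding dtgt_def
  by (rule tmap_tspace[OF atlases(2,1) smooth_tgt assms] tmap_add[OF atlases(2,1) smooth_tgt assms]
      tmap_tscale[OF atlases(2,1) smooth_tgt assms] tmap_minus[OF atlases(2,1) smooth_tgt assms]
      tmap_diff[OF atlases(2,1) smooth_tgt assms]; assumption)+

lemma dsrc_0: "g \<in> G1 \<Longrightarrow> dsrc X g 0 = 0" and dtgt_0: "g \<in> G1 \<Longrightarrow> dtgt X g 0 = 0"
  unfolding dsrc_def dtgt_def
  using tmap_0[OF atlases(2,1) smooth_src] tmap_0[OF atlases(2,1) smooth_tgt] by auto

lemma dunit_0: "x \<in> G0 \<Longrightarrow> dunit X x 0 = 0"
  unfolding dunit_def by (rule tmap_0[OF atlases(1,2) smooth_unit])

lemma dinv_in: "g \<in> G1 \<Longrightarrow> v \<in> T1 g \<Longrightarrow> dinv g v \<in> T1 (ginv X g)"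
  by (rule tmap_tspace[OF atlases(2,2) smooth_inv])

lemma velocity_src: "smooth_curve (arr X) G1 \<gamma> \<Longrightarrow>
    dsrc X (\<gamma> 0) (velocity (arr X) \<gamma>) = velocity (obj X) (\<lambda>t. src X (\<gamma> t))"
  unfolding dsrc_def by (rule tmap_velocity[OF atlases(2,1) smooth_src])

lemma velocity_tgt: "smooth_curve (arr X) G1 \<gamma> \<Longrightarrow>
    dtgt X (\<gamma> 0) (velocity (arr X) \<gamma>) = velocity (obj X) (\<lambda>t. tgt X (\<gamma> t))"
  unfolding dtgt_def by (rule tmap_velocity[OF atlases(2,1) smooth_tgt])

lemma velocity_unit: "smooth_curve (obj X) G0 \<gamma> \<Longrightarrow>
    dunit X (\<gamma> 0) (velocity (obj X) \<gamma>) = velocity (arr X) (\<lambda>t. gunit X (\<gamma> t))"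
  unfolding dunit_def by (rule tmap_velocity[OF atlases(1,2) smooth_unit])

lemma velocity_inv: "smooth_curve (arr X) G1 \<gamma> \<Longrightarrow>
    dinv (\<gamma> 0) (velocity (arr X) \<gamma>) = velocity (arr X) (\<lambda>t. ginv X (\<gamma> t))"
  by (rule tmap_velocity[OF atlases(2,2) smooth_inv])

lemma
  assumes "smooth_curve (arr X) G1 \<gamma>"
  shows curve_src: "smooth_curve (obj X) G0 (\<lambda>t. src X (\<gamma> t))"
    and curve_tgt: "smooth_curve (obj X) G0 (\<lambda>t. tgt X (\<gamma> t))"
    and curve_inv: "smooth_curve (arr X) G1 (\<lambda>t. ginv X (\<gamma> t))"
  by (rule smooth_curve_compose[OF atlases(2,1) smooth_src assms] smooth_curve_compose[OF atlases(2,1) smooth_tgt assms]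
      smooth_curve_compose[OF atlases(2,2) smooth_inv assms]; use src_in tgt_in inv_in in blast)+

lemma curve_unit: "smooth_curve (obj X) G0 \<gamma> \<Longrightarrow> smooth_curve (arr X) G1 (\<lambda>t. gunit X (\<gamma> t))"
  by (rule smooth_curve_compose[OF atlases(1,2) smooth_unit]) (use unit_in in blast)+

lemma dsrc_surj: "g \<in> G1 \<Longrightarrow> dsrc X g ` T1 g = T0 (src X g)"
  using lie by (simp add: lie_groupoid_def surj_submersion_def dsrc_def)

lemma curve_interval:
  assumes "smooth_curve A S \<gamma>" obtains \<epsilon> where "\<epsilon> > 0" "\<And>t. t \<in> {-\<epsilon><..<\<epsilon>} \<Longrightarrow> \<gamma> t \<in> S"
  using assms unfolding smooth_curve_def by blast


subsection \<open>The product of tangent vectors\<close>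

text \<open>
  Tangency of \<open>(\<beta>, \<alpha>)\<close> to the submanifold of composable pairs at \<open>(g, h)\<close>.
\<close>

definition tcomposable :: "'g \<Rightarrow> 'g \<Rightarrow> ('g, 'e) tvec \<Rightarrow> ('g, 'e) tvec \<Rightarrow> bool" where
  "tcomposable g h \<beta> \<alpha> \<longleftrightarrow> (g, h) \<in> composable X \<and> \<beta> \<in> T1 g \<and> \<alpha> \<in> T1 h \<and> dsrc X g \<beta> = dtgt X h \<alpha>"

definition ccurve :: "(real \<Rightarrow> 'g) \<Rightarrow> (real \<Rightarrow> 'g) \<Rightarrow> bool" where
  "ccurve \<gamma> \<delta> \<longleftrightarrow> smooth_curve (prod_atlas (arr X) (arr X)) (composable X) (\<lambda>t. (\<gamma> t, \<delta> t))"

lemma ccurveI: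
  assumes \<gamma>: "smooth_curve (arr X) G1 \<gamma>" and \<delta>: "smooth_curve (arr X) G1 \<delta>"
    and e: "e > 0" "\<And>t. t \<in> {-e<..<e} \<Longrightarrow> src X (\<gamma> t) = tgt X (\<delta> t)"
  shows "ccurve \<gamma> \<delta>"
proof -
  obtain e1 where e1: "e1 > 0" "\<And>t. t \<in> {-e1<..<e1} \<Longrightarrow> \<gamma> t \<in> G1" using \<gamma> by (rule curve_interval; blast)
  obtain e2 where e2: "e2 > 0" "\<And>t. t \<in> {-e2<..<e2} \<Longrightarrow> \<delta> t \<in> G1" using \<delta> by (rule curve_interval; blast)
  show ?thesis unfolding ccurve_def
    by (rule smooth_curve_shrink[OF smooth_curve_Pair[OF atlases(2,2) \<gamma> \<delta>], of "min e (min e1 e2)"])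
      (use e e1 e2 in \<open>auto simp: composable_iff\<close>)
qed

lemma ccurveD:
  assumes "ccurve \<gamma> \<delta>"
  shows ccurve_left: "smooth_curve (arr X) G1 \<gamma>" and ccurve_right: "smooth_curve (arr X) G1 \<delta>"
    and ccurve_at_0: "(\<gamma> 0, \<delta> 0) \<in> composable X"
  using smooth_curve_prod_components[OF atlases(2,2) assms[unfolded ccurve_def]]
    smooth_curve_at_0[OF assms[unfolded ccurve_def]] by auto

lemma ccurve_interval:
  assumes "ccurve \<gamma> \<delta>" obtains \<epsilon> where "\<epsilon> > 0" "\<And>t. t \<in> {-\<epsilon><..<\<epsilon>} \<Longrightarrow> (\<gamma> t, \<delta> t) \<in> composable X"
  using assms[unfolded ccurve_def] by (rule curve_interval) blast

lemma ccurve_comp: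
  assumes "ccurve \<gamma> \<delta>"
  shows "smooth_curve (arr X) G1 (\<lambda>t. \<gamma> t \<odot> \<delta> t)"
proof -
  have "(\<lambda>(g, h). g \<odot> h) ` composable X \<subseteq> G1" using comp_in by auto
  from smooth_curve_compose[OF atlases(3,2) smooth_comp assms[unfolded ccurve_def] this]
  show ?thesis by simp
qed

lemma ccurve_tcomposable:
  assumes "ccurve \<gamma> \<delta>"
  shows "tcomposable (\<gamma> 0) (\<delta> 0) (velocity (arr X) \<gamma>) (velocity (arr X) \<delta>)"
proof -
  note c = ccurveD[OF assms]
  obtain e where e: "e > 0" "\<And>t. t \<in> {-e<..<e} \<Longrightarrow> (\<gamma> t, \<delta> t) \<in> composable X"
    using assms by (rule ccurve_interval) blast
  have "velocity (obj X) (\<lambda>t. src X (\<gamma> t)) = velocity (obj X) (\<lambda>t. tgt X (\<delta> t))"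
    by (rule velocity_cong[OF e(1)]) (use e(2) in \<open>simp add: composable_iff\<close>)
  then show ?thesis
    unfolding tcomposable_def
    using c velocity_tspace[OF atlases(2) c(1)] velocity_tspace[OF atlases(2) c(2)]
    by (simp add: velocity_src velocity_tgt)
qed

text \<open>
  A curve of composable pairs is determined to first order by the velocities of its two components,
  so the definite description in \<open>dcomp\<close> picks out the velocity of the product curve.
\<close>

lemma dcomp_velocity:
  assumes "ccurve \<gamma> \<delta>"
  shows "dcomp X (\<gamma> 0) (\<delta> 0) (velocity (arr X) \<gamma>) (velocity (arr X) \<delta>) = velocity (arr X) (\<lambda>t. \<gamma> t \<odot> \<delta> t)"
  unfolding dcomp_def
proof (rule the_equality)
  show "\<exists>\<gamma>' \<delta>'. smooth_curve (prod_atlas (arr X) (arr X)) (composable X) (\<lambda>t. (\<gamma>' t, \<delta>' t)) \<and>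
      \<gamma>' 0 = \<gamma> 0 \<and> \<delta>' 0 = \<delta> 0 \<and> velocity (arr X) \<gamma>' = velocity (arr X) \<gamma> \<and> velocity (arr X) \<delta>' = velocity (arr X) \<delta> \<and>
      velocity (arr X) (\<lambda>t. \<gamma>' t \<odot> \<delta>' t) = velocity (arr X) (\<lambda>t. \<gamma> t \<odot> \<delta> t)"
    using assms unfolding ccurve_def by blast
  fix w assume "\<exists>\<gamma>' \<delta>'. smooth_curve (prod_atlas (arr X) (arr X)) (composable X) (\<lambda>t. (\<gamma>' t, \<delta>' t)) \<and>
      \<gamma>' 0 = \<gamma> 0 \<and> \<delta>' 0 = \<delta> 0 \<and> velocity (arr X) \<gamma>' = velocity (arr X) \<gamma> \<and> velocity (arr X) \<delta>' = velocity (arr X) \<delta> \<and>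
      velocity (arr X) (\<lambda>t. \<gamma>' t \<odot> \<delta>' t) = w"
  then obtain \<gamma>' \<delta>' where c': "ccurve \<gamma>' \<delta>'" and 0: "\<gamma>' 0 = \<gamma> 0" "\<delta>' 0 = \<delta> 0"
    and v: "velocity (arr X) \<gamma>' = velocity (arr X) \<gamma>" "velocity (arr X) \<delta>' = velocity (arr X) \<delta>"
    and w: "velocity (arr X) (\<lambda>t. \<gamma>' t \<odot> \<delta>' t) = w" unfolding ccurve_def by blast
  have "velocity (prod_atlas (arr X) (arr X)) (\<lambda>t. (\<gamma>' t, \<delta>' t)) (A, p)
      = velocity (prod_atlas (arr X) (arr X)) (\<lambda>t. (\<gamma> t, \<delta> t)) (A, p)"
    if Ap: "(A, p) \<in> prod_atlas (arr X) (arr X)" and in_A: "(\<gamma>' 0, \<delta>' 0) \<in> A" for A p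
  proof -
    obtain U c V d where U: "(U, c) \<in> arr X" "(V, d) \<in> arr X" "A = U \<times> V" "p = (\<lambda>(x, y). (c x, d y))"
      using Ap by (rule prod_atlasE)
    show ?thesis unfolding U(3,4)
      using velocity_Pair[OF atlases(2,2) ccurve_left[OF c'] ccurve_right[OF c'] U(1) _ U(2)]
        velocity_Pair[OF atlases(2,2) ccurve_left[OF assms] ccurve_right[OF assms] U(1) _ U(2)] in_A U(3) 0 v
      by simp
  qed
  with velocity_compose_unique[OF atlases(3,2) smooth_comp c'[unfolded ccurve_def] assms[unfolded ccurve_def]] 0
  show "w = velocity (arr X) (\<lambda>t. \<gamma> t \<odot> \<delta> t)" using w by simp
qed

text \<open>
  The source map is a submersion, so the curve of targets of \<open>\<delta>\<close> lifts along it with any initial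
  velocity that is compatible with \<open>\<alpha>\<close>. Prescribing the right factor allows lifts to be iterated
  for triple products.
\<close>

lemma tcomposable_lift:
  assumes tc: "tcomposable g h \<beta> \<alpha>" and \<delta>: "smooth_curve (arr X) G1 \<delta>" "\<delta> 0 = h" "velocity (arr X) \<delta> = \<alpha>"
  obtains \<gamma> where "ccurve \<gamma> \<delta>" "\<gamma> 0 = g" "velocity (arr X) \<gamma> = \<beta>"
proof -
  have gh: "g \<in> G1" "h \<in> G1" "src X g = tgt X h" "\<beta> \<in> T1 g" "dsrc X g \<beta> = dtgt X h \<alpha>"
    using tc by (auto simp: tcomposable_def composable_iff)
  have surj: "tmap (arr X) (obj X) G1 (src X) g ` T1 g = T0 (src X g)"
    using dsrc_surj[OF gh(1)] by (simp add: dsrc_def)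
  have v: "tmap (arr X) (obj X) G1 (src X) g \<beta> = velocity (obj X) (\<lambda>t. tgt X (\<delta> t))"
    using velocity_tgt[OF \<delta>(1)] gh \<delta> by (simp add: dsrc_def)
  have 0: "tgt X (\<delta> 0) = src X g" using gh \<delta> by simp
  obtain \<gamma> e where "smooth_curve (arr X) G1 \<gamma>" "\<gamma> 0 = g" "velocity (arr X) \<gamma> = \<beta>" "e > 0"
    "\<And>t. t \<in> {-e<..<e} \<Longrightarrow> src X (\<gamma> t) = tgt X (\<delta> t)"
    by (rule submersion_lift[OF atlases(2,1) smooth_src surj gh(1) curve_tgt[OF \<delta>(1)] 0 gh(4) v]; blast)
  then show thesis using that ccurveI[OF _ \<delta>(1)] by blast
qed

lemma tcomposable_curves:
  assumes tc: "tcomposable g h \<beta> \<alpha>"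
  obtains \<gamma> \<delta> where "ccurve \<gamma> \<delta>" "\<gamma> 0 = g" "\<delta> 0 = h" "velocity (arr X) \<gamma> = \<beta>" "velocity (arr X) \<delta> = \<alpha>"
    "dcomp X g h \<beta> \<alpha> = velocity (arr X) (\<lambda>t. \<gamma> t \<odot> \<delta> t)"
proof -
  have h: "h \<in> G1" "\<alpha> \<in> T1 h" using tc by (auto simp: tcomposable_def composable_iff)
  obtain \<delta> where \<delta>: "smooth_curve (arr X) G1 \<delta>" "\<delta> 0 = h" "velocity (arr X) \<delta> = \<alpha>"
    by (rule curve_with_velocity[OF atlases(2) h])
  obtain \<gamma> where \<gamma>: "ccurve \<gamma> \<delta>" "\<gamma> 0 = g" "velocity (arr X) \<gamma> = \<beta>" by (rule tcomposable_lift[OF tc \<delta>])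
  show thesis using that[OF \<gamma>(1,2) \<delta>(2) \<gamma>(3) \<delta>(3)] dcomp_velocity[OF \<gamma>(1)] \<gamma> \<delta> by simp
qed

lemma
  assumes tc: "tcomposable g h \<beta> \<alpha>"
  shows dcomp_in: "dcomp X g h \<beta> \<alpha> \<in> T1 (g \<odot> h)"
    and dsrc_dcomp: "dsrc X (g \<odot> h) (dcomp X g h \<beta> \<alpha>) = dsrc X h \<alpha>"
    and dtgt_dcomp: "dtgt X (g \<odot> h) (dcomp X g h \<beta> \<alpha>) = dtgt X g \<beta>"
proof -
  obtain \<gamma> \<delta> where c: "ccurve \<gamma> \<delta>" and 0: "\<gamma> 0 = g" "\<delta> 0 = h" "velocity (arr X) \<gamma> = \<beta>" "velocity (arr X) \<delta> = \<alpha>"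
    and dc: "dcomp X g h \<beta> \<alpha> = velocity (arr X) (\<lambda>t. \<gamma> t \<odot> \<delta> t)"
    by (rule tcomposable_curves[OF tc])
  note cc = ccurve_comp[OF c]
  obtain e where e: "e > 0" "\<And>t. t \<in> {-e<..<e} \<Longrightarrow> (\<gamma> t, \<delta> t) \<in> composable X"
    using c by (rule ccurve_interval) blast
  show "dcomp X g h \<beta> \<alpha> \<in> T1 (g \<odot> h)" using velocity_tspace[OF atlases(2) cc] dc 0 by simp
  have "velocity (obj X) (\<lambda>t. src X (\<gamma> t \<odot> \<delta> t)) = velocity (obj X) (\<lambda>t. src X (\<delta> t))"
    by (rule velocity_cong[OF e(1)]) (simp add: src_comp e(2))
  then show "dsrc X (g \<odot> h) (dcomp X g h \<beta> \<alpha>) = dsrc X h \<alpha>"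
    using velocity_src[OF cc] velocity_src[OF ccurve_right[OF c]] dc 0 by simp
  have "velocity (obj X) (\<lambda>t. tgt X (\<gamma> t \<odot> \<delta> t)) = velocity (obj X) (\<lambda>t. tgt X (\<gamma> t))"
    by (rule velocity_cong[OF e(1)]) (simp add: tgt_comp e(2))
  then show "dtgt X (g \<odot> h) (dcomp X g h \<beta> \<alpha>) = dtgt X g \<beta>"
    using velocity_tgt[OF cc] velocity_tgt[OF ccurve_left[OF c]] dc 0 by simp
qed

text \<open>
  In charts the product of tangent vectors is the derivative of an extension of the multiplication;
  linearity and smoothness of the product are read off from this.
\<close>

lemma dcomp_coord:
  assumes tc: "tcomposable g h \<beta> \<alpha>" and U: "(U, c) \<in> arr X" "g \<in> U" and U': "(U', c') \<in> arr X" "h \<in> U'"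
    and V: "(V, d) \<in> arr X" and W: "open W" "(c g, c' h) \<in> W" "Cinf_on F W"
    and F: "\<And>g h. (g, h) \<in> composable X \<Longrightarrow> g \<in> U \<Longrightarrow> h \<in> U' \<Longrightarrow> (c g, c' h) \<in> W \<Longrightarrow> g \<odot> h \<in> V \<and> d (g \<odot> h) = F (c g, c' h)"
  shows "dcomp X g h \<beta> \<alpha> (V, d) = frechet_derivative F (at (c g, c' h)) (\<beta> (U, c), \<alpha> (U', c'))"
proof -
  obtain \<gamma> \<delta> where c: "ccurve \<gamma> \<delta>" and 0: "\<gamma> 0 = g" "\<delta> 0 = h" "velocity (arr X) \<gamma> = \<beta>" "velocity (arr X) \<delta> = \<alpha>"
    and dc: "dcomp X g h \<beta> \<alpha> = velocity (arr X) (\<lambda>t. \<gamma> t \<odot> \<delta> t)"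
    by (rule tcomposable_curves[OF tc])
  let ?p = "\<lambda>(x, y). (c x, c' y)"
  have "velocity (arr X) (\<lambda>t. (\<lambda>(g, h). g \<odot> h) (\<gamma> t, \<delta> t)) (V, d)
      = frechet_derivative F (at (?p (\<gamma> 0, \<delta> 0))) (velocity (prod_atlas (arr X) (arr X)) (\<lambda>t. (\<gamma> t, \<delta> t)) (U \<times> U', ?p))"
    by (rule velocity_compose[OF atlases(3) c[unfolded ccurve_def] prod_atlasI[OF U(1) U'(1)] _ V W(1) _ W(3)])
      (use U U' W(2) F 0 in auto)
  then show ?thesis
    using velocity_Pair[OF atlases(2,2) ccurve_left[OF c] ccurve_right[OF c] U(1) _ U'(1)] U(2) U'(2) dc 0 by simp
qed

lemma comp_chart:
  assumes gh: "(g, h) \<in> composable X" and U: "(U, c) \<in> arr X" "g \<in> U" and U': "(U', c') \<in> arr X" "h \<in> U'"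
    and V: "(V, d) \<in> arr X" "g \<odot> h \<in> V"
  obtains W F where "open W" "(c g, c' h) \<in> W" "Cinf_on F W"
    "\<And>g h. (g, h) \<in> composable X \<Longrightarrow> g \<in> U \<Longrightarrow> h \<in> U' \<Longrightarrow> (c g, c' h) \<in> W \<Longrightarrow> g \<odot> h \<in> V \<and> d (g \<odot> h) = F (c g, c' h)"
proof -
  have p: "(g, h) \<in> U \<times> U'" using U U' by simp
  have V': "(\<lambda>(g, h). g \<odot> h) (g, h) \<in> V" using V by simp
  obtain W F where W: "open W" "(\<lambda>(x, y). (c x, c' y)) (g, h) \<in> W" "Cinf_on F W"
    and F: "\<And>y. y \<in> composable X \<Longrightarrow> y \<in> U \<times> U' \<Longrightarrow> (\<lambda>(x, y). (c x, c' y)) y \<in> W \<Longrightarrow>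
      (\<lambda>(g, h). g \<odot> h) y \<in> V \<and> d ((\<lambda>(g, h). g \<odot> h) y) = F ((\<lambda>(x, y). (c x, c' y)) y)"
    by (rule smooth_mapE[OF atlases(3,2) smooth_comp gh prod_atlasI[OF U(1) U'(1)] p V(1) V']; blast)
  show thesis
    by (rule that[of W F]) (use W F in fastforce)+
qed

lemma tcomposable_add:
  "tcomposable g h \<beta> \<alpha> \<Longrightarrow> tcomposable g h \<beta>' \<alpha>' \<Longrightarrow> tcomposable g h (\<beta> + \<beta>') (\<alpha> + \<alpha>')"
  by (auto simp: tcomposable_def tspace_add[OF atlases(2)] dsrc_add dtgt_add composable_iff)

lemma tcomposable_tscale: "tcomposable g h \<beta> \<alpha> \<Longrightarrow> tcomposable g h (tscale r \<beta>) (tscale r \<alpha>)"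
  by (auto simp: tcomposable_def tspace_tscale[OF atlases(2)] dsrc_tscale dtgt_tscale composable_iff)

lemma
  assumes tc: "tcomposable g h \<beta> \<alpha>"
  shows dcomp_add: "tcomposable g h \<beta>' \<alpha>' \<Longrightarrow>
      dcomp X g h (\<beta> + \<beta>') (\<alpha> + \<alpha>') = dcomp X g h \<beta> \<alpha> + dcomp X g h \<beta>' \<alpha>'"
    and dcomp_tscale: "dcomp X g h (tscale r \<beta>) (tscale r \<alpha>) = tscale r (dcomp X g h \<beta> \<alpha>)"
proof -
  have gh: "(g, h) \<in> composable X" "g \<in> G1" "h \<in> G1" using tc by (auto simp: tcomposable_def composable_iff)
  obtain U c where U: "(U, c) \<in> arr X" "g \<in> U" using gh(2) by (rule carrierE)
  obtain U' c' where U': "(U', c') \<in> arr X" "h \<in> U'" using gh(3) by (rule carrierE)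
  obtain V d where V: "(V, d) \<in> arr X" "g \<odot> h \<in> V" using comp_in[OF gh(1)] by (rule carrierE)
  obtain W F where W: "open W" "(c g, c' h) \<in> W" "Cinf_on F W"
    and F: "\<And>g h. (g, h) \<in> composable X \<Longrightarrow> g \<in> U \<Longrightarrow> h \<in> U' \<Longrightarrow> (c g, c' h) \<in> W \<Longrightarrow> g \<odot> h \<in> V \<and> d (g \<odot> h) = F (c g, c' h)"
    by (rule comp_chart[OF gh(1) U U' V]; blast)
  have lin: "linear (frechet_derivative F (at (c g, c' h)))" by (rule Cinf_on_linear_derivative[OF W(3,2)])
  have coord: "dcomp X g h \<beta> \<alpha> (V, d) = frechet_derivative F (at (c g, c' h)) (\<beta> (U, c), \<alpha> (U', c'))"
    if "tcomposable g h \<beta> \<alpha>" for \<beta> \<alpha> by (rule dcomp_coord[OF that U U' V(1) W F])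
  show "dcomp X g h (tscale r \<beta>) (tscale r \<alpha>) = tscale r (dcomp X g h \<beta> \<alpha>)"
  proof (rule tspace_eqI[OF dcomp_in[OF tcomposable_tscale[OF tc]] tspace_tscale[OF atlases(2) dcomp_in[OF tc]] V])
    show "dcomp X g h (tscale r \<beta>) (tscale r \<alpha>) (V, d) = tscale r (dcomp X g h \<beta> \<alpha>) (V, d)"
      using linear_cmul[OF lin, of r "(\<beta> (U, c), \<alpha> (U', c'))"]
      by (simp add: coord[OF tcomposable_tscale[OF tc]] coord[OF tc] tscale_apply)
  qed
  assume tc': "tcomposable g h \<beta>' \<alpha>'"
  show "dcomp X g h (\<beta> + \<beta>') (\<alpha> + \<alpha>') = dcomp X g h \<beta> \<alpha> + dcomp X g h \<beta>' \<alpha>'"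
  proof (rule tspace_eqI[OF dcomp_in[OF tcomposable_add[OF tc tc']]
        tspace_add[OF atlases(2) dcomp_in[OF tc] dcomp_in[OF tc']] V])
    show "dcomp X g h (\<beta> + \<beta>') (\<alpha> + \<alpha>') (V, d) = (dcomp X g h \<beta> \<alpha> + dcomp X g h \<beta>' \<alpha>') (V, d)"
      using linear_add[OF lin, of "(\<beta> (U, c), \<alpha> (U', c'))" "(\<beta>' (U, c), \<alpha>' (U', c'))"]
      by (simp add: coord[OF tcomposable_add[OF tc tc']] coord[OF tc] coord[OF tc'])
  qed
qed

lemma tcomposable_assoc:
  assumes "tcomposable g h \<beta> \<alpha>" "tcomposable h k \<alpha> \<kappa>"
  shows "tcomposable (g \<odot> h) k (dcomp X g h \<beta> \<alpha>) \<kappa>" "tcomposable g (h \<odot> k) \<beta> (dcomp X h k \<alpha> \<kappa>)"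
  using assms dcomp_in[OF assms(1)] dcomp_in[OF assms(2)] dsrc_dcomp[OF assms(1)] dtgt_dcomp[OF assms(2)]
  by (auto simp: tcomposable_def composable_iff comp_in src_comp tgt_comp)

text \<open>
  Lifting twice produces a curve of composable triples, along which associativity is
  differentiated.
\<close>

lemma dcomp_assoc:
  assumes tc: "tcomposable g h \<beta> \<alpha>" and tc': "tcomposable h k \<alpha> \<kappa>"
  shows "dcomp X (g \<odot> h) k (dcomp X g h \<beta> \<alpha>) \<kappa> = dcomp X g (h \<odot> k) \<beta> (dcomp X h k \<alpha> \<kappa>)"
proof -
  obtain \<delta> \<zeta> where c': "ccurve \<delta> \<zeta>" and 0: "\<delta> 0 = h" "\<zeta> 0 = k" "velocity (arr X) \<delta> = \<alpha>" "velocity (arr X) \<zeta> = \<kappa>"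
    and dc': "dcomp X h k \<alpha> \<kappa> = velocity (arr X) (\<lambda>t. \<delta> t \<odot> \<zeta> t)"
    by (rule tcomposable_curves[OF tc'])
  obtain \<gamma> where c: "ccurve \<gamma> \<delta>" and ini: "\<gamma> 0 = g" "velocity (arr X) \<gamma> = \<beta>"
    by (rule tcomposable_lift[OF tc ccurve_left[OF c'] 0(1,3)])
  have dc: "dcomp X g h \<beta> \<alpha> = velocity (arr X) (\<lambda>t. \<gamma> t \<odot> \<delta> t)" using dcomp_velocity[OF c] 0 ini by simp
  obtain e where e: "e > 0" "\<And>t. t \<in> {-e<..<e} \<Longrightarrow> (\<gamma> t, \<delta> t) \<in> composable X"
    using c by (rule ccurve_interval) blast
  obtain e' where e': "e' > 0" "\<And>t. t \<in> {-e'<..<e'} \<Longrightarrow> (\<delta> t, \<zeta> t) \<in> composable X"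
    using c' by (rule ccurve_interval) blast
  let ?r = "min e e'"
  have r: "?r > 0" using e(1) e'(1) by simp
  have rr: "(\<gamma> t, \<delta> t) \<in> composable X" "(\<delta> t, \<zeta> t) \<in> composable X" if "t \<in> {- ?r<..<?r}" for t
    using e(2)[of t] e'(2)[of t] that by auto
  have c1: "ccurve (\<lambda>t. \<gamma> t \<odot> \<delta> t) \<zeta>"
    by (rule ccurveI[OF ccurve_comp[OF c] ccurve_right[OF c'] r]) (use rr in \<open>simp add: src_comp composable_iff\<close>)
  have c2: "ccurve \<gamma> (\<lambda>t. \<delta> t \<odot> \<zeta> t)"
    by (rule ccurveI[OF ccurve_left[OF c] ccurve_comp[OF c'] r]) (use rr in \<open>simp add: tgt_comp composable_iff\<close>)
  have "velocity (arr X) (\<lambda>t. (\<gamma> t \<odot> \<delta> t) \<odot> \<zeta> t) = velocity (arr X) (\<lambda>t. \<gamma> t \<odot> (\<delta> t \<odot> \<zeta> t))"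
    by (rule velocity_cong[OF r]) (use rr comp_assoc in blast)
  then show ?thesis
    using dcomp_velocity[OF c1] dcomp_velocity[OF c2] 0 ini dc dc' by simp
qed

text \<open>
  The laws for units and inverses, differentiated along a curve with velocity \<open>\<beta>\<close>.
\<close>

lemma
  assumes g: "g \<in> G1" and \<beta>: "\<beta> \<in> T1 g"
  shows dcomp_dunit: "dcomp X g (gunit X (src X g)) \<beta> (dunit X (src X g) (dsrc X g \<beta>)) = \<beta>"
    and dunit_dcomp: "dcomp X (gunit X (tgt X g)) g (dunit X (tgt X g) (dtgt X g \<beta>)) \<beta> = \<beta>"
    and dcomp_dinv: "tcomposable g (ginv X g) \<beta> (dinv g \<beta>)"
      "dcomp X g (ginv X g) \<beta> (dinv g \<beta>) = dunit X (tgt X g) (dtgt X g \<beta>)"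
    and dinv_dcomp: "tcomposable (ginv X g) g (dinv g \<beta>) \<beta>"
      "dcomp X (ginv X g) g (dinv g \<beta>) \<beta> = dunit X (src X g) (dsrc X g \<beta>)"
    and dsrc_dinv: "dsrc X (ginv X g) (dinv g \<beta>) = dtgt X g \<beta>"
    and dtgt_dinv: "dtgt X (ginv X g) (dinv g \<beta>) = dsrc X g \<beta>"
proof -
  obtain \<gamma> where \<gamma>: "smooth_curve (arr X) G1 \<gamma>" "\<gamma> 0 = g" "velocity (arr X) \<gamma> = \<beta>"
    by (rule curve_with_velocity[OF atlases(2) g \<beta>])
  obtain e where e: "e > 0" "\<And>t. t \<in> {-e<..<e} \<Longrightarrow> \<gamma> t \<in> G1" using \<gamma>(1) by (rule curve_interval; blast)
  note cs = curve_src[OF \<gamma>(1)] and ct = curve_tgt[OF \<gamma>(1)] and ci = curve_inv[OF \<gamma>(1)]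
  have vs: "velocity (arr X) (\<lambda>t. gunit X (src X (\<gamma> t))) = dunit X (src X g) (dsrc X g \<beta>)"
    using velocity_unit[OF cs] velocity_src[OF \<gamma>(1)] \<gamma> by simp
  have vt: "velocity (arr X) (\<lambda>t. gunit X (tgt X (\<gamma> t))) = dunit X (tgt X g) (dtgt X g \<beta>)"
    using velocity_unit[OF ct] velocity_tgt[OF \<gamma>(1)] \<gamma> by simp
  have vi: "velocity (arr X) (\<lambda>t. ginv X (\<gamma> t)) = dinv g \<beta>" using velocity_inv[OF \<gamma>(1)] \<gamma> by simp
  have c1: "ccurve \<gamma> (\<lambda>t. gunit X (src X (\<gamma> t)))"
    by (rule ccurveI[OF \<gamma>(1) curve_unit[OF cs] e(1)]) (simp add: tgt_unit src_in e(2))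
  have "velocity (arr X) (\<lambda>t. \<gamma> t \<odot> gunit X (src X (\<gamma> t))) = velocity (arr X) \<gamma>"
    by (rule velocity_cong[OF e(1)]) (simp add: comp_unit e(2))
  then show "dcomp X g (gunit X (src X g)) \<beta> (dunit X (src X g) (dsrc X g \<beta>)) = \<beta>"
    using dcomp_velocity[OF c1] \<gamma> vs by simp
  have c2: "ccurve (\<lambda>t. gunit X (tgt X (\<gamma> t))) \<gamma>"
    by (rule ccurveI[OF curve_unit[OF ct] \<gamma>(1) e(1)]) (simp add: src_unit tgt_in e(2))
  have "velocity (arr X) (\<lambda>t. gunit X (tgt X (\<gamma> t)) \<odot> \<gamma> t) = velocity (arr X) \<gamma>"
    by (rule velocity_cong[OF e(1)]) (simp add: unit_comp e(2))
  then show "dcomp X (gunit X (tgt X g)) g (dunit X (tgt X g) (dtgt X g \<beta>)) \<beta> = \<beta>"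
    using dcomp_velocity[OF c2] \<gamma> vt by simp
  have c3: "ccurve \<gamma> (\<lambda>t. ginv X (\<gamma> t))"
    by (rule ccurveI[OF \<gamma>(1) ci e(1)]) (simp add: tgt_inv e(2))
  have "velocity (arr X) (\<lambda>t. \<gamma> t \<odot> ginv X (\<gamma> t)) = velocity (arr X) (\<lambda>t. gunit X (tgt X (\<gamma> t)))"
    by (rule velocity_cong[OF e(1)]) (simp add: comp_inv e(2))
  then show "tcomposable g (ginv X g) \<beta> (dinv g \<beta>)"
    "dcomp X g (ginv X g) \<beta> (dinv g \<beta>) = dunit X (tgt X g) (dtgt X g \<beta>)"
    using dcomp_velocity[OF c3] ccurve_tcomposable[OF c3] \<gamma> vi vt by simp_all
  have c4: "ccurve (\<lambda>t. ginv X (\<gamma> t)) \<gamma>"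
    by (rule ccurveI[OF ci \<gamma>(1) e(1)]) (simp add: src_inv e(2))
  have "velocity (arr X) (\<lambda>t. ginv X (\<gamma> t) \<odot> \<gamma> t) = velocity (arr X) (\<lambda>t. gunit X (src X (\<gamma> t)))"
    by (rule velocity_cong[OF e(1)]) (simp add: inv_comp e(2))
  then show "tcomposable (ginv X g) g (dinv g \<beta>) \<beta>"
    "dcomp X (ginv X g) g (dinv g \<beta>) \<beta> = dunit X (src X g) (dsrc X g \<beta>)"
    using dcomp_velocity[OF c4] ccurve_tcomposable[OF c4] \<gamma> vi vs by simp_all
  then show "dsrc X (ginv X g) (dinv g \<beta>) = dtgt X g \<beta>" by (simp add: tcomposable_def)
  show "dtgt X (ginv X g) (dinv g \<beta>) = dsrc X g \<beta>"
    using \<open>tcomposable g (ginv X g) \<beta> (dinv g \<beta>)\<close> by (simp add: tcomposable_def)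
qed

lemma
  assumes x: "x \<in> G0" and v: "v \<in> T0 x"
  shows dsrc_dunit: "dsrc X (gunit X x) (dunit X x v) = v"
    and dtgt_dunit: "dtgt X (gunit X x) (dunit X x v) = v"
proof -
  obtain \<gamma> where \<gamma>: "smooth_curve (obj X) G0 \<gamma>" "\<gamma> 0 = x" "velocity (obj X) \<gamma> = v"
    by (rule curve_with_velocity[OF atlases(1) x v])
  obtain e where e: "e > 0" "\<And>t. t \<in> {-e<..<e} \<Longrightarrow> \<gamma> t \<in> G0" using \<gamma>(1) by (rule curve_interval; blast)
  have "velocity (obj X) (\<lambda>t. src X (gunit X (\<gamma> t))) = velocity (obj X) \<gamma>"
    by (rule velocity_cong[OF e(1)]) (simp add: src_unit e(2))
  then show "dsrc X (gunit X x) (dunit X x v) = v"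
    using velocity_unit[OF \<gamma>(1)] velocity_src[OF curve_unit[OF \<gamma>(1)]] \<gamma> by simp
  have "velocity (obj X) (\<lambda>t. tgt X (gunit X (\<gamma> t))) = velocity (obj X) \<gamma>"
    by (rule velocity_cong[OF e(1)]) (simp add: tgt_unit e(2))
  then show "dtgt X (gunit X x) (dunit X x v) = v"
    using velocity_unit[OF \<gamma>(1)] velocity_tgt[OF curve_unit[OF \<gamma>(1)]] \<gamma> by simp
qed

lemma tcomposable_0: "(g, h) \<in> composable X \<Longrightarrow> tcomposable g h 0 0"
  by (auto simp: tcomposable_def tspace_0[OF atlases(2)] dsrc_0 dtgt_0 composable_iff)

lemma dcomp_0: "(g, h) \<in> composable X \<Longrightarrow> dcomp X g h 0 0 = 0"
  using dcomp_add[OF tcomposable_0 tcomposable_0, of g h] by simp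

lemma algebroid_iff: "\<alpha> \<in> algebroid X x \<longleftrightarrow> \<alpha> \<in> T1 (gunit X x) \<and> dsrc X (gunit X x) \<alpha> = 0"
  by (simp add: algebroid_def)

text \<open>
  Lifting a constant curve along the source map gives a curve in a source fibre.
\<close>

lemma src_fibre_curve:
  assumes x: "x \<in> G0" and \<alpha>: "\<alpha> \<in> algebroid X x"
  obtains \<gamma> e where "smooth_curve (arr X) (src_fibre X x) \<gamma>" "smooth_curve (arr X) G1 \<gamma>"
    "\<gamma> 0 = gunit X x" "velocity (arr X) \<gamma> = \<alpha>"
    "e > 0" "\<And>t. t \<in> {-e<..<e} \<Longrightarrow> \<gamma> t \<in> G1 \<and> src X (\<gamma> t) = x"
proof -
  have u: "gunit X x \<in> G1" by (rule unit_in[OF x])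
  have surj: "tmap (arr X) (obj X) G1 (src X) (gunit X x) ` T1 (gunit X x) = T0 (src X (gunit X x))"
    using dsrc_surj[OF u] by (simp add: dsrc_def)
  have v: "tmap (arr X) (obj X) G1 (src X) (gunit X x) \<alpha> = velocity (obj X) (\<lambda>t. x)"
    using \<alpha> by (simp add: algebroid_iff dsrc_def velocity_const)
  have 0: "x = src X (gunit X x)" using src_unit[OF x] by simp
  have \<alpha>T: "\<alpha> \<in> T1 (gunit X x)" using \<alpha> by (simp add: algebroid_iff)
  obtain \<gamma> e where \<gamma>: "smooth_curve (arr X) G1 \<gamma>" "\<gamma> 0 = gunit X x" "velocity (arr X) \<gamma> = \<alpha>"
    and e: "e > 0" "\<And>t. t \<in> {-e<..<e} \<Longrightarrow> src X (\<gamma> t) = x"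
    by (rule submersion_lift[OF atlases(2,1) smooth_src surj u smooth_curve_const[OF x x] 0 \<alpha>T v]; blast)
  obtain e1 where e1: "e1 > 0" "\<And>t. t \<in> {-e1<..<e1} \<Longrightarrow> \<gamma> t \<in> G1" using \<gamma>(1) by (rule curve_interval; blast)
  have r: "min e e1 > 0" using e(1) e1(1) by simp
  have in_fibre: "\<gamma> t \<in> G1 \<and> src X (\<gamma> t) = x" if "t \<in> {- min e e1<..<min e e1}" for t
    using e(2)[of t] e1(2)[of t] that by auto
  have "smooth_curve (arr X) (src_fibre X x) \<gamma>"
    by (rule smooth_curve_shrink[OF \<gamma>(1) r]) (simp add: src_fibre_def in_fibre)
  with that \<gamma> r in_fibre show thesis by blast
qed

lemma tcomposable_rtrans:
  assumes "g \<in> G1" "\<alpha> \<in> algebroid X (tgt X g)"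
  shows "tcomposable (gunit X (tgt X g)) g \<alpha> 0"
  using assms by (auto simp: tcomposable_def algebroid_iff unit_composable tspace_0[OF atlases(2)] dtgt_0)

text \<open>
  Right translation multiplies by a constant curve, that is, by a zero vector; likewise left
  translation below, after inversion.
\<close>

lemma rtrans_eq:
  assumes g: "g \<in> G1" and \<alpha>: "\<alpha> \<in> algebroid X (tgt X g)"
  shows "rtrans X g \<alpha> = dcomp X (gunit X (tgt X g)) g \<alpha> 0"
proof -
  let ?x = "tgt X g"
  obtain \<gamma> e where \<gamma>: "smooth_curve (arr X) (src_fibre X ?x) \<gamma>" "smooth_curve (arr X) G1 \<gamma>"
    "\<gamma> 0 = gunit X ?x" "velocity (arr X) \<gamma> = \<alpha>"
    and e: "e > 0" "\<And>t. t \<in> {-e<..<e} \<Longrightarrow> \<gamma> t \<in> G1 \<and> src X (\<gamma> t) = ?x"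
    by (rule src_fibre_curve[OF tgt_in[OF g] \<alpha>]; blast)
  have sub: "src_fibre X ?x \<subseteq> G1" by (auto simp: src_fibre_def)
  have "smooth_map (arr X) (arr X) (src_fibre X ?x) (\<lambda>h. (\<lambda>(g, h). g \<odot> h) (h, g))"
    by (rule smooth_map_compose[OF atlases(2,3,2) smooth_map_Pair[OF atlases(2,2,2) smooth_map_id[OF sub]
            smooth_map_const[OF sub g]] smooth_comp]) (auto simp: src_fibre_def composable_iff g)
  then have sm: "smooth_map (arr X) (arr X) (src_fibre X ?x) (\<lambda>h. h \<odot> g)" by simp
  have c: "ccurve \<gamma> (\<lambda>t. g)"
    by (rule ccurveI[OF \<gamma>(2) smooth_curve_const[OF g g] e(1)]) (use e(2) in simp)
  show ?thesis
    unfolding rtrans_def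
    using tmap_velocity[OF atlases(2,2) sm \<gamma>(1)] dcomp_velocity[OF c] \<gamma> by (simp add: velocity_const)
qed

lemma algebroid_dinv:
  assumes x: "x \<in> G0" and \<alpha>: "\<alpha> \<in> algebroid X x"
  shows "dinv (gunit X x) \<alpha> \<in> T1 (gunit X x)" "dtgt X (gunit X x) (dinv (gunit X x) \<alpha>) = 0"
    "dsrc X (gunit X x) (dinv (gunit X x) \<alpha>) = dtgt X (gunit X x) \<alpha>"
  using dinv_in[OF unit_in[OF x], of \<alpha>] dtgt_dinv[OF unit_in[OF x], of \<alpha>] dsrc_dinv[OF unit_in[OF x], of \<alpha>] \<alpha>
  by (auto simp: inv_unit x algebroid_iff)

lemma tcomposable_ltrans:
  assumes "g \<in> G1" "\<alpha> \<in> algebroid X (src X g)"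
  shows "tcomposable g (gunit X (src X g)) 0 (dinv (gunit X (src X g)) \<alpha>)"
  using assms algebroid_dinv[OF src_in[OF assms(1)] assms(2)]
  by (auto simp: tcomposable_def unit_composable tspace_0[OF atlases(2)] dsrc_0)

lemma ltrans_eq:
  assumes g: "g \<in> G1" and \<alpha>: "\<alpha> \<in> algebroid X (src X g)"
  shows "ltrans X g \<alpha> = dcomp X g (gunit X (src X g)) 0 (dinv (gunit X (src X g)) \<alpha>)"
proof -
  let ?x = "src X g"
  obtain \<gamma> e where \<gamma>: "smooth_curve (arr X) (src_fibre X ?x) \<gamma>" "smooth_curve (arr X) G1 \<gamma>"
    "\<gamma> 0 = gunit X ?x" "velocity (arr X) \<gamma> = \<alpha>"
    and e: "e > 0" "\<And>t. t \<in> {-e<..<e} \<Longrightarrow> \<gamma> t \<in> G1 \<and> src X (\<gamma> t) = ?x"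
    by (rule src_fibre_curve[OF src_in[OF g] \<alpha>]; blast)
  have sub: "src_fibre X ?x \<subseteq> G1" by (auto simp: src_fibre_def)
  have "smooth_map (arr X) (arr X) (src_fibre X ?x) (\<lambda>h. (\<lambda>(g, h). g \<odot> h) (g, ginv X h))"
    by (rule smooth_map_compose[OF atlases(2,3,2) smooth_map_Pair[OF atlases(2,2,2) smooth_map_const[OF sub g]
            smooth_map_subset[OF smooth_inv sub]] smooth_comp])
      (auto simp: src_fibre_def composable_iff g inv_in tgt_inv)
  then have sm: "smooth_map (arr X) (arr X) (src_fibre X ?x) (\<lambda>h. g \<odot> ginv X h)" by simp
  have c: "ccurve (\<lambda>t. g) (\<lambda>t. ginv X (\<gamma> t))"
    by (rule ccurveI[OF smooth_curve_const[OF g g] curve_inv[OF \<gamma>(2)] e(1)]) (use e(2) in \<open>simp add: tgt_inv\<close>)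
  show ?thesis
    unfolding ltrans_def
    using tmap_velocity[OF atlases(2,2) sm \<gamma>(1)] dcomp_velocity[OF c] velocity_inv[OF \<gamma>(2)] \<gamma> src_in[OF g]
    by (simp add: velocity_const inv_unit)
qed

lemma smooth_map_dcomp:
  fixes Z :: "('z, 'f::finite_dim_normed) atlas"
  assumes Z: "smooth_atlas Z" and v: "smooth_map Z (tangent (arr X)) S (\<lambda>z. (f z, v z))"
    and w: "smooth_map Z (tangent (arr X)) S (\<lambda>z. (g z, w z))"
    and tc: "\<And>z. z \<in> S \<Longrightarrow> tcomposable (f z) (g z) (v z) (w z)"
  shows "smooth_map Z (tangent (arr X)) S (\<lambda>z. (f z \<odot> g z, dcomp X (f z) (g z) (v z) (w z)))"
proof (rule smooth_map_tangentI[OF Z atlases(2)])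
  note A2 = atlases(2)
  note f = smooth_map_base[OF Z A2 v] and g = smooth_map_base[OF Z A2 w]
  have comp: "(f z, g z) \<in> composable X" if "z \<in> S" for z using tc[OF that] by (simp add: tcomposable_def)
  have "smooth_map Z (arr X) S (\<lambda>z. (\<lambda>(g, h). g \<odot> h) (f z, g z))"
    by (rule smooth_map_compose[OF Z atlases(3,2) smooth_map_Pair[OF Z A2 A2 f g] smooth_comp]) (use comp in auto)
  then show "smooth_map Z (arr X) S (\<lambda>z. f z \<odot> g z)" by simp
  fix z assume z: "z \<in> S"
  show "dcomp X (f z) (g z) (v z) (w z) \<in> T1 (f z \<odot> g z)" by (rule dcomp_in[OF tc[OF z]])
  obtain A a where A: "(A, a) \<in> Z" "z \<in> A" using smooth_map_carrier[OF f z] by (blast elim: carrierE)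
  obtain U c where U: "(U, c) \<in> arr X" "f z \<in> U" using smooth_map_carrier[OF f z] by (blast elim: carrierE)
  obtain U' c' where U': "(U', c') \<in> arr X" "g z \<in> U'" using smooth_map_carrier[OF g z] by (blast elim: carrierE)
  obtain V d where V: "(V, d) \<in> arr X" "f z \<odot> g z \<in> V" using comp_in[OF comp[OF z]] by (rule carrierE)
  obtain W F where W: "open W" "(c (f z), c' (g z)) \<in> W" "Cinf_on F W"
    and F: "\<And>g h. (g, h) \<in> composable X \<Longrightarrow> g \<in> U \<Longrightarrow> h \<in> U' \<Longrightarrow> (c g, c' h) \<in> W \<Longrightarrow> g \<odot> h \<in> V \<and> d (g \<odot> h) = F (c g, c' h)"
    by (rule comp_chart[OF comp[OF z] U U' V]; blast)
  obtain W1 G1' where W1: "open W1" "a z \<in> W1" "Cinf_on G1' W1" and G1': "\<And>y. y \<in> S \<Longrightarrow> y \<in> A \<Longrightarrow> a y \<in> W1 \<Longrightarrow>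
      f y \<in> U \<and> v y \<in> T1 (f y) \<and> v y (U, c) = G1' (a y)"
    by (rule smooth_map_tangentE[OF Z A2 v z A U]; blast)
  obtain W2 G2 where W2: "open W2" "a z \<in> W2" "Cinf_on G2 W2" and G2: "\<And>y. y \<in> S \<Longrightarrow> y \<in> A \<Longrightarrow> a y \<in> W2 \<Longrightarrow>
      g y \<in> U' \<and> w y \<in> T1 (g y) \<and> w y (U', c') = G2 (a y)"
    by (rule smooth_map_tangentE[OF Z A2 w z A U']; blast)
  obtain W3 F1 where W3: "open W3" "a z \<in> W3" "Cinf_on F1 W3"
      and F1: "\<And>y. y \<in> S \<Longrightarrow> y \<in> A \<Longrightarrow> a y \<in> W3 \<Longrightarrow> f y \<in> U \<and> c (f y) = F1 (a y)"
    by (rule smooth_mapE[OF Z A2 f z A U]; blast)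
  obtain W4 F2 where W4: "open W4" "a z \<in> W4" "Cinf_on F2 W4"
      and F2: "\<And>y. y \<in> S \<Longrightarrow> y \<in> A \<Longrightarrow> a y \<in> W4 \<Longrightarrow> g y \<in> U' \<and> c' (g y) = F2 (a y)"
    by (rule smooth_mapE[OF Z A2 g z A U']; blast)
  let ?O = "W1 \<inter> W2 \<inter> (W3 \<inter> W4)"
  have oO: "open ?O" using W1(1) W2(1) W3(1) W4(1) by blast
  have FF: "Cinf_on (\<lambda>y. (F1 y, F2 y)) ?O"
    by (rule Cinf_on_Pair[OF oO Cinf_on_subset[OF W3(3)] Cinf_on_subset[OF W4(3)]]) auto
  let ?W = "?O \<inter> (\<lambda>y. (F1 y, F2 y)) -` W"
  have o: "open ?W" by (rule open_vimage_Int[OF Cinf_on_continuous_on[OF FF] oO W(1)])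
  let ?G = "\<lambda>y. (\<lambda>(x, v). frechet_derivative F (at x) v) ((F1 y, F2 y), (G1' y, G2 y))"
  have GG: "Cinf_on (\<lambda>y. (G1' y, G2 y)) ?W"
    by (rule Cinf_on_Pair[OF o Cinf_on_subset[OF W1(3)] Cinf_on_subset[OF W2(3)]]) auto
  have "Cinf_on ?G ?W"
    by (rule Cinf_on_compose[OF Cinf_on_joint_derivative[OF W(1,3)] Cinf_on_Pair[OF o Cinf_on_subset[OF FF] GG] o])
      auto
  moreover have "a z \<in> ?W" using W(2) W1(2) W2(2) W3(2) W4(2) F1[OF z A(2) W3(2)] F2[OF z A(2) W4(2)] by auto
  moreover have "dcomp X (f y) (g y) (v y) (w y) (V, d) = ?G (a y)" if y: "y \<in> S" "y \<in> A" "a y \<in> ?W" for y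
  proof -
    have fy: "f y \<in> U" "c (f y) = F1 (a y)" "v y (U, c) = G1' (a y)"
      "g y \<in> U'" "c' (g y) = F2 (a y)" "w y (U', c') = G2 (a y)"
      using F1[of y] F2[of y] G1'[of y] G2[of y] y by auto
    have W': "(c (f y), c' (g y)) \<in> W" using y(3) fy by simp
    show ?thesis
      using dcomp_coord[OF tc[OF y(1)] U(1) fy(1) U'(1) fy(4) V(1) W(1) W' W(3) F] fy by simp
  qed
  ultimately show "coord_smooth_at Z (arr X) S (\<lambda>y. f y \<odot> g y) (\<lambda>y. dcomp X (f y) (g y) (v y) (w y)) z"
    using A V o by (intro coord_smooth_atI[of A a _ _ V d _ _ ?W ?G]) auto
qed

end


section \<open>Connections and the adjoint quasi action\<close>

context lie_gpd
begin

lemma algebroid_0: "x \<in> G0 \<Longrightarrow> 0 \<in> algebroid X x"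
  by (simp add: algebroid_iff tspace_0[OF atlases(2)] dsrc_0 unit_in)

lemma algebroid_add: "x \<in> G0 \<Longrightarrow> \<alpha> \<in> algebroid X x \<Longrightarrow> \<beta> \<in> algebroid X x \<Longrightarrow> \<alpha> + \<beta> \<in> algebroid X x"
  by (simp add: algebroid_iff tspace_add[OF atlases(2)] dsrc_add unit_in)

lemma algebroid_tscale: "x \<in> G0 \<Longrightarrow> \<alpha> \<in> algebroid X x \<Longrightarrow> tscale r \<alpha> \<in> algebroid X x"
  by (simp add: algebroid_iff tspace_tscale[OF atlases(2)] dsrc_tscale unit_in) (simp add: tscale_def fun_eq_iff)

lemma algebroid_minus: "x \<in> G0 \<Longrightarrow> \<alpha> \<in> algebroid X x \<Longrightarrow> - \<alpha> \<in> algebroid X x"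
  by (simp add: algebroid_iff tspace_minus[OF atlases(2)] dsrc_minus unit_in)

lemma algebroid_tspace: "\<alpha> \<in> algebroid X x \<Longrightarrow> \<alpha> \<in> T1 (gunit X x)"
  by (simp add: algebroid_iff)

lemma anchor_in: "x \<in> G0 \<Longrightarrow> \<alpha> \<in> algebroid X x \<Longrightarrow> dtgt X (gunit X x) \<alpha> \<in> T0 x"
  using dtgt_in[OF unit_in, of x \<alpha>] by (simp add: algebroid_iff tgt_unit)

lemma
  assumes g: "g \<in> G1" and \<alpha>: "\<alpha> \<in> algebroid X (tgt X g)"
  shows rtrans_in: "rtrans X g \<alpha> \<in> T1 g"
    and dsrc_rtrans: "dsrc X g (rtrans X g \<alpha>) = 0"
    and dtgt_rtrans: "dtgt X g (rtrans X g \<alpha>) = dtgt X (gunit X (tgt X g)) \<alpha>"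
    and rtrans_add: "\<beta> \<in> algebroid X (tgt X g) \<Longrightarrow> rtrans X g (\<alpha> + \<beta>) = rtrans X g \<alpha> + rtrans X g \<beta>"
    and rtrans_tscale: "rtrans X g (tscale r \<alpha>) = tscale r (rtrans X g \<alpha>)"
proof -
  note tc = tcomposable_rtrans[OF g \<alpha>] and eq = rtrans_eq[OF g \<alpha>] and x = tgt_in[OF g]
  show "rtrans X g \<alpha> \<in> T1 g" using dcomp_in[OF tc] eq unit_comp[OF g] by simp
  show "dsrc X g (rtrans X g \<alpha>) = 0" using dsrc_dcomp[OF tc] eq unit_comp[OF g] by (simp add: dsrc_0 g)
  show "dtgt X g (rtrans X g \<alpha>) = dtgt X (gunit X (tgt X g)) \<alpha>"
    using dtgt_dcomp[OF tc] eq unit_comp[OF g] by simp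
  show "rtrans X g (tscale r \<alpha>) = tscale r (rtrans X g \<alpha>)"
    using dcomp_tscale[OF tc, of r] eq rtrans_eq[OF g algebroid_tscale[OF x \<alpha>]]
    by (simp add: tscale_def zero_fun_def)
  assume \<beta>: "\<beta> \<in> algebroid X (tgt X g)"
  show "rtrans X g (\<alpha> + \<beta>) = rtrans X g \<alpha> + rtrans X g \<beta>"
    using dcomp_add[OF tc tcomposable_rtrans[OF g \<beta>]] eq rtrans_eq[OF g \<beta>] rtrans_eq[OF g algebroid_add[OF x \<alpha> \<beta>]]
    by simp
qed

lemma rtrans_dcomp_0:
  assumes gh: "(g, h) \<in> composable X" and \<alpha>: "\<alpha> \<in> algebroid X (tgt X g)"
  shows "tcomposable g h (rtrans X g \<alpha>) 0"
    and "dcomp X g h (rtrans X g \<alpha>) 0 = rtrans X (g \<odot> h) \<alpha>"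
proof -
  have g: "g \<in> G1" and h: "h \<in> G1" using gh by (auto simp: composable_iff)
  show "tcomposable g h (rtrans X g \<alpha>) 0"
    using gh rtrans_in[OF g \<alpha>] dsrc_rtrans[OF g \<alpha>] by (simp add: tcomposable_def tspace_0[OF atlases(2)] dtgt_0 h)
  show "dcomp X g h (rtrans X g \<alpha>) 0 = rtrans X (g \<odot> h) \<alpha>"
    using dcomp_assoc[OF tcomposable_rtrans[OF g \<alpha>] tcomposable_0[OF gh]] \<alpha>
    by (simp add: unit_comp[OF g] rtrans_eq[OF g \<alpha>] rtrans_eq comp_in[OF gh] tgt_comp[OF gh] dcomp_0[OF gh])
qed

lemma rtrans_unit: "x \<in> G0 \<Longrightarrow> \<alpha> \<in> algebroid X x \<Longrightarrow> rtrans X (gunit X x) \<alpha> = \<alpha>"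
  using dcomp_dunit[OF unit_in, of x \<alpha>] rtrans_eq[OF unit_in, of x \<alpha>]
  by (simp add: algebroid_iff src_unit tgt_unit dunit_0)

lemma rtrans_cancel:
  assumes g: "g \<in> G1" and \<alpha>: "\<alpha> \<in> algebroid X (tgt X g)"
  shows "dcomp X g (ginv X g) (rtrans X g \<alpha>) 0 = \<alpha>"
  using rtrans_dcomp_0(2)[OF inv_composable(2)[OF g] \<alpha>] rtrans_unit[OF tgt_in[OF g] \<alpha>] by (simp add: comp_inv g)

lemma rtrans_inject:
  "g \<in> G1 \<Longrightarrow> \<alpha> \<in> algebroid X (tgt X g) \<Longrightarrow> \<beta> \<in> algebroid X (tgt X g) \<Longrightarrow>
    rtrans X g \<alpha> = rtrans X g \<beta> \<Longrightarrow> \<alpha> = \<beta>"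
  using rtrans_cancel by metis

text \<open>
  Right translation by \<open>g\<close> identifies \<open>A\<close> at the target with the kernel of \<open>ds\<close> at \<open>g\<close>; its inverse
  is right translation by the inverse of \<open>g\<close>.
\<close>

lemma rtrans_surj:
  assumes g: "g \<in> G1" and w: "w \<in> T1 g" "dsrc X g w = 0"
  shows "dcomp X g (ginv X g) w 0 \<in> algebroid X (tgt X g)"
    and "rtrans X g (dcomp X g (ginv X g) w 0) = w"
proof -
  note c = inv_composable[OF g]
  have tc: "tcomposable g (ginv X g) w 0"
    using w c(2) by (simp add: tcomposable_def tspace_0[OF atlases(2)] dtgt_0 inv_in g)
  show A: "dcomp X g (ginv X g) w 0 \<in> algebroid X (tgt X g)"
    using dcomp_in[OF tc] dsrc_dcomp[OF tc] by (simp add: algebroid_iff comp_inv g dsrc_0 inv_in)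
  show "rtrans X g (dcomp X g (ginv X g) w 0) = w"
    using dcomp_assoc[OF tc tcomposable_0[OF c(1)]] rtrans_eq[OF g A] dcomp_dunit[OF g w(1)]
    by (simp add: comp_inv inv_comp g dcomp_0[OF c(1)] w(2) dunit_0 src_in)
qed

lemma
  assumes g: "g \<in> G1" and \<alpha>: "\<alpha> \<in> algebroid X (src X g)"
  shows ltrans_in: "ltrans X g \<alpha> \<in> T1 g"
    and dsrc_ltrans: "dsrc X g (ltrans X g \<alpha>) = dtgt X (gunit X (src X g)) \<alpha>"
    and dtgt_ltrans: "dtgt X g (ltrans X g \<alpha>) = 0"
    and ltrans_add: "\<beta> \<in> algebroid X (src X g) \<Longrightarrow> ltrans X g (\<alpha> + \<beta>) = ltrans X g \<alpha> + ltrans X g \<beta>"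
    and ltrans_tscale: "ltrans X g (tscale r \<alpha>) = tscale r (ltrans X g \<alpha>)"
proof -
  note tc = tcomposable_ltrans[OF g \<alpha>] and eq = ltrans_eq[OF g \<alpha>] and x = src_in[OF g]
  show "ltrans X g \<alpha> \<in> T1 g" using dcomp_in[OF tc] eq comp_unit[OF g] by simp
  show "dsrc X g (ltrans X g \<alpha>) = dtgt X (gunit X (src X g)) \<alpha>"
    using dsrc_dcomp[OF tc] eq comp_unit[OF g] algebroid_dinv(3)[OF x \<alpha>] by simp
  show "dtgt X g (ltrans X g \<alpha>) = 0"
    using dtgt_dcomp[OF tc] eq comp_unit[OF g] by (simp add: dtgt_0 g)
  have di: "dinv (gunit X (src X g)) (tscale r \<alpha>) = tscale r (dinv (gunit X (src X g)) \<alpha>)"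
    by (rule tmap_tscale[OF atlases(2,2) smooth_inv unit_in[OF x] algebroid_tspace[OF \<alpha>]])
  show "ltrans X g (tscale r \<alpha>) = tscale r (ltrans X g \<alpha>)"
    using dcomp_tscale[OF tc, of r] eq ltrans_eq[OF g algebroid_tscale[OF x \<alpha>]] di
    by (simp add: tscale_def zero_fun_def)
  assume \<beta>: "\<beta> \<in> algebroid X (src X g)"
  have di': "dinv (gunit X (src X g)) (\<alpha> + \<beta>) = dinv (gunit X (src X g)) \<alpha> + dinv (gunit X (src X g)) \<beta>"
    by (rule tmap_add[OF atlases(2,2) smooth_inv unit_in[OF x] algebroid_tspace[OF \<alpha>] algebroid_tspace[OF \<beta>]])
  show "ltrans X g (\<alpha> + \<beta>) = ltrans X g \<alpha> + ltrans X g \<beta>"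
    using dcomp_add[OF tc tcomposable_ltrans[OF g \<beta>]] eq ltrans_eq[OF g \<beta>] ltrans_eq[OF g algebroid_add[OF x \<alpha> \<beta>]] di'
    by simp
qed

text \<open>
  The product is \<open>0\<^sub>g.di(\<beta>).\<beta>.0\<^sub>h\<close>, and \<open>di(\<beta>).\<beta>\<close> is the unit over \<open>ds(\<beta>) = 0\<close>.
\<close>

lemma dcomp_ltrans_rtrans:
  assumes gh: "(g, h) \<in> composable X" and \<beta>: "\<beta> \<in> algebroid X (src X g)"
  shows "tcomposable g h (ltrans X g \<beta>) (rtrans X h \<beta>)"
    and "dcomp X g h (ltrans X g \<beta>) (rtrans X h \<beta>) = 0"
proof -
  let ?x = "src X g"
  let ?u = "gunit X ?x"
  have g: "g \<in> G1" and h: "h \<in> G1" and xh: "tgt X h = ?x"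
    using gh by (auto simp: composable_iff)
  note x = src_in[OF g]
  note \<beta>h = \<beta>[folded xh]
  show tc: "tcomposable g h (ltrans X g \<beta>) (rtrans X h \<beta>)"
    using gh ltrans_in[OF g \<beta>] rtrans_in[OF h \<beta>h] dsrc_ltrans[OF g \<beta>] dtgt_rtrans[OF h \<beta>h] xh
    by (simp add: tcomposable_def)
  note l = tcomposable_ltrans[OF g \<beta>] and r = tcomposable_rtrans[OF h \<beta>h, unfolded xh]
  have u: "?u \<in> G1" by (rule unit_in[OF x])
  have i: "tcomposable ?u ?u (dinv ?u \<beta>) \<beta>" "dcomp X ?u ?u (dinv ?u \<beta>) \<beta> = 0"
    using dinv_dcomp[OF u algebroid_tspace[OF \<beta>]] \<beta>
    by (auto simp: inv_unit x src_unit algebroid_iff dunit_0)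
  have uu: "?u \<odot> ?u = ?u" using comp_unit[OF u] by (simp add: src_unit x)
  have uh: "?u \<odot> h = h" using unit_comp[OF h] xh by simp
  have "dcomp X ?u h (dinv ?u \<beta>) (dcomp X ?u h \<beta> 0) = 0"
    using dcomp_assoc[OF i(1) r] i(2) uu uh r by (simp add: tcomposable_def dcomp_0)
  moreover have "dcomp X g h (ltrans X g \<beta>) (rtrans X h \<beta>) = dcomp X g h 0 (dcomp X ?u h (dinv ?u \<beta>) (dcomp X ?u h \<beta> 0))"
    using dcomp_assoc[OF l, of h "dcomp X ?u h \<beta> 0"] tcomposable_assoc(2)[OF i(1) r] uh comp_unit[OF g]
    by (simp add: ltrans_eq[OF g \<beta>] rtrans_eq[OF h \<beta>h] xh)
  ultimately show "dcomp X g h (ltrans X g \<beta>) (rtrans X h \<beta>) = 0" using dcomp_0[OF gh] by simp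
qed

text \<open>
  By associativity the product is \<open>\<gamma>.0\<^sub>g.0\<^sub>h.di(\<alpha>) = \<gamma>.(l\<^sub>g\<^sub>h\<alpha>)\<close>, and bilinearity splits \<open>(\<gamma> + 0).(0 + l\<^sub>g\<^sub>h\<alpha>)\<close>.
\<close>

lemma dcomp_rtrans_ltrans:
  assumes gh: "(g, h) \<in> composable X" and \<gamma>: "\<gamma> \<in> algebroid X (tgt X g)" and \<alpha>: "\<alpha> \<in> algebroid X (src X h)"
  shows "tcomposable g h (rtrans X g \<gamma>) (ltrans X h \<alpha>)"
    and "dcomp X g h (rtrans X g \<gamma>) (ltrans X h \<alpha>) = rtrans X (g \<odot> h) \<gamma> + ltrans X (g \<odot> h) \<alpha>"
proof -
  have g: "g \<in> G1" and h: "h \<in> G1" and gh1: "g \<odot> h \<in> G1" and s: "src X (g \<odot> h) = src X h" and t: "tgt X (g \<odot> h) = tgt X g"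
    using gh comp_in src_comp tgt_comp by (auto simp: composable_iff)
  show tc: "tcomposable g h (rtrans X g \<gamma>) (ltrans X h \<alpha>)"
    using gh rtrans_in[OF g \<gamma>] ltrans_in[OF h \<alpha>] dsrc_rtrans[OF g \<gamma>] dtgt_ltrans[OF h \<alpha>]
    by (simp add: tcomposable_def)
  note r = tcomposable_rtrans[OF g \<gamma>] and l = tcomposable_ltrans[OF h \<alpha>]
  have 0: "tcomposable g h 0 (ltrans X h \<alpha>)"
    using gh ltrans_in[OF h \<alpha>] dtgt_ltrans[OF h \<alpha>] by (simp add: tcomposable_def tspace_0[OF atlases(2)] dsrc_0 g)
  have l': "dcomp X g h 0 (ltrans X h \<alpha>) = ltrans X (g \<odot> h) \<alpha>"
    using dcomp_assoc[OF tcomposable_0[OF gh] l] comp_unit[OF h] \<alpha>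
    by (simp add: ltrans_eq[OF h \<alpha>] ltrans_eq gh1 s dcomp_0[OF gh])
  have \<gamma>': "\<gamma> \<in> algebroid X (tgt X (g \<odot> h))" and \<alpha>': "\<alpha> \<in> algebroid X (src X (g \<odot> h))" using \<gamma> \<alpha> s t by auto
  note r' = tcomposable_rtrans[OF gh1 \<gamma>']
  note ul = dunit_dcomp[OF gh1 ltrans_in[OF gh1 \<alpha>']]
  have tl: "tcomposable (gunit X (tgt X (g \<odot> h))) (g \<odot> h) 0 (ltrans X (g \<odot> h) \<alpha>)"
    using ltrans_in[OF gh1 \<alpha>'] dtgt_ltrans[OF gh1 \<alpha>'] unit_composable(1)[OF gh1]
    by (simp add: tcomposable_def tspace_0[OF atlases(2)] dsrc_0 unit_in tgt_in gh1)
  have "dcomp X g h (rtrans X g \<gamma>) (ltrans X h \<alpha>) = dcomp X (gunit X (tgt X g)) (g \<odot> h) \<gamma> (ltrans X (g \<odot> h) \<alpha>)"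
    using dcomp_assoc[OF r 0] l' unit_comp[OF g] by (simp add: rtrans_eq[OF g \<gamma>])
  also have "\<dots> = rtrans X (g \<odot> h) \<gamma> + ltrans X (g \<odot> h) \<alpha>"
    using dcomp_add[OF r' tl] ul dtgt_ltrans[OF gh1 \<alpha>'] t
    by (simp add: rtrans_eq[OF gh1 \<gamma>'] dunit_0 tgt_in g)
  finally show "dcomp X g h (rtrans X g \<gamma>) (ltrans X h \<alpha>) = rtrans X (g \<odot> h) \<gamma> + ltrans X (g \<odot> h) \<alpha>" .
qed

end


locale connection = lie_gpd X for X :: "('x, 'd::finite_dim_normed, 'g, 'e::finite_dim_normed) groupoid" +
  fixes H :: "('g \<times> ('g, 'e) tvec) set"
  assumes conn: "ehresmann_connection X H"
begin

abbreviation "hl \<equiv> hlift X H"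
abbreviation "vp \<equiv> vpart X H"
abbreviation "l0 \<equiv> lambda0 X H"
abbreviation "l1 \<equiv> lambda1 X H"
abbreviation "curv \<equiv> basic_curvature X H"

lemma H_in: "(g, w) \<in> H \<Longrightarrow> g \<in> G1 \<and> w \<in> T1 g"
proof -
  assume "(g, w) \<in> H"
  moreover have "H \<subseteq> carrier (tangent (arr X))"
    using conn by (simp add: ehresmann_connection_def vector_bundle_def tangent_subbundle_def)
  ultimately show ?thesis by (auto simp: carrier_tangent)
qed

lemma H_trivialization:
  assumes "g \<in> G1"
  obtains V U \<Phi> where "subspace V" "g \<in> U" "local_trivialization (arr X) (tangent_subbundle (arr X) H) V U \<Phi>"
  using conn assms unfolding ehresmann_connection_def vector_bundle_def by blast

lemma
  assumes v: "(g, v) \<in> H"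
  shows H_add: "(g, w) \<in> H \<Longrightarrow> (g, v + w) \<in> H" and H_tscale: "(g, tscale r v) \<in> H"
proof -
  have g: "g \<in> G1" using H_in[OF v] by simp
  obtain V U \<Phi> where U: "g \<in> U" and lt: "local_trivialization (arr X) (tangent_subbundle (arr X) H) V U \<Phi>"
    by (rule H_trivialization[OF g])
  have f: "(g, w) \<in> fibre (tangent_subbundle (arr X) H) g \<longleftrightarrow> (g, w) \<in> H" for w
    by (simp add: fibre_def tangent_subbundle_def)
  have "vscale (tangent_subbundle (arr X) H) r (g, v) \<in> fibre (tangent_subbundle (arr X) H) g"
    using lt U f[of v] v unfolding local_trivialization_def by blast
  then show "(g, tscale r v) \<in> H" by (simp add: fibre_def tangent_subbundle_def)
  assume w: "(g, w) \<in> H"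
  have "vadd (tangent_subbundle (arr X) H) (g, v) (g, w) \<in> fibre (tangent_subbundle (arr X) H) g"
    using lt U f[of v] v f[of w] w unfolding local_trivialization_def by blast
  then show "(g, v + w) \<in> H" by (simp add: fibre_def tangent_subbundle_def)
qed

lemma H_complement:
  assumes "g \<in> G1"
  shows "T1 g = {w + u | w u. (g, w) \<in> H \<and> u \<in> T1 g \<and> dsrc X g u = 0}"
    and "(g, w) \<in> H \<Longrightarrow> dsrc X g w = 0 \<Longrightarrow> w = 0"
proof -
  note * = bspec[OF conjunct1[OF conjunct2[OF conn[unfolded ehresmann_connection_def Let_def]]] assms]
  note * = conjunct1[OF *] conjunct2[OF *]
  show "T1 g = {w + u | w u. (g, w) \<in> H \<and> u \<in> T1 g \<and> dsrc X g u = 0}" using *(1) by simp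
  show "(g, w) \<in> H \<Longrightarrow> dsrc X g w = 0 \<Longrightarrow> w = 0" using *(2) H_in[of g w] by blast
qed

lemma H_unique:
  assumes v: "(g, v) \<in> H" and w: "(g, w) \<in> H" and eq: "dsrc X g v = dsrc X g w"
  shows "v = w"
proof -
  have g: "g \<in> G1" "v \<in> T1 g" "w \<in> T1 g" using H_in v w by auto
  have "(g, v + tscale (-1) w) \<in> H" by (rule H_add[OF v H_tscale[OF w]])
  then have "(g, v - w) \<in> H" by (simp add: tscale_minus_one)
  then have "v - w = 0" by (rule H_complement(2)[OF g(1)]) (simp add: dsrc_diff[OF g] eq)
  then show ?thesis by simp
qed

lemma hlift_unique: "(g, w) \<in> H \<Longrightarrow> dsrc X g w = v \<Longrightarrow> hl g v = w"
  unfolding hlift_def by (rule the_equality) (use H_unique in auto)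

lemma hlift_ex:
  assumes g: "g \<in> G1" and v: "v \<in> T0 (src X g)"
  shows "\<exists>w. (g, w) \<in> H \<and> dsrc X g w = v"
proof -
  from v have "v \<in> dsrc X g ` T1 g" by (simp only: dsrc_surj[OF g])
  then obtain z where z: "z \<in> T1 g" "dsrc X g z = v" by (rule imageE) simp
  have "z \<in> {w + u | w u. (g, w) \<in> H \<and> u \<in> T1 g \<and> dsrc X g u = 0}"
    using z(1) unfolding H_complement(1)[OF g, symmetric] .
  then obtain w u where wu: "z = w + u" "(g, w) \<in> H" "u \<in> T1 g" "dsrc X g u = 0"
    by blast
  then show ?thesis using dsrc_add[OF g _ wu(3), of w] H_in[OF wu(2)] z by auto
qed

lemma
  assumes g: "g \<in> G1" and v: "v \<in> T0 (src X g)"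
  shows hlift_H: "(g, hl g v) \<in> H" and dsrc_hlift: "dsrc X g (hl g v) = v" and hlift_in: "hl g v \<in> T1 g"
    and hlift_add: "w \<in> T0 (src X g) \<Longrightarrow> hl g (v + w) = hl g v + hl g w"
    and hlift_tscale: "hl g (tscale r v) = tscale r (hl g v)"
proof -
  obtain z where "(g, z) \<in> H \<and> dsrc X g z = v" using hlift_ex[OF g v] by blast
  then show v': "(g, hl g v) \<in> H" "dsrc X g (hl g v) = v" using hlift_unique[of g z v] by auto
  then show in1: "hl g v \<in> T1 g" using H_in by blast
  show "hl g (tscale r v) = tscale r (hl g v)"
    by (rule hlift_unique[OF H_tscale[OF v'(1)]]) (simp add: dsrc_tscale[OF g in1] v'(2))
  assume "w \<in> T0 (src X g)"
  then obtain u where u: "(g, u) \<in> H" "dsrc X g u = w" using hlift_ex[OF g] by blast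
  then have "hl g w = u" by (rule hlift_unique)
  moreover have "hl g (v + w) = hl g v + u"
    by (rule hlift_unique[OF H_add[OF v'(1) u(1)]]) (use u dsrc_add[OF g in1, of u] H_in[OF u(1)] v'(2) in simp)
  ultimately show "hl g (v + w) = hl g v + hl g w" by simp
qed

lemma hlift_unit:
  assumes "x \<in> G0" "v \<in> T0 x"
  shows "hl (gunit X x) v = dunit X x v"
proof (rule hlift_unique)
  have "{w. (gunit X x, w) \<in> H} = dunit X x ` T0 x"
    using conn assms(1) unfolding ehresmann_connection_def by blast
  then show "(gunit X x, dunit X x v) \<in> H" using assms(2) by blast
qed (rule dsrc_dunit[OF assms])

lemma
  assumes g: "g \<in> G1" and w: "w \<in> T1 g"
  shows vpart_eq: "vp g w = dcomp X g (ginv X g) (w - hl g (dsrc X g w)) 0"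
    and vpart_in: "vp g w \<in> algebroid X (tgt X g)"
    and rtrans_vpart: "rtrans X g (vp g w) = w - hl g (dsrc X g w)"
proof -
  note s = dsrc_in[OF g w]
  have k: "w - hl g (dsrc X g w) \<in> T1 g" "dsrc X g (w - hl g (dsrc X g w)) = 0"
    using w hlift_in[OF g s] dsrc_hlift[OF g s] by (auto simp: tspace_diff[OF atlases(2)] dsrc_diff g)
  note r = rtrans_surj[OF g k]
  show eq: "vp g w = dcomp X g (ginv X g) (w - hl g (dsrc X g w)) 0"
    unfolding vpart_def
  proof (rule the_equality)
    fix \<alpha> assume \<alpha>: "\<alpha> \<in> algebroid X (tgt X g) \<and> rtrans X g \<alpha> + hl g (dsrc X g w) = w"
    then have "rtrans X g \<alpha> = w - hl g (dsrc X g w)" by (metis add_diff_cancel_right')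
    then show "\<alpha> = dcomp X g (ginv X g) (w - hl g (dsrc X g w)) 0" using rtrans_cancel[OF g] \<alpha> by metis
  qed (use r in simp)
  show "vp g w \<in> algebroid X (tgt X g)" "rtrans X g (vp g w) = w - hl g (dsrc X g w)" using r eq by auto
qed

lemma vpart_unique:
  assumes g: "g \<in> G1" and w: "w \<in> T1 g" and \<alpha>: "\<alpha> \<in> algebroid X (tgt X g)" "w = rtrans X g \<alpha> + hl g (dsrc X g w)"
  shows "vp g w = \<alpha>"
proof (rule rtrans_inject[OF g vpart_in[OF g w] \<alpha>(1)])
  show "rtrans X g (vp g w) = rtrans X g \<alpha>"
    using rtrans_vpart[OF g w] \<alpha>(2) by (metis add_diff_cancel_right')
qed

lemma
  assumes g: "g \<in> G1" and w: "w \<in> T1 g"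
  shows vpart_add: "w' \<in> T1 g \<Longrightarrow> vp g (w + w') = vp g w + vp g w'"
    and vpart_tscale: "vp g (tscale r w) = tscale r (vp g w)"
proof -
  note x = tgt_in[OF g] and s = dsrc_in[OF g w]
  have w_eq: "w = rtrans X g (vp g w) + hl g (dsrc X g w)" if "w \<in> T1 g" for w
    using rtrans_vpart[OF g that] by simp
  have tscale_plus: "tscale r (a + b) = tscale r a + tscale r b" for a b :: "('g, 'e) tvec"
    by (simp add: tscale_def fun_eq_iff scaleR_add_right)
  show "vp g (tscale r w) = tscale r (vp g w)"
    by (rule vpart_unique[OF g tspace_tscale[OF atlases(2) w] algebroid_tscale[OF x vpart_in[OF g w]]])
      (simp add: dsrc_tscale[OF g w] hlift_tscale[OF g s] rtrans_tscale[OF g vpart_in[OF g w]]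
        rtrans_vpart[OF g w] flip: tscale_plus)
  assume w': "w' \<in> T1 g"
  show "vp g (w + w') = vp g w + vp g w'"
    by (rule vpart_unique[OF g tspace_add[OF atlases(2) w w'] algebroid_add[OF x vpart_in[OF g w] vpart_in[OF g w']]])
      (simp add: dsrc_add[OF g w w'] hlift_add[OF g s dsrc_in[OF g w']] rtrans_vpart[OF g w] rtrans_vpart[OF g w']
        rtrans_add[OF g vpart_in[OF g w] vpart_in[OF g w']])
qed

text \<open>
  The splitting of the horizontal lift of an anchor into translations characterises the quasi
  action on \<open>A\<close> without reference to the vertical projection.
\<close>

lemma
  assumes g: "g \<in> G1" and \<alpha>: "\<alpha> \<in> algebroid X (src X g)"
  shows lambda0_in: "l0 g \<alpha> \<in> algebroid X (tgt X g)"
    and hlift_anchor: "hl g (dtgt X (gunit X (src X g)) \<alpha>) = ltrans X g \<alpha> + rtrans X g (l0 g \<alpha>)"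
    and lambda0_add: "\<beta> \<in> algebroid X (src X g) \<Longrightarrow> l0 g (\<alpha> + \<beta>) = l0 g \<alpha> + l0 g \<beta>"
    and lambda0_tscale: "l0 g (tscale r \<alpha>) = tscale r (l0 g \<alpha>)"
proof -
  note l = ltrans_in[OF g \<alpha>] and x = tgt_in[OF g]
  note v = vpart_in[OF g l]
  show in0: "l0 g \<alpha> \<in> algebroid X (tgt X g)" unfolding lambda0_def by (rule algebroid_minus[OF x v])
  have "rtrans X g (l0 g \<alpha>) = - rtrans X g (vp g (ltrans X g \<alpha>))"
    using rtrans_tscale[OF g v, of "-1"] by (simp add: lambda0_def tscale_minus_one)
  then show "hl g (dtgt X (gunit X (src X g)) \<alpha>) = ltrans X g \<alpha> + rtrans X g (l0 g \<alpha>)"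
    using rtrans_vpart[OF g l] dsrc_ltrans[OF g \<alpha>] by simp
  have tscale_neg: "- tscale r a = tscale r (- a)" for a :: "('g, 'e) tvec"
    by (simp add: tscale_def fun_eq_iff)
  show "l0 g (tscale r \<alpha>) = tscale r (l0 g \<alpha>)"
    by (simp add: lambda0_def ltrans_tscale[OF g \<alpha>] vpart_tscale[OF g l] tscale_neg)
  assume \<beta>: "\<beta> \<in> algebroid X (src X g)"
  show "l0 g (\<alpha> + \<beta>) = l0 g \<alpha> + l0 g \<beta>"
    by (simp add: lambda0_def ltrans_add[OF g \<alpha> \<beta>] vpart_add[OF g l ltrans_in[OF g \<beta>]])
qed

lemma lambda0_unique:
  assumes g: "g \<in> G1" and \<alpha>: "\<alpha> \<in> algebroid X (src X g)" and \<beta>: "\<beta> \<in> algebroid X (tgt X g)"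
    "hl g (dtgt X (gunit X (src X g)) \<alpha>) = ltrans X g \<alpha> + rtrans X g \<beta>"
  shows "l0 g \<alpha> = \<beta>"
  by (rule rtrans_inject[OF g lambda0_in[OF g \<alpha>] \<beta>(1)]) (use hlift_anchor[OF g \<alpha>] \<beta>(2) in simp)

lemma
  assumes g: "g \<in> G1" and v: "v \<in> T0 (src X g)"
  shows lambda1_in: "l1 g v \<in> T0 (tgt X g)"
    and lambda1_add: "w \<in> T0 (src X g) \<Longrightarrow> l1 g (v + w) = l1 g v + l1 g w"
    and lambda1_tscale: "l1 g (tscale r v) = tscale r (l1 g v)"
  using dtgt_in[OF g hlift_in[OF g v]] dtgt_add[OF g hlift_in[OF g v]] hlift_in[OF g]
    dtgt_tscale[OF g hlift_in[OF g v]] hlift_add[OF g v] hlift_tscale[OF g v]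
  by (auto simp: lambda1_def)

lemma lambda_anchor:
  assumes g: "g \<in> G1" and \<alpha>: "\<alpha> \<in> algebroid X (src X g)"
  shows "dtgt X (gunit X (tgt X g)) (l0 g \<alpha>) = l1 g (dtgt X (gunit X (src X g)) \<alpha>)"
  using dtgt_add[OF g ltrans_in[OF g \<alpha>] rtrans_in[OF g lambda0_in[OF g \<alpha>]]]
    dtgt_ltrans[OF g \<alpha>] dtgt_rtrans[OF g lambda0_in[OF g \<alpha>]] hlift_anchor[OF g \<alpha>]
  by (simp add: lambda1_def)

lemma tcomposable_hlift:
  assumes gh: "(g, h) \<in> composable X" and v: "v \<in> T0 (src X h)"
  shows "tcomposable g h (hl g (l1 h v)) (hl h v)"
proof -
  have *: "g \<in> G1" "h \<in> G1" "src X g = tgt X h" using gh by (auto simp: composable_iff)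
  have l: "l1 h v \<in> T0 (src X g)" using lambda1_in[OF *(2) v] *(3) by simp
  show ?thesis
    using gh hlift_in[OF *(1) l] dsrc_hlift[OF *(1) l] hlift_in[OF *(2) v] by (simp add: tcomposable_def lambda1_def)
qed

text \<open>
  The curvature measures the failure of horizontal lifts to be multiplicative; like the formula for
  \<open>lambda0\<close>, the equation determines it.
\<close>

lemma
  assumes gh: "(g, h) \<in> composable X" and v: "v \<in> T0 (src X h)"
  shows curv_in: "curv g h v \<in> algebroid X (tgt X g)"
    and hlift_comp: "hl (g \<odot> h) v = dcomp X g h (hl g (l1 h v)) (hl h v) + rtrans X (g \<odot> h) (curv g h v)"
    and curv_add: "w \<in> T0 (src X h) \<Longrightarrow> curv g h (v + w) = curv g h v + curv g h w"
    and curv_tscale: "curv g h (tscale r v) = tscale r (curv g h v)"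
proof -
  have g: "g \<in> G1" and h: "h \<in> G1" and sg: "src X g = tgt X h" and gh1: "g \<odot> h \<in> G1"
    and t: "tgt X (g \<odot> h) = tgt X g"
    using gh comp_in tgt_comp by (auto simp: composable_iff)
  note tc = tcomposable_hlift[OF gh]
  note c = dcomp_in[OF tc[OF v]]
  note k = vpart_in[OF gh1 c]
  show "curv g h v \<in> algebroid X (tgt X g)"
    unfolding basic_curvature_def using algebroid_minus[OF tgt_in[OF g]] k t by simp
  have "rtrans X (g \<odot> h) (curv g h v) = - rtrans X (g \<odot> h) (vp (g \<odot> h) (dcomp X g h (hl g (l1 h v)) (hl h v)))"
    using rtrans_tscale[OF gh1 k, of "-1"] by (simp add: basic_curvature_def tscale_minus_one)
  then show "hl (g \<odot> h) v = dcomp X g h (hl g (l1 h v)) (hl h v) + rtrans X (g \<odot> h) (curv g h v)"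
    using rtrans_vpart[OF gh1 c] dsrc_dcomp[OF tc[OF v]] dsrc_hlift[OF h v] by simp
  have l: "l1 h v \<in> T0 (src X g)" using lambda1_in[OF h v] sg by simp
  have tscale_neg: "- tscale r a = tscale r (- a)" for a :: "('g, 'e) tvec"
    by (simp add: tscale_def fun_eq_iff)
  show "curv g h (tscale r v) = tscale r (curv g h v)"
    by (simp add: basic_curvature_def lambda1_tscale[OF h v] hlift_tscale[OF g l] hlift_tscale[OF h v]
        dcomp_tscale[OF tc[OF v]] vpart_tscale[OF gh1 c] tscale_neg)
  assume w: "w \<in> T0 (src X h)"
  have l': "l1 h w \<in> T0 (src X g)" using lambda1_in[OF h w] sg by simp
  show "curv g h (v + w) = curv g h v + curv g h w"
    by (simp add: basic_curvature_def lambda1_add[OF h v w] hlift_add[OF g l l'] hlift_add[OF h v w]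
        dcomp_add[OF tc[OF v] tc[OF w]] vpart_add[OF gh1 c dcomp_in[OF tc[OF w]]])
qed

text \<open>
  This is \<open>dt\<close> of the equation for the lift at \<open>gh\<close>.
\<close>

lemma lambda1_curv:
  assumes gh: "(g, h) \<in> composable X" and v: "v \<in> T0 (src X h)"
  shows "l1 (g \<odot> h) v = l1 g (l1 h v) + dtgt X (gunit X (tgt X g)) (curv g h v)"
proof -
  have gh1: "g \<odot> h \<in> G1" and t: "tgt X (g \<odot> h) = tgt X g" using gh comp_in tgt_comp by auto
  have k: "curv g h v \<in> algebroid X (tgt X (g \<odot> h))" using curv_in[OF gh v] t by simp
  show ?thesis
    using dtgt_add[OF gh1 dcomp_in[OF tcomposable_hlift[OF gh v]] rtrans_in[OF gh1 k]] hlift_comp[OF gh v]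
      dtgt_dcomp[OF tcomposable_hlift[OF gh v]] dtgt_rtrans[OF gh1 k] t
    by (simp add: lambda1_def)
qed

text \<open>
  Of the two summands of the lift, the left translation is annihilated by \<open>r\<^sub>h\<beta>\<close>.
\<close>

lemma dcomp_hlift_anchor_rtrans:
  assumes gh: "(g, h) \<in> composable X" and \<beta>: "\<beta> \<in> algebroid X (src X g)"
  shows "tcomposable g h (hl g (dtgt X (gunit X (src X g)) \<beta>)) (rtrans X h \<beta>)"
    and "dcomp X g h (hl g (dtgt X (gunit X (src X g)) \<beta>)) (rtrans X h \<beta>) = rtrans X (g \<odot> h) (l0 g \<beta>)"
proof -
  have g: "g \<in> G1" using gh by (auto simp: composable_iff)
  note 1 = dcomp_ltrans_rtrans[OF gh \<beta>] and 2 = rtrans_dcomp_0[OF gh lambda0_in[OF g \<beta>]]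
  show "tcomposable g h (hl g (dtgt X (gunit X (src X g)) \<beta>)) (rtrans X h \<beta>)"
    using tcomposable_add[OF 1(1) 2(1)] hlift_anchor[OF g \<beta>] by simp
  show "dcomp X g h (hl g (dtgt X (gunit X (src X g)) \<beta>)) (rtrans X h \<beta>) = rtrans X (g \<odot> h) (l0 g \<beta>)"
    using dcomp_add[OF 1(1) 2(1)] hlift_anchor[OF g \<beta>] 1(2) 2(2) by simp
qed

text \<open>
  The product of the splittings of \<open>\<sigma>\<^sub>h(\<rho>\<alpha>)\<close> and \<open>\<sigma>\<^sub>g(\<rho>\<lambda>\<^sup>0\<^sub>h\<alpha>)\<close> differs from \<open>\<sigma>\<^sub>g\<^sub>h(\<rho>\<alpha>)\<close> by the
  curvature, which yields a splitting of \<open>\<sigma>\<^sub>g\<^sub>h(\<rho>\<alpha>)\<close>; such a splitting is unique.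
\<close>

lemma lambda0_curv:
  assumes gh: "(g, h) \<in> composable X" and \<alpha>: "\<alpha> \<in> algebroid X (src X h)"
  shows "l0 (g \<odot> h) \<alpha> = l0 g (l0 h \<alpha>) + curv g h (dtgt X (gunit X (src X h)) \<alpha>)"
proof -
  have g: "g \<in> G1" and h: "h \<in> G1" and sg: "src X g = tgt X h" and gh1: "g \<odot> h \<in> G1"
    and s: "src X (g \<odot> h) = src X h" and t: "tgt X (g \<odot> h) = tgt X g"
    using gh comp_in src_comp tgt_comp by (auto simp: composable_iff)
  define v where "v = dtgt X (gunit X (src X h)) \<alpha>"
  define \<beta> where "\<beta> = l0 h \<alpha>"
  define \<gamma> where "\<gamma> = l0 g \<beta>"
  have v: "v \<in> T0 (src X h)" unfolding v_def by (rule anchor_in[OF src_in[OF h] \<alpha>])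
  have \<beta>h: "\<beta> \<in> algebroid X (tgt X h)" unfolding \<beta>_def by (rule lambda0_in[OF h \<alpha>])
  have \<beta>: "\<beta> \<in> algebroid X (src X g)" using \<beta>h sg by simp
  have \<gamma>: "\<gamma> \<in> algebroid X (tgt X g)" unfolding \<gamma>_def by (rule lambda0_in[OF g \<beta>])
  have hv: "hl h v = rtrans X h \<beta> + ltrans X h \<alpha>"
    using hlift_anchor[OF h \<alpha>] by (simp add: v_def \<beta>_def)
  have hg: "hl g (l1 h v) = ltrans X g \<beta> + rtrans X g \<gamma>"
    using hlift_anchor[OF g \<beta>] lambda_anchor[OF h \<alpha>] sg by (simp add: v_def \<beta>_def \<gamma>_def)
  note 1 = dcomp_ltrans_rtrans[OF gh \<beta>] and 2 = dcomp_rtrans_ltrans[OF gh \<gamma> \<alpha>]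
  have "dcomp X g h (hl g (l1 h v)) (hl h v) = rtrans X (g \<odot> h) \<gamma> + ltrans X (g \<odot> h) \<alpha>"
    unfolding hv hg dcomp_add[OF 1(1) 2(1)] 1(2) 2(2) by simp
  then have "hl (g \<odot> h) v = rtrans X (g \<odot> h) \<gamma> + ltrans X (g \<odot> h) \<alpha> + rtrans X (g \<odot> h) (curv g h v)"
    using hlift_comp[OF gh v] by simp
  moreover have "rtrans X (g \<odot> h) (\<gamma> + curv g h v) = rtrans X (g \<odot> h) \<gamma> + rtrans X (g \<odot> h) (curv g h v)"
    using rtrans_add[OF gh1] \<gamma> curv_in[OF gh v] t by simp
  ultimately have "hl (g \<odot> h) v = ltrans X (g \<odot> h) \<alpha> + rtrans X (g \<odot> h) (\<gamma> + curv g h v)"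
    by (simp add: algebra_simps)
  then show ?thesis
    using lambda0_unique[OF gh1, of \<alpha> "\<gamma> + curv g h v"] algebroid_add[OF tgt_in[OF g] \<gamma> curv_in[OF gh v]] \<alpha> s t
    by (simp add: v_def \<gamma>_def \<beta>_def)
qed

text \<open>
  Both sides arise as the difference between \<open>\<sigma>\<^sub>g\<^sub>h\<^sub>k(v)\<close> and the product of three lifts, computed with
  the two bracketings. With the second one, the lift at \<open>hk\<close> deviates from the product of the lifts
  by \<open>r\<^sub>h\<^sub>kK(h,k)(v)\<close>, and multiplication by a lift at \<open>g\<close> turns this into the term with \<open>\<lambda>\<^sup>0\<^sub>g\<close>.
\<close>

lemma curv_cocycle:
  assumes gh: "(g, h) \<in> composable X" and hk: "(h, k) \<in> composable X" and v: "v \<in> T0 (src X k)"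
  shows "l0 g (curv h k v) + curv g (h \<odot> k) v = curv (g \<odot> h) k v + curv g h (l1 k v)"
proof -
  have g: "g \<in> G1" and h: "h \<in> G1" and k: "k \<in> G1" and sg: "src X g = tgt X h" and sh: "src X h = tgt X k"
    and gh1: "g \<odot> h \<in> G1" and hk1: "h \<odot> k \<in> G1"
    and s: "src X (g \<odot> h) = src X h" "src X (h \<odot> k) = src X k"
    and t: "tgt X (g \<odot> h) = tgt X g" "tgt X (h \<odot> k) = tgt X h"
    using gh hk comp_in src_comp tgt_comp by (auto simp: composable_iff)
  have ghk: "(g \<odot> h, k) \<in> composable X" "(g, h \<odot> k) \<in> composable X"
    using g h k sg sh gh1 hk1 s t by (auto simp: composable_iff)
  note assoc = comp_assoc[OF gh hk]
  define A where "A = g \<odot> (h \<odot> k)"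
  have A1: "A \<in> G1" and tA: "tgt X A = tgt X g" using comp_in[OF ghk(2)] tgt_comp[OF ghk(2)] by (auto simp: A_def)
  have hkv: "v \<in> T0 (src X (h \<odot> k))" using v s by simp
  have lv: "l1 k v \<in> T0 (src X h)" using lambda1_in[OF k v] sh by simp
  have llv: "l1 h (l1 k v) \<in> T0 (src X g)" using lambda1_in[OF h lv] sg by simp
  note tc1 = tcomposable_hlift[OF hk v] and tc2 = tcomposable_hlift[OF gh lv]
  define Z where "Z = dcomp X (g \<odot> h) k (dcomp X g h (hl g (l1 h (l1 k v))) (hl h (l1 k v))) (hl k v)"
  have Z: "Z = dcomp X g (h \<odot> k) (hl g (l1 h (l1 k v))) (dcomp X h k (hl h (l1 k v)) (hl k v))"
    unfolding Z_def by (rule dcomp_assoc[OF tc2 tc1])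
  note tcA = tcomposable_assoc[OF tc2 tc1]
  have K1: "curv h k v \<in> algebroid X (src X g)" using curv_in[OF hk v] sg by simp
  have K2: "curv (g \<odot> h) k v \<in> algebroid X (tgt X A)" using curv_in[OF ghk(1) v] t tA by simp
  have K3: "curv g (h \<odot> k) v \<in> algebroid X (tgt X A)" using curv_in[OF ghk(2) hkv] tA by simp
  have K4: "curv g h (l1 k v) \<in> algebroid X (tgt X (g \<odot> h))" using curv_in[OF gh lv] t by simp
  have K4A: "curv g h (l1 k v) \<in> algebroid X (tgt X A)" using K4 t tA by simp
  have L: "l0 g (curv h k v) \<in> algebroid X (tgt X A)" using lambda0_in[OF g K1] tA by simp
  \<comment> \<open>the two left factors are multiplied first: \<open>\<sigma>\<^sub>g\<^sub>h(\<lambda>\<^sup>1\<^sub>kv)\<close> is their product up to \<open>K(g,h)\<close>\<close>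
  note r4 = rtrans_dcomp_0[OF ghk(1) K4]
  have "dcomp X (g \<odot> h) k (hl (g \<odot> h) (l1 k v)) (hl k v) = Z + rtrans X A (curv g h (l1 k v))"
    using dcomp_add[OF tcA(1) r4(1)] r4(2) hlift_comp[OF gh lv] by (simp add: Z_def A_def assoc)
  then have left: "hl A v = Z + rtrans X A (curv g h (l1 k v)) + rtrans X A (curv (g \<odot> h) k v)"
    using hlift_comp[OF ghk(1) v] by (simp add: A_def assoc)
  \<comment> \<open>the two right factors are multiplied first; \<open>\<lambda>\<^sup>1\<^sub>h\<^sub>kv\<close> differs from \<open>\<lambda>\<^sup>1\<^sub>h\<lambda>\<^sup>1\<^sub>kv\<close> by an anchor\<close>
  note r1 = dcomp_hlift_anchor_rtrans[OF ghk(2) K1]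
  have a: "dtgt X (gunit X (src X g)) (curv h k v) \<in> T0 (src X g)" by (rule anchor_in[OF src_in[OF g] K1])
  have "hl g (l1 (h \<odot> k) v) = hl g (l1 h (l1 k v)) + hl g (dtgt X (gunit X (src X g)) (curv h k v))"
    using lambda1_curv[OF hk v] hlift_add[OF g llv a] sg by simp
  then have "dcomp X g (h \<odot> k) (hl g (l1 (h \<odot> k) v)) (hl (h \<odot> k) v) = Z + rtrans X A (l0 g (curv h k v))"
    using dcomp_add[OF tcA(2) r1(1)] r1(2) hlift_comp[OF hk v] by (simp add: Z A_def)
  then have right: "hl A v = Z + rtrans X A (l0 g (curv h k v)) + rtrans X A (curv g (h \<odot> k) v)"
    using hlift_comp[OF ghk(2) hkv] by (simp add: A_def)
  show ?thesis
  proof (rule rtrans_inject[OF A1 algebroid_add[OF tgt_in[OF A1] L K3] algebroid_add[OF tgt_in[OF A1] K2 K4A]])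
    show "rtrans X A (l0 g (curv h k v) + curv g (h \<odot> k) v) = rtrans X A (curv (g \<odot> h) k v + curv g h (l1 k v))"
      unfolding rtrans_add[OF A1 L K3] rtrans_add[OF A1 K2 K4A]
      using left right by (simp add: algebra_simps)
  qed
qed

lemma lambda1_unit: "x \<in> G0 \<Longrightarrow> v \<in> T0 x \<Longrightarrow> l1 (gunit X x) v = v"
  by (simp add: lambda1_def hlift_unit dtgt_dunit)

text \<open>
  At a unit the horizontal lift of \<open>\<rho>\<alpha>\<close> is the unit vector \<open>\<alpha>.di(\<alpha>)\<close>, which splits into \<open>\<alpha>.0 + 0.di(\<alpha>)\<close>.
\<close>

lemma lambda0_unit:
  assumes x: "x \<in> G0" and \<alpha>: "\<alpha> \<in> algebroid X x"
  shows "l0 (gunit X x) \<alpha> = \<alpha>"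
proof (rule lambda0_unique[OF unit_in[OF x]])
  let ?u = "gunit X x"
  have u: "?u \<in> G1" and \<alpha>T: "\<alpha> \<in> T1 ?u" and s: "src X ?u = x" "tgt X ?u = x"
    using unit_in[OF x] \<alpha> src_unit[OF x] tgt_unit[OF x] by (auto simp: algebroid_iff)
  show "\<alpha> \<in> algebroid X (src X ?u)" "\<alpha> \<in> algebroid X (tgt X ?u)" using \<alpha> s by auto
  note d = algebroid_dinv[OF x \<alpha>]
  have uu: "(?u, ?u) \<in> composable X" using u s by (simp add: composable_iff)
  have tc: "tcomposable ?u ?u \<alpha> 0" "tcomposable ?u ?u 0 (dinv ?u \<alpha>)"
    using uu \<alpha> d by (auto simp: tcomposable_def algebroid_iff tspace_0[OF atlases(2)] dsrc_0 dtgt_0 u)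
  have "dunit X x (dtgt X ?u \<alpha>) = dcomp X ?u ?u (\<alpha> + 0) (0 + dinv ?u \<alpha>)"
    using dcomp_dinv(2)[OF u \<alpha>T] s by (simp add: inv_unit x)
  also have "\<dots> = dcomp X ?u ?u \<alpha> 0 + dcomp X ?u ?u 0 (dinv ?u \<alpha>)"
    by (rule dcomp_add[OF tc])
  also have "\<dots> = rtrans X ?u \<alpha> + ltrans X ?u \<alpha>"
    using rtrans_eq[OF u, of \<alpha>] ltrans_eq[OF u, of \<alpha>] \<alpha> s by simp
  finally show "hl ?u (dtgt X (gunit X (src X ?u)) \<alpha>) = ltrans X ?u \<alpha> + rtrans X ?u \<alpha>"
    using hlift_unit[OF x anchor_in[OF x \<alpha>]] s by (simp add: add.commute)
qed

end


section \<open>Smoothness of the connection and of the quasi action\<close>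

context connection
begin

lemma H_sum:
  assumes g: "g \<in> G1" and f: "\<And>i. i \<in> I \<Longrightarrow> (g, f i) \<in> H"
  shows "(g, sum f I) \<in> H"
proof -
  have "(g, tscale 0 (hl g 0)) \<in> H"
    by (rule H_tscale[OF hlift_H[OF g tspace_0[OF atlases(1)]]])
  then have 0: "(g, 0) \<in> H" by (simp add: tscale_def zero_fun_def)
  show ?thesis using f
    by (induction I rule: infinite_finite_induct) (auto intro: 0 H_add)
qed

lemma sum_fun_apply: "(sum f I :: 'a \<Rightarrow> 'b::comm_monoid_add) k = (\<Sum>i\<in>I. f i k)"
  by (induction I rule: infinite_finite_induct) auto

text \<open>
  Sections of \<open>H\<close> through the lifts of a basis at one point are mapped by \<open>ds\<close> to vector fields that
  remain a frame nearby. The lift of a vector is the combination of the sections with the coefficients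
  of the vector in this frame, and these depend smoothly on the point by \<open>Cinf_on_inverse_family\<close>.
\<close>

lemma hlift_local:
  assumes g0: "g0 \<in> G1" and U: "(U, c) \<in> arr X" "g0 \<in> U" and V: "(V, d) \<in> obj X" "src X g0 \<in> V"
  obtains W \<Sigma> where "open W" "c g0 \<in> W" "\<And>y. y \<in> W \<Longrightarrow> linear (\<Sigma> y)" "\<And>b. Cinf_on (\<lambda>y. \<Sigma> y b) W"
    "\<And>g v. g \<in> U \<Longrightarrow> c g \<in> W \<Longrightarrow> v \<in> T0 (src X g) \<Longrightarrow> hl g v (U, c) = \<Sigma> (c g) (v (V, d))"
proof -
  note A1 = atlases(2) and A0 = atlases(1)
  obtain K N \<Phi> where K: "g0 \<in> N" and lt: "local_trivialization (arr X) (tangent_subbundle (arr X) H) K N \<Phi>"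
    by (rule H_trivialization[OF g0])
  let ?D = "{e \<in> H. fst e \<in> N}" and ?f = "\<lambda>e. (fst e, \<Phi> e)"
  have N: "mopen (arr X) N" and diff: "diffeo (tangent (arr X)) ?D (prod_atlas (arr X) model_atlas) (N \<times> K) ?f"
    using lt by (simp_all add: local_trivialization_def tangent_subbundle_def)
  let ?\<Psi> = "inv_into ?D ?f"
  have bij: "bij_betw ?f ?D (N \<times> K)" and sm: "smooth_map (prod_atlas (arr X) model_atlas) (tangent (arr X)) (N \<times> K) ?\<Psi>"
    using diff by (auto simp: diffeo_def)
  have \<Psi>: "?\<Psi> (g, k) \<in> H \<and> fst (?\<Psi> (g, k)) = g" if "g \<in> N" "k \<in> K" for g k
  proof -
    have gk: "(g, k) \<in> ?f ` ?D" using bij that by (simp add: bij_betw_def)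
    show ?thesis using inv_into_into[OF gk] f_inv_into_f[OF gk] by auto
  qed
  have NG: "N \<subseteq> G1" using N by (simp add: mopen_def)
  \<comment> \<open>sections of \<open>H\<close> whose values at \<open>g0\<close> lift the coordinate basis\<close>
  let ?w = "\<lambda>b. hl g0 (tvec_of (obj X) V d (src X g0) b)"
  have tv: "tvec_of (obj X) V d (src X g0) b \<in> T0 (src X g0)" for b by (rule tvec_of_tspace[OF A0 V])
  define k where "k b = \<Phi> (g0, ?w b)" for b
  have w_D: "(g0, ?w b) \<in> ?D" for b using hlift_H[OF g0 tv] K by simp
  have kK: "k b \<in> K" for b using bij_betw_apply[OF bij w_D[of b]] by (simp add: k_def)
  define s where "s b g = snd (?\<Psi> (g, k b))" for b g
  have s_eq: "?\<Psi> (g, k b) = (g, s b g)" if "g \<in> N" for b g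
    using \<Psi>[OF that kK] by (simp add: s_def prod_eq_iff)
  have sH: "(g, s b g) \<in> H" if "g \<in> N" for b g using \<Psi>[OF that kK, of b] s_eq[OF that, of b] by simp
  have s0: "s b g0 = ?w b" for b
    using inv_into_f_f[OF bij_betw_imp_inj_on[OF bij] w_D[of b]] by (simp add: s_def k_def)
  have smooth_s: "smooth_map (arr X) (tangent (arr X)) N (\<lambda>g. (g, s b g))" for b
  proof -
    have "smooth_map (arr X) (tangent (arr X)) N (\<lambda>g. ?\<Psi> (g, k b))"
      by (rule smooth_map_compose[OF A1 smooth_atlas_prod[OF A1 smooth_atlas_model] smooth_atlas_tangent[OF A1]
            smooth_map_Pair[OF A1 A1 smooth_atlas_model smooth_map_id[OF NG] smooth_map_const[OF NG]] sm])
        (use kK in auto)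
    then show ?thesis by (rule smooth_map_cong) (rule s_eq)
  qed
  have "\<exists>W G. open W \<and> c g0 \<in> W \<and> Cinf_on G W \<and> (\<forall>y. y \<in> N \<longrightarrow> y \<in> U \<longrightarrow> c y \<in> W \<longrightarrow> s b y (U, c) = G (c y))" for b
  proof -
    obtain W G where "open W" "c g0 \<in> W" "Cinf_on G W"
      "\<And>y. y \<in> N \<Longrightarrow> y \<in> U \<Longrightarrow> c y \<in> W \<Longrightarrow> y \<in> U \<and> s b y \<in> T1 y \<and> s b y (U, c) = G (c y)"
      by (rule smooth_map_tangentE[OF A1 A1 smooth_s[of b] K U U]; blast)
    then show ?thesis by blast
  qed
  then obtain Wb G where Wb: "\<And>b. open (Wb b)" "\<And>b. c g0 \<in> Wb b" "\<And>b. Cinf_on (G b) (Wb b)"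
    and G: "\<And>b y. y \<in> N \<Longrightarrow> y \<in> U \<Longrightarrow> c y \<in> Wb b \<Longrightarrow> s b y (U, c) = G b (c y)"
    by metis
  obtain W1 F where W1: "open W1" "c g0 \<in> W1" "Cinf_on F W1"
    and F: "\<And>y. y \<in> G1 \<Longrightarrow> y \<in> U \<Longrightarrow> c y \<in> W1 \<Longrightarrow> src X y \<in> V \<and> d (src X y) = F (c y)"
    by (rule smooth_mapE[OF A1 A0 smooth_src g0 U V]; blast)
  let ?W0 = "W1 \<inter> c ` (N \<inter> U) \<inter> (\<Inter>b\<in>(fbasis :: 'd set). Wb b)"
  have oW0: "open ?W0"
    using W1(1) N U(1) Wb(1) finite_fbasis unfolding mopen_def by blast
  have g0W0: "c g0 \<in> ?W0" using W1(2) K U(2) Wb(2) by blast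
  have dF: "linear (frechet_derivative F (at y))" if "y \<in> W1" for y
    by (rule Cinf_on_linear_derivative[OF W1(3) that])
  have dsrc_coord: "dsrc X g w (V, d) = frechet_derivative F (at (c g)) (w (U, c))"
    if "g \<in> U" "c g \<in> W1" "w \<in> T1 g" for g w
    unfolding dsrc_def
    by (rule tmap_coord[OF A1 A0 smooth_src carrierI[OF U(1) that(1)] that(3) U(1) that(1) V(1) W1(1) that(2) W1(3) F])
  define B where "B y e = (\<Sum>b\<in>fbasis. fcoord b e *\<^sub>R G b y)" for y and e :: 'd
  have linB: "linear (B y)" for y unfolding B_def
    by (rule linearI) (simp_all add: linear_add[OF linear_fcoord] linear_cmul[OF linear_fcoord]
      scaleR_add_left sum.distrib scaleR_sum_right)
  have CB: "Cinf_on (\<lambda>y. B y e) ?W0" for e unfolding B_def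
    by (rule Cinf_on_sum[OF oW0 Cinf_on_scaleR[OF oW0 Cinf_on_const Cinf_on_subset[OF Wb(3)]]]) blast
  define T where "T y e = frechet_derivative F (at y) (B y e)" for y e
  have linT: "linear (T y)" if "y \<in> ?W0" for y
    unfolding T_def using linear_compose[OF linB dF[of y]] that by (simp add: o_def)
  have CT: "Cinf_on (\<lambda>y. T y e) ?W0" for e unfolding T_def
    by (rule Cinf_on_family_apply[OF oW0 dF Cinf_on_subset[OF Cinf_on_derivative[OF W1(3)]] CB]) auto
  have T0: "T (c g0) e = e" for e
  proof -
    have "frechet_derivative F (at (c g0)) (G b (c g0)) = b" if "b \<in> fbasis" for b
    proof -
      have "G b (c g0) = ?w b (U, c)" using G[OF K U(2) Wb(2), of b] s0[of b] by simp
      then show ?thesis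
        using dsrc_coord[OF U(2) W1(2) hlift_in[OF g0 tv, of b]] dsrc_hlift[OF g0 tv, of b] tvec_of_coord[OF A0 V]
        by simp
    qed
    then show ?thesis
      using fcoord_expand[of e] by (simp add: T_def B_def linear_sum[OF dF[OF W1(2)]] linear_cmul[OF dF[OF W1(2)]])
  qed
  obtain r where r: "r > 0" "ball (c g0) r \<subseteq> ?W0"
    and near: "\<And>y w. y \<in> ball (c g0) r \<Longrightarrow> norm (T y w - w) \<le> norm w / 2"
  proof -
    from eventually_near_identity[OF oW0 g0W0 linT Cinf_on_continuous_on[OF CT] T0] obtain r
      where "r > 0 \<and> ball (c g0) r \<subseteq> ?W0 \<and> (\<forall>y\<in>ball (c g0) r. \<forall>w. norm (T y w - w) \<le> norm w / 2)"
      by (rule exE)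
    then show thesis by (intro that[of r]) simp_all
  qed
  let ?W = "ball (c g0) r"
  define S where "S y = inv (T y)" for y
  have linTW: "linear (T y)" if "y \<in> ?W" for y using linT r(2) that by blast
  have TS: "T y (S y e) = e" if "y \<in> ?W" for y e
    unfolding S_def using near_identity_bij[OF linTW[OF that] near[OF that]] by (simp add: bij_def surj_f_inv_f)
  note inv = Cinf_on_inverse_family[of ?W T S, OF open_ball linTW Cinf_on_subset[OF CT r(2)] near TS]
  have linS: "linear (S y)" if "y \<in> ?W" for y by (rule inv(1)) (use that in auto)
  have CS: "Cinf_on (\<lambda>y. S y e) ?W" for e by (rule inv(2)) auto
  show thesis
  proof (rule that[of ?W "\<lambda>y e. B y (S y e)"])
    show "open ?W" "c g0 \<in> ?W" using r(1) by auto
    show "linear (\<lambda>e. B y (S y e))" if "y \<in> ?W" for y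
      using linear_compose[OF linS[OF that] linB[of y]] by (simp add: o_def)
    show "Cinf_on (\<lambda>y. B y (S y e)) ?W" for e
      by (rule Cinf_on_family_apply[OF open_ball linB Cinf_on_subset[OF CB r(2)] CS])
    fix g v assume g: "g \<in> U" "c g \<in> ?W" and v: "v \<in> T0 (src X g)"
    have cW: "c g \<in> W1" "c g \<in> c ` (N \<inter> U)" "\<And>b. b \<in> fbasis \<Longrightarrow> c g \<in> Wb b"
      using subsetD[OF r(2) g(2)] by auto
    from cW(2) obtain g' where "g' \<in> N \<inter> U" "c g = c g'" by blast
    then have gN: "g \<in> N" using inj_onD[OF chart_inj[OF A1 U(1)]] g(1) by auto
    have gG: "g \<in> G1" by (rule carrierI[OF U(1) g(1)])
    define e where "e = S (c g) (v (V, d))"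
    define w where "w = (\<Sum>b\<in>fbasis. tscale (fcoord b e) (s b g))"
    have wH: "(g, w) \<in> H" unfolding w_def by (rule H_sum[OF gG H_tscale[OF sH[OF gN]]])
    then have wT: "w \<in> T1 g" using H_in by blast
    have wc: "w (U, c) = B (c g) e"
      unfolding w_def B_def sum_fun_apply
      by (rule sum.cong[OF refl]) (use G[OF gN g(1)] cW in \<open>simp add: tscale_apply\<close>)
    have "dsrc X g w (V, d) = v (V, d)"
      using dsrc_coord[OF g(1) _ wT] cW TS[OF g(2)] by (simp add: wc T_def e_def)
    moreover have "src X g \<in> V" using F[OF gG g(1)] cW by blast
    ultimately have "dsrc X g w = v" by (intro tspace_eqI[OF dsrc_in[OF gG wT] v V(1)])
    then show "hl g v (U, c) = B (c g) (S (c g) (v (V, d)))"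
      using hlift_unique[OF wH] wc by (simp add: e_def)
  qed
qed

context
  fixes Z :: "('z, 'f::finite_dim_normed) atlas" and S :: "'z set"
  assumes Z: "smooth_atlas Z"
begin

lemma smooth_map_hlift:
  assumes g: "smooth_map Z (arr X) S g" and v: "smooth_map Z (tangent (obj X)) S (\<lambda>z. (src X (g z), v z))"
  shows "smooth_map Z (tangent (arr X)) S (\<lambda>z. (g z, hl (g z) (v z)))"
proof (rule smooth_map_tangentI[OF Z atlases(2) g])
  note A1 = atlases(2) and A0 = atlases(1)
  fix z assume z: "z \<in> S"
  have gz: "g z \<in> G1" using smooth_map_carrier[OF g z] by simp
  note vz = conjunct2[OF smooth_map_tangent_in[OF v z]]
  show "hl (g z) (v z) \<in> T1 (g z)" by (rule hlift_in[OF gz vz])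
  obtain A a where A: "(A, a) \<in> Z" "z \<in> A" using smooth_map_carrier[OF g z] by (blast elim: carrierE)
  obtain U c where U: "(U, c) \<in> arr X" "g z \<in> U" using gz by (rule carrierE)
  obtain V d where V: "(V, d) \<in> obj X" "src X (g z) \<in> V" using src_in[OF gz] by (rule carrierE)
  obtain W \<Sigma> where W: "open W" "c (g z) \<in> W" and \<Sigma>: "\<And>y. y \<in> W \<Longrightarrow> linear (\<Sigma> y)" "\<And>b. Cinf_on (\<lambda>y. \<Sigma> y b) W"
    and hl: "\<And>g v. g \<in> U \<Longrightarrow> c g \<in> W \<Longrightarrow> v \<in> T0 (src X g) \<Longrightarrow> hl g v (U, c) = \<Sigma> (c g) (v (V, d))"
    by (rule hlift_local[OF gz U V]; blast)
  obtain W1 F where W1: "open W1" "a z \<in> W1" "Cinf_on F W1"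
      and F: "\<And>y. y \<in> S \<Longrightarrow> y \<in> A \<Longrightarrow> a y \<in> W1 \<Longrightarrow> g y \<in> U \<and> c (g y) = F (a y)"
    by (rule smooth_mapE[OF Z A1 g z A U]; blast)
  obtain W2 G where W2: "open W2" "a z \<in> W2" "Cinf_on G W2" and G: "\<And>y. y \<in> S \<Longrightarrow> y \<in> A \<Longrightarrow> a y \<in> W2 \<Longrightarrow>
      src X (g y) \<in> V \<and> v y \<in> T0 (src X (g y)) \<and> v y (V, d) = G (a y)"
    by (rule smooth_map_tangentE[OF Z A0 v z A V]; blast)
  let ?O = "W2 \<inter> (W1 \<inter> F -` W)"
  have o: "open ?O" using W2(1) open_vimage_Int[OF Cinf_on_continuous_on[OF W1(3)] W1(1) W(1)] by blast
  let ?G = "\<lambda>y. \<Sigma> (F y) (G y)"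
  have "Cinf_on ?G ?O"
  proof (rule Cinf_on_family_apply[OF o _ _ Cinf_on_subset[OF W2(3)]])
    show "linear (\<Sigma> (F y))" if "y \<in> ?O" for y using \<Sigma>(1) that by blast
    show "Cinf_on (\<lambda>y. \<Sigma> (F y) b) ?O" for b
      by (rule Cinf_on_compose[OF \<Sigma>(2) Cinf_on_subset[OF W1(3)] o]) auto
  qed auto
  moreover have "a z \<in> ?O" using W1(2) W2(2) W(2) F[OF z A(2) W1(2)] by auto
  moreover have "hl (g y) (v y) (U, c) = ?G (a y)" if y: "y \<in> S" "y \<in> A" "a y \<in> ?O" for y
    using F[OF y(1,2)] G[OF y(1,2)] hl[of "g y" "v y"] y(3) by auto
  ultimately show "coord_smooth_at Z (arr X) S g (\<lambda>y. hl (g y) (v y)) z"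
    using A U o by (intro coord_smooth_atI[of A a _ _ U c _ _ ?O ?G]) auto
qed

lemma smooth_map_vpart:
  assumes w: "smooth_map Z (tangent (arr X)) S (\<lambda>z. (g z, w z))"
  shows "smooth_map Z (tangent (arr X)) S (\<lambda>z. (gunit X (tgt X (g z)), vp (g z) (w z)))"
proof -
  note A1 = atlases(2) and A0 = atlases(1)
  note g = smooth_map_base[OF Z A1 w]
  have gi: "smooth_map Z (arr X) S (\<lambda>z. ginv X (g z))"
    by (rule smooth_map_compose[OF Z A1 A1 g smooth_inv]) (use smooth_map_carrier[OF g] in blast)
  have w_in: "g z \<in> G1" "w z \<in> T1 (g z)" if "z \<in> S" for z using smooth_map_tangent_in[OF w that] by auto
  note ds = smooth_map_tmap[OF Z A1 A0 smooth_src w, folded dsrc_def]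
  note df = smooth_map_tangent_diff[OF Z A1 w smooth_map_hlift[OF g ds]]
  have "smooth_map Z (tangent (arr X)) S (\<lambda>z. (g z \<odot> ginv X (g z), dcomp X (g z) (ginv X (g z)) (w z - hl (g z) (dsrc X (g z) (w z))) 0))"
  proof (rule smooth_map_dcomp[OF Z df smooth_map_zero[OF Z A1 gi]])
    fix z assume z: "z \<in> S"
    note s = dsrc_in[OF w_in[OF z]]
    show "tcomposable (g z) (ginv X (g z)) (w z - hl (g z) (dsrc X (g z) (w z))) 0"
      using w_in[OF z] hlift_in[OF _ s] dsrc_hlift[OF _ s]
      by (simp add: tcomposable_def inv_composable tspace_0[OF A1] tspace_diff[OF A1] dtgt_0 inv_in dsrc_diff)
  qed
  then show ?thesis
    by (rule smooth_map_cong) (simp add: comp_inv w_in vpart_eq)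
qed

lemma smooth_map_lambda0:
  assumes g: "smooth_map Z (arr X) S g"
    and \<alpha>: "smooth_map Z (tangent (arr X)) S (\<lambda>z. (gunit X (src X (g z)), \<alpha> z))"
    and in_A: "\<And>z. z \<in> S \<Longrightarrow> \<alpha> z \<in> algebroid X (src X (g z))"
  shows "smooth_map Z (tangent (arr X)) S (\<lambda>z. (gunit X (tgt X (g z)), l0 (g z) (\<alpha> z)))"
proof -
  note A1 = atlases(2)
  have gz: "g z \<in> G1" if "z \<in> S" for z using smooth_map_carrier[OF g that] by simp
  have di: "smooth_map Z (tangent (arr X)) S (\<lambda>z. (gunit X (src X (g z)), dinv (gunit X (src X (g z))) (\<alpha> z)))"
    by (rule smooth_map_cong[OF smooth_map_tmap[OF Z A1 A1 smooth_inv \<alpha>]]) (simp add: inv_unit src_in gz)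
  have "smooth_map Z (tangent (arr X)) S (\<lambda>z. (g z \<odot> gunit X (src X (g z)),
      dcomp X (g z) (gunit X (src X (g z))) 0 (dinv (gunit X (src X (g z))) (\<alpha> z))))"
    by (rule smooth_map_dcomp[OF Z smooth_map_zero[OF Z A1 g] di]) (rule tcomposable_ltrans[OF gz in_A])
  then have "smooth_map Z (tangent (arr X)) S (\<lambda>z. (g z, ltrans X (g z) (\<alpha> z)))"
    by (rule smooth_map_cong) (simp add: comp_unit gz ltrans_eq in_A)
  from smooth_map_tangent_minus[OF Z A1 smooth_map_vpart[OF this]]
  show ?thesis by (simp add: lambda0_def)
qed

lemma smooth_map_lambda1:
  assumes g: "smooth_map Z (arr X) S g" and v: "smooth_map Z (tangent (obj X)) S (\<lambda>z. (src X (g z), v z))"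
  shows "smooth_map Z (tangent (obj X)) S (\<lambda>z. (tgt X (g z), l1 (g z) (v z)))"
  using smooth_map_tmap[OF Z atlases(2,1) smooth_tgt smooth_map_hlift[OF g v]]
  by (simp add: lambda1_def dtgt_def)

lemma smooth_map_curv:
  assumes g: "smooth_map Z (arr X) S g" and h: "smooth_map Z (arr X) S h"
    and v: "smooth_map Z (tangent (obj X)) S (\<lambda>z. (src X (h z), v z))"
    and gh: "\<And>z. z \<in> S \<Longrightarrow> (g z, h z) \<in> composable X"
  shows "smooth_map Z (tangent (arr X)) S (\<lambda>z. (gunit X (tgt X (g z)), curv (g z) (h z) (v z)))"
proof -
  note A1 = atlases(2)
  have vz: "v z \<in> T0 (src X (h z))" if "z \<in> S" for z using smooth_map_tangent_in[OF v that] by simp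
  have "smooth_map Z (tangent (obj X)) S (\<lambda>z. (src X (g z), l1 (h z) (v z)))"
    by (rule smooth_map_cong[OF smooth_map_lambda1[OF h v]]) (use gh in \<open>simp add: composable_iff\<close>)
  note X = smooth_map_dcomp[OF Z smooth_map_hlift[OF g this] smooth_map_hlift[OF h v] tcomposable_hlift[OF gh vz]]
  from smooth_map_tangent_minus[OF Z A1 smooth_map_vpart[OF X]]
  have "smooth_map Z (tangent (arr X)) S (\<lambda>z. (gunit X (tgt X (g z \<odot> h z)), curv (g z) (h z) (v z)))"
    by (simp add: basic_curvature_def)
  then show ?thesis by (rule smooth_map_cong) (simp add: tgt_comp gh)
qed

end

end


section \<open>Pullbacks of subbundles of a tangent bundle\<close>

text \<open>
  Both bundles over \<open>P\<close> have this form, with \<open>Y\<close> the manifold of arrows or of objects.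
\<close>

definition tangent_family_bundle ::
    "('p, 'c::real_normed_vector) atlas \<Rightarrow> ('y, 'e::real_normed_vector) atlas \<Rightarrow> ('p \<Rightarrow> 'y)
      \<Rightarrow> ('p \<Rightarrow> ('y, 'e) tvec set) \<Rightarrow> ('p \<times> 'y \<times> ('y, 'e) tvec, 'c \<times> 'e \<times> 'e, 'p) vbundle" where
  "tangent_family_bundle P Y f F =
     \<lparr>ambient = prod_atlas P (tangent Y),
      total = {(p, y, v). p \<in> carrier P \<and> y = f p \<and> v \<in> F p},
      proj = fst,
      vadd = (\<lambda>(p, u, \<alpha>) (q, w, \<beta>). (p, u, \<alpha> + \<beta>)),
      vscale = (\<lambda>r (p, u, \<alpha>). (p, u, tscale r \<alpha>))\<rparr>"

text \<open>
  A chart of \<open>Y\<close> turns the fibres into subspaces of the model space; the smooth family \<open>T\<close> moves them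
  to the fixed subspace \<open>V\<close>, with \<open>S\<close> as inverse there. The typical fibre sits in the last factor of
  the model space of the ambient manifold.
\<close>

lemma tangent_family_local_trivialization:
  fixes P :: "('p, 'c::finite_dim_normed) atlas" and Y :: "('y, 'e::finite_dim_normed) atlas"
  assumes P: "smooth_atlas P" and Y: "smooth_atlas Y" and f: "smooth_map P Y (carrier P) f"
    and F: "\<And>p. p \<in> carrier P \<Longrightarrow> F p \<subseteq> tspace Y (f p)"
    and F_add: "\<And>p v w. p \<in> carrier P \<Longrightarrow> v \<in> F p \<Longrightarrow> w \<in> F p \<Longrightarrow> v + w \<in> F p"
    and F_tscale: "\<And>p v r. p \<in> carrier P \<Longrightarrow> v \<in> F p \<Longrightarrow> tscale r v \<in> F p"
    and U: "(U, c) \<in> Y" and W: "open W"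
    and T: "\<And>y. y \<in> W \<Longrightarrow> linear (T y)" "\<And>b. Cinf_on (\<lambda>y. T y b) W"
    and S: "\<And>y. y \<in> W \<Longrightarrow> linear (S y)" "\<And>b. Cinf_on (\<lambda>y. S y b) W"
    and TF: "\<And>p v. p \<in> carrier P \<Longrightarrow> f p \<in> U \<Longrightarrow> c (f p) \<in> W \<Longrightarrow> v \<in> F p \<Longrightarrow>
      T (c (f p)) (v (U, c)) \<in> V \<and> S (c (f p)) (T (c (f p)) (v (U, c))) = v (U, c)"
    and SV: "\<And>p k. p \<in> carrier P \<Longrightarrow> f p \<in> U \<Longrightarrow> c (f p) \<in> W \<Longrightarrow> k \<in> V \<Longrightarrow>
      tvec_of Y U c (f p) (S (c (f p)) k) \<in> F p \<and> T (c (f p)) (S (c (f p)) k) = k"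
  shows "local_trivialization P (tangent_family_bundle P Y f F) ({0} \<times> {0} \<times> V)
    {p \<in> carrier P. f p \<in> {y \<in> U. c y \<in> W}} (\<lambda>(p, y, v). (0, 0, T (c y) (v (U, c))))"
proof -
  let ?E = "tangent_family_bundle P Y f F"
  let ?N = "{p \<in> carrier P. f p \<in> {y \<in> U. c y \<in> W}}"
  let ?V = "{0 :: 'c} \<times> {0 :: 'e} \<times> V"
  let ?\<Phi> = "\<lambda>(p, y, v). (0 :: 'c, 0 :: 'e, T (c y) (v (U, c)))"
  let ?D = "{e \<in> total ?E. proj ?E e \<in> ?N}"
  let ?f = "\<lambda>e. (proj ?E e, ?\<Phi> e)"
  let ?g = "\<lambda>(p, k). (p, f p, tvec_of Y U c (f p) (S (c (f p)) (snd (snd k))))"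
  note TY = smooth_atlas_tangent[OF Y]
  note PTY = smooth_atlas_prod[OF P TY]
  note M = smooth_atlas_model
  note PM = smooth_atlas_prod[OF P M]
  have N: "mopen P ?N"
    by (rule mopen_preimage[OF P Y f mopen_carrier[OF P] mopen_chart_preimage[OF Y U W]])
  have D: "?D = {(p, y, v). p \<in> ?N \<and> y = f p \<and> v \<in> F p}"
    by (auto simp: tangent_family_bundle_def)
  have bij: "bij_betw ?f ?D (?N \<times> ?V)" and inv: "\<And>z. z \<in> ?N \<times> ?V \<Longrightarrow> ?g z = inv_into ?D ?f z"
  proof -
    have fD: "?f e \<in> ?N \<times> ?V" "?g (?f e) = e" if e: "e \<in> ?D" for e
    proof -
      obtain p v where p: "e = (p, f p, v)" "p \<in> carrier P" "f p \<in> U" "c (f p) \<in> W" "v \<in> F p"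
        using e unfolding D by blast
      have v: "v \<in> tspace Y (f p)" using F p by blast
      show "?f e \<in> ?N \<times> ?V" using TF[OF p(2-5)] p by (simp add: tangent_family_bundle_def)
      have "tvec_of Y U c (f p) (S (c (f p)) (T (c (f p)) (v (U, c)))) = v"
        using TF[OF p(2-5)] tspace_eqI[OF tvec_of_tspace[OF Y U p(3)] v U p(3)] tvec_of_coord[OF Y U p(3)] by simp
      then show "?g (?f e) = e" using p(1) by (simp add: tangent_family_bundle_def)
    qed
    have gN: "?g z \<in> ?D" "?f (?g z) = z" if z: "z \<in> ?N \<times> ?V" for z
    proof -
      obtain p k where p: "z = (p, 0, 0, k)" "p \<in> carrier P" "f p \<in> U" "c (f p) \<in> W" "k \<in> V"
        using z by blast
      show "?g z \<in> ?D" unfolding D using SV[OF p(2-5)] p by simp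
      show "?f (?g z) = z" using SV[OF p(2-5)] p tvec_of_coord[OF Y U p(3)]
        by (simp add: tangent_family_bundle_def)
    qed
    show bij: "bij_betw ?f ?D (?N \<times> ?V)"
    proof (rule bij_betwI[of _ _ _ ?g])
      show "?f \<in> ?D \<rightarrow> ?N \<times> ?V" by (rule Pi_I) (rule fD(1))
      show "?g \<in> ?N \<times> ?V \<rightarrow> ?D" by (rule Pi_I) (rule gN(1))
    qed (rule fD(2) gN(2); assumption)+
    show "?g z = inv_into ?D ?f z" if z: "z \<in> ?N \<times> ?V" for z
      using inv_into_f_eq[OF bij_betw_imp_inj_on[OF bij] gN(1)[OF z] gN(2)[OF z]] by simp
  qed
  have DS: "?D \<subseteq> carrier P \<times> carrier (tangent Y)"
    using F carrierI[OF U] unfolding D carrier_tangent by blast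
  have smooth_f: "smooth_map (prod_atlas P (tangent Y)) (prod_atlas P model_atlas) ?D ?f"
  proof -
    have oW: "open (W \<times> (UNIV :: 'e set))" using W by (simp add: open_Times)
    have "Cinf_on (\<lambda>z. (0 :: 'c, 0 :: 'e, (\<lambda>(y, v). T y v) z)) (W \<times> UNIV)"
      by (rule Cinf_on_Pair[OF oW Cinf_on_const Cinf_on_Pair[OF oW Cinf_on_const Cinf_on_family[OF W T]]])
    note CT = smooth_map_Cinf[OF oW this]
    have sndD: "smooth_map (prod_atlas P (tangent Y)) (tangent Y) ?D snd" by (rule smooth_map_snd[OF DS])
    have "smooth_map (prod_atlas P (tangent Y)) model_atlas ?D (\<lambda>e. tchart U c (snd e))"
      by (rule smooth_map_compose[OF PTY TY M sndD smooth_map_chart[OF tangent_chartI[OF U]]])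
        (unfold D, use subsetD[OF F] in auto)
    note tc = this
    have im: "(\<lambda>e. tchart U c (snd e)) ` ?D \<subseteq> W \<times> UNIV" unfolding D by auto
    from smooth_map_compose[OF PTY M M tc CT im]
    have "smooth_map (prod_atlas P (tangent Y)) model_atlas ?D
        (\<lambda>e. (0 :: 'c, 0 :: 'e, (\<lambda>(y, v). T y v) (tchart U c (snd e))))" .
    from smooth_map_Pair[OF PTY P M smooth_map_fst[OF DS] this]
    show ?thesis by (rule smooth_map_cong) (auto simp: tangent_family_bundle_def)
  qed
  have smooth_g: "smooth_map (prod_atlas P model_atlas) (prod_atlas P (tangent Y)) (?N \<times> ?V) ?g"
  proof -
    have sub: "?N \<times> ?V \<subseteq> carrier P \<times> carrier model_atlas" by auto
    note p1 = smooth_map_fst[OF sub] and p2 = smooth_map_snd[OF sub]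
    have fp: "smooth_map (prod_atlas P model_atlas) Y (?N \<times> ?V) (\<lambda>z. f (fst z))"
      by (rule smooth_map_compose[OF PM P Y p1 f]) auto
    have cf: "smooth_map (prod_atlas P model_atlas) model_atlas (?N \<times> ?V) (\<lambda>z. c (f (fst z)))"
      by (rule smooth_map_compose[OF PM Y M fp smooth_map_chart[OF U]]) auto
    have "Cinf_on (\<lambda>k :: 'c \<times> 'e \<times> 'e. snd (snd k)) UNIV"
      by (intro Cinf_on_bounded_linear bounded_linear_compose[OF bounded_linear_snd bounded_linear_snd])
    from smooth_map_compose[OF PM M M p2 smooth_map_Cinf[OF open_UNIV this]]
    have kk: "smooth_map (prod_atlas P model_atlas) model_atlas (?N \<times> ?V) (\<lambda>z. snd (snd (snd z)))" by simp
    have oW: "open (W \<times> (UNIV :: 'e set))" using W by (simp add: open_Times)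
    note CS = smooth_map_Cinf[OF oW Cinf_on_family[OF W S]]
    have im: "(\<lambda>z. (c (f (fst z)), snd (snd (snd z)))) ` (?N \<times> ?V) \<subseteq> W \<times> UNIV" by auto
    from smooth_map_compose[OF PM M M smooth_map_Pair[OF PM M M cf kk, unfolded prod_atlas_model] CS im]
    have e: "smooth_map (prod_atlas P model_atlas) model_atlas (?N \<times> ?V) (\<lambda>z. S (c (f (fst z))) (snd (snd (snd z))))"
      by simp
    have im: "(\<lambda>z. f (fst z)) ` (?N \<times> ?V) \<subseteq> U" by auto
    from smooth_map_Pair[OF PM P TY p1 smooth_map_tvec_of[OF PM Y fp U im e]]
    have "smooth_map (prod_atlas P model_atlas) (prod_atlas P (tangent Y)) (?N \<times> ?V)
      (\<lambda>z. (fst z, f (fst z), tvec_of Y U c (f (fst z)) (S (c (f (fst z))) (snd (snd (snd z))))))" .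
    then show ?thesis by (simp add: case_prod_unfold)
  qed
  have diff: "diffeo (ambient ?E) ?D (prod_atlas P model_atlas) (?N \<times> ?V) ?f"
    unfolding diffeo_def
    using bij smooth_f smooth_map_cong[OF smooth_g inv] by (simp add: tangent_family_bundle_def)
  have fib: "fibre ?E p = {(p, f p, v) | v. v \<in> F p}" if "p \<in> ?N" for p
    using that by (auto simp: fibre_def tangent_family_bundle_def)
  show ?thesis
    unfolding local_trivialization_def
  proof (intro conjI N diff ballI allI)
    fix p e e' r assume p: "p \<in> ?N" and e: "e \<in> fibre ?E p"
    obtain v where v: "e = (p, f p, v)" "v \<in> F p" using e unfolding fib[OF p] by blast
    have lin: "linear (T (c (f p)))" using T(1) p by blast
    have p': "p \<in> carrier P" using p by blast
    show "vscale ?E r e \<in> fibre ?E p"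
      unfolding fib[OF p] using v F_tscale[OF p' v(2)] by (simp add: tangent_family_bundle_def)
    show "?\<Phi> (vscale ?E r e) = r *\<^sub>R ?\<Phi> e"
      using v by (simp add: tangent_family_bundle_def tscale_apply linear_cmul[OF lin])
    assume "e' \<in> fibre ?E p"
    then obtain v' where v': "e' = (p, f p, v')" "v' \<in> F p" unfolding fib[OF p] by blast
    show "vadd ?E e e' \<in> fibre ?E p"
      unfolding fib[OF p] using v v' F_add[OF p' v(2) v'(2)] by (simp add: tangent_family_bundle_def)
    show "?\<Phi> (vadd ?E e e') = ?\<Phi> e + ?\<Phi> e'"
      using v v' by (simp add: tangent_family_bundle_def linear_add[OF lin])
  qed
qed

lemma tangent_family_vector_bundle:
  fixes P :: "('p, 'c::finite_dim_normed) atlas" and Y :: "('y, 'e::finite_dim_normed) atlas"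
  assumes P: "manifold P" and Y: "manifold Y" and f: "smooth_map P Y (carrier P) f"
    and F: "\<And>p. p \<in> carrier P \<Longrightarrow> F p \<subseteq> tspace Y (f p)"
    and V: "subspace V"
    and loc: "\<And>p. p \<in> carrier P \<Longrightarrow> \<exists>U \<Phi>. p \<in> U \<and>
      local_trivialization P (tangent_family_bundle P Y f F) ({0} \<times> {0} \<times> V) U \<Phi>"
  shows "vector_bundle P (tangent_family_bundle P Y f F)"
proof -
  have sub: "{(p, y, v). p \<in> carrier P \<and> y = f p \<and> v \<in> F p} \<subseteq> carrier P \<times> carrier (tangent Y)"
    using F smooth_map_carrier[OF f] unfolding carrier_tangent by blast
  have "subspace ({0 :: 'c} \<times> {0 :: 'e} \<times> V)"
    by (intro subspace_Times subspace_single_0 V)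
  then show ?thesis
    unfolding vector_bundle_def
    using P manifold_prod[OF P manifold_tangent[OF Y]] sub smooth_map_fst[OF sub] loc
    by (auto simp: tangent_family_bundle_def)
qed


section \<open>The quasi equivariant bundle\<close>

locale gpd_action = connection X H
  for X :: "('x, 'd::finite_dim_normed, 'g, 'e::finite_dim_normed) groupoid" and H +
  fixes P :: "('p, 'c::finite_dim_normed) atlas" and a :: "'p \<Rightarrow> 'x" and act :: "'p \<Rightarrow> 'g \<Rightarrow> 'p"
  assumes action: "right_action X P a act"
begin

lemma manifold_P: "manifold P" and smooth_anchor: "smooth_map P (obj X) (carrier P) a"
  and smooth_act: "smooth_map (prod_atlas P (arr X)) P (action_domain X P a) (\<lambda>(p, g). act p g)"
  using action by (auto simp: right_action_def)

lemmas P_atlas = manifold_smooth_atlas[OF manifold_P]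

lemma anchor_obj: "p \<in> carrier P \<Longrightarrow> a p \<in> G0"
  using smooth_map_carrier[OF smooth_anchor] by blast

lemma action_domain_iff: "(p, g) \<in> action_domain X P a \<longleftrightarrow> p \<in> carrier P \<and> g \<in> G1 \<and> a p = tgt X g"
  by (simp add: action_domain_def)

lemma
  assumes "(p, g) \<in> action_domain X P a"
  shows act_in: "act p g \<in> carrier P" and anchor_act: "a (act p g) = src X g"
    and act_act: "(g, h) \<in> composable X \<Longrightarrow> act (act p g) h = act p (g \<odot> h)"
proof -
  show "act p g \<in> carrier P" using smooth_map_carrier[OF smooth_act assms] by simp
  show "a (act p g) = src X g" using action assms unfolding right_action_def by blast
  show "(g, h) \<in> composable X \<Longrightarrow> act (act p g) h = act p (g \<odot> h)"
    using action assms unfolding right_action_def by blast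
qed

lemma act_unit: "p \<in> carrier P \<Longrightarrow> act p (gunit X (a p)) = p"
  using action unfolding right_action_def by blast

lemma action_domain_comp:
  assumes "(p, g) \<in> action_domain X P a" "(g, h) \<in> composable X"
  shows "(act p g, h) \<in> action_domain X P a" "(p, g \<odot> h) \<in> action_domain X P a"
  using assms act_in[OF assms(1)] anchor_act[OF assms(1)]
  by (auto simp: action_domain_iff composable_iff comp_in tgt_comp)

abbreviation "E0 \<equiv> algebroid_pullback X P a"
abbreviation "E1 \<equiv> tangent_pullback X P a"
abbreviation "tau0 \<equiv> \<lambda>g (p, u, \<alpha>). (act p g, gunit X (a (act p g)), l0 (ginv X g) \<alpha>)"
abbreviation "tau1 \<equiv> \<lambda>g (p, x, v). (act p g, a (act p g), l1 (ginv X g) v)"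
abbreviation "xi \<equiv> \<lambda>(p, u, \<alpha>). (p, a p, dtgt X (gunit X (a p)) \<alpha>)"
abbreviation "ups \<equiv> \<lambda>g h (p, x, v). (act (act p g) h, gunit X (a (act (act p g) h)), curv (ginv X h) (ginv X g) v)"

lemma E0_family: "E0 = tangent_family_bundle P (arr X) (\<lambda>p. gunit X (a p)) (\<lambda>p. algebroid X (a p))"
  by (simp add: algebroid_pullback_def tangent_family_bundle_def)

lemma E1_family: "E1 = tangent_family_bundle P (obj X) a (\<lambda>p. T0 (a p))"
  by (simp add: tangent_pullback_def tangent_family_bundle_def)

lemma fibre_E0: "p \<in> carrier P \<Longrightarrow> fibre E0 p = {(p, gunit X (a p), \<alpha>) | \<alpha>. \<alpha> \<in> algebroid X (a p)}"
  by (auto simp: fibre_def algebroid_pullback_def)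

lemma fibre_E1: "p \<in> carrier P \<Longrightarrow> fibre E1 p = {(p, a p, v) | v. v \<in> T0 (a p)}"
  by (auto simp: fibre_def tangent_pullback_def)

lemma vector_bundle_E1: "vector_bundle P E1"
  unfolding E1_family
proof (rule tangent_family_vector_bundle[OF manifold_P manifolds(1) smooth_anchor order_refl subspace_UNIV])
  fix p assume p: "p \<in> carrier P"
  obtain U c where U: "(U, c) \<in> obj X" "a p \<in> U" using anchor_obj[OF p] by (rule carrierE)
  have "local_trivialization P (tangent_family_bundle P (obj X) a (\<lambda>p. T0 (a p))) ({0} \<times> {0} \<times> UNIV)
    {p \<in> carrier P. a p \<in> {y \<in> U. c y \<in> UNIV}} (\<lambda>(p, y, v). (0, 0, (\<lambda>y v. v) (c y) (v (U, c))))"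
    by (rule tangent_family_local_trivialization[OF P_atlas atlases(1) smooth_anchor, where S = "\<lambda>y v. v"])
      (auto simp: tspace_add[OF atlases(1)] tspace_tscale[OF atlases(1)] U(1) linear_ident Cinf_on_const
        tvec_of_tspace[OF atlases(1) U(1)])
  then show "\<exists>U \<Phi>. p \<in> U \<and> local_trivialization P (tangent_family_bundle P (obj X) a (\<lambda>p. T0 (a p)))
      ({0} \<times> {0} \<times> UNIV) U \<Phi>"
    using p U(2) by (intro exI conjI) auto
qed

lemma smooth_unit_anchor: "smooth_map P (arr X) (carrier P) (\<lambda>p. gunit X (a p))"
  by (rule smooth_map_compose[OF P_atlas atlases(1,2) smooth_anchor smooth_unit]) (use anchor_obj in blast)

lemma src_chart:
  assumes g: "g \<in> G1"
  obtains U c W F d V where "(U, c) \<in> arr X" "g \<in> U" "open W" "c g \<in> W" "Cinf_on F W"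
    "linear (frechet_derivative F (at (c g)) :: 'e \<Rightarrow> 'd)" "surj (frechet_derivative F (at (c g)))"
    "(V, d) \<in> obj X" "\<And>h. h \<in> U \<Longrightarrow> c h \<in> W \<Longrightarrow> src X h \<in> V"
    "\<And>h w. h \<in> U \<Longrightarrow> c h \<in> W \<Longrightarrow> w \<in> T1 h \<Longrightarrow> dsrc X h w (V, d) = frechet_derivative F (at (c h)) (w (U, c))"
proof -
  note A1 = atlases(2) and A0 = atlases(1)
  obtain U c where U: "(U, c) \<in> arr X" "g \<in> U" using g by (rule carrierE)
  obtain V d where V: "(V, d) \<in> obj X" "src X g \<in> V" using src_in[OF g] by (rule carrierE)
  obtain W F where W: "open W" "c g \<in> W" "Cinf_on F W"
    and F: "\<And>y. y \<in> G1 \<Longrightarrow> y \<in> U \<Longrightarrow> c y \<in> W \<Longrightarrow> src X y \<in> V \<and> d (src X y) = F (c y)"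
    by (rule smooth_mapE[OF A1 A0 smooth_src g U V]; blast)
  have surj: "surj (frechet_derivative F (at (c g)))"
    by (rule submersion_coord_surj[OF A1 A0 smooth_src g dsrc_surj[OF g, unfolded dsrc_def] U V W F])
  have coord: "dsrc X h w (V, d) = frechet_derivative F (at (c h)) (w (U, c))"
    if "h \<in> U" "c h \<in> W" "w \<in> T1 h" for h w
    unfolding dsrc_def
    by (rule tmap_coord[OF A1 A0 smooth_src carrierI[OF U(1) that(1)] that(3) U(1) that(1) V(1) W(1) that(2) W(3) F])
  show thesis
    by (rule that[OF U W Cinf_on_linear_derivative[OF W(3,2)] surj V(1) _ coord]) (use F carrierI[OF U(1)] in blast)
qed

lemma algebroid_coord:
  assumes x: "x \<in> G0" and u: "gunit X x \<in> U" and U: "(U, c) \<in> arr X" and V: "(V, d) \<in> obj X" "x \<in> V"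
    and coord: "\<And>w. w \<in> T1 (gunit X x) \<Longrightarrow> dsrc X (gunit X x) w (V, d) = L (w (U, c))"
    and w: "w \<in> T1 (gunit X x)"
  shows "w \<in> algebroid X x \<longleftrightarrow> L (w (U, c)) = 0"
proof -
  have "dsrc X (gunit X x) w = 0 \<longleftrightarrow> dsrc X (gunit X x) w (V, d) = 0"
    using tspace_eqI[OF dsrc_in[OF unit_in[OF x] w] tspace_0[OF atlases(1)], of V d] V src_unit[OF x] by auto
  then show ?thesis using w coord[OF w] by (simp add: algebroid_iff)
qed

text \<open>
  Let \<open>L\<^sub>y\<close> be the differential of the source map in charts, \<open>L\<close> its value at a unit, and \<open>R\<close> a right
  inverse of \<open>L\<close>. Then \<open>L Q\<^sub>y = L\<^sub>y\<close> for \<open>Q\<^sub>y(w) = w - RLw + RL\<^sub>yw\<close>, and \<open>Q\<^sub>y\<close> is close to the identity,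
  so it maps the kernel of \<open>L\<^sub>y\<close>, the fibre of \<open>A\<close>, onto the kernel of \<open>L\<close>. This is identified with
  the kernel at a reference point, which serves as the typical fibre.
\<close>

lemma vector_bundle_E0: "vector_bundle P E0"
proof -
  let ?u = "\<lambda>p. gunit X (a p)"
  note A1 = atlases(2)
  have u: "?u p \<in> G1" if "p \<in> carrier P" for p using unit_in[OF anchor_obj[OF that]] .
  have sub: "algebroid X (a p) \<subseteq> T1 (?u p)" for p by (auto simp: algebroid_iff)
  have "\<exists>V :: 'e set. subspace V \<and> (\<forall>p\<in>carrier P. \<exists>U \<Phi>. p \<in> U \<and>
      local_trivialization P (tangent_family_bundle P (arr X) ?u (\<lambda>p. algebroid X (a p))) ({0} \<times> {0} \<times> V) U \<Phi>)"
  proof (cases "carrier P = {}")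
    case True
    then show ?thesis using subspace_UNIV by blast
  next
    case False
    then obtain p1 where p1: "p1 \<in> carrier P" by blast
    obtain L1 :: "'e \<Rightarrow> 'd" where L1: "linear L1" "surj L1" by (rule src_chart[OF u[OF p1]])
    let ?V = "{k. L1 k = 0}"
    have "\<exists>N \<Phi>. p \<in> N \<and> local_trivialization P (tangent_family_bundle P (arr X) ?u (\<lambda>p. algebroid X (a p)))
      ({0} \<times> {0} \<times> ?V) N \<Phi>" if p: "p \<in> carrier P" for p
    proof -
      obtain U c W F d V where U: "(U, c) \<in> arr X" "?u p \<in> U" and W: "open W" "c (?u p) \<in> W" "Cinf_on F W"
        and L: "linear (frechet_derivative F (at (c (?u p))) :: 'e \<Rightarrow> 'd)" "surj (frechet_derivative F (at (c (?u p))))"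
        and V: "(V, d) \<in> obj X" "\<And>h. h \<in> U \<Longrightarrow> c h \<in> W \<Longrightarrow> src X h \<in> V"
        and coord: "\<And>h w. h \<in> U \<Longrightarrow> c h \<in> W \<Longrightarrow> w \<in> T1 h \<Longrightarrow>
          dsrc X h w (V, d) = frechet_derivative F (at (c h)) (w (U, c))"
        by (rule src_chart[OF u[OF p]]; blast)
      let ?L = "frechet_derivative F (at (c (?u p)))"
      obtain R where R: "linear R" "?L \<circ> R = id" using linear_surjective_right_inverse[OF L] by blast
      have LR: "?L (R y) = y" for y using R(2) by (metis comp_apply id_apply)
      obtain J J' where J: "linear J" "linear J'" "J ` {x. ?L x = 0} = ?V" "\<And>x. ?L x = 0 \<Longrightarrow> J' (J x) = x"
        by (rule kernels_isomorphic[OF L L1]; blast)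
      define Q where "Q y w = (w - R (?L w)) + R (frechet_derivative F (at y) w)" for y w
      have dF: "linear (frechet_derivative F (at y))" if "y \<in> W" for y by (rule Cinf_on_linear_derivative[OF W(3) that])
      have linT0: "linear (Q y)" if "y \<in> W" for y
        unfolding Q_def
        by (rule linear_compose_add[OF linear_compose_sub[OF linear_ident linear_compose[OF L(1) R(1), unfolded o_def]]
              linear_compose[OF dF[OF that] R(1), unfolded o_def]])
      have CT0: "Cinf_on (\<lambda>y. Q y w) W" for w
        unfolding Q_def
        by (rule Cinf_on_add[OF W(1) Cinf_on_const
              Cinf_on_linear_compose[OF linear_imp_bounded_linear[OF R(1)] W(1) Cinf_on_derivative[OF W(3)]]])
      have T00: "Q (c (?u p)) w = w" for w by (simp add: Q_def)
      obtain r where r: "r > 0" "ball (c (?u p)) r \<subseteq> W"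
        and near: "\<And>y w. y \<in> ball (c (?u p)) r \<Longrightarrow> norm (Q y w - w) \<le> norm w / 2"
      proof -
        from eventually_near_identity[OF W(1,2) linT0 Cinf_on_continuous_on[OF CT0] T00] obtain r
          where "r > 0 \<and> ball (c (?u p)) r \<subseteq> W \<and> (\<forall>y\<in>ball (c (?u p)) r. \<forall>w. norm (Q y w - w) \<le> norm w / 2)"
          by (rule exE)
        then show thesis by (intro that[of r]) simp_all
      qed
      let ?W = "ball (c (?u p)) r"
      define S0 where "S0 y = inv (Q y)" for y
      have linT0W: "linear (Q y)" if "y \<in> ?W" for y using linT0 r(2) that by blast
      have bij: "bij (Q y)" if "y \<in> ?W" for y by (rule near_identity_bij[OF linT0W[OF that] near[OF that]])
      have TS: "Q y (S0 y e) = e" if "y \<in> ?W" for y e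
        unfolding S0_def using bij[OF that] by (simp add: bij_def surj_f_inv_f)
      have ST: "S0 y (Q y e) = e" if "y \<in> ?W" for y e
        unfolding S0_def using bij[OF that] by (simp add: bij_def)
      note inv = Cinf_on_inverse_family[of ?W Q S0, OF open_ball linT0W Cinf_on_subset[OF CT0 r(2)] near TS]
      have linS0: "linear (S0 y)" if "y \<in> ?W" for y by (rule inv(1)) (use that in auto)
      have CS0: "Cinf_on (\<lambda>y. S0 y e) ?W" for e by (rule inv(2)) auto
      have mem: "w \<in> algebroid X (a q) \<longleftrightarrow> frechet_derivative F (at (c (?u q))) (w (U, c)) = 0"
        if q: "q \<in> carrier P" "?u q \<in> U" "c (?u q) \<in> ?W" and w: "w \<in> T1 (?u q)" for q w
      proof (rule algebroid_coord[OF anchor_obj[OF q(1)] q(2) U(1) V(1) _ coord[OF q(2)] w])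
        show cW: "c (?u q) \<in> W" using q(3) r(2) by blast
        show "a q \<in> V" using V(2)[OF q(2) cW] src_unit[OF anchor_obj[OF q(1)]] by simp
      qed
      have lt: "local_trivialization P (tangent_family_bundle P (arr X) ?u (\<lambda>p. algebroid X (a p))) ({0} \<times> {0} \<times> ?V)
        {q \<in> carrier P. ?u q \<in> {y \<in> U. c y \<in> ?W}} (\<lambda>(p, y, v). (0, 0, (\<lambda>y w. J (Q y w)) (c y) (v (U, c))))"
      proof (rule tangent_family_local_trivialization[OF P_atlas A1 smooth_unit_anchor sub _ _ U(1) open_ball,
            where S = "\<lambda>y k. S0 y (J' k)"])
        show "v + w \<in> algebroid X (a q)" if "q \<in> carrier P" "v \<in> algebroid X (a q)" "w \<in> algebroid X (a q)" for q v w
          by (rule algebroid_add[OF anchor_obj that(2,3)]) (rule that(1))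
        show "tscale s v \<in> algebroid X (a q)" if "q \<in> carrier P" "v \<in> algebroid X (a q)" for q v s
          by (rule algebroid_tscale[OF anchor_obj that(2)]) (rule that(1))
        show "linear (\<lambda>w. J (Q y w))" if "y \<in> ?W" for y
          by (rule linear_compose[OF linT0W[OF that] J(1), unfolded o_def])
        show "Cinf_on (\<lambda>y. J (Q y w)) ?W" for w
          by (rule Cinf_on_linear_compose[OF linear_imp_bounded_linear[OF J(1)] open_ball Cinf_on_subset[OF CT0 r(2)]])
        show "linear (\<lambda>k. S0 y (J' k))" if "y \<in> ?W" for y
          by (rule linear_compose[OF J(2) linS0[OF that], unfolded o_def])
        show "Cinf_on (\<lambda>y. S0 y (J' k)) ?W" for k by (rule CS0)
        fix q assume q: "q \<in> carrier P" "?u q \<in> U" "c (?u q) \<in> ?W"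
        let ?y = "c (?u q)"
        have L_T0: "?L (Q ?y w) = frechet_derivative F (at ?y) w" for w
          by (simp add: Q_def linear_add[OF L(1)] linear_diff[OF L(1)] LR)
        show "J (Q ?y (v (U, c))) \<in> ?V \<and> S0 ?y (J' (J (Q ?y (v (U, c))))) = v (U, c)"
          if v: "v \<in> algebroid X (a q)" for v
        proof -
          have "?L (Q ?y (v (U, c))) = 0"
            using mem[OF q, of v] v sub[of q] by (auto simp: L_T0)
          then show ?thesis using J(3,4) ST[OF q(3)] by auto
        qed
        show "tvec_of (arr X) U c (?u q) (S0 ?y (J' k)) \<in> algebroid X (a q) \<and> J (Q ?y (S0 ?y (J' k))) = k"
          if k: "k \<in> ?V" for k
        proof -
          have "k \<in> J ` {x. ?L x = 0}" using k J(3) by simp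
          then obtain x where x: "?L x = 0" "k = J x" by blast
          have "frechet_derivative F (at ?y) (S0 ?y x) = 0" using L_T0[of "S0 ?y x"] x(1) by (simp add: TS[OF q(3)])
          then show ?thesis
            using mem[OF q tvec_of_tspace[OF A1 U(1) q(2)]] J(4)[OF x(1)] x(2) TS[OF q(3)]
            by (simp add: tvec_of_coord[OF A1 U(1) q(2)])
        qed
      qed
      have "p \<in> {q \<in> carrier P. ?u q \<in> {y \<in> U. c y \<in> ?W}}" using p U(2) r(1) by simp
      with lt show ?thesis by (intro exI conjI)
    qed
    then show ?thesis using linear_subspace_kernel[OF L1(1)] by (intro exI[of _ ?V] conjI ballI)
  qed
  then obtain V :: "'e set" where V: "subspace V \<and> (\<forall>p\<in>carrier P. \<exists>U \<Phi>. p \<in> U \<and>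
      local_trivialization P (tangent_family_bundle P (arr X) ?u (\<lambda>p. algebroid X (a p))) ({0} \<times> {0} \<times> V) U \<Phi>)"
    by (rule exE)
  show ?thesis
    unfolding E0_family
    by (rule tangent_family_vector_bundle[OF manifold_P manifolds(2) smooth_unit_anchor sub
          conjunct1[OF V] bspec[OF conjunct2[OF V]]])
qed

subsection \<open>Fibrewise properties\<close>

lemma inv_src_tgt:
  "(p, g) \<in> action_domain X P a \<Longrightarrow> ginv X g \<in> G1 \<and> src X (ginv X g) = a p \<and> tgt X (ginv X g) = a (act p g)"
  using anchor_act[of p g] by (auto simp: action_domain_iff inv_in src_inv tgt_inv)

lemma inv_comp_composable:
  assumes "(g, h) \<in> composable X" shows "(ginv X h, ginv X g) \<in> composable X"
  using assms by (auto simp: composable_iff inv_in src_inv tgt_inv)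

lemma fibre_linear_tau0:
  assumes pg: "(p, g) \<in> action_domain X P a"
  shows "fibre_linear E0 p E0 (act p g) (tau0 g)"
proof -
  have p: "p \<in> carrier P" using pg by (simp add: action_domain_iff)
  note i = inv_src_tgt[OF pg]
  show ?thesis
    unfolding fibre_linear_def fibre_E0[OF p] fibre_E0[OF act_in[OF pg]]
    using i lambda0_in[of "ginv X g"] lambda0_add[of "ginv X g"] lambda0_tscale[of "ginv X g"]
    by (auto simp: algebroid_pullback_def)
qed

lemma fibre_linear_tau1:
  assumes pg: "(p, g) \<in> action_domain X P a"
  shows "fibre_linear E1 p E1 (act p g) (tau1 g)"
proof -
  have p: "p \<in> carrier P" using pg by (simp add: action_domain_iff)
  note i = inv_src_tgt[OF pg]
  show ?thesis
    unfolding fibre_linear_def fibre_E1[OF p] fibre_E1[OF act_in[OF pg]]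
    using i lambda1_in[of "ginv X g"] lambda1_add[of "ginv X g"] lambda1_tscale[of "ginv X g"]
    by (auto simp: tangent_pullback_def)
qed

lemma fibre_linear_xi:
  assumes p: "p \<in> carrier P"
  shows "fibre_linear E0 p E1 p xi"
  unfolding fibre_linear_def fibre_E0[OF p] fibre_E1[OF p]
  using anchor_in[OF anchor_obj[OF p]] dtgt_add[OF unit_in[OF anchor_obj[OF p]]] dtgt_tscale[OF unit_in[OF anchor_obj[OF p]]]
  by (auto simp: tangent_pullback_def algebroid_pullback_def algebroid_iff)

lemma
  assumes pg: "(p, g) \<in> action_domain X P a" and gh: "(g, h) \<in> composable X"
  shows inv_pair: "(ginv X h, ginv X g) \<in> composable X" "src X (ginv X g) = a p"
      "tgt X (ginv X h) = a (act (act p g) h)" "ginv X (g \<odot> h) = ginv X h \<odot> ginv X g"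
    and act_comp_in: "act (act p g) h \<in> carrier P" "act p (g \<odot> h) = act (act p g) h"
  using inv_comp_composable[OF gh] inv_src_tgt[OF pg] inv_src_tgt[OF action_domain_comp(1)[OF pg gh]]
    inv_of_comp[OF gh] act_in[OF action_domain_comp(1)[OF pg gh]] act_act[OF pg gh] by auto

lemma fibre_linear_ups:
  assumes pg: "(p, g) \<in> action_domain X P a" and gh: "(g, h) \<in> composable X"
  shows "fibre_linear E1 p E0 (act p (g \<odot> h)) (ups g h)"
proof -
  have p: "p \<in> carrier P" using pg by (simp add: action_domain_iff)
  note i = inv_pair[OF pg gh] and ac = act_comp_in[OF pg gh]
  show ?thesis
    unfolding fibre_linear_def fibre_E1[OF p] ac(2) fibre_E0[OF ac(1)]
    using i curv_in[OF i(1)] curv_add[OF i(1)] curv_tscale[OF i(1)]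
    by (auto simp: tangent_pullback_def algebroid_pullback_def)
qed

lemma tau_unit:
  assumes p: "p \<in> carrier P"
  shows "e \<in> fibre E0 p \<Longrightarrow> tau0 (gunit X (a p)) e = e" "e' \<in> fibre E1 p \<Longrightarrow> tau1 (gunit X (a p)) e' = e'"
  using lambda0_unit[OF anchor_obj[OF p]] lambda1_unit[OF anchor_obj[OF p]]
  by (auto simp: fibre_E0[OF p] fibre_E1[OF p] act_unit[OF p] inv_unit[OF anchor_obj[OF p]])

lemma xi_tau:
  assumes pg: "(p, g) \<in> action_domain X P a" and e: "e \<in> fibre E0 p"
  shows "xi (tau0 g e) = tau1 g (xi e)"
proof -
  have p: "p \<in> carrier P" using pg by (simp add: action_domain_iff)
  obtain \<alpha> where \<alpha>: "e = (p, gunit X (a p), \<alpha>)" "\<alpha> \<in> algebroid X (a p)" using e unfolding fibre_E0[OF p] by blast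
  note i = inv_src_tgt[OF pg]
  show ?thesis using lambda_anchor[of "ginv X g" \<alpha>] i \<alpha> by simp
qed

lemma tau0_comp:
  assumes pg: "(p, g) \<in> action_domain X P a" and gh: "(g, h) \<in> composable X" and e: "e \<in> fibre E0 p"
  shows "vsub E0 (tau0 (g \<odot> h) e) (tau0 h (tau0 g e)) = ups g h (xi e)"
proof -
  have p: "p \<in> carrier P" using pg by (simp add: action_domain_iff)
  obtain \<alpha> where \<alpha>: "e = (p, gunit X (a p), \<alpha>)" "\<alpha> \<in> algebroid X (a p)" using e unfolding fibre_E0[OF p] by blast
  note i = inv_pair[OF pg gh] and ac = act_comp_in[OF pg gh]
  have "l0 (ginv X h \<odot> ginv X g) \<alpha> = l0 (ginv X h) (l0 (ginv X g) \<alpha>) + curv (ginv X h) (ginv X g) (dtgt X (gunit X (a p)) \<alpha>)"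
    using lambda0_curv[OF i(1), of \<alpha>] \<alpha>(2) i(2) by simp
  then show ?thesis
    by (simp add: \<alpha>(1) vsub_def algebroid_pullback_def ac(2) i(4) tscale_minus_one)
qed

lemma tau1_comp:
  assumes pg: "(p, g) \<in> action_domain X P a" and gh: "(g, h) \<in> composable X" and e: "e \<in> fibre E1 p"
  shows "vsub E1 (tau1 (g \<odot> h) e) (tau1 h (tau1 g e)) = xi (ups g h e)"
proof -
  have p: "p \<in> carrier P" using pg by (simp add: action_domain_iff)
  obtain v where v: "e = (p, a p, v)" "v \<in> T0 (a p)" using e unfolding fibre_E1[OF p] by blast
  note i = inv_pair[OF pg gh] and ac = act_comp_in[OF pg gh]
  have "l1 (ginv X h \<odot> ginv X g) v = l1 (ginv X h) (l1 (ginv X g) v)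
      + dtgt X (gunit X (a (act (act p g) h))) (curv (ginv X h) (ginv X g) v)"
    using lambda1_curv[OF i(1), of v] v(2) i(2,3) by simp
  then show ?thesis
    by (simp add: v(1) vsub_def tangent_pullback_def ac(2) i(4) tscale_minus_one)
qed

lemma vzero_E0:
  assumes p: "p \<in> carrier P"
  shows "vzero E0 p = (p, gunit X (a p), 0)"
  unfolding vzero_def fibre_E0[OF p]
proof (rule the_equality)
  show "(p, gunit X (a p), 0) \<in> {(p, gunit X (a p), \<alpha>) |\<alpha>. \<alpha> \<in> algebroid X (a p)} \<and>
      (\<forall>e\<in>{(p, gunit X (a p), \<alpha>) |\<alpha>. \<alpha> \<in> algebroid X (a p)}. vadd E0 (p, gunit X (a p), 0) e = e)"
    using algebroid_0[OF anchor_obj[OF p]] by (auto simp: algebroid_pullback_def)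
  fix z assume z: "z \<in> {(p, gunit X (a p), \<alpha>) |\<alpha>. \<alpha> \<in> algebroid X (a p)} \<and>
      (\<forall>e\<in>{(p, gunit X (a p), \<alpha>) |\<alpha>. \<alpha> \<in> algebroid X (a p)}. vadd E0 z e = e)"
  then obtain \<alpha> where \<alpha>: "z = (p, gunit X (a p), \<alpha>)" "\<alpha> \<in> algebroid X (a p)" by blast
  then have "vadd E0 z z = z" using z by blast
  then show "z = (p, gunit X (a p), 0)" using \<alpha>(1) by (simp add: algebroid_pullback_def)
qed

lemma ups_cocycle:
  assumes pg: "(p, g) \<in> action_domain X P a" and gh: "(g, h) \<in> composable X" and hk: "(h, k) \<in> composable X"
    and e: "e \<in> fibre E1 p"
  shows "vsub E0 (vsub E0 (vadd E0 (tau0 k (ups g h e)) (ups (g \<odot> h) k e)) (ups g (h \<odot> k) e)) (ups h k (tau1 g e))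
    = vzero E0 (act p ((g \<odot> h) \<odot> k))"
proof -
  have p: "p \<in> carrier P" using pg by (simp add: action_domain_iff)
  obtain v where v: "e = (p, a p, v)" "v \<in> T0 (a p)" using e unfolding fibre_E1[OF p] by blast
  note i = inv_pair[OF pg gh] and ac = act_comp_in[OF pg gh]
  note pgh = action_domain_comp[OF pg gh]
  note i' = inv_pair[OF pgh(1) hk] and ac' = act_comp_in[OF pgh(1) hk]
  have ghk: "(g \<odot> h, k) \<in> composable X" "(g, h \<odot> k) \<in> composable X"
    using gh hk by (auto simp: composable_iff comp_in src_comp tgt_comp)
  have A: "act p ((g \<odot> h) \<odot> k) = act (act (act p g) h) k"
    using act_act[OF pgh(2) ghk(1)] ac(2) by simp
  have A': "act (act p g) (h \<odot> k) = act (act (act p g) h) k" by (rule ac'(2))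
  have "l0 (ginv X k) (curv (ginv X h) (ginv X g) v) + curv (ginv X k) (ginv X h \<odot> ginv X g) v
      = curv (ginv X k \<odot> ginv X h) (ginv X g) v + curv (ginv X k) (ginv X h) (l1 (ginv X g) v)"
    by (rule curv_cocycle[OF i'(1) i(1)]) (use v(2) i(2) in simp)
  then show ?thesis
    unfolding A vzero_E0[OF ac'(1)]
    by (simp add: v(1) vsub_def algebroid_pullback_def ac(2) A' i(4) i'(4) tscale_minus_one)
qed

subsection \<open>Smoothness\<close>

lemma smooth_map_act:
  fixes Z :: "('z, 'f::finite_dim_normed) atlas"
  assumes Z: "smooth_atlas Z" and p: "smooth_map Z P S p" and g: "smooth_map Z (arr X) S g"
    and pg: "\<And>z. z \<in> S \<Longrightarrow> (p z, g z) \<in> action_domain X P a"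
  shows "smooth_map Z P S (\<lambda>z. act (p z) (g z))"
proof -
  have "smooth_map Z P S (\<lambda>z. (\<lambda>(p, g). act p g) (p z, g z))"
    by (rule smooth_map_compose[OF Z smooth_atlas_prod[OF P_atlas atlases(2)] P_atlas
          smooth_map_Pair[OF Z P_atlas atlases(2) p g] smooth_act]) (use pg in auto)
  then show ?thesis by simp
qed

lemma smooth_map_ginv:
  fixes Z :: "('z, 'f::finite_dim_normed) atlas"
  assumes Z: "smooth_atlas Z" and g: "smooth_map Z (arr X) S g"
  shows "smooth_map Z (arr X) S (\<lambda>z. ginv X (g z))"
  by (rule smooth_map_compose[OF Z atlases(2,2) g smooth_inv]) (use smooth_map_carrier[OF g] in blast)

lemmas T_atlases = smooth_atlas_tangent[OF atlases(1)] smooth_atlas_tangent[OF atlases(2)]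
lemmas E_atlases = smooth_atlas_prod[OF P_atlas T_atlases(1)] smooth_atlas_prod[OF P_atlas T_atlases(2)]

lemma total_E0: "total E0 \<subseteq> carrier P \<times> carrier (tangent (arr X))"
  using unit_in[OF anchor_obj] by (auto simp: algebroid_pullback_def carrier_tangent algebroid_iff)

lemma total_E1: "total E1 \<subseteq> carrier P \<times> carrier (tangent (obj X))"
  using anchor_obj by (auto simp: tangent_pullback_def carrier_tangent)

lemma ambient_E: "ambient E0 = prod_atlas P (tangent (arr X))" "ambient E1 = prod_atlas P (tangent (obj X))"
  by (simp_all add: algebroid_pullback_def tangent_pullback_def)

lemma smooth_tau0:
  "smooth_map (prod_atlas (ambient E0) (arr X)) (ambient E0)
     {(e, g). e \<in> total E0 \<and> (proj E0 e, g) \<in> action_domain X P a} (\<lambda>(e, g). tau0 g e)"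
  (is "smooth_map _ _ ?S _")
  unfolding ambient_E
proof -
  let ?Z = "prod_atlas (prod_atlas P (tangent (arr X))) (arr X)"
  note Z = smooth_atlas_prod[OF E_atlases(2) atlases(2)]
  have S: "?S \<subseteq> carrier (prod_atlas P (tangent (arr X))) \<times> G1"
    using total_E0 by (auto simp: action_domain_iff)
  have img: "fst ` ?S \<subseteq> carrier P \<times> carrier (tangent (arr X))" using total_E0 by auto
  note e = smooth_map_fst[OF S] and g = smooth_map_snd[OF S]
  have p: "smooth_map ?Z P ?S (\<lambda>z. fst (fst z))"
    by (rule smooth_map_compose[OF Z E_atlases(2) P_atlas e smooth_map_fst[OF order_refl] img])
  have t: "smooth_map ?Z (tangent (arr X)) ?S (\<lambda>z. snd (fst z))"
    by (rule smooth_map_compose[OF Z E_atlases(2) T_atlases(2) e smooth_map_snd[OF order_refl] img])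
  have mem: "fst (fst z) \<in> carrier P" "(fst (fst z), snd z) \<in> action_domain X P a"
      "fst (snd (fst z)) = gunit X (a (fst (fst z)))" "snd (snd (fst z)) \<in> algebroid X (a (fst (fst z)))"
    if "z \<in> ?S" for z
    using that by (auto simp: algebroid_pullback_def)
  have \<alpha>: "smooth_map ?Z (tangent (arr X)) ?S (\<lambda>z. (gunit X (src X (ginv X (snd z))), snd (snd (fst z))))"
  proof (rule smooth_map_cong[OF t])
    fix z assume z: "z \<in> ?S"
    show "snd (fst z) = (gunit X (src X (ginv X (snd z))), snd (snd (fst z)))"
      using mem(3)[OF z] inv_src_tgt[OF mem(2)[OF z]] by (simp add: prod_eq_iff)
  qed
  note l = smooth_map_lambda0[OF Z smooth_map_ginv[OF Z g] \<alpha>]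
  have "smooth_map ?Z (prod_atlas P (tangent (arr X))) ?S
      (\<lambda>z. (act (fst (fst z)) (snd z), gunit X (tgt X (ginv X (snd z))), l0 (ginv X (snd z)) (snd (snd (fst z)))))"
  proof (rule smooth_map_Pair[OF Z P_atlas T_atlases(2) smooth_map_act[OF Z p g mem(2)] l])
    fix z assume z: "z \<in> ?S"
    show "snd (snd (fst z)) \<in> algebroid X (src X (ginv X (snd z)))"
      using mem(4)[OF z] inv_src_tgt[OF mem(2)[OF z]] by simp
  qed
  then show "smooth_map ?Z (prod_atlas P (tangent (arr X))) ?S (\<lambda>(e, g). tau0 g e)"
  proof (rule smooth_map_cong)
    fix z assume z: "z \<in> ?S"
    show "(act (fst (fst z)) (snd z), gunit X (tgt X (ginv X (snd z))), l0 (ginv X (snd z)) (snd (snd (fst z))))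
        = (\<lambda>(e, g). tau0 g e) z"
      using inv_src_tgt[OF mem(2)[OF z]] by (simp add: case_prod_unfold)
  qed
qed

lemma smooth_tau1:
  "smooth_map (prod_atlas (ambient E1) (arr X)) (ambient E1)
     {(e, g). e \<in> total E1 \<and> (proj E1 e, g) \<in> action_domain X P a} (\<lambda>(e, g). tau1 g e)"
  (is "smooth_map _ _ ?S _")
  unfolding ambient_E
proof -
  let ?Z = "prod_atlas (prod_atlas P (tangent (obj X))) (arr X)"
  note Z = smooth_atlas_prod[OF E_atlases(1) atlases(2)]
  have S: "?S \<subseteq> carrier (prod_atlas P (tangent (obj X))) \<times> G1"
    using total_E1 by (auto simp: action_domain_iff)
  have img: "fst ` ?S \<subseteq> carrier P \<times> carrier (tangent (obj X))" using total_E1 by auto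
  note e = smooth_map_fst[OF S] and g = smooth_map_snd[OF S]
  have p: "smooth_map ?Z P ?S (\<lambda>z. fst (fst z))"
    by (rule smooth_map_compose[OF Z E_atlases(1) P_atlas e smooth_map_fst[OF order_refl] img])
  have t: "smooth_map ?Z (tangent (obj X)) ?S (\<lambda>z. snd (fst z))"
    by (rule smooth_map_compose[OF Z E_atlases(1) T_atlases(1) e smooth_map_snd[OF order_refl] img])
  have mem: "(fst (fst z), snd z) \<in> action_domain X P a" "fst (snd (fst z)) = a (fst (fst z))"
    if "z \<in> ?S" for z
    using that by (auto simp: tangent_pullback_def)
  have v: "smooth_map ?Z (tangent (obj X)) ?S (\<lambda>z. (src X (ginv X (snd z)), snd (snd (fst z))))"
  proof (rule smooth_map_cong[OF t])
    fix z assume z: "z \<in> ?S"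
    show "snd (fst z) = (src X (ginv X (snd z)), snd (snd (fst z)))"
      using mem(2)[OF z] inv_src_tgt[OF mem(1)[OF z]] by (simp add: prod_eq_iff)
  qed
  note l = smooth_map_lambda1[OF Z smooth_map_ginv[OF Z g] v]
  have "smooth_map ?Z (prod_atlas P (tangent (obj X))) ?S
      (\<lambda>z. (act (fst (fst z)) (snd z), tgt X (ginv X (snd z)), l1 (ginv X (snd z)) (snd (snd (fst z)))))"
    by (rule smooth_map_Pair[OF Z P_atlas T_atlases(1) smooth_map_act[OF Z p g mem(1)] l])
  then show "smooth_map ?Z (prod_atlas P (tangent (obj X))) ?S (\<lambda>(e, g). tau1 g e)"
  proof (rule smooth_map_cong)
    fix z assume z: "z \<in> ?S"
    show "(act (fst (fst z)) (snd z), tgt X (ginv X (snd z)), l1 (ginv X (snd z)) (snd (snd (fst z))))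
        = (\<lambda>(e, g). tau1 g e) z"
      using inv_src_tgt[OF mem(1)[OF z]] by (simp add: case_prod_unfold)
  qed
qed

lemma smooth_xi: "smooth_map (ambient E0) (ambient E1) (total E0) xi"
  unfolding ambient_E
proof -
  let ?Z = "prod_atlas P (tangent (arr X))"
  note Z = E_atlases(2)
  note p = smooth_map_fst[OF total_E0] and t = smooth_map_snd[OF total_E0]
  have mem: "fst z \<in> carrier P" "fst (snd z) = gunit X (a (fst z))" if "z \<in> total E0" for z
    using that by (auto simp: algebroid_pullback_def)
  have t': "smooth_map ?Z (tangent (arr X)) (total E0) (\<lambda>z. (gunit X (a (fst z)), snd (snd z)))"
    by (rule smooth_map_cong[OF t]) (simp add: mem prod_eq_iff)
  note r = smooth_map_tmap[OF Z atlases(2,1) smooth_tgt t']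
  from smooth_map_Pair[OF Z P_atlas T_atlases(1) p r]
  show "smooth_map ?Z (prod_atlas P (tangent (obj X))) (total E0) xi"
    by (rule smooth_map_cong) (use mem anchor_obj in \<open>auto simp: case_prod_unfold tgt_unit dtgt_def\<close>)
qed

lemma smooth_ups:
  "smooth_map (prod_atlas (ambient E1) (prod_atlas (arr X) (arr X))) (ambient E0)
     {(e, g, h). e \<in> total E1 \<and> (proj E1 e, g) \<in> action_domain X P a \<and> (g, h) \<in> composable X} (\<lambda>(e, g, h). ups g h e)"
  (is "smooth_map _ _ ?S _")
  unfolding ambient_E
proof -
  let ?Z = "prod_atlas (prod_atlas P (tangent (obj X))) (prod_atlas (arr X) (arr X))"
  note Z = smooth_atlas_prod[OF E_atlases(1) atlases(3)]
  have S: "?S \<subseteq> carrier (prod_atlas P (tangent (obj X))) \<times> carrier (prod_atlas (arr X) (arr X))"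
    using total_E1 by (auto simp: composable_iff)
  have img: "fst ` ?S \<subseteq> carrier P \<times> carrier (tangent (obj X))" using total_E1 by auto
  have img': "snd ` ?S \<subseteq> G1 \<times> G1" by (auto simp: composable_iff)
  note e = smooth_map_fst[OF S] and gh = smooth_map_snd[OF S]
  have g: "smooth_map ?Z (arr X) ?S (\<lambda>z. fst (snd z))"
    by (rule smooth_map_compose[OF Z atlases(3) atlases(2) gh smooth_map_fst[OF order_refl] img'])
  have h: "smooth_map ?Z (arr X) ?S (\<lambda>z. snd (snd z))"
    by (rule smooth_map_compose[OF Z atlases(3) atlases(2) gh smooth_map_snd[OF order_refl] img'])
  have p: "smooth_map ?Z P ?S (\<lambda>z. fst (fst z))"
    by (rule smooth_map_compose[OF Z E_atlases(1) P_atlas e smooth_map_fst[OF order_refl] img])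
  have t: "smooth_map ?Z (tangent (obj X)) ?S (\<lambda>z. snd (fst z))"
    by (rule smooth_map_compose[OF Z E_atlases(1) T_atlases(1) e smooth_map_snd[OF order_refl] img])
  have mem: "(fst (fst z), fst (snd z)) \<in> action_domain X P a" "(fst (snd z), snd (snd z)) \<in> composable X"
      "fst (snd (fst z)) = a (fst (fst z))"
    if "z \<in> ?S" for z
    using that by (auto simp: tangent_pullback_def)
  have v: "smooth_map ?Z (tangent (obj X)) ?S (\<lambda>z. (src X (ginv X (fst (snd z))), snd (snd (fst z))))"
  proof (rule smooth_map_cong[OF t])
    fix z assume z: "z \<in> ?S"
    show "snd (fst z) = (src X (ginv X (fst (snd z))), snd (snd (fst z)))"
      using mem(3)[OF z] inv_src_tgt[OF mem(1)[OF z]] by (simp add: prod_eq_iff)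
  qed
  note gi = smooth_map_ginv[OF Z g] and hi = smooth_map_ginv[OF Z h]
  note k = smooth_map_curv[OF Z hi gi v inv_comp_composable[OF mem(2)]]
  note pg = smooth_map_act[OF Z p g mem(1)]
  note pgh = smooth_map_act[OF Z pg h action_domain_comp(1)[OF mem(1,2)]]
  from smooth_map_Pair[OF Z P_atlas T_atlases(2) pgh k]
  show "smooth_map ?Z (prod_atlas P (tangent (arr X))) ?S (\<lambda>(e, g, h). ups g h e)"
  proof (rule smooth_map_cong)
    fix z assume z: "z \<in> ?S"
    show "(act (act (fst (fst z)) (fst (snd z))) (snd (snd z)), gunit X (tgt X (ginv X (snd (snd z)))),
          curv (ginv X (snd (snd z))) (ginv X (fst (snd z))) (snd (snd (fst z))))
        = (\<lambda>(e, g, h). ups g h e) z"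
      using inv_pair(3)[OF mem(1,2)[OF z]] by (simp add: case_prod_unfold)
  qed
qed

lemma quasi_equivariant: "quasi_equivariant_bundle X P a act E0 E1 tau0 tau1 xi ups"
  unfolding quasi_equivariant_bundle_def
proof (intro conjI action vector_bundle_E0 vector_bundle_E1 smooth_tau0 smooth_tau1 smooth_xi smooth_ups)
  show "\<forall>(p, g)\<in>action_domain X P a.
      fibre_linear E0 p E0 (act p g) (tau0 g) \<and> fibre_linear E1 p E1 (act p g) (tau1 g)"
    using fibre_linear_tau0 fibre_linear_tau1 by blast
  show "\<forall>p\<in>carrier P. (\<forall>e\<in>fibre E0 p. tau0 (gunit X (a p)) e = e) \<and> (\<forall>e\<in>fibre E1 p. tau1 (gunit X (a p)) e = e)"
    using tau_unit by blast
  show "\<forall>p\<in>carrier P. fibre_linear E0 p E1 p xi" using fibre_linear_xi by blast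
  show "\<forall>p g h. (p, g) \<in> action_domain X P a \<and> (g, h) \<in> composable X \<longrightarrow>
      fibre_linear E1 p E0 (act p (g \<odot> h)) (ups g h)"
    using fibre_linear_ups by blast
  show "\<forall>p g. (p, g) \<in> action_domain X P a \<longrightarrow> (\<forall>e\<in>fibre E0 p. xi (tau0 g e) = tau1 g (xi e))"
    using xi_tau by blast
  show "\<forall>p g h. (p, g) \<in> action_domain X P a \<and> (g, h) \<in> composable X \<longrightarrow>
      (\<forall>e\<in>fibre E0 p. vsub E0 (tau0 (g \<odot> h) e) (tau0 h (tau0 g e)) = ups g h (xi e)) \<and>
      (\<forall>e\<in>fibre E1 p. vsub E1 (tau1 (g \<odot> h) e) (tau1 h (tau1 g e)) = xi (ups g h e))"
    using tau0_comp tau1_comp by blast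
  show "\<forall>p g h k. (p, g) \<in> action_domain X P a \<and> (g, h) \<in> composable X \<and> (h, k) \<in> composable X \<longrightarrow>
      (\<forall>e\<in>fibre E1 p. vsub E0 (vsub E0 (vadd E0 (tau0 k (ups g h e)) (ups (g \<odot> h) k e)) (ups g (h \<odot> k) e))
        (ups h k (tau1 g e)) = vzero E0 (act p ((g \<odot> h) \<odot> k)))"
    using ups_cocycle by blast
qed

end

theorem proposition7:
  fixes X :: "('x, 'd::finite_dim_normed, 'g, 'e::finite_dim_normed) groupoid"
    and H :: "('g \<times> ('g, 'e) tvec) set"
    and P :: "('p, 'c::finite_dim_normed) atlas"
    and M :: "('m, 'b::finite_dim_normed) atlas"
    and \<pi> :: "'p \<Rightarrow> 'm" and a :: "'p \<Rightarrow> 'x" and act :: "'p \<Rightarrow> 'g \<Rightarrow> 'p"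
  assumes "lie_groupoid X"
    and "ehresmann_connection X H"
    and "principal_bundle X P M \<pi> a act"
  shows "quasi_equivariant_bundle X P a act (algebroid_pullback X P a) (tangent_pullback X P a)
    (\<lambda>g (p, u, \<alpha>). (act p g, gunit X (a (act p g)), lambda0 X H (ginv X g) \<alpha>))
    (\<lambda>g (p, x, v). (act p g, a (act p g), lambda1 X H (ginv X g) v))
    (\<lambda>(p, u, \<alpha>). (p, a p, dtgt X (gunit X (a p)) \<alpha>))
    (\<lambda>g h (p, x, v).
       (act (act p g) h, gunit X (a (act (act p g) h)), basic_curvature X H (ginv X h) (ginv X g) v))"
proof -
  interpret gpd_action X H P a act
    using assms by unfold_locales (auto simp: principal_bundle_def)
  show ?thesis by (rule quasi_equivariant)
qed

end
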